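(* Let $A$ be an algebra. If $\mathcal{S}=\{X_i\}_{i\in I}$ is a Hom-orthogonal set in $\mathrm{mod}\,A$ (indexed so that $X_i\not\simeq X_j$ for $i\neq j$), then there exists a Hom-orthogonal set of bricks $\mathcal{S}_b=\{B_i\}_{i\in I}$ (with $B_i\not\simeq B_j$ for $i\ne j$), where each $B_i$ is (isomorphic to) a submodule of $X_i$ and a quotient module of $X_i$. Moreover: (1) If $A$ is a brick-finite algebra of rank $n$, then there is no Hom-orthogonal set of modules with $n+1$ elements. In addition, there exists a unique semibrick of size $n$, and it is given by the (isomorphism classes of) simple modules in $\mathrm{mod}\,A$. (2) If $A$ admits an infinite set of Hom-orthogonal modules which are all of the same dimension $d'$, then for some $d\le d'$ there exists an infinite semibrick consisting of bricks of dimension $d$.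
   Context: Throughout, $k$ is an algebraically closed field and $A$ is a finite dimensional, unital, associative, basic and connected $k$-algebra. The rank $n$ of $A$ is the number of isomorphism classes of simple $A$-modules. $\mathrm{mod}\,A$ is the category of finitely generated left $A$-modules; modules are considered up to isomorphism, and the dimension of a module means its dimension over $k$. A brick is a module $X$ with $\mathrm{End}_A(X)\simeq k$. $A$ is brick-finite if it admits only finitely many isomorphism classes of bricks. A Hom-orthogonal set is a non-empty set of non-zero, pairwise non-isomorphic modules in $\mathrm{mod}\,A$ such that $\mathrm{Hom}_A(X,Y)=0=\mathrm{Hom}_A(Y,X)$ for any two distinct elements $X,Y$ of the set. A semibrick is a Hom-orthogonal set of bricks; its size is the number of (isomorphism classes of) bricks in it. *)

theory Defs
  imports
    "Jordan_Normal_Form.Missing_VectorSpace"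
    "HOL-Algebra.AbelCoset"
    "HOL-Algebra.QuotRing"
    "HOL-Algebra.Algebraic_Closure"
begin

section \<open>Finite dimensional algebras\<close>

text \<open>
  An algebra is a record of type \<open>('k, 'a) module\<close>: its ring structure together with the
  scalar multiplication by \<open>K\<close>. The locale \<open>algebra\<close> of HOL-Algebra only covers
  commutative algebras.
\<close>

locale fd_algebra = vectorspace K A + A: ring A
  for K :: "'k ring" and A :: "('k, 'a) module" +
  assumes alg_closed: "algebraically_closed K"
    and smult_mult_left:
      "\<lbrakk>c \<in> carrier K; x \<in> carrier A; y \<in> carrier A\<rbrakk> \<Longrightarrow>
        (c \<odot>\<^bsub>A\<^esub> x) \<otimes>\<^bsub>A\<^esub> y = c \<odot>\<^bsub>A\<^esub> (x \<otimes>\<^bsub>A\<^esub> y)"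
    and smult_mult_right:
      "\<lbrakk>c \<in> carrier K; x \<in> carrier A; y \<in> carrier A\<rbrakk> \<Longrightarrow>
        x \<otimes>\<^bsub>A\<^esub> (c \<odot>\<^bsub>A\<^esub> y) = c \<odot>\<^bsub>A\<^esub> (x \<otimes>\<^bsub>A\<^esub> y)"
    and finite_dimensional: "fin_dim"

text \<open>
  Connected: nonzero, and not a direct product of two nonzero algebras. The direct product is
  expressed internally; two-sided ideals of a unital algebra are automatically stable under
  the scalars.
\<close>

definition connected_algebra :: "('k, 'a) module \<Rightarrow> bool" where
  "connected_algebra A \<longleftrightarrow> carrier A \<noteq> {\<zero>\<^bsub>A\<^esub>} \<and>
     \<not> (\<exists>I J. ideal I A \<and> ideal J A \<and> I \<noteq> {\<zero>\<^bsub>A\<^esub>} \<and> J \<noteq> {\<zero>\<^bsub>A\<^esub>} \<and>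
            I \<inter> J = {\<zero>\<^bsub>A\<^esub>} \<and> I <+>\<^bsub>A\<^esub> J = carrier A)"


section \<open>Left modules\<close>

text \<open>
  The locale \<open>module\<close> of HOL-Algebra requires a commutative ring. The axioms below are the same
  ones over an arbitrary ring. The fields \<open>mult\<close> and \<open>one\<close> of a module record play no role.
\<close>

locale left_module = R: ring R + M?: abelian_group M
  for R :: "('a, 'x) ring_scheme" and M :: "('a, 'm) module" (structure) +
  assumes smult_closed [simp, intro]:
      "\<lbrakk>a \<in> carrier R; x \<in> carrier M\<rbrakk> \<Longrightarrow> a \<odot> x \<in> carrier M"
    and smult_l_distr:
      "\<lbrakk>a \<in> carrier R; b \<in> carrier R; x \<in> carrier M\<rbrakk> \<Longrightarrow>
        (a \<oplus>\<^bsub>R\<^esub> b) \<odot> x = a \<odot> x \<oplus> b \<odot> x"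
    and smult_r_distr:
      "\<lbrakk>a \<in> carrier R; x \<in> carrier M; y \<in> carrier M\<rbrakk> \<Longrightarrow>
        a \<odot> (x \<oplus> y) = a \<odot> x \<oplus> a \<odot> y"
    and smult_assoc:
      "\<lbrakk>a \<in> carrier R; b \<in> carrier R; x \<in> carrier M\<rbrakk> \<Longrightarrow>
        (a \<otimes>\<^bsub>R\<^esub> b) \<odot> x = a \<odot> (b \<odot> x)"
    and smult_one [simp]: "x \<in> carrier M \<Longrightarrow> \<one>\<^bsub>R\<^esub> \<odot> x = x"

text \<open>
  Several imported theories use the names \<open>submodule\<close> and \<open>module_hom\<close>. The two versions fixed
  here make no commutativity assumption on the ring.
\<close>

abbreviation is_submodule ::
    "('a, 'x) ring_scheme \<Rightarrow> ('a, 'm) module \<Rightarrow> 'm set \<Rightarrow> bool" where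
  "is_submodule R M N \<equiv> Module.submodule N R M"

abbreviation Hom ::
    "('a, 'x) ring_scheme \<Rightarrow> ('a, 'm) module \<Rightarrow> ('a, 'n) module \<Rightarrow> ('m \<Rightarrow> 'n) set" where
  "Hom R M N \<equiv> LinearCombinations.module_hom R M N"

definition Hom_zero ::
    "('a, 'x) ring_scheme \<Rightarrow> ('a, 'm) module \<Rightarrow> ('a, 'n) module \<Rightarrow> bool" where
  "Hom_zero R M N \<longleftrightarrow> (\<forall>f\<in>Hom R M N. \<forall>x\<in>carrier M. f x = \<zero>\<^bsub>N\<^esub>)"

definition mod_iso ::
    "('a, 'x) ring_scheme \<Rightarrow> ('a, 'm) module \<Rightarrow> ('a, 'n) module \<Rightarrow> bool" where
  "mod_iso R M N \<longleftrightarrow> (\<exists>f\<in>Hom R M N. bij_betw f (carrier M) (carrier N))"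

definition nonzero_module :: "('a, 'm) module \<Rightarrow> bool" where
  "nonzero_module M \<longleftrightarrow> carrier M \<noteq> {\<zero>\<^bsub>M\<^esub>}"

definition fin_gen :: "('a, 'x) ring_scheme \<Rightarrow> ('a, 'm) module \<Rightarrow> bool" where
  "fin_gen R M \<longleftrightarrow>
     (\<exists>G. finite G \<and> G \<subseteq> carrier M \<and> (\<forall>N. is_submodule R M N \<and> G \<subseteq> N \<longrightarrow> N = carrier M))"

definition simple_module :: "('a, 'x) ring_scheme \<Rightarrow> ('a, 'm) module \<Rightarrow> bool" where
  "simple_module R M \<longleftrightarrow> left_module R M \<and> nonzero_module M \<and>
     (\<forall>N. is_submodule R M N \<longrightarrow> N = {\<zero>\<^bsub>M\<^esub>} \<or> N = carrier M)"

definition quotient_module :: "('a, 'm) module \<Rightarrow> 'm set \<Rightarrow> ('a, 'm set) module" where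
  "quotient_module M N =
     \<lparr>carrier = a_rcosets\<^bsub>M\<^esub> N, monoid.mult = undefined, one = undefined, zero = N, add = set_add M,
      smult = (\<lambda>a C. N <+>\<^bsub>M\<^esub> ((\<lambda>x. a \<odot>\<^bsub>M\<^esub> x) ` C))\<rparr>"

lemma quotient_module_is_left_module:
  assumes "left_module R M" "Module.submodule N R M"
  shows "left_module R (quotient_module M N)"
proof -
  interpret left_module R M by fact
  interpret N: Module.submodule N R M by fact
  have ab: "abelian_subgroup N M"
    by (metis N.subgroup_axioms a_comm_group abelian_group.intro abelian_group_axioms abelian_subgroupI3 additive_subgroup_def)
  interpret ab: abelian_subgroup N M by fact
  have Nc: "N \<subseteq> carrier M" by (rule ab.a_subset)
  have sm: "N <+>\<^bsub>M\<^esub> ((\<lambda>x. a \<odot>\<^bsub>M\<^esub> x) ` (N +>\<^bsub>M\<^esub> x)) = N +>\<^bsub>M\<^esub> (a \<odot>\<^bsub>M\<^esub> x)"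
    if a: "a \<in> carrier R" and x: "x \<in> carrier M" for a x
  proof -
    have 1: "(n' \<oplus>\<^bsub>M\<^esub> a \<odot>\<^bsub>M\<^esub> (n \<oplus>\<^bsub>M\<^esub> x)) = (n' \<oplus>\<^bsub>M\<^esub> a \<odot>\<^bsub>M\<^esub> n) \<oplus>\<^bsub>M\<^esub> a \<odot>\<^bsub>M\<^esub> x" if "n\<in>N" "n'\<in>N" for n n'
      using that Nc a x by (simp add: smult_r_distr a_assoc subset_iff)
    have 2: "n' \<oplus>\<^bsub>M\<^esub> a \<odot>\<^bsub>M\<^esub> n \<in> N" if "n\<in>N" "n'\<in>N" for n n'
      using that a by auto
    have 3: "n' \<oplus>\<^bsub>M\<^esub> a \<odot>\<^bsub>M\<^esub> x = n' \<oplus>\<^bsub>M\<^esub> a \<odot>\<^bsub>M\<^esub> (\<zero>\<^bsub>M\<^esub> \<oplus>\<^bsub>M\<^esub> x)" for n'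
      using x by simp
    have 4: "\<zero>\<^bsub>M\<^esub> \<in> N" by simp
    show ?thesis
    proof (intro Set.equalityI subsetI)
      fix z assume "z \<in> N <+>\<^bsub>M\<^esub> ((\<lambda>x. a \<odot>\<^bsub>M\<^esub> x) ` (N +>\<^bsub>M\<^esub> x))"
      then obtain n n' where "n\<in>N" "n'\<in>N" "z = n' \<oplus>\<^bsub>M\<^esub> a \<odot>\<^bsub>M\<^esub> (n \<oplus>\<^bsub>M\<^esub> x)"
        unfolding set_add_def' a_r_coset_def' by auto
      then show "z \<in> N +>\<^bsub>M\<^esub> (a \<odot>\<^bsub>M\<^esub> x)" unfolding a_r_coset_def' using 1[of n n'] 2[of n n'] by auto
    next
      fix z assume "z \<in> N +>\<^bsub>M\<^esub> (a \<odot>\<^bsub>M\<^esub> x)"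
      then obtain n' where "n'\<in>N" "z = n' \<oplus>\<^bsub>M\<^esub> a \<odot>\<^bsub>M\<^esub> (\<zero>\<^bsub>M\<^esub> \<oplus>\<^bsub>M\<^esub> x)"
        unfolding a_r_coset_def' using 3 by auto
      then have "\<exists>h\<in>N. \<exists>k\<in>N. z = h \<oplus>\<^bsub>M\<^esub> a \<odot>\<^bsub>M\<^esub> (k \<oplus>\<^bsub>M\<^esub> x)" using 4
        by (intro bexI[where x = n'] bexI[where x = "\<zero>\<^bsub>M\<^esub>"])
      then show "z \<in> N <+>\<^bsub>M\<^esub> ((\<lambda>x. a \<odot>\<^bsub>M\<^esub> x) ` (N +>\<^bsub>M\<^esub> x))"
        unfolding set_add_def' a_r_coset_def' by auto
    qed
  qed
  have add: "(N +>\<^bsub>M\<^esub> x) <+>\<^bsub>M\<^esub> (N +>\<^bsub>M\<^esub> y) = N +>\<^bsub>M\<^esub> (x \<oplus>\<^bsub>M\<^esub> y)" if "x \<in> carrier M" "y \<in> carrier M" for x y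
    using that by (simp add: ab.a_rcos_sum)
  have ag: "abelian_group (quotient_module M N)"
  proof -
    have zN: "N +>\<^bsub>M\<^esub> \<zero>\<^bsub>M\<^esub> = N" by (simp add: a_coset_add_zero Nc)
    then have addN: "N <+>\<^bsub>M\<^esub> (N +>\<^bsub>M\<^esub> x) = N +>\<^bsub>M\<^esub> x" if "x \<in> carrier M" for x
      using add[of "\<zero>\<^bsub>M\<^esub>" x] that by simp
    have inv: "(N +>\<^bsub>M\<^esub> (\<ominus>\<^bsub>M\<^esub> x)) <+>\<^bsub>M\<^esub> (N +>\<^bsub>M\<^esub> x) = N" if "x \<in> carrier M" for x
      using that zN by (simp add: add l_neg)
    have carr: "(C \<in> carrier (quotient_module M N)) = (\<exists>x\<in>carrier M. C = N +>\<^bsub>M\<^esub> x)" for C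
      by (auto simp: quotient_module_def A_RCOSETS_def')
    have ops: "zero (quotient_module M N) = N" "Ring.add (quotient_module M N) = set_add M"
      by (simp_all add: quotient_module_def)
    show ?thesis
    proof (rule abelian_groupI)
      show "\<zero>\<^bsub>quotient_module M N\<^esub> \<in> carrier (quotient_module M N)"
        unfolding carr ops using zN by (intro bexI[where x = "\<zero>\<^bsub>M\<^esub>"]) auto
      fix x assume "x \<in> carrier (quotient_module M N)"
      then obtain u where "u \<in> carrier M" "x = N +>\<^bsub>M\<^esub> u" unfolding carr by auto
      then show "\<exists>y\<in>carrier (quotient_module M N). y \<oplus>\<^bsub>quotient_module M N\<^esub> x = \<zero>\<^bsub>quotient_module M N\<^esub>"
        unfolding ops using inv[of u] by (intro bexI[where x = "N +>\<^bsub>M\<^esub> (\<ominus>\<^bsub>M\<^esub> u)"]) (auto simp: carr)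
    qed (auto simp: carr ops add addN a_ac)
  qed
  show ?thesis
  proof (intro left_module.intro left_module_axioms.intro ag)
    show "ring R" by (rule R.ring_axioms)
  qed (auto simp: quotient_module_def A_RCOSETS_def' sm add smult_l_distr smult_r_distr smult_assoc)
qed

definition iso_to_submodule ::
    "('a, 'x) ring_scheme \<Rightarrow> ('a, 'n) module \<Rightarrow> ('a, 'm) module \<Rightarrow> bool" where
  "iso_to_submodule R B M \<longleftrightarrow> (\<exists>N. is_submodule R M N \<and> mod_iso R B (M\<lparr>carrier := N\<rparr>))"

definition iso_to_quotient ::
    "('a, 'x) ring_scheme \<Rightarrow> ('a, 'n) module \<Rightarrow> ('a, 'm) module \<Rightarrow> bool" where
  "iso_to_quotient R B M \<longleftrightarrow> (\<exists>N. is_submodule R M N \<and> mod_iso R B (quotient_module M N))"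


context left_module
begin

lemma zero_smult [simp]: "x \<in> carrier M \<Longrightarrow> \<zero>\<^bsub>R\<^esub> \<odot>\<^bsub>M\<^esub> x = \<zero>\<^bsub>M\<^esub>"
proof -
  assume x: "x \<in> carrier M"
  have "\<zero>\<^bsub>R\<^esub> \<odot>\<^bsub>M\<^esub> x \<oplus>\<^bsub>M\<^esub> \<zero>\<^bsub>R\<^esub> \<odot>\<^bsub>M\<^esub> x = \<zero>\<^bsub>R\<^esub> \<odot>\<^bsub>M\<^esub> x"
    using x smult_l_distr[of "\<zero>\<^bsub>R\<^esub>" "\<zero>\<^bsub>R\<^esub>" x] by simp
  then show ?thesis using x by (simp add: add.l_cancel_one)
qed

lemma smult_zero [simp]: "a \<in> carrier R \<Longrightarrow> a \<odot>\<^bsub>M\<^esub> \<zero>\<^bsub>M\<^esub> = \<zero>\<^bsub>M\<^esub>"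
proof -
  assume a: "a \<in> carrier R"
  have "a \<odot>\<^bsub>M\<^esub> \<zero>\<^bsub>M\<^esub> \<oplus>\<^bsub>M\<^esub> a \<odot>\<^bsub>M\<^esub> \<zero>\<^bsub>M\<^esub> = a \<odot>\<^bsub>M\<^esub> \<zero>\<^bsub>M\<^esub>"
    using a smult_r_distr[of a "\<zero>\<^bsub>M\<^esub>" "\<zero>\<^bsub>M\<^esub>"] by simp
  then show ?thesis using a by (simp add: add.l_cancel_one)
qed

lemma uminus_one_smult: "x \<in> carrier M \<Longrightarrow> (\<ominus>\<^bsub>R\<^esub> \<one>\<^bsub>R\<^esub>) \<odot>\<^bsub>M\<^esub> x = \<ominus>\<^bsub>M\<^esub> x"
proof -
  assume x: "x \<in> carrier M"
  have "(\<ominus>\<^bsub>R\<^esub> \<one>\<^bsub>R\<^esub>) \<odot>\<^bsub>M\<^esub> x \<oplus>\<^bsub>M\<^esub> x = \<zero>\<^bsub>M\<^esub>"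
    using x smult_l_distr[of "\<ominus>\<^bsub>R\<^esub> \<one>\<^bsub>R\<^esub>" "\<one>\<^bsub>R\<^esub>" x] by (simp add: R.l_neg)
  then show ?thesis using x by (simp add: minus_equality)
qed

lemma submoduleI:
  assumes "N \<subseteq> carrier M" "\<zero>\<^bsub>M\<^esub> \<in> N"
    and "\<And>x y. x \<in> N \<Longrightarrow> y \<in> N \<Longrightarrow> x \<oplus>\<^bsub>M\<^esub> y \<in> N"
    and "\<And>a x. a \<in> carrier R \<Longrightarrow> x \<in> N \<Longrightarrow> a \<odot>\<^bsub>M\<^esub> x \<in> N"
  shows "is_submodule R M N"
proof (intro Module.submodule.intro subgroup.intro Module.submodule_axioms.intro)
  fix x assume "x \<in> N"
  then show "inv\<^bsub>add_monoid M\<^esub> x \<in> N"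
    using assms(1) assms(4)[of "\<ominus>\<^bsub>R\<^esub> \<one>\<^bsub>R\<^esub>" x] uminus_one_smult[of x] by (auto simp: a_inv_def)
qed (use assms in auto)

lemma finsum_submodule:
  assumes "finite G" "G \<subseteq> carrier M"
  shows "is_submodule R M {finsum M (\<lambda>x. a x \<odot>\<^bsub>M\<^esub> x) G | a. a \<in> G \<rightarrow> carrier R}" (is "is_submodule R M ?N")
    and "G \<subseteq> {finsum M (\<lambda>x. a x \<odot>\<^bsub>M\<^esub> x) G | a. a \<in> G \<rightarrow> carrier R}"
proof -
  have cl: "(\<lambda>x. a x \<odot>\<^bsub>M\<^esub> x) \<in> G \<rightarrow> carrier M" if "a \<in> G \<rightarrow> carrier R" for a
    using that assms(2) by (auto simp: Pi_iff)
  show "is_submodule R M ?N"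
  proof (rule submoduleI)
    show "?N \<subseteq> carrier M" using cl by auto
    have "finsum M (\<lambda>x. \<zero>\<^bsub>R\<^esub> \<odot>\<^bsub>M\<^esub> x) G = finsum M (\<lambda>x. \<zero>\<^bsub>M\<^esub>) G"
      using assms(2) by (intro finsum_cong') auto
    then have "\<zero>\<^bsub>M\<^esub> = finsum M (\<lambda>x. \<zero>\<^bsub>R\<^esub> \<odot>\<^bsub>M\<^esub> x) G" by simp
    then show "\<zero>\<^bsub>M\<^esub> \<in> ?N" by (intro CollectI exI[of _ "\<lambda>_. \<zero>\<^bsub>R\<^esub>"]) auto
  next
    fix u v assume "u \<in> ?N" "v \<in> ?N"
    then obtain a b where a: "a \<in> G \<rightarrow> carrier R" "u = finsum M (\<lambda>x. a x \<odot>\<^bsub>M\<^esub> x) G"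
      and b: "b \<in> G \<rightarrow> carrier R" "v = finsum M (\<lambda>x. b x \<odot>\<^bsub>M\<^esub> x) G" by auto
    have "u \<oplus>\<^bsub>M\<^esub> v = finsum M (\<lambda>x. a x \<odot>\<^bsub>M\<^esub> x \<oplus>\<^bsub>M\<^esub> b x \<odot>\<^bsub>M\<^esub> x) G"
      using a b cl by (simp add: finsum_addf)
    also have "\<dots> = finsum M (\<lambda>x. (a x \<oplus>\<^bsub>R\<^esub> b x) \<odot>\<^bsub>M\<^esub> x) G"
      using a(1) b(1) assms(2) by (intro finsum_cong') (auto simp: Pi_iff smult_l_distr subset_iff)
    finally show "u \<oplus>\<^bsub>M\<^esub> v \<in> ?N" using a(1) b(1)
      by (intro CollectI exI[of _ "\<lambda>x. a x \<oplus>\<^bsub>R\<^esub> b x"]) auto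
  next
    fix c u assume c: "c \<in> carrier R" and "u \<in> ?N"
    then obtain a where a: "a \<in> G \<rightarrow> carrier R" "u = finsum M (\<lambda>x. a x \<odot>\<^bsub>M\<^esub> x) G" by auto
    have "c \<odot>\<^bsub>M\<^esub> finsum M f H = finsum M (\<lambda>x. c \<odot>\<^bsub>M\<^esub> f x) H" if "finite H" "f \<in> H \<rightarrow> carrier M" for f H
      using that by (induction H) (auto simp: c smult_r_distr Pi_iff)
    from this[OF assms(1) cl[OF a(1)]] have "c \<odot>\<^bsub>M\<^esub> u = finsum M (\<lambda>x. c \<odot>\<^bsub>M\<^esub> (a x \<odot>\<^bsub>M\<^esub> x)) G"
      unfolding a(2) .
    also have "\<dots> = finsum M (\<lambda>x. (c \<otimes>\<^bsub>R\<^esub> a x) \<odot>\<^bsub>M\<^esub> x) G"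
      using a(1) c assms(2) by (intro finsum_cong') (auto simp: Pi_iff smult_assoc subset_iff)
    finally show "c \<odot>\<^bsub>M\<^esub> u \<in> ?N" using a(1) c
      by (intro CollectI exI[of _ "\<lambda>x. c \<otimes>\<^bsub>R\<^esub> a x"]) auto
  qed
  show "G \<subseteq> ?N"
  proof
    fix y assume y: "y \<in> G"
    then have yM: "y \<in> carrier M" using assms(2) by auto
    have "finsum M (\<lambda>x. (if y = x then \<one>\<^bsub>R\<^esub> else \<zero>\<^bsub>R\<^esub>) \<odot>\<^bsub>M\<^esub> x) G
        = finsum M (\<lambda>x. if y = x then x else \<zero>\<^bsub>M\<^esub>) G"
      using assms(2) by (intro finsum_cong') auto
    also have "\<dots> = y"
      using finsum_singleton[OF y assms(1), of "\<lambda>x. x"] assms(2) by auto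
    finally show "y \<in> ?N"
      by (intro CollectI exI[of _ "\<lambda>x. if y = x then \<one>\<^bsub>R\<^esub> else \<zero>\<^bsub>R\<^esub>"]) auto
  qed
qed

end

lemma transport_module:
  fixes M :: "('a, 'm) module" and p :: "'m \<Rightarrow> 'n"
  assumes "left_module R M" and "fin_gen R M" and p: "inj_on p (carrier M)"
  shows "\<exists>N :: ('a, 'n) module. left_module R N \<and> fin_gen R N \<and> mod_iso R M N"
proof -
  interpret left_module R M by fact
  define q where "q = inv_into (carrier M) p"
  have qp [simp]: "q (p x) = x" if "x \<in> carrier M" for x
    using p that by (simp add: q_def)
  define N :: "('a, 'n) module" where "N =
    \<lparr>carrier = p ` carrier M, monoid.mult = undefined, one = undefined, zero = p \<zero>\<^bsub>M\<^esub>,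
     add = (\<lambda>x y. p (q x \<oplus>\<^bsub>M\<^esub> q y)), smult = (\<lambda>a x. p (a \<odot>\<^bsub>M\<^esub> q x))\<rparr>"
  have N [simp]: "carrier N = p ` carrier M" "zero N = p \<zero>\<^bsub>M\<^esub>"
      "add N x y = p (q x \<oplus>\<^bsub>M\<^esub> q y)" "smult N a x = p (a \<odot>\<^bsub>M\<^esub> q x)" for x y a
    by (simp_all add: N_def)
  have "abelian_group N"
  proof (rule abelian_groupI)
    fix x assume "x \<in> carrier N"
    then obtain x' where x': "x' \<in> carrier M" "x = p x'" by auto
    then show "\<exists>y\<in>carrier N. y \<oplus>\<^bsub>N\<^esub> x = \<zero>\<^bsub>N\<^esub>"
      by (intro bexI[of _ "p (\<ominus>\<^bsub>M\<^esub> x')"]) (simp_all add: l_neg)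
  qed (auto simp: a_ac)
  moreover have "ring R" by (rule R.ring_axioms)
  ultimately have lm: "left_module R N"
    by (intro left_module.intro left_module_axioms.intro)
       (auto simp: smult_l_distr smult_r_distr smult_assoc)
  have hom: "p \<in> Hom R M N"
    by (auto simp: LinearCombinations.module_hom_def)
  have iso: "mod_iso R M N"
    unfolding mod_iso_def bij_betw_def by (rule bexI[OF _ hom]) (simp add: p)
  have sub: "is_submodule R M (q ` N')" if "is_submodule R N N'" for N'
  proof -
    interpret N': Module.submodule N' R N by fact
    have sub: "N' \<subseteq> p ` carrier M" using N'.subset by simp
    have cl: "p (q x \<oplus>\<^bsub>M\<^esub> q y) \<in> N'" "p (a \<odot>\<^bsub>M\<^esub> q x) \<in> N'"
      if "x \<in> N'" "y \<in> N'" "a \<in> carrier R" for x y a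
      using N'.m_closed[of x y] N'.smult_closed[of a x] that by simp_all
    have qN: "q x \<in> carrier M" if "x \<in> N'" for x
    proof -
      have "x \<in> p ` carrier M" using sub that by (rule subsetD)
      then obtain u where "u \<in> carrier M" "x = p u" by (rule imageE)
      then show ?thesis by simp
    qed
    have one: "p \<zero>\<^bsub>M\<^esub> \<in> N'" using N'.one_closed by simp
    show ?thesis
    proof (rule submoduleI)
      show "q ` N' \<subseteq> carrier M" using qN by auto
      show "\<zero>\<^bsub>M\<^esub> \<in> q ` N'" using imageI[OF one, of q] by simp
      fix x y assume "x \<in> q ` N'" "y \<in> q ` N'"
      then obtain u v where uv: "u \<in> N'" "x = q u" "v \<in> N'" "y = q v" by auto
      then show "x \<oplus>\<^bsub>M\<^esub> y \<in> q ` N'"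
        using imageI[OF cl(1)[OF uv(1,3)], of "\<one>\<^bsub>R\<^esub>" q] qN[OF uv(1)] qN[OF uv(3)] by simp
    next
      fix a x assume a: "a \<in> carrier R" and "x \<in> q ` N'"
      then obtain u where u: "u \<in> N'" "x = q u" by auto
      then show "a \<odot>\<^bsub>M\<^esub> x \<in> q ` N'"
        using imageI[OF cl(2)[OF u(1) u(1) a], of q] qN[OF u(1)] a by simp
    qed
  qed
  obtain G where G: "finite G" "G \<subseteq> carrier M"
      "\<And>N. is_submodule R M N \<Longrightarrow> G \<subseteq> N \<Longrightarrow> N = carrier M"
    using \<open>fin_gen R M\<close> unfolding fin_gen_def by blast
  have "N' = carrier N" if N': "is_submodule R N N'" "p ` G \<subseteq> N'" for N'
  proof -
    have "G \<subseteq> q ` N'"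
    proof
      fix x assume x: "x \<in> G"
      then have "x = q (p x)" using G(2) qp[of x] by auto
      moreover have "p x \<in> N'" using x N'(2) by auto
      ultimately show "x \<in> q ` N'" by (rule image_eqI)
    qed
    then have "q ` N' = carrier M" using sub[OF N'(1)] G(3) by blast
    moreover have "N' \<subseteq> p ` carrier M"
      using subgroup.subset[OF Module.submodule.axioms(1)[OF N'(1)]] by simp
    moreover have "p (q y) = y" if "y \<in> p ` carrier M" for y
      using that by auto
    ultimately have "N' = (\<lambda>y. p (q y)) ` N'" by (metis (no_types, lifting) image_cong image_ident subsetD)
    then have "N' = p ` (q ` N')" by (simp only: image_image)
    then show ?thesis using \<open>q ` N' = carrier M\<close> by simp
  qed
  then have "fin_gen R N"
    unfolding fin_gen_def using G by (intro exI[of _ "p ` G"]) auto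
  with lm iso show ?thesis by blast
qed


section \<open>Basic algebras\<close>

definition idempotent :: "('a, 'x) ring_scheme \<Rightarrow> 'a \<Rightarrow> bool" where
  "idempotent R e \<longleftrightarrow> e \<in> carrier R \<and> e \<otimes>\<^bsub>R\<^esub> e = e"

definition orthogonal_elements :: "('a, 'x) ring_scheme \<Rightarrow> 'a \<Rightarrow> 'a \<Rightarrow> bool" where
  "orthogonal_elements R e f \<longleftrightarrow> e \<otimes>\<^bsub>R\<^esub> f = \<zero>\<^bsub>R\<^esub> \<and> f \<otimes>\<^bsub>R\<^esub> e = \<zero>\<^bsub>R\<^esub>"

definition primitive_idempotent :: "('a, 'x) ring_scheme \<Rightarrow> 'a \<Rightarrow> bool" where
  "primitive_idempotent R e \<longleftrightarrow> idempotent R e \<and> e \<noteq> \<zero>\<^bsub>R\<^esub> \<and>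
     (\<forall>f g. idempotent R f \<and> idempotent R g \<and> orthogonal_elements R f g \<and> e = f \<oplus>\<^bsub>R\<^esub> g \<longrightarrow>
            f = \<zero>\<^bsub>R\<^esub> \<or> g = \<zero>\<^bsub>R\<^esub>)"

definition complete_primitive_orthogonal :: "('a, 'x) ring_scheme \<Rightarrow> 'a set \<Rightarrow> bool" where
  "complete_primitive_orthogonal R E \<longleftrightarrow> finite E \<and> (\<forall>e\<in>E. primitive_idempotent R e) \<and>
     pairwise (orthogonal_elements R) E \<and> (\<Oplus>\<^bsub>R\<^esub>e\<in>E. e) = \<one>\<^bsub>R\<^esub>"

text \<open>The left module \<open>A e\<close>.\<close>

definition principal_left_module :: "('k, 'a) module \<Rightarrow> 'a \<Rightarrow> ('a, 'a) module" where
  "principal_left_module A e =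
     \<lparr>carrier = (\<lambda>x. x \<otimes>\<^bsub>A\<^esub> e) ` carrier A, monoid.mult = undefined, one = undefined,
      zero = \<zero>\<^bsub>A\<^esub>, add = add A, smult = monoid.mult A\<rparr>"

text \<open>
  Every finite dimensional algebra has a complete set of primitive orthogonal idempotents, and by
  Krull--Schmidt the condition does not depend on its choice.
\<close>

definition basic_algebra :: "('k, 'a) module \<Rightarrow> bool" where
  "basic_algebra A \<longleftrightarrow>
     (\<exists>E. complete_primitive_orthogonal A E \<and>
          pairwise (\<lambda>e f. \<not> mod_iso A (principal_left_module A e) (principal_left_module A f)) E)"


section \<open>The category of finitely generated modules\<close>

text \<open>
  HOL cannot quantify over all carrier types inside a formula, so \<open>mod A\<close> consists of the
  finitely generated left modules whose carrier is a set of elements of type \<open>nat \<Rightarrow> 'k\<close>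
  (with arbitrary operations). Nothing is lost: by \<open>mod_cat_universal\<close> below, every finitely
  generated left module with carrier in any type is isomorphic to one of these.
\<close>

definition mod_cat :: "('k, 'a) module \<Rightarrow> ('a, nat \<Rightarrow> 'k) module set" where
  "mod_cat A = {M. left_module A M \<and> fin_gen A M}"

lemma mod_cat_universal:
  fixes K :: "'k ring" and A :: "('k, 'a) module" and M :: "('a, 'm) module"
  assumes "fd_algebra K A" and "left_module A M" and "fin_gen A M"
  shows "\<exists>N\<in>mod_cat A. mod_iso A M N"
proof -
  interpret fd_algebra K A by fact
  interpret M: left_module A M by fact
  obtain B where B: "finite B" "B \<subseteq> carrier A" "span B = carrier A"
    using finite_dimensional unfolding fin_dim_def by auto
  obtain G where G: "finite G" "G \<subseteq> carrier M"
      "\<And>N. is_submodule A M N \<Longrightarrow> G \<subseteq> N \<Longrightarrow> N = carrier M"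
    using assms(3) unfolding fin_gen_def by blast
  have expA: "\<exists>c. c \<in> B \<rightarrow> carrier K \<and> a = lincomb c B" if "a \<in> carrier A" for a
  proof -
    have "a \<in> {lincomb c B | c. c \<in> B \<rightarrow> carrier K}"
      using that B finite_span[of B] by simp
    then show ?thesis by blast
  qed
  obtain e :: "'m \<times> 'a \<Rightarrow> nat" where e: "inj_on e (G \<times> B)"
    using finite_imp_inj_to_nat_seg[of "G \<times> B"] G(1) B(1) by blast
  define F where "F c = finsum M (\<lambda>x. lincomb (\<lambda>b. c (e (x, b))) B \<odot>\<^bsub>M\<^esub> x) G" for c
  have ex: "\<exists>c. m = F c" if m: "m \<in> carrier M" for m
  proof -
    have "carrier M = {finsum M (\<lambda>x. a x \<odot>\<^bsub>M\<^esub> x) G | a. a \<in> G \<rightarrow> carrier A}"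
      using G(3) M.finsum_submodule[OF G(1,2)] by blast
    then obtain a where a: "a \<in> G \<rightarrow> carrier A" "m = finsum M (\<lambda>x. a x \<odot>\<^bsub>M\<^esub> x) G"
      using m by auto
    have "\<forall>x\<in>G. \<exists>c. c \<in> B \<rightarrow> carrier K \<and> a x = lincomb c B" using a(1) expA by blast
    then obtain c where c: "\<And>x. x \<in> G \<Longrightarrow> c x \<in> B \<rightarrow> carrier K"
        "\<And>x. x \<in> G \<Longrightarrow> a x = lincomb (c x) B" by metis
    define d where "d i = case_prod c (inv_into (G \<times> B) e i)" for i
    have d: "d (e (x, b)) = c x b" if "x \<in> G" "b \<in> B" for x b
      using that e by (simp add: d_def)
    have "a x = lincomb (\<lambda>b. d (e (x, b))) B" if x: "x \<in> G" for x
      unfolding c(2)[OF x] lincomb_def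
      using c(1)[OF x] B(2) d[OF x] by (intro finsum_cong') (auto simp: Pi_iff subset_iff)
    then have "m = F d"
      unfolding a(2) F_def using a(1) G(2)
      by (intro M.finsum_cong') (auto simp: Pi_iff subset_iff)
    then show ?thesis by blast
  qed
  define cf where "cf m = (SOME c. m = F c)" for m
  have "F (cf m) = m" if "m \<in> carrier M" for m
    using someI_ex[OF ex[OF that]] by (simp add: cf_def)
  then have inj: "inj_on cf (carrier M)"
    by (metis inj_onI)
  from transport_module[OF assms(2,3) inj] show ?thesis
    unfolding mod_cat_def by blast
qed

definition iso_class ::
    "('k, 'a) module \<Rightarrow> ('a, nat \<Rightarrow> 'k) module \<Rightarrow> ('a, nat \<Rightarrow> 'k) module set" where
  "iso_class A M = {N \<in> mod_cat A. mod_iso A M N}"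

definition simples :: "('k, 'a) module \<Rightarrow> ('a, nat \<Rightarrow> 'k) module set" where
  "simples A = {M \<in> mod_cat A. simple_module A M}"

definition alg_rank :: "('k, 'a) module \<Rightarrow> nat" where
  "alg_rank A = card (iso_class A ` simples A)"

text \<open>The \<open>K\<close>-vector space underlying an \<open>A\<close>-module, where \<open>c\<close> acts as \<open>c 1\<^sub>A\<close>.\<close>

definition underlying_vs :: "('k, 'a) module \<Rightarrow> ('a, 'm) module \<Rightarrow> ('k, 'm) module" where
  "underlying_vs A M =
     \<lparr>carrier = carrier M, monoid.mult = undefined, one = undefined, zero = zero M, add = add M,
      smult = (\<lambda>c x. (c \<odot>\<^bsub>A\<^esub> \<one>\<^bsub>A\<^esub>) \<odot>\<^bsub>M\<^esub> x)\<rparr>"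

definition mod_dim :: "'k ring \<Rightarrow> ('k, 'a) module \<Rightarrow> ('a, 'm) module \<Rightarrow> nat" where
  "mod_dim K A M = vectorspace.dim K (underlying_vs A M)"


section \<open>Bricks and semibricks\<close>

text \<open>
  Homomorphisms are only determined on the carrier; taking them extensional makes every
  endomorphism occur exactly once in the endomorphism algebra.
\<close>

definition End_algebra :: "('k, 'a) module \<Rightarrow> ('a, 'm) module \<Rightarrow> ('k, 'm \<Rightarrow> 'm) module" where
  "End_algebra A M =
     \<lparr>carrier = Hom A M M \<inter> extensional (carrier M),
      monoid.mult = (\<lambda>f g. compose (carrier M) f g),
      one = (\<lambda>x\<in>carrier M. x),
      zero = (\<lambda>x\<in>carrier M. \<zero>\<^bsub>M\<^esub>),
      add = (\<lambda>f g. \<lambda>x\<in>carrier M. f x \<oplus>\<^bsub>M\<^esub> g x),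
      smult = (\<lambda>c f. \<lambda>x\<in>carrier M. (c \<odot>\<^bsub>A\<^esub> \<one>\<^bsub>A\<^esub>) \<odot>\<^bsub>M\<^esub> f x)\<rparr>"

definition ground_algebra :: "'k ring \<Rightarrow> ('k, 'k) module" where
  "ground_algebra K =
     \<lparr>carrier = carrier K, monoid.mult = monoid.mult K, one = one K, zero = zero K, add = add K,
      smult = monoid.mult K\<rparr>"

definition algebra_iso :: "'k ring \<Rightarrow> ('k, 'a) module \<Rightarrow> ('k, 'b) module \<Rightarrow> bool" where
  "algebra_iso K A B \<longleftrightarrow>
     (\<exists>h\<in>ring_iso A B. \<forall>c\<in>carrier K. \<forall>x\<in>carrier A. h (c \<odot>\<^bsub>A\<^esub> x) = c \<odot>\<^bsub>B\<^esub> h x)"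

definition bricks :: "'k ring \<Rightarrow> ('k, 'a) module \<Rightarrow> ('a, nat \<Rightarrow> 'k) module set" where
  "bricks K A = {M \<in> mod_cat A. algebra_iso K (End_algebra A M) (ground_algebra K)}"

definition brick_finite :: "'k ring \<Rightarrow> ('k, 'a) module \<Rightarrow> bool" where
  "brick_finite K A \<longleftrightarrow> finite (iso_class A ` bricks K A)"

definition hom_orthogonal :: "('k, 'a) module \<Rightarrow> ('a, nat \<Rightarrow> 'k) module set \<Rightarrow> bool" where
  "hom_orthogonal A S \<longleftrightarrow> S \<noteq> {} \<and> S \<subseteq> mod_cat A \<and> (\<forall>M\<in>S. nonzero_module M) \<and>
     pairwise (\<lambda>M N. \<not> mod_iso A M N \<and> Hom_zero A M N \<and> Hom_zero A N M) S"

definition semibrick ::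
    "'k ring \<Rightarrow> ('k, 'a) module \<Rightarrow> ('a, nat \<Rightarrow> 'k) module set \<Rightarrow> bool" where
  "semibrick K A S \<longleftrightarrow> hom_orthogonal A S \<and> S \<subseteq> bricks K A"

text \<open>Semibricks of size \<open>n\<close> up to isomorphism, as sets of isomorphism classes of modules.\<close>

definition semibricks_of_size ::
    "'k ring \<Rightarrow> ('k, 'a) module \<Rightarrow> nat \<Rightarrow> ('a, nat \<Rightarrow> 'k) module set set set" where
  "semibricks_of_size K A n = {iso_class A ` S | S. semibrick K A S \<and> finite S \<and> card S = n}"

end

theory Submission
  imports Defs
begin

text \<open>
  For a nonzero module \<open>M\<close>, let \<open>e\<close> be a nonzero endomorphism whose image \<open>B\<close> has minimal dimension. An
  endomorphism of \<open>B\<close> with nonzero kernel, composed with \<open>e\<close>, has a smaller image and hence vanishes;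
  subtracting an eigenvalue from an arbitrary endomorphism of \<open>B\<close> shows that \<open>B\<close> is a brick. A nonzero
  homomorphism between two such images yields one between the modules, so Hom-orthogonality is inherited.
  Part (2) follows by the pigeonhole principle.

  For part (1), attach to a torsion pair \<open>(T, F)\<close> the simple objects of the heart of its tilted t-structure:
  certain modules of \<open>T\<close> and certain (shifted) modules of \<open>F\<close>. If \<open>F\<close> is nonzero, take a torsion class
  \<open>T'\<close> above \<open>T\<close> with as few bricks as possible and \<open>B\<close> of minimal dimension in \<open>T' \<inter> F\<close>. Then
  \<open>B\<close> is a simple object for both pairs, and mutation at \<open>B\<close> maps the other simple objects for
  \<open>(T, F)\<close> injectively to those for \<open>(T', F')\<close>; the extremal choices it needs exist because there
  are only finitely many bricks. As the torsion classes reach \<open>mod A\<close> after finitely many steps, where the simple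
  objects are the \<open>n\<close> simple modules, every torsion pair has at most \<open>n\<close> of them. A semibrick consists
  of simple objects lying in the torsion class it generates. If it has size \<open>n\<close>, there is no room for
  one in \<open>F\<close>, so \<open>F\<close> vanishes and the semibrick consists of the simple modules.
\<close>


text \<open>The heart itself is never formed; only its monomorphisms and epimorphisms are needed,
  and these are visible on modules. A map between modules of \<open>T\<close> is an epimorphism of
  the heart if it is onto with kernel in \<open>T\<close>; a map between modules of
  \<open>F\<close>, once shifted, is a monomorphism if it is injective with cokernel in
  \<open>F\<close>. The obstacle is that the heart is not known to have finite length, so the number
  of its simple objects cannot be read off from a Grothendieck group. Hence only an inequality is
  transported through the torsion classes, and an injection suffices at each step. Between two
  neighbouring pairs lies a gap, whose modules are iterated extensions of \<open>B\<close>. Crossing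
  it, \<open>B\<close> loses its shift, and every other simple object absorbs or sheds as much of
  the gap as possible. That a largest amount exists is not clear from lengths alone: each candidate,
  or its kernel, turns out to be a brick, or else it embeds in a fixed module, and in the
  brick-finite case this bounds its length.\<close>

abbreviation restrict_module :: "('a, 'm) module \<Rightarrow> 'm set \<Rightarrow> ('a, 'm) module"
    (infixl "\<restriction>" 75) where
  "M \<restriction> U \<equiv> M\<lparr>carrier := U\<rparr>"

definition kern :: "('m \<Rightarrow> 'n) \<Rightarrow> ('a, 'm) module \<Rightarrow> ('a, 'n) module \<Rightarrow> 'm set" where
  "kern f M N = {x \<in> carrier M. f x = \<zero>\<^bsub>N\<^esub>}"

section \<open>Submodules and homomorphisms\<close>

lemma is_submodule_iff:
  assumes "left_module R M"
  shows "is_submodule R M U \<longleftrightarrow> U \<subseteq> carrier M \<and> \<zero>\<^bsub>M\<^esub> \<in> U \<and> (\<forall>x\<in>U. \<forall>y\<in>U. x \<oplus>\<^bsub>M\<^esub> y \<in> U) \<and>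
           (\<forall>a\<in>carrier R. \<forall>x\<in>U. a \<odot>\<^bsub>M\<^esub> x \<in> U)"
proof -
  interpret left_module R M by fact
  show ?thesis
  proof
    assume "is_submodule R M U"
    then interpret Module.submodule U R M .
    show "U \<subseteq> carrier M \<and> \<zero>\<^bsub>M\<^esub> \<in> U \<and> (\<forall>x\<in>U. \<forall>y\<in>U. x \<oplus>\<^bsub>M\<^esub> y \<in> U) \<and>
           (\<forall>a\<in>carrier R. \<forall>x\<in>U. a \<odot>\<^bsub>M\<^esub> x \<in> U)"
      using subset one_closed m_closed smult_closed by auto
  qed (blast intro: submoduleI)
qed

lemma left_module_restrict:
  assumes M: "left_module R M" and U: "is_submodule R M U"
  shows "left_module R (M \<restriction> U)"
proof -
  interpret left_module R M by fact
  have s: "U \<subseteq> carrier M" "\<zero>\<^bsub>M\<^esub> \<in> U" "\<And>x y. x \<in> U \<Longrightarrow> y \<in> U \<Longrightarrow> x \<oplus>\<^bsub>M\<^esub> y \<in> U"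
    "\<And>a x. a \<in> carrier R \<Longrightarrow> x \<in> U \<Longrightarrow> a \<odot>\<^bsub>M\<^esub> x \<in> U"
    using U unfolding is_submodule_iff[OF M] by auto
  have "abelian_group (M \<restriction> U)"
  proof (rule abelian_groupI)
    fix x assume "x \<in> carrier (M \<restriction> U)"
    then have x: "x \<in> U" "x \<in> carrier M" using s by auto
    then have "\<ominus>\<^bsub>M\<^esub> x \<in> U"
      using s(4)[of "\<ominus>\<^bsub>R\<^esub> \<one>\<^bsub>R\<^esub>" x] uminus_one_smult[of x] by simp
    then show "\<exists>y\<in>carrier (M \<restriction> U). y \<oplus>\<^bsub>M \<restriction> U\<^esub> x = \<zero>\<^bsub>M \<restriction> U\<^esub>"
      using x by (intro bexI[of _ "\<ominus>\<^bsub>M\<^esub> x"]) (auto simp: l_neg)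
  qed (use s in \<open>auto simp: a_ac subset_iff\<close>)
  then show ?thesis
    using s by (intro left_module.intro left_module_axioms.intro R.ring_axioms)
      (auto simp: smult_l_distr smult_r_distr smult_assoc subset_iff)
qed

lemma is_submodule_restrict:
  assumes "left_module R M" "is_submodule R M U"
  shows "is_submodule R (M \<restriction> U) V \<longleftrightarrow> is_submodule R M V \<and> V \<subseteq> U"
proof -
  have "U \<subseteq> carrier M" using assms by (simp add: is_submodule_iff)
  then show ?thesis
    using assms(1) left_module_restrict[OF assms] by (auto simp: is_submodule_iff)
qed

lemma Hom_iff:
  "f \<in> Hom R M N \<longleftrightarrow> (\<forall>x\<in>carrier M. f x \<in> carrier N) \<and>
     (\<forall>x\<in>carrier M. \<forall>y\<in>carrier M. f (x \<oplus>\<^bsub>M\<^esub> y) = f x \<oplus>\<^bsub>N\<^esub> f y) \<and>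
     (\<forall>a\<in>carrier R. \<forall>x\<in>carrier M. f (a \<odot>\<^bsub>M\<^esub> x) = a \<odot>\<^bsub>N\<^esub> f x)"
  unfolding LinearCombinations.module_hom_def by blast

locale module_hom_pair =
  M: left_module R M + N: left_module R N
  for R :: "('a, 'x) ring_scheme" and M :: "('a, 'm) module" and N :: "('a, 'n) module" and f +
  assumes hom: "f \<in> Hom R M N"
begin

lemma closed [simp, intro]: "x \<in> carrier M \<Longrightarrow> f x \<in> carrier N"
  and add: "x \<in> carrier M \<Longrightarrow> y \<in> carrier M \<Longrightarrow> f (x \<oplus>\<^bsub>M\<^esub> y) = f x \<oplus>\<^bsub>N\<^esub> f y"
  and smult: "a \<in> carrier R \<Longrightarrow> x \<in> carrier M \<Longrightarrow> f (a \<odot>\<^bsub>M\<^esub> x) = a \<odot>\<^bsub>N\<^esub> f x"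
  using hom by (auto simp: Hom_iff)

lemma zero [simp]: "f \<zero>\<^bsub>M\<^esub> = \<zero>\<^bsub>N\<^esub>"
  using smult[of "\<zero>\<^bsub>R\<^esub>" "\<zero>\<^bsub>M\<^esub>"] by simp

lemma minus: "x \<in> carrier M \<Longrightarrow> y \<in> carrier M \<Longrightarrow> f (x \<ominus>\<^bsub>M\<^esub> y) = f x \<ominus>\<^bsub>N\<^esub> f y"
  using smult[of "\<ominus>\<^bsub>R\<^esub> \<one>\<^bsub>R\<^esub>" y]
  by (simp add: a_minus_def add M.uminus_one_smult N.uminus_one_smult)

lemma eq_iff: "x \<in> carrier M \<Longrightarrow> y \<in> carrier M \<Longrightarrow> f x = f y \<longleftrightarrow> x \<ominus>\<^bsub>M\<^esub> y \<in> kern f M N"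
  by (auto simp: kern_def minus)

lemma submodule_kern: "is_submodule R M (kern f M N)"
  using M.left_module_axioms by (auto simp: is_submodule_iff kern_def add smult)

lemma submodule_image:
  assumes "is_submodule R M U"
  shows "is_submodule R N (f ` U)"
proof -
  have s: "U \<subseteq> carrier M" "\<zero>\<^bsub>M\<^esub> \<in> U" "\<And>x y. x \<in> U \<Longrightarrow> y \<in> U \<Longrightarrow> x \<oplus>\<^bsub>M\<^esub> y \<in> U"
    "\<And>a x. a \<in> carrier R \<Longrightarrow> x \<in> U \<Longrightarrow> a \<odot>\<^bsub>M\<^esub> x \<in> U"
    using assms unfolding is_submodule_iff[OF M.left_module_axioms] by auto
  show ?thesis unfolding is_submodule_iff[OF N.left_module_axioms]
  proof (intro conjI ballI)
    show "f ` U \<subseteq> carrier N" using s(1) by auto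
    show "\<zero>\<^bsub>N\<^esub> \<in> f ` U" using s(2) by (metis image_eqI zero)
    show "x \<oplus>\<^bsub>N\<^esub> y \<in> f ` U" if "x \<in> f ` U" "y \<in> f ` U" for x y
      using that s(1,3) by (auto simp: subset_iff simp flip: add)
    show "a \<odot>\<^bsub>N\<^esub> x \<in> f ` U" if "a \<in> carrier R" "x \<in> f ` U" for a x
      using that s(1,4) by (auto simp: subset_iff simp flip: smult)
  qed
qed

lemma submodule_vimage:
  assumes "is_submodule R N V"
  shows "is_submodule R M {x \<in> carrier M. f x \<in> V}"
  using assms M.left_module_axioms N.left_module_axioms
  by (auto simp: is_submodule_iff add smult)

lemma inj_on_iff: "inj_on f (carrier M) \<longleftrightarrow> kern f M N = {\<zero>\<^bsub>M\<^esub>}"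
proof
  assume "inj_on f (carrier M)"
  then show "kern f M N = {\<zero>\<^bsub>M\<^esub>}"
    unfolding kern_def by (auto dest: inj_onD[of f "carrier M" _ "\<zero>\<^bsub>M\<^esub>"])
next
  assume k: "kern f M N = {\<zero>\<^bsub>M\<^esub>}"
  show "inj_on f (carrier M)"
    by (rule inj_onI) (auto simp: eq_iff k)
qed

end

section \<open>Classes of modules with a length function\<close>

text \<open>A class of modules that behaves like an abelian length category, with all carriers in
  one fixed type. Quotients and products are asserted only as objects of \<open>C\<close> with
  suitable maps, because cosets and pairs leave the carrier type. Additivity of \<open>len\<close>
  is stated for an arbitrary homomorphism, so that invariance under isomorphism and additivity along
  quotients come from the same axiom.\<close>

locale length_category =
  fixes R :: "('a, 'x) ring_scheme" and C :: "('a, 'm) module set" and len :: "('a, 'm) module \<Rightarrow> nat"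
  assumes is_left_module: "M \<in> C \<Longrightarrow> left_module R M"
    and restrict_in: "M \<in> C \<Longrightarrow> is_submodule R M U \<Longrightarrow> M \<restriction> U \<in> C"
    and quotient_ex: "M \<in> C \<Longrightarrow> is_submodule R M U \<Longrightarrow>
      \<exists>Q\<in>C. \<exists>p\<in>Hom R M Q. p ` carrier M = carrier Q \<and> kern p M Q = U"
    and product_ex: "M \<in> C \<Longrightarrow> N \<in> C \<Longrightarrow>
      \<exists>P\<in>C. \<exists>a\<in>Hom R P M. \<exists>b\<in>Hom R P N.
        bij_betw (\<lambda>z. (a z, b z)) (carrier P) (carrier M \<times> carrier N)"
    and len_hom: "M \<in> C \<Longrightarrow> N \<in> C \<Longrightarrow> f \<in> Hom R M N \<Longrightarrow>
      len M = len (M \<restriction> kern f M N) + len (N \<restriction> (f ` carrier M))"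
    and len_eq_0: "M \<in> C \<Longrightarrow> len M = 0 \<longleftrightarrow> carrier M = {\<zero>\<^bsub>M\<^esub>}"
begin

definition mor :: "('m \<Rightarrow> 'm) \<Rightarrow> ('a, 'm) module \<Rightarrow> ('a, 'm) module \<Rightarrow> bool" where
  "mor f M N \<longleftrightarrow> M \<in> C \<and> N \<in> C \<and> f \<in> Hom R M N"

definition submod :: "'m set \<Rightarrow> ('a, 'm) module \<Rightarrow> bool" where
  "submod U M \<longleftrightarrow> M \<in> C \<and> is_submodule R M U"

lemma mor_pair: "mor f M N \<Longrightarrow> module_hom_pair R M N f"
  by (simp add: mor_def module_hom_pair_def module_hom_pair_axioms_def is_left_module)

lemma morD: "mor f M N \<Longrightarrow> M \<in> C" "mor f M N \<Longrightarrow> N \<in> C" "mor f M N \<Longrightarrow> f \<in> Hom R M N"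
  by (auto simp: mor_def)

lemma mor_iff:
  "mor f M N \<longleftrightarrow> M \<in> C \<and> N \<in> C \<and> (\<forall>x\<in>carrier M. f x \<in> carrier N) \<and>
     (\<forall>x\<in>carrier M. \<forall>y\<in>carrier M. f (x \<oplus>\<^bsub>M\<^esub> y) = f x \<oplus>\<^bsub>N\<^esub> f y) \<and>
     (\<forall>a\<in>carrier R. \<forall>x\<in>carrier M. f (a \<odot>\<^bsub>M\<^esub> x) = a \<odot>\<^bsub>N\<^esub> f x)"
  by (simp add: mor_def Hom_iff)

lemma submod_iff:
  "submod U M \<longleftrightarrow> M \<in> C \<and> U \<subseteq> carrier M \<and> \<zero>\<^bsub>M\<^esub> \<in> U \<and> (\<forall>x\<in>U. \<forall>y\<in>U. x \<oplus>\<^bsub>M\<^esub> y \<in> U) \<and>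
     (\<forall>a\<in>carrier R. \<forall>x\<in>U. a \<odot>\<^bsub>M\<^esub> x \<in> U)"
  unfolding submod_def by (rule conj_cong[OF refl]) (rule is_submodule_iff[OF is_left_module])

lemma submod_subset: "submod U M \<Longrightarrow> U \<subseteq> carrier M"
  and submod_zero: "submod U M \<Longrightarrow> \<zero>\<^bsub>M\<^esub> \<in> U"
  and submod_in: "submod U M \<Longrightarrow> M \<in> C"
  by (simp_all only: submod_iff)

lemma submod_restrict_in: "submod U M \<Longrightarrow> M \<restriction> U \<in> C"
  by (simp add: submod_def restrict_in)

lemma submod_carrier: "M \<in> C \<Longrightarrow> submod (carrier M) M"
proof -
  assume M: "M \<in> C"
  then interpret left_module R M by (rule is_left_module)
  show ?thesis using M by (auto simp: submod_iff)
qed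

lemma submod_trivial: "M \<in> C \<Longrightarrow> submod {\<zero>\<^bsub>M\<^esub>} M"
proof -
  assume M: "M \<in> C"
  then interpret left_module R M by (rule is_left_module)
  show ?thesis using M by (auto simp: submod_iff)
qed

lemma zero_in: "M \<in> C \<Longrightarrow> \<zero>\<^bsub>M\<^esub> \<in> carrier M"
  using submod_carrier submod_zero by blast

lemma submod_restrict: "submod U M \<Longrightarrow> submod V (M \<restriction> U) \<longleftrightarrow> submod V M \<and> V \<subseteq> U"
  using submod_restrict_in is_submodule_restrict is_left_module unfolding submod_def by blast

lemma submod_Int: "submod U M \<Longrightarrow> submod V M \<Longrightarrow> submod (U \<inter> V) M"
  by (auto simp: submod_iff)

lemma submod_kern: "mor f M N \<Longrightarrow> submod (kern f M N) M"
  using module_hom_pair.submodule_kern[OF mor_pair] morD by (auto simp: submod_def)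

lemma submod_image: "mor f M N \<Longrightarrow> submod U M \<Longrightarrow> submod (f ` U) N"
  using module_hom_pair.submodule_image[OF mor_pair] morD by (auto simp: submod_def)

lemma submod_range: "mor f M N \<Longrightarrow> submod (f ` carrier M) N"
  using submod_image submod_carrier morD by blast

lemma submod_vimage: "mor f M N \<Longrightarrow> submod V N \<Longrightarrow> submod {x \<in> carrier M. f x \<in> V} M"
  using module_hom_pair.submodule_vimage[OF mor_pair] morD by (auto simp: submod_def)

lemma mor_closed: "mor f M N \<Longrightarrow> x \<in> carrier M \<Longrightarrow> f x \<in> carrier N"
  by (auto simp: mor_iff)

lemma mor_zero: "mor f M N \<Longrightarrow> f \<zero>\<^bsub>M\<^esub> = \<zero>\<^bsub>N\<^esub>"
proof -
  assume "mor f M N"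
  then interpret module_hom_pair R M N f by (rule mor_pair)
  show ?thesis by simp
qed

lemma mor_eq_iff: "mor f M N \<Longrightarrow> x \<in> carrier M \<Longrightarrow> y \<in> carrier M \<Longrightarrow>
    f x = f y \<longleftrightarrow> x \<ominus>\<^bsub>M\<^esub> y \<in> kern f M N"
  using module_hom_pair.eq_iff[OF mor_pair] by blast

lemma minus_closed: "M \<in> C \<Longrightarrow> x \<in> carrier M \<Longrightarrow> y \<in> carrier M \<Longrightarrow> x \<ominus>\<^bsub>M\<^esub> y \<in> carrier M"
proof -
  assume "M \<in> C" "x \<in> carrier M" "y \<in> carrier M"
  then interpret left_module R M using is_left_module by blast
  show ?thesis using \<open>x \<in> carrier M\<close> \<open>y \<in> carrier M\<close> by simp
qed

lemma mor_inj_iff: "mor f M N \<Longrightarrow> inj_on f (carrier M) \<longleftrightarrow> kern f M N = {\<zero>\<^bsub>M\<^esub>}"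
  using module_hom_pair.inj_on_iff[OF mor_pair] by blast

lemma mor_comp: "mor f M N \<Longrightarrow> mor g N P \<Longrightarrow> mor (g \<circ> f) M P"
  by (auto simp: mor_iff)

lemma mor_comp': "mor f M N \<Longrightarrow> mor g N P \<Longrightarrow> mor (\<lambda>x. g (f x)) M P"
  by (auto simp: mor_iff)

lemma mor_incl: "submod U M \<Longrightarrow> mor (\<lambda>x. x) (M \<restriction> U) M"
  using submod_restrict_in[of U M] by (auto simp: mor_iff submod_iff)

lemma mor_id: "M \<in> C \<Longrightarrow> mor (\<lambda>x. x) M M"
  by (auto simp: mor_iff)

lemma mor_restrict: "mor f M N \<Longrightarrow> submod U M \<Longrightarrow> mor f (M \<restriction> U) N"
  using submod_restrict_in[of U M] by (auto simp: mor_iff submod_iff subset_iff)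

lemma mor_corestrict: "mor f M N \<Longrightarrow> submod V N \<Longrightarrow> f ` carrier M \<subseteq> V \<Longrightarrow> mor f M (N \<restriction> V)"
  using submod_restrict_in[of V N] by (auto simp: mor_iff)

lemma kern_restrict: "U \<subseteq> carrier M \<Longrightarrow> kern f (M \<restriction> U) N = kern f M N \<inter> U"
  by (auto simp: kern_def)

lemma kern_corestrict [simp]: "kern f M (N \<restriction> V) = kern f M N"
  by (auto simp: kern_def)

lemma kern_subset: "kern f M N \<subseteq> carrier M"
  by (auto simp: kern_def)

text \<open>Any preimage under \<open>p\<close> serves to define the new map: two of them differ by
  an element of \<open>kern p M Q\<close>, which \<open>f\<close> kills.\<close>

lemma mor_descend:
  assumes p: "mor p M Q" "p ` carrier M = carrier Q" and f: "mor f M N" and k: "kern p M Q \<subseteq> kern f M N"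
  shows "\<exists>g. mor g Q N \<and> (\<forall>x\<in>carrier M. g (p x) = f x)"
proof -
  interpret p: module_hom_pair R M Q p using p(1) by (rule mor_pair)
  interpret f: module_hom_pair R M N f using f by (rule mor_pair)
  define g where "g = f \<circ> inv_into (carrier M) p"
  have g: "g (p x) = f x" if x: "x \<in> carrier M" for x
  proof -
    let ?y = "inv_into (carrier M) p (p x)"
    have y: "?y \<in> carrier M" "p ?y = p x" using x by (auto intro: inv_into_into f_inv_into_f)
    then have "f ?y = f x" using k x p.eq_iff f.eq_iff by blast
    then show ?thesis by (simp add: g_def)
  qed
  have gC: "\<forall>z\<in>carrier Q. g z \<in> carrier N" 
  proof
    fix z assume "z \<in> carrier Q"
    then obtain x where "x \<in> carrier M" "z = p x" using p(2) by blast
    then show "g z \<in> carrier N" by (simp add: g)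
  qed
  have "mor g Q N" unfolding mor_iff
  proof (intro conjI ballI)
    fix z w assume "z \<in> carrier Q" "w \<in> carrier Q"
    then obtain x y where "x \<in> carrier M" "z = p x" "y \<in> carrier M" "w = p y" using p(2) by blast
    then show "g (z \<oplus>\<^bsub>Q\<^esub> w) = g z \<oplus>\<^bsub>N\<^esub> g w" by (simp add: g f.add flip: p.add)
  next
    fix a z assume a: "a \<in> carrier R" and "z \<in> carrier Q"
    then obtain x where "x \<in> carrier M" "z = p x" using p(2) by blast
    then show "g (a \<odot>\<^bsub>Q\<^esub> z) = a \<odot>\<^bsub>N\<^esub> g z" using a by (simp add: g f.smult flip: p.smult)
  qed (use p f gC in \<open>auto dest: morD\<close>)
  then show ?thesis using g by blast
qed

lemma mor_inverse:
  assumes f: "mor f M N" and bij: "bij_betw f (carrier M) (carrier N)"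
  shows "\<exists>g. mor g N M \<and> bij_betw g (carrier N) (carrier M) \<and>
    (\<forall>x\<in>carrier M. g (f x) = x) \<and> (\<forall>y\<in>carrier N. f (g y) = y)"
proof -
  have surj: "f ` carrier M = carrier N" and "kern f M N = {\<zero>\<^bsub>M\<^esub>}"
    using bij mor_inj_iff[OF f] by (auto simp: bij_betw_def)
  then have "kern f M N \<subseteq> kern (\<lambda>x. x) M M" using zero_in[OF morD(1)[OF f]] by (auto simp: kern_def)
  with surj obtain g where g: "mor g N M" "\<And>x. x \<in> carrier M \<Longrightarrow> g (f x) = x"
    using mor_descend[OF f _ mor_id] morD[OF f] by blast
  have fg: "f (g y) = y" if "y \<in> carrier N" for y
    using that g(2) by (auto simp flip: surj)
  moreover have "bij_betw g (carrier N) (carrier M)"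
    by (rule bij_betw_byWitness[of _ f]) (use g fg f mor_closed[OF f] mor_closed[OF g(1)] in auto)
  ultimately show ?thesis using g by blast
qed

lemma mod_isoI: "mor f M N \<Longrightarrow> bij_betw f (carrier M) (carrier N) \<Longrightarrow> mod_iso R M N"
  by (auto simp: mod_iso_def dest: morD)

lemma mod_isoE:
  assumes "mod_iso R M N" "M \<in> C" "N \<in> C"
  obtains f where "mor f M N" "bij_betw f (carrier M) (carrier N)"
  using assms by (auto simp: mod_iso_def mor_def)

lemma mod_iso_refl: "M \<in> C \<Longrightarrow> mod_iso R M M"
  using mod_isoI[OF mor_id] by (auto simp: bij_betw_def)

lemma mod_iso_sym: "mod_iso R M N \<Longrightarrow> M \<in> C \<Longrightarrow> N \<in> C \<Longrightarrow> mod_iso R N M"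
  by (erule mod_isoE, assumption+) (drule (1) mor_inverse, blast intro: mod_isoI)

lemma mod_iso_trans:
  "mod_iso R M N \<Longrightarrow> mod_iso R N P \<Longrightarrow> M \<in> C \<Longrightarrow> N \<in> C \<Longrightarrow> P \<in> C \<Longrightarrow> mod_iso R M P"
  by (elim mod_isoE) (auto intro: mod_isoI mor_comp bij_betw_trans)

text \<open>The difference of the two lengths is the length of a quotient by \<open>U\<close>, and a
  quotient of length zero is trivial.\<close>

lemma len_restrict_le: "submod U M \<Longrightarrow> len (M \<restriction> U) \<le> len M"
  and len_restrict_eq: "submod U M \<Longrightarrow> len (M \<restriction> U) = len M \<Longrightarrow> U = carrier M"
proof -
  assume U: "submod U M"
  then obtain Q p where p: "mor p M Q" "p ` carrier M = carrier Q" "kern p M Q = U"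
    using quotient_ex unfolding submod_def mor_def by blast
  then have l: "len M = len (M \<restriction> U) + len Q" using len_hom[of M Q p] by (auto dest: morD)
  then show "len (M \<restriction> U) \<le> len M" by simp
  assume "len (M \<restriction> U) = len M"
  then have "carrier Q = {\<zero>\<^bsub>Q\<^esub>}" using l len_eq_0 morD[OF p(1)] by auto
  then have "kern p M Q = carrier M" using p(2) by (auto simp: kern_def)
  then show "U = carrier M" using p by simp
qed

lemma len_mor: "mor f M N \<Longrightarrow> len M = len (M \<restriction> kern f M N) + len (N \<restriction> (f ` carrier M))"
  using len_hom morD by blast

lemma len_trivial: "M \<in> C \<Longrightarrow> len (M \<restriction> {\<zero>\<^bsub>M\<^esub>}) = 0"
  using len_eq_0[OF submod_restrict_in[OF submod_trivial]] by simp

lemma len_epi: "mor f M N \<Longrightarrow> f ` carrier M = carrier N \<Longrightarrow> len M = len (M \<restriction> kern f M N) + len N"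
  using len_mor by fastforce

lemma len_mono: "mor f M N \<Longrightarrow> kern f M N = {\<zero>\<^bsub>M\<^esub>} \<Longrightarrow> len M = len (N \<restriction> (f ` carrier M))"
  using len_mor len_trivial morD by fastforce

lemma len_iso: "mor f M N \<Longrightarrow> bij_betw f (carrier M) (carrier N) \<Longrightarrow> len M = len N"
  using len_epi[of f M N] mor_inj_iff[of f M N] len_trivial[of M] by (auto simp: bij_betw_def mor_def)

lemma len_mod_iso: "mod_iso R M N \<Longrightarrow> M \<in> C \<Longrightarrow> N \<in> C \<Longrightarrow> len M = len N"
  by (erule mod_isoE, assumption+) (rule len_iso)

lemma inj_iff_surj:
  assumes "mor f M N" "len M = len N"
  shows "kern f M N = {\<zero>\<^bsub>M\<^esub>} \<longleftrightarrow> f ` carrier M = carrier N"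
proof
  assume "kern f M N = {\<zero>\<^bsub>M\<^esub>}"
  then show "f ` carrier M = carrier N"
    using len_mono[OF assms(1)] assms(2) len_restrict_eq[OF submod_range[OF assms(1)]] by simp
next
  assume "f ` carrier M = carrier N"
  then have "len (M \<restriction> kern f M N) = 0" using len_epi[OF assms(1)] assms(2) by simp
  then show "kern f M N = {\<zero>\<^bsub>M\<^esub>}"
    using len_eq_0[OF submod_restrict_in[OF submod_kern[OF assms(1)]]] by simp
qed

end

section \<open>Subquotients\<close>

lemma image_factor: "p ` A = B \<Longrightarrow> (\<And>x. x \<in> A \<Longrightarrow> g (p x) = q x) \<Longrightarrow> g ` B = q ` A"
  by (auto simp: image_image image_iff)

context length_category
begin

text \<open>\<open>subq \<P> M U V\<close> says that the subquotient \<open>U / V\<close> of \<open>M\<close> belongs to \<open>\<P>\<close>.\<close>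

definition subq :: "('a, 'm) module set \<Rightarrow> ('a, 'm) module \<Rightarrow> 'm set \<Rightarrow> 'm set \<Rightarrow> bool" where
  "subq \<P> M U V \<longleftrightarrow> submod U M \<and> submod V M \<and> V \<subseteq> U \<and>
     (\<exists>Q\<in>\<P>. \<exists>p. mor p (M \<restriction> U) Q \<and> p ` U = carrier Q \<and> kern p (M \<restriction> U) Q = V)"

definition iso_closed :: "('a, 'm) module set \<Rightarrow> bool" where
  "iso_closed \<P> \<longleftrightarrow> \<P> \<subseteq> C \<and> (\<forall>M\<in>\<P>. \<forall>N\<in>C. mod_iso R M N \<longrightarrow> N \<in> \<P>)"

lemma subqD: "subq \<P> M U V \<Longrightarrow> submod U M" "subq \<P> M U V \<Longrightarrow> submod V M" "subq \<P> M U V \<Longrightarrow> V \<subseteq> U"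
  by (auto simp: subq_def)

lemma subqE:
  assumes "subq \<P> M U V"
  obtains Q p where "Q \<in> \<P>" "mor p (M \<restriction> U) Q" "p ` U = carrier Q" "kern p (M \<restriction> U) Q = V"
  using assms by (auto simp: subq_def)

lemma subqI:
  "submod U M \<Longrightarrow> mor p (M \<restriction> U) Q \<Longrightarrow> Q \<in> \<P> \<Longrightarrow> p ` U = carrier Q \<Longrightarrow> kern p (M \<restriction> U) Q = V
    \<Longrightarrow> subq \<P> M U V"
  using submod_kern[of p "M \<restriction> U" Q] submod_restrict[of U M V] unfolding subq_def by blast

lemma subq_mono: "subq \<P> M U V \<Longrightarrow> \<P> \<subseteq> \<Q> \<Longrightarrow> subq \<Q> M U V"
  unfolding subq_def by blast

lemma subq_restrict:
  assumes "submod U M" "V \<subseteq> U"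
  shows "subq \<P> (M \<restriction> U) V W \<longleftrightarrow> subq \<P> M V W"
  using assms unfolding subq_def by (auto simp: submod_restrict)

lemma quotientE:
  assumes "submod U M"
  obtains Q p where "mor p M Q" "p ` carrier M = carrier Q" "kern p M Q = U"
  using assms quotient_ex unfolding submod_def mor_def by blast

lemma subq_C:
  assumes "submod U M" "submod V M" "V \<subseteq> U"
  shows "subq C M U V"
proof -
  have "submod V (M \<restriction> U)" using assms by (simp add: submod_restrict)
  then obtain Q p where "mor p (M \<restriction> U) Q" "p ` carrier (M \<restriction> U) = carrier Q" "kern p (M \<restriction> U) Q = V"
    by (rule quotientE)
  then show ?thesis using assms(1) by (intro subqI[of U M p Q]) (auto dest: morD)
qed

lemma submod_diff:
  assumes U: "submod U M" and x: "x \<in> carrier M" and y: "y \<in> U"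
  shows "x \<ominus>\<^bsub>M\<^esub> y \<in> U \<longleftrightarrow> x \<in> U"
proof -
  interpret left_module R M using submod_in[OF U] by (rule is_left_module)
  have s: "y \<in> carrier M" "\<And>a b. a \<in> U \<Longrightarrow> b \<in> U \<Longrightarrow> a \<oplus>\<^bsub>M\<^esub> b \<in> U"
    "\<And>a b. a \<in> carrier R \<Longrightarrow> b \<in> U \<Longrightarrow> a \<odot>\<^bsub>M\<^esub> b \<in> U"
    using U y by (auto simp: submod_iff)
  have neg: "\<ominus>\<^bsub>M\<^esub> y \<in> U" using s(3)[of "\<ominus>\<^bsub>R\<^esub> \<one>\<^bsub>R\<^esub>" y] y s(1) by (simp add: uminus_one_smult)
  have "(x \<ominus>\<^bsub>M\<^esub> y) \<oplus>\<^bsub>M\<^esub> y = x" using x s(1) by (simp add: a_minus_def a_assoc l_neg)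
  then show ?thesis using s(2)[of "x \<ominus>\<^bsub>M\<^esub> y" y] s(2)[of x "\<ominus>\<^bsub>M\<^esub> y"] neg y by (auto simp: a_minus_def)
qed

lemma epi_kern_iso:
  assumes p: "mor p M Q" "p ` carrier M = carrier Q" and q: "mor q M P" "q ` carrier M = carrier P"
    and k: "kern p M Q = kern q M P"
  shows "mod_iso R Q P"
proof -
  obtain g where g: "mor g Q P" "\<And>x. x \<in> carrier M \<Longrightarrow> g (p x) = q x"
    using mor_descend[OF p q(1) equalityD1[OF k]] by blast
  have "g ` carrier Q = carrier P" using image_factor[where g = g and q = q, OF p(2) g(2)] q(2) by simp
  moreover have "kern g Q P = {\<zero>\<^bsub>Q\<^esub>}"
  proof
    show "kern g Q P \<subseteq> {\<zero>\<^bsub>Q\<^esub>}"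
    proof
      fix y assume y: "y \<in> kern g Q P"
      then obtain x where x: "x \<in> carrier M" "y = p x" using p(2) unfolding kern_def by blast
      then have "x \<in> kern q M P" using y g(2) by (simp add: kern_def)
      then show "y \<in> {\<zero>\<^bsub>Q\<^esub>}" using x by (simp add: k[symmetric]) (simp add: kern_def)
    qed
    show "{\<zero>\<^bsub>Q\<^esub>} \<subseteq> kern g Q P" using submod_zero[OF submod_kern[OF g(1)]] by simp
  qed
  ultimately show ?thesis
    using g(1) by (intro mod_isoI[of g]) (auto simp: bij_betw_def mor_inj_iff)
qed

text \<open>Membership does not depend on the chosen model of \<open>U / V\<close>, since two
  projections with the same kernel have isomorphic targets.\<close>

lemma subq_all:
  assumes "iso_closed \<P>" "subq \<P> M U V" and p: "mor p (M \<restriction> U) Q" "p ` U = carrier Q" "kern p (M \<restriction> U) Q = V"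
  shows "Q \<in> \<P>"
proof -
  obtain P q where q: "P \<in> \<P>" "mor q (M \<restriction> U) P" "q ` U = carrier P" "kern q (M \<restriction> U) P = V"
    using assms(2) by (rule subqE)
  then have "mod_iso R P Q" using epi_kern_iso[of q "M \<restriction> U" P p Q] p by simp
  then show ?thesis using assms(1) q(1) morD[OF p(1)] unfolding iso_closed_def by blast
qed

text \<open>Taking \<open>f\<close> injective, surjective, or the composition of an inclusion with a projection, this
  transports subquotients along submodules and quotients, and contains the second isomorphism theorem.\<close>

lemma subq_image:
  assumes f: "mor f M N" and U: "submod U M" and V: "submod V M" "V \<subseteq> U"
    and k: "kern f M N \<inter> U \<subseteq> V"
  shows "subq \<P> N (f ` U) (f ` V) \<longleftrightarrow> subq \<P> M U V"
proof
  assume "subq \<P> N (f ` U) (f ` V)"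
  then obtain Q p where p: "Q \<in> \<P>" "mor p (N \<restriction> (f ` U)) Q" "p ` f ` U = carrier Q"
      "kern p (N \<restriction> (f ` U)) Q = f ` V" by (rule subqE)
  have "mor f (M \<restriction> U) (N \<restriction> (f ` U))"
    using mor_corestrict[OF mor_restrict[OF f U] submod_image[OF f U]] by simp
  then have m: "mor (p \<circ> f) (M \<restriction> U) Q" using p(2) by (rule mor_comp)
  have "kern (p \<circ> f) (M \<restriction> U) Q = V"
  proof
    show "V \<subseteq> kern (p \<circ> f) (M \<restriction> U) Q"
    proof
      fix v assume v: "v \<in> V"
      then have "f v \<in> kern p (N \<restriction> (f ` U)) Q" using p(4) by blast
      then show "v \<in> kern (p \<circ> f) (M \<restriction> U) Q" using v V(2) by (auto simp: kern_def)
    qed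
    show "kern (p \<circ> f) (M \<restriction> U) Q \<subseteq> V"
    proof
      fix x assume x: "x \<in> kern (p \<circ> f) (M \<restriction> U) Q"
      then have xU: "x \<in> U" by (simp add: kern_def)
      have "f x \<in> f ` V" using x unfolding p(4)[symmetric] by (auto simp: kern_def)
      then obtain v where v: "v \<in> V" "f x = f v" by blast
      have c: "x \<in> carrier M" "v \<in> carrier M" using xU v(1) V(2) submod_subset[OF U] by auto
      have "x \<ominus>\<^bsub>M\<^esub> v \<in> kern f M N" using mor_eq_iff[OF f c] v(2) by simp
      moreover have "x \<ominus>\<^bsub>M\<^esub> v \<in> U" using submod_diff[OF U c(1)] v(1) V(2) xU by blast
      ultimately show "x \<in> V" using k submod_diff[OF V(1) c(1) v(1)] by blast
    qed
  qed
  then show "subq \<P> M U V" using U m p by (intro subqI[of U M "p \<circ> f" Q]) (auto simp: image_comp)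
next
  assume "subq \<P> M U V"
  then obtain Q p where p: "Q \<in> \<P>" "mor p (M \<restriction> U) Q" "p ` U = carrier Q"
      "kern p (M \<restriction> U) Q = V" by (rule subqE)
  have fU: "mor f (M \<restriction> U) (N \<restriction> (f ` U))"
    using mor_corestrict[OF mor_restrict[OF f U] submod_image[OF f U]] by simp
  moreover have "kern f (M \<restriction> U) (N \<restriction> (f ` U)) \<subseteq> kern p (M \<restriction> U) Q"
    using k p(4) by (simp add: kern_restrict[OF submod_subset[OF U]])
  ultimately obtain g where g: "mor g (N \<restriction> (f ` U)) Q" "\<And>x. x \<in> U \<Longrightarrow> g (f x) = p x"
    using mor_descend[OF fU _ p(2)] by auto
  have "g ` f ` U = carrier Q" using image_factor[where g = g and q = p, OF refl g(2)] p(3) by simp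
  moreover have "kern g (N \<restriction> (f ` U)) Q = f ` V"
    using g(2) V(2) unfolding p(4)[symmetric] kern_def by auto
  ultimately show "subq \<P> N (f ` U) (f ` V)"
    using submod_image[OF f U] g(1) p(1) by (intro subqI[of "f ` U" N g Q])
qed

lemma subq_bot:
  assumes "iso_closed \<P>"
  shows "subq \<P> M U {\<zero>\<^bsub>M\<^esub>} \<longleftrightarrow> submod U M \<and> M \<restriction> U \<in> \<P>"
proof -
  have *: "mor (\<lambda>x. x) (M \<restriction> U) (M \<restriction> U)" "kern (\<lambda>x. x) (M \<restriction> U) (M \<restriction> U) = {\<zero>\<^bsub>M\<^esub>}" if "submod U M"
    using mor_id[OF submod_restrict_in[OF that]] submod_zero[OF that] by (auto simp: kern_def)
  show ?thesis
  proof
    assume s: "subq \<P> M U {\<zero>\<^bsub>M\<^esub>}"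
    then show "submod U M \<and> M \<restriction> U \<in> \<P>"
      using subq_all[OF assms s *(1)] *(2) subqD[OF s] by simp
  next
    assume "submod U M \<and> M \<restriction> U \<in> \<P>"
    then show "subq \<P> M U {\<zero>\<^bsub>M\<^esub>}" using * by (intro subqI[of U M "\<lambda>x. x" "M \<restriction> U"]) simp_all
  qed
qed

text \<open>The first isomorphism theorem in the language of subquotients; it trades quotients for
  images.\<close>

lemma subq_kern:
  assumes "iso_closed \<P>" and f: "mor f M N" and U: "submod U M"
  shows "subq \<P> M U (kern f M N \<inter> U) \<longleftrightarrow> N \<restriction> (f ` U) \<in> \<P>"
proof -
  let ?V = "kern f M N \<inter> U"
  have V: "submod ?V M" by (intro submod_Int submod_kern f U)
  have "f ` ?V = {\<zero>\<^bsub>N\<^esub>}"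
    using submod_zero[OF V] mor_zero[OF f] by (force simp: kern_def)
  then show ?thesis
    using subq_image[OF f U V, of \<P>] subq_bot[OF assms(1)] submod_image[OF f U] by simp
qed

lemma subq_kern_epi:
  assumes "iso_closed \<P>" and f: "mor f M N" "f ` carrier M = carrier N"
  shows "subq \<P> M (carrier M) (kern f M N) \<longleftrightarrow> N \<in> \<P>"
proof -
  have "kern f M N \<inter> carrier M = kern f M N" by (auto simp: kern_def)
  then show ?thesis
    using subq_kern[OF assms(1) f(1) submod_carrier[OF morD(1)[OF f(1)]]] f(2) by simp
qed

section \<open>Torsion pairs\<close>

definition rperp :: "('a, 'm) module set \<Rightarrow> ('a, 'm) module set" where
  "rperp T = {N \<in> C. \<forall>M\<in>T. Hom_zero R M N}"

definition lperp :: "('a, 'm) module set \<Rightarrow> ('a, 'm) module set" where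
  "lperp F = {M \<in> C. \<forall>N\<in>F. Hom_zero R M N}"

lemma Hom_zero_iff:
  "M \<in> C \<Longrightarrow> N \<in> C \<Longrightarrow> Hom_zero R M N \<longleftrightarrow> (\<forall>f. mor f M N \<longrightarrow> (\<forall>x\<in>carrier M. f x = \<zero>\<^bsub>N\<^esub>))"
  by (auto simp: Hom_zero_def mor_def)

end

text \<open>Mutual orthogonality is the whole definition. The closure properties and the torsion
  submodule are derived from it, the latter with the help of lengths.\<close>

locale torsion_pair = length_category R C len
  for R :: "('a, 'x) ring_scheme" and C :: "('a, 'm) module set" and len +
  fixes T F :: "('a, 'm) module set"
  assumes T_eq: "T = lperp F" and F_eq: "F = rperp T"
begin

lemma T_in: "M \<in> T \<Longrightarrow> M \<in> C"
  unfolding T_eq by (auto simp: lperp_def)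

lemma F_in: "M \<in> F \<Longrightarrow> M \<in> C"
  unfolding F_eq by (auto simp: rperp_def)

lemma Hom_T_F:
  assumes "mor f M N" "M \<in> T" "N \<in> F" "x \<in> carrier M"
  shows "f x = \<zero>\<^bsub>N\<^esub>"
proof -
  have "Hom_zero R M N" using assms(2,3) unfolding F_eq by (auto simp: rperp_def)
  then show ?thesis using assms morD[OF assms(1)] by (auto simp: Hom_zero_iff)
qed

lemma T_I:
  assumes "M \<in> C" "\<And>N f x. N \<in> F \<Longrightarrow> mor f M N \<Longrightarrow> x \<in> carrier M \<Longrightarrow> f x = \<zero>\<^bsub>N\<^esub>"
  shows "M \<in> T"
  unfolding T_eq lperp_def using assms F_in by (auto simp: Hom_zero_iff)

lemma F_I:
  assumes "N \<in> C" "\<And>M f x. M \<in> T \<Longrightarrow> mor f M N \<Longrightarrow> x \<in> carrier M \<Longrightarrow> f x = \<zero>\<^bsub>N\<^esub>"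
  shows "N \<in> F"
  unfolding F_eq rperp_def using assms T_in by (auto simp: Hom_zero_iff)

lemma T_quotient:
  assumes f: "mor f M N" "f ` carrier M = carrier N" and M: "M \<in> T"
  shows "N \<in> T"
proof (rule T_I)
  fix P g y assume P: "P \<in> F" and g: "mor g N P" and "y \<in> carrier N"
  then obtain x where "x \<in> carrier M" "y = f x" using f(2) by blast
  then show "g y = \<zero>\<^bsub>P\<^esub>" using Hom_T_F[OF mor_comp[OF f(1) g] M P] by simp
qed (use f morD in blast)

lemma F_mono:
  assumes f: "mor f M N" "kern f M N = {\<zero>\<^bsub>M\<^esub>}" and N: "N \<in> F"
  shows "M \<in> F"
proof (rule F_I)
  fix P g x assume P: "P \<in> T" and g: "mor g P M" and x: "x \<in> carrier P"
  then have "f (g x) = \<zero>\<^bsub>N\<^esub>" using Hom_T_F[OF mor_comp[OF g f(1)] P N] by simp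
  then have "g x \<in> kern f M N" using mor_closed[OF g x] by (simp add: kern_def)
  then show "g x = \<zero>\<^bsub>M\<^esub>" using f(2) by simp
qed (use f morD in blast)

lemma T_iso_closed: "iso_closed T"
  unfolding iso_closed_def
proof (intro conjI ballI impI subsetI)
  fix M N assume "M \<in> T" "N \<in> C" "mod_iso R M N"
  then show "N \<in> T" using T_in by (elim mod_isoE) (auto intro: T_quotient simp: bij_betw_def)
qed (rule T_in)

lemma F_iso_closed: "iso_closed F"
  unfolding iso_closed_def
proof (intro conjI ballI impI subsetI)
  fix M N assume *: "M \<in> F" "N \<in> C" "mod_iso R M N"
  then obtain f where f: "mor f N M" "bij_betw f (carrier N) (carrier M)"
    using mod_isoE[OF mod_iso_sym] F_in by blast
  then show "N \<in> F" using F_mono[of f N M] *(1) mor_inj_iff[of f N M] by (simp add: bij_betw_def)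
qed (rule F_in)

lemma T_range: "mor f M N \<Longrightarrow> M \<in> T \<Longrightarrow> N \<restriction> (f ` carrier M) \<in> T"
  using T_quotient[of f M "N \<restriction> (f ` carrier M)"] mor_corestrict[OF _ submod_range] by simp

lemma F_restrict:
  assumes "submod U M" "M \<in> F"
  shows "M \<restriction> U \<in> F"
  using F_mono[OF mor_incl[OF assms(1)] _ assms(2)] submod_zero[OF assms(1)] by (auto simp: kern_def)

lemma T_Int_F: "M \<in> T \<Longrightarrow> M \<in> F \<Longrightarrow> carrier M = {\<zero>\<^bsub>M\<^esub>}"
  using Hom_T_F[OF mor_id, of M] T_in[of M] zero_in[of M] by blast

lemma zero_T: "M \<in> C \<Longrightarrow> carrier M = {\<zero>\<^bsub>M\<^esub>} \<Longrightarrow> M \<in> T"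
  by (rule T_I) (auto simp: mor_zero)

lemma zero_F:
  assumes "M \<in> C" "carrier M = {\<zero>\<^bsub>M\<^esub>}"
  shows "M \<in> F"
proof (rule F_I)
  fix P f x assume "mor f P M" "x \<in> carrier P"
  then have "f x \<in> carrier M" by (rule mor_closed)
  then show "f x = \<zero>\<^bsub>M\<^esub>" using assms(2) by simp
qed fact

lemma subq_T_refl: "submod U M \<Longrightarrow> subq T M U U"
proof -
  assume U: "submod U M"
  then obtain Q p where p: "mor p (M \<restriction> U) Q" "p ` U = carrier Q" "kern p (M \<restriction> U) Q = U"
    using subqE[OF subq_C[OF U U order_refl]] by metis
  have "carrier Q = {\<zero>\<^bsub>Q\<^esub>}" using p(3) submod_zero[OF U] unfolding p(2)[symmetric] by (force simp: kern_def)
  then show ?thesis using U p zero_T morD[OF p(1)] by (intro subqI[of U M p Q]) auto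
qed

lemma subq_T_upper:
  assumes "subq T M U W" "submod V M" "W \<subseteq> V" "V \<subseteq> U"
  shows "subq T M U V"
proof -
  obtain Q p where p: "Q \<in> T" "mor p (M \<restriction> U) Q" "p ` U = carrier Q" "kern p (M \<restriction> U) Q = W"
    using assms(1) by (rule subqE)
  obtain P q where q: "mor q (M \<restriction> U) P" "q ` U = carrier P" "kern q (M \<restriction> U) P = V"
    using subq_C[OF subqD(1)[OF assms(1)] assms(2,4)] by (rule subqE)
  obtain g where g: "mor g Q P" "\<And>x. x \<in> U \<Longrightarrow> g (p x) = q x"
    using mor_descend[OF p(2) _ q(1)] p(3,4) q(3) assms(3) by auto
  have "g ` carrier Q = carrier P" using image_factor[where g = g and q = q, OF p(3) g(2)] q(2) by simp
  then have "P \<in> T" using T_quotient g(1) p(1) by blast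
  then show ?thesis using subqI[OF subqD(1)[OF assms(1)] q(1) _ q(2,3)] by blast
qed

lemma subq_F_lower:
  assumes "subq F M U W" "submod V M" "W \<subseteq> V" "V \<subseteq> U"
  shows "subq F M V W"
proof -
  obtain Q p where p: "Q \<in> F" "mor p (M \<restriction> U) Q" "p ` U = carrier Q" "kern p (M \<restriction> U) Q = W"
    using assms(1) by (rule subqE)
  have V: "submod V (M \<restriction> U)" using assms subqD(1)[OF assms(1)] by (simp add: submod_restrict)
  then have "subq F (M \<restriction> U) V (kern p (M \<restriction> U) Q \<inter> V)"
    using subq_kern[OF F_iso_closed p(2)] F_restrict[OF submod_image[OF p(2) V] p(1)] by simp
  then show ?thesis using assms p(4) subq_restrict[OF subqD(1)[OF assms(1)]] by (simp add: Int_absorb2)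
qed

text \<open>Extension closure of \<open>T\<close>: a map from \<open>U / W\<close> to a module of
  \<open>F\<close> kills \<open>V / W\<close>, hence descends to \<open>U / V\<close>, where it
  vanishes as well.\<close>

lemma subq_T_trans:
  assumes UV: "subq T M U V" and VW: "subq T M V W"
  shows "subq T M U W"
proof -
  have U: "submod U M" and V: "submod V M" "V \<subseteq> U" and W: "submod W M" "W \<subseteq> V"
    using subqD assms by blast+
  obtain Q p where p: "mor p (M \<restriction> U) Q" "p ` U = carrier Q" "kern p (M \<restriction> U) Q = W"
    using subq_C[OF U W(1) order_trans[OF W(2) V(2)]] by (rule subqE)
  obtain P q where q: "P \<in> T" "mor q (M \<restriction> U) P" "q ` U = carrier P" "kern q (M \<restriction> U) P = V"
    using UV by (rule subqE)
  have VU: "submod V (M \<restriction> U)" using U V by (simp add: submod_restrict)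
  have pV: "Q \<restriction> (p ` V) \<in> T"
    using VW W V subq_kern[OF T_iso_closed p(1) VU] subq_restrict[OF U V(2)] p(3)
    by (simp add: Int_absorb2)
  have "Q \<in> T"
  proof (rule T_I)
    fix N f y assume N: "N \<in> F" and f: "mor f Q N" and y: "y \<in> carrier Q"
    have z: "f (p x) = \<zero>\<^bsub>N\<^esub>" if "x \<in> V" for x
      using Hom_T_F[OF mor_restrict[OF f submod_image[OF p(1) VU]] pV N] that by auto
    have fp: "mor (\<lambda>x. f (p x)) (M \<restriction> U) N" using p(1) f by (rule mor_comp')
    have "kern q (M \<restriction> U) P \<subseteq> kern (\<lambda>x. f (p x)) (M \<restriction> U) N"
      unfolding q(4) using z V(2) by (auto simp: kern_def)
    then obtain g where g: "mor g P N" "\<And>x. x \<in> U \<Longrightarrow> g (q x) = f (p x)"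
      using mor_descend[OF q(2) _ fp] q(3) by auto
    obtain x where x: "x \<in> U" "y = p x" using y p(2) by blast
    then have "q x \<in> carrier P" using q(3) by blast
    then show "f y = \<zero>\<^bsub>N\<^esub>" using Hom_T_F[OF g(1) q(1) N] x g(2) by metis
  qed (use p morD in blast)
  then show ?thesis using subqI[OF U p(1) _ p(2,3)] by blast
qed

text \<open>Dually, a map from a module of \<open>T\<close> to \<open>U / W\<close> becomes zero in
  \<open>U / V\<close>, so it lands in \<open>V / W\<close>, where it is zero.\<close>

lemma subq_F_trans:
  assumes UV: "subq F M U V" and VW: "subq F M V W"
  shows "subq F M U W"
proof -
  have U: "submod U M" and V: "submod V M" "V \<subseteq> U" and W: "submod W M" "W \<subseteq> V"
    using subqD assms by blast+
  obtain Q p where p: "mor p (M \<restriction> U) Q" "p ` U = carrier Q" "kern p (M \<restriction> U) Q = W"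
    using subq_C[OF U W(1) order_trans[OF W(2) V(2)]] by (rule subqE)
  obtain P q where q: "P \<in> F" "mor q (M \<restriction> U) P" "q ` U = carrier P" "kern q (M \<restriction> U) P = V"
    using UV by (rule subqE)
  have VU: "submod V (M \<restriction> U)" using U V by (simp add: submod_restrict)
  have pV: "Q \<restriction> (p ` V) \<in> F"
    using VW W V subq_kern[OF F_iso_closed p(1) VU] subq_restrict[OF U V(2)] p(3)
    by (simp add: Int_absorb2)
  obtain r where r: "mor r Q P" "\<And>x. x \<in> U \<Longrightarrow> r (p x) = q x"
    using mor_descend[OF p(1) _ q(2)] p(2,3) q(4) W(2) by auto
  have "Q \<in> F"
  proof (rule F_I)
    fix N f y assume N: "N \<in> T" and f: "mor f N Q" and y: "y \<in> carrier N"
    have "f ` carrier N \<subseteq> p ` V"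
    proof
      fix z assume "z \<in> f ` carrier N"
      then obtain w where w: "w \<in> carrier N" "z = f w" by blast
      then have "z \<in> carrier Q" using mor_closed[OF f] by blast
      then obtain x where x: "x \<in> U" "z = p x" using p(2) by blast
      have "r z = \<zero>\<^bsub>P\<^esub>" using Hom_T_F[OF mor_comp[OF f r(1)] N q(1) w(1)] w(2) by simp
      then have "x \<in> V" using x r(2) unfolding q(4)[symmetric] by (simp add: kern_def)
      then show "z \<in> p ` V" using x by blast
    qed
    then have "mor f N (Q \<restriction> (p ` V))" using mor_corestrict[OF f submod_image[OF p(1) VU]] by blast
    then show "f y = \<zero>\<^bsub>Q\<^esub>" using Hom_T_F[OF _ N pV y] by fastforce
  qed (use p morD in blast)
  then show ?thesis using subqI[OF U p(1) _ p(2,3)] by blast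
qed

text \<open>The torsion submodule of \<open>U / V\<close> is found as \<open>W / V\<close> with
  \<open>W\<close> of largest length such that \<open>W / V\<close> lies in \<open>T\<close>. The
  image of a map from \<open>T\<close> to \<open>U / W\<close> pulls back to a larger submodule of
  the same kind, so maximality forces that map to vanish.\<close>

lemma subq_torsion:
  assumes U: "submod U M" and V: "submod V M" "V \<subseteq> U"
  obtains W where "V \<subseteq> W" "W \<subseteq> U" "subq T M W V" "subq F M U W"
proof -
  let ?P = "\<lambda>W. W \<subseteq> U \<and> subq T M W V"
  \<comment> \<open>The search for a greatest value needs a strict bound, whence the successor of
    \<open>len M\<close>.\<close>
  have "\<exists>W. ?P W \<and> (\<forall>W'. ?P W' \<longrightarrow> len (M \<restriction> W') \<le> len (M \<restriction> W))"
    using subq_T_refl[OF V(1)] V(2)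
    by (intro ex_has_greatest_nat[of ?P V _ "Suc (len M)"]) (auto simp: less_Suc_eq_le intro: len_restrict_le dest: subqD)
  then obtain W where W: "W \<subseteq> U" "subq T M W V"
    and max: "\<And>W'. W' \<subseteq> U \<Longrightarrow> subq T M W' V \<Longrightarrow> len (M \<restriction> W') \<le> len (M \<restriction> W)" by blast
  have Ws: "submod W M" using subqD W by blast
  obtain Q p where p: "mor p (M \<restriction> U) Q" "p ` U = carrier Q" "kern p (M \<restriction> U) Q = W"
    using subq_C[OF U Ws W(1)] by (rule subqE)
  have "Q \<in> F"
  proof (rule F_I)
    fix N f y assume N: "N \<in> T" and f: "mor f N Q" and y: "y \<in> carrier N"
    define W' where "W' = {x \<in> carrier (M \<restriction> U). p x \<in> f ` carrier N}"
    have W'U: "submod W' (M \<restriction> U)"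
      unfolding W'_def using p(1) submod_range[OF f] by (rule submod_vimage)
    then have W': "submod W' M" "W' \<subseteq> U" using submod_restrict[OF U] by auto
    have fc: "f ` carrier N \<subseteq> p ` U" using mor_closed[OF f] p(2) by blast
    then have pW': "p ` W' = f ` carrier N"
    proof -
      have "f ` carrier N \<subseteq> p ` W'"
      proof
        fix z assume z: "z \<in> f ` carrier N"
        then obtain x where "x \<in> U" "z = p x" using fc by blast
        then show "z \<in> p ` W'" using z by (simp add: W'_def)
      qed
      then show ?thesis by (auto simp: W'_def)
    qed
    have WW': "W \<subseteq> W'"
    proof
      fix x assume "x \<in> W"
      then have "x \<in> U" "p x = \<zero>\<^bsub>Q\<^esub>" using p(3) by (auto simp: kern_def)
      then show "x \<in> W'" using submod_zero[OF submod_range[OF f]] by (simp add: W'_def)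
    qed
    have "subq T (M \<restriction> U) W' (kern p (M \<restriction> U) Q \<inter> W')"
      using subq_kern[OF T_iso_closed p(1) W'U] T_range[OF f N] pW' by simp
    then have "subq T M W' W"
      using p(3) WW' subq_restrict[OF U W'(2)] by (simp add: Int_absorb2)
    then have "len (M \<restriction> W') \<le> len (M \<restriction> W)" using max[OF W'(2)] W(2) subq_T_trans by blast
    moreover have "len (M \<restriction> W) \<le> len (M \<restriction> W')"
      using len_restrict_le[of W "M \<restriction> W'"] Ws W' WW' by (simp add: submod_restrict)
    ultimately have "W = W'"
      using len_restrict_eq[of W "M \<restriction> W'"] Ws W' WW' by (simp add: submod_restrict)
    moreover have "f y \<in> p ` W'" using y pW' by blast
    ultimately obtain x where "x \<in> W" "f y = p x" by blast
    then show "f y = \<zero>\<^bsub>Q\<^esub>" unfolding p(3)[symmetric] by (simp add: kern_def)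
  qed (use p morD in blast)
  then have "subq F M U W" using subqI[OF U p(1) _ p(2,3)] by blast
  then show thesis by (rule that[OF subqD(3)[OF W(2)] W])
qed

text \<open>A map that vanishes on \<open>V\<close> factors over the torsion module
  \<open>U / V\<close>. So a map to \<open>F\<close> is nonzero already on a submodule with torsion
  quotient, if it is nonzero at all.\<close>

lemma subq_T_Hom_F:
  assumes TM: "subq T M U V" and f: "mor f (M \<restriction> U) N" and N: "N \<in> F"
    and z: "\<And>x. x \<in> V \<Longrightarrow> f x = \<zero>\<^bsub>N\<^esub>" and x: "x \<in> U"
  shows "f x = \<zero>\<^bsub>N\<^esub>"
proof -
  obtain Q p where p: "Q \<in> T" "mor p (M \<restriction> U) Q" "p ` U = carrier Q" "kern p (M \<restriction> U) Q = V"
    using TM by (rule subqE)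
  have "kern p (M \<restriction> U) Q \<subseteq> kern f (M \<restriction> U) N"
    unfolding p(4) using z subqD(3)[OF TM] by (auto simp: kern_def)
  then obtain g where g: "mor g Q N" "\<And>x. x \<in> U \<Longrightarrow> g (p x) = f x"
    using mor_descend[OF p(2) _ f] p(3) by auto
  have "p x \<in> carrier Q" using x p(3) by blast
  then show ?thesis using Hom_T_F[OF g(1) p(1) N] g(2)[OF x] by simp
qed

end

section \<open>The second isomorphism theorem, and simple objects of the tilted heart\<close>

context length_category
begin

text \<open>The hypothesis \<open>sum\<close> expresses \<open>W = U + V\<close> by elements; then
  \<open>U\<close> and \<open>W\<close> have the same image modulo \<open>V\<close>.\<close>

lemma subq_iso2:
  assumes U: "submod U M" and V: "submod V M" and W: "submod W M" "U \<subseteq> W" "V \<subseteq> W"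
    and sum: "\<And>x. x \<in> W \<Longrightarrow> \<exists>u\<in>U. x \<ominus>\<^bsub>M\<^esub> u \<in> V"
  shows "subq \<P> M W V \<longleftrightarrow> subq \<P> M U (U \<inter> V)"
proof -
  obtain Q p where p: "mor p M Q" "p ` carrier M = carrier Q" "kern p M Q = V"
    using V by (rule quotientE)
  have pz: "p ` V = {\<zero>\<^bsub>Q\<^esub>}" "p ` (U \<inter> V) = {\<zero>\<^bsub>Q\<^esub>}"
    using submod_zero[OF V] submod_zero[OF U] mor_zero[OF p(1)] p(3) by (auto simp: kern_def image_iff)
  have "p ` W \<subseteq> p ` U"
  proof
    fix y assume "y \<in> p ` W"
    then obtain x where x: "x \<in> W" "y = p x" by blast
    obtain u where u: "u \<in> U" "x \<ominus>\<^bsub>M\<^esub> u \<in> V" using sum[OF x(1)] by blast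
    have "x \<in> carrier M" "u \<in> carrier M" using x(1) u(1) submod_subset[OF W(1)] submod_subset[OF U] by auto
    then have "p x = p u" using mor_eq_iff[OF p(1)] u(2) p(3) by blast
    then show "y \<in> p ` U" using x(2) u(1) by blast
  qed
  then have "p ` W = p ` U" using W(2) by blast
  moreover have "subq \<P> Q (p ` W) (p ` V) \<longleftrightarrow> subq \<P> M W V"
    using p(3) by (intro subq_image[OF p(1) W(1) V W(3)]) auto
  moreover have "subq \<P> Q (p ` U) (p ` (U \<inter> V)) \<longleftrightarrow> subq \<P> M U (U \<inter> V)"
    using p(3) by (intro subq_image[OF p(1) U submod_Int[OF U V]]) auto
  ultimately show ?thesis using pz by simp
qed

lemma minus_minus:
  assumes "M \<in> C" and x: "x \<in> carrier M" and y: "y \<in> carrier M"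
  shows "x \<ominus>\<^bsub>M\<^esub> (x \<ominus>\<^bsub>M\<^esub> y) = y"
proof -
  interpret left_module R M using assms(1) by (rule is_left_module)
  show ?thesis using x y by (simp add: a_minus_def minus_add r_neg2)
qed

lemma mem_iff_subq: "iso_closed \<P> \<Longrightarrow> M \<in> C \<Longrightarrow> M \<in> \<P> \<longleftrightarrow> subq \<P> M (carrier M) {\<zero>\<^bsub>M\<^esub>}"
  by (simp add: subq_bot submod_carrier)

definition vanishes :: "('m \<Rightarrow> 'm) \<Rightarrow> ('a, 'm) module \<Rightarrow> ('a, 'm) module \<Rightarrow> bool" where
  "vanishes f M N \<longleftrightarrow> (\<forall>x\<in>carrier M. f x = \<zero>\<^bsub>N\<^esub>)"

text \<open>For a torsion pair \<open>(T, F)\<close>, these are the simple objects of the heart of the tilted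
  t-structure that lie in \<open>T\<close>, and those that lie in the shift of \<open>F\<close>.\<close>

definition simpT :: "('a, 'm) module set \<Rightarrow> ('a, 'm) module set" where
  "simpT T = {M \<in> T. carrier M \<noteq> {\<zero>\<^bsub>M\<^esub>} \<and>
     (\<forall>N\<in>T. \<forall>f. mor f N M \<longrightarrow> \<not> vanishes f N M \<longrightarrow>
        f ` carrier N = carrier M \<and> N \<restriction> kern f N M \<in> T)}"

definition simpF :: "('a, 'm) module set \<Rightarrow> ('a, 'm) module set" where
  "simpF F = {M \<in> F. carrier M \<noteq> {\<zero>\<^bsub>M\<^esub>} \<and>
     (\<forall>N\<in>F. \<forall>f. mor f M N \<longrightarrow> \<not> vanishes f M N \<longrightarrow>
        kern f M N = {\<zero>\<^bsub>M\<^esub>} \<and> subq F N (carrier N) (f ` carrier M))}"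

lemma simpTD:
  assumes "M \<in> simpT T"
  shows "M \<in> T" "carrier M \<noteq> {\<zero>\<^bsub>M\<^esub>}"
    "\<And>N f. N \<in> T \<Longrightarrow> mor f N M \<Longrightarrow> \<not> vanishes f N M \<Longrightarrow> f ` carrier N = carrier M"
    "\<And>N f. N \<in> T \<Longrightarrow> mor f N M \<Longrightarrow> \<not> vanishes f N M \<Longrightarrow> N \<restriction> kern f N M \<in> T"
  using assms by (auto simp: simpT_def)

lemma simpFD:
  assumes "M \<in> simpF F"
  shows "M \<in> F" "carrier M \<noteq> {\<zero>\<^bsub>M\<^esub>}"
    "\<And>N f. N \<in> F \<Longrightarrow> mor f M N \<Longrightarrow> \<not> vanishes f M N \<Longrightarrow> kern f M N = {\<zero>\<^bsub>M\<^esub>}"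
    "\<And>N f. N \<in> F \<Longrightarrow> mor f M N \<Longrightarrow> \<not> vanishes f M N \<Longrightarrow> subq F N (carrier N) (f ` carrier M)"
  using assms by (auto simp: simpF_def)

lemma vanishes_iff_kern: "vanishes f M N \<longleftrightarrow> kern f M N = carrier M"
  by (auto simp: vanishes_def kern_def)

lemma not_vanishes_mono: "kern f M N = {\<zero>\<^bsub>M\<^esub>} \<Longrightarrow> carrier M \<noteq> {\<zero>\<^bsub>M\<^esub>} \<Longrightarrow> \<not> vanishes f M N"
  by (simp add: vanishes_iff_kern)

end

context torsion_pair
begin

text \<open>Schur's lemma in the heart. The kernel lies in \<open>T\<close>; if it were nonzero, its
  inclusion into \<open>M\<close> would have to be onto, and \<open>f\<close> would vanish.\<close>

lemma simpT_Hom_iso: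
  assumes M: "M \<in> simpT T" and N: "N \<in> simpT T" and f: "mor f M N" "\<not> vanishes f M N"
  shows "bij_betw f (carrier M) (carrier N)"
proof -
  note M' = simpTD[OF M] and N' = simpTD[OF N]
  let ?K = "kern f M N"
  have K: "submod ?K M" by (rule submod_kern[OF f(1)])
  have KT: "M \<restriction> ?K \<in> T" by (rule N'(4)[OF M'(1) f])
  have "?K = {\<zero>\<^bsub>M\<^esub>}"
  proof (rule ccontr)
    assume "?K \<noteq> {\<zero>\<^bsub>M\<^esub>}"
    then have "\<not> vanishes (\<lambda>x. x) (M \<restriction> ?K) M"
      using submod_zero[OF K] by (auto simp: vanishes_def)
    then have "?K = carrier M" using M'(3)[OF KT mor_incl[OF K]] by simp
    then show False using f(2) by (simp add: vanishes_iff_kern)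
  qed
  then show ?thesis using N'(3)[OF M'(1) f] mor_inj_iff[OF f(1)] by (simp add: bij_betw_def)
qed

text \<open>The dual of \<open>simpT_Hom_iso\<close>: the cokernel lies in \<open>F\<close>, and a
  nonzero projection onto it would have to be injective, leaving no room for the image of
  \<open>f\<close>.\<close>

lemma simpF_Hom_iso:
  assumes M: "M \<in> simpF F" and N: "N \<in> simpF F" and f: "mor f M N" "\<not> vanishes f M N"
  shows "bij_betw f (carrier M) (carrier N)"
proof -
  note M' = simpFD[OF M] and N' = simpFD[OF N]
  have inj: "kern f M N = {\<zero>\<^bsub>M\<^esub>}" and sq: "subq F N (carrier N) (f ` carrier M)"
    using M'(3,4)[OF N'(1) f] by auto
  obtain Q p where p: "Q \<in> F" "mor p N Q" "p ` carrier N = carrier Q" "kern p N Q = f ` carrier M"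
    using subqE[OF sq] by auto
  have "vanishes p N Q"
  proof (rule ccontr)
    assume "\<not> vanishes p N Q"
    then have "f ` carrier M = {\<zero>\<^bsub>N\<^esub>}" using N'(3)[OF p(1,2)] p(4) by simp
    then show False using f(2) by (auto simp: vanishes_def)
  qed
  then have "f ` carrier M = carrier N" using p(4) by (simp add: vanishes_iff_kern)
  then show ?thesis using inj mor_inj_iff[OF f(1)] by (simp add: bij_betw_def)
qed

text \<open>Everything depends on the torsion part \<open>L\<close> of the extension
  \<open>W\<close>. If \<open>L\<close> maps to zero, it lies in the kernel, which is in
  \<open>F\<close>, so \<open>L\<close> is zero and \<open>W\<close> is in \<open>F\<close>.
  Otherwise simplicity of \<open>M\<close> makes \<open>L\<close> map isomorphically onto
  \<open>M\<close>, which gives a section.\<close>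

lemma simpT_split:
  assumes M: "M \<in> simpT T" and v: "mor v W M" "v ` carrier W = carrier M" and k: "W \<restriction> kern v W M \<in> F"
  shows "W \<in> F \<or> (\<exists>s. mor s M W \<and> (\<forall>x\<in>carrier M. v (s x) = x))"
proof -
  have WC: "W \<in> C" by (rule morD(1)[OF v(1)])
  have z: "{\<zero>\<^bsub>W\<^esub>} \<subseteq> carrier W" using zero_in[OF WC] by simp
  obtain L where L: "subq T W L {\<zero>\<^bsub>W\<^esub>}" "subq F W (carrier W) L"
    using subq_torsion[OF submod_carrier[OF WC] submod_trivial[OF WC] z] .
  have Ls: "submod L W" by (rule subqD(1)[OF L(1)])
  have LT: "W \<restriction> L \<in> T" using L(1) subq_bot[OF T_iso_closed] by blast
  have vL: "mor v (W \<restriction> L) M" by (rule mor_restrict[OF v(1) Ls])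
  have K: "submod (kern v W M) W" by (rule submod_kern[OF v(1)])
  show ?thesis
  proof (cases "vanishes v (W \<restriction> L) M")
    case True
    then have "L \<subseteq> kern v W M" using submod_subset[OF Ls] by (auto simp: vanishes_def kern_def)
    then have "W \<restriction> L \<in> F" using F_restrict[OF _ k, of L] Ls submod_restrict[OF K] by simp
    then have "L = {\<zero>\<^bsub>W\<^esub>}" using T_Int_F[OF LT] by simp
    then show ?thesis using L(2) mem_iff_subq[OF F_iso_closed WC] by simp
  next
    case False
    have surj: "v ` L = carrier M" using simpTD(3)[OF M LT vL False] by simp
    have KL: "submod (kern v W M \<inter> L) W" by (rule submod_Int[OF K Ls])
    have "W \<restriction> (kern v W M \<inter> L) \<in> T"
      using simpTD(4)[OF M LT vL False] by (simp add: kern_restrict[OF submod_subset[OF Ls]])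
    moreover have "W \<restriction> (kern v W M \<inter> L) \<in> F"
      using F_restrict[OF _ k, of "kern v W M \<inter> L"] KL submod_restrict[OF K] by simp
    ultimately have "kern v W M \<inter> L = {\<zero>\<^bsub>W\<^esub>}" using T_Int_F by fastforce
    then have "bij_betw v (carrier (W \<restriction> L)) (carrier M)"
      using mor_inj_iff[OF vL] surj by (simp add: bij_betw_def kern_restrict[OF submod_subset[OF Ls]])
    then obtain s where s: "mor s M (W \<restriction> L)" "\<And>y. y \<in> carrier M \<Longrightarrow> v (s y) = y"
      using mor_inverse[OF vL] by blast
    then show ?thesis using mor_comp'[OF s(1) mor_incl[OF Ls]] s(2) by blast
  qed
qed

end

section \<open>Enlarging the torsion class at a simple object\<close>

text \<open>\<open>B\<close> is the simple object at which the torsion pair is mutated. It generates the gap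
  \<open>T' \<inter> F\<close> between the two torsion pairs.\<close>

locale torsion_step = length_category R C len +
    lo: torsion_pair R C len T F + up: torsion_pair R C len T' F'
  for R :: "('a, 'x) ring_scheme" and C :: "('a, 'm) module set" and len T F T' F' +
  fixes B :: "('a, 'm) module"
  assumes T_le: "T \<subseteq> T'" and B_T': "B \<in> T'" and B_simpF: "B \<in> simpF F"
    and F'_I: "\<And>M. M \<in> F \<Longrightarrow> (\<And>f. mor f B M \<Longrightarrow> vanishes f B M) \<Longrightarrow> M \<in> F'"
begin

lemma F'_le: "F' \<subseteq> F"
proof
  fix M assume "M \<in> F'"
  then show "M \<in> F" using T_le up.Hom_T_F by (intro lo.F_I up.F_in) auto
qed

lemma B_C: "B \<in> C"
  using B_T' up.T_in by blast

text \<open>A nonzero module of \<open>T'\<close> is not in \<open>F'\<close>, so the criterion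
  \<open>F'_I\<close> has to fail for it. All later inductions over the gap peel off the image of
  such a map.\<close>

lemma B_embeds:
  assumes M: "M \<in> T'" "M \<in> F" "carrier M \<noteq> {\<zero>\<^bsub>M\<^esub>}"
  obtains b where "mor b B M" "\<not> vanishes b B M"
  using F'_I[OF M(2)] up.T_Int_F[OF M(1)] M(3) by blast

text \<open>Copies of \<open>B\<close> are peeled off \<open>N\<close>: a nonzero \<open>N\<close>
  receives a nonzero map from \<open>B\<close>, whose image in \<open>Z\<close> has its cokernel in
  \<open>F\<close> because \<open>B\<close> is simple, and passing to that cokernel shortens
  \<open>N\<close>.\<close>

lemma gap_sub_F:
  assumes "Z \<in> F" "submod N Z" "Z \<restriction> N \<in> T'"
  shows "subq F Z (carrier Z) N"
  using assms
proof (induction "len (Z \<restriction> N)" arbitrary: Z N rule: less_induct)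
  case less
  note Z = less.prems(1) and N = less.prems(2,3)
  have ZC: "Z \<in> C" by (rule lo.F_in[OF Z])
  show ?case
  proof (cases "N = {\<zero>\<^bsub>Z\<^esub>}")
    case True
    then show ?thesis using Z mem_iff_subq[OF lo.F_iso_closed ZC] by simp
  next
    case False
    then obtain b where b: "mor b B (Z \<restriction> N)" "\<not> vanishes b B (Z \<restriction> N)"
      using B_embeds[OF N(2) lo.F_restrict[OF N(1) Z]] by auto
    have bZ: "mor b B Z" using mor_comp'[OF b(1) mor_incl[OF N(1)]] .
    have bv: "\<not> vanishes b B Z" using b(2) by (simp add: vanishes_def)
    have sq: "subq F Z (carrier Z) (b ` carrier B)" by (rule simpFD(4)[OF B_simpF Z bZ bv])
    have bN: "b ` carrier B \<subseteq> N" using mor_closed[OF b(1)] by auto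
    obtain Z1 p where p: "Z1 \<in> F" "mor p Z Z1" "p ` carrier Z = carrier Z1" "kern p Z Z1 = b ` carrier B"
      using subqE[OF sq] by auto
    have pN: "mor p (Z \<restriction> N) Z1" by (rule mor_restrict[OF p(2) N(1)])
    have "len (Z \<restriction> N) = len (Z \<restriction> b ` carrier B) + len (Z1 \<restriction> p ` N)"
      using len_mor[OF pN] bN p(4) by (simp add: kern_restrict[OF submod_subset[OF N(1)]] Int_absorb2)
    moreover have "len (Z \<restriction> b ` carrier B) \<noteq> 0"
      using len_eq_0[OF submod_restrict_in[OF submod_range[OF bZ]]] bv by (auto simp: vanishes_def)
    ultimately have "len (Z1 \<restriction> p ` N) < len (Z \<restriction> N)" by simp
    then have "subq F Z1 (carrier Z1) (p ` N)"
      using less.hyps[OF _ p(1) submod_image[OF p(2) N(1)]] up.T_range[OF pN N(2)] by simp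
    moreover have "kern p Z Z1 \<inter> carrier Z \<subseteq> N" using p(4) bN by auto
    ultimately show ?thesis
      using subq_image[OF p(2) submod_carrier[OF ZC] N(1) submod_subset[OF N(1)]] p(3) by simp
  qed
qed

text \<open>The relative form of \<open>gap_sub_F\<close>, applied inside a model of
  \<open>U / V\<close>.\<close>

lemma subq_F_upper:
  assumes T': "subq T' Z N V" and F: "subq F Z U V" and NU: "N \<subseteq> U"
  shows "subq F Z U N"
proof -
  have N: "submod N Z" and U: "submod U Z" and V: "submod V Z" "V \<subseteq> N"
    using subqD[OF T'] subqD[OF F] by auto
  obtain Q p where p: "Q \<in> F" "mor p (Z \<restriction> U) Q" "p ` U = carrier Q" "kern p (Z \<restriction> U) Q = V"
    using F by (rule subqE)
  have NU': "submod N (Z \<restriction> U)" using N U NU by (simp add: submod_restrict)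
  have "subq T' (Z \<restriction> U) N (kern p (Z \<restriction> U) Q \<inter> N)"
    using T' p(4) V subq_restrict[OF U NU] by (simp add: Int_absorb2)
  then have "Q \<restriction> (p ` N) \<in> T'" using subq_kern[OF up.T_iso_closed p(2) NU'] by blast
  then have "subq F Q (p ` U) (p ` N)" using gap_sub_F[OF p(1) submod_image[OF p(2) NU']] p(3) by simp
  moreover have "submod U (Z \<restriction> U)" using U by (simp add: submod_restrict)
  ultimately have "subq F (Z \<restriction> U) U N"
    using subq_image[OF p(2) _ NU' NU] p(4) V(2) by auto
  then show ?thesis using subq_restrict[OF U order_refl] by blast
qed

text \<open>Induction along a copy \<open>?I\<close> of \<open>B\<close> in \<open>M\<close>. As
  \<open>B\<close> has no nonzero map to \<open>K\<close>, the copy survives in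
  \<open>M / K\<close>. Thus \<open>K\<close> meets it trivially and embeds in the shorter module
  \<open>M / ?I\<close> with all hypotheses preserved; by induction \<open>K\<close> lies in
  \<open>?I\<close>, hence is zero.\<close>

lemma gap_no_F'_kernel:
  assumes "M \<in> T'" "M \<in> F" "submod K M" "M \<restriction> K \<in> F'" "subq F M (carrier M) K"
  shows "K = {\<zero>\<^bsub>M\<^esub>}"
  using assms
proof (induction "len M" arbitrary: M K rule: less_induct)
  case less
  note M = less.prems(1,2) and K = less.prems(3-5)
  have MC: "M \<in> C" by (rule lo.F_in[OF M(2)])
  show ?case
  proof (cases "carrier M = {\<zero>\<^bsub>M\<^esub>}")
    case True
    then show ?thesis using submod_subset[OF K(1)] submod_zero[OF K(1)] by auto
  next
    case False
    then obtain b where b: "mor b B M" "\<not> vanishes b B M" by (rule B_embeds[OF M])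
    let ?I = "b ` carrier B"
    have I: "submod ?I M" by (rule submod_range[OF b(1)])
    have bI: "subq F M (carrier M) ?I" by (rule simpFD(4)[OF B_simpF M(2) b])
    obtain Q q where q: "Q \<in> F" "mor q M Q" "q ` carrier M = carrier Q" "kern q M Q = K"
      using subqE[OF K(3)] by auto
    have qb: "mor (\<lambda>x. q (b x)) B Q" by (rule mor_comp'[OF b(1) q(2)])
    have nv: "\<not> vanishes (\<lambda>x. q (b x)) B Q"
    proof
      assume "vanishes (\<lambda>x. q (b x)) B Q"
      then have "b ` carrier B \<subseteq> K"
        using mor_closed[OF b(1)] unfolding q(4)[symmetric] by (auto simp: vanishes_def kern_def)
      then have "mor b B (M \<restriction> K)" by (rule mor_corestrict[OF b(1) K(1)])
      then have "vanishes b B M" using up.Hom_T_F[OF _ B_T' K(2)] by (simp add: vanishes_def)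
      then show False using b(2) by blast
    qed
    have qbI: "subq F Q (carrier Q) (q ` ?I)"
      using simpFD(4)[OF B_simpF q(1) qb nv] by (simp add: image_image)
    have KI: "K \<inter> ?I = {\<zero>\<^bsub>M\<^esub>}"
    proof (intro equalityI subsetI)
      fix x assume x: "x \<in> K \<inter> ?I"
      then obtain y where y: "y \<in> carrier B" "x = b y" by blast
      then have "y \<in> kern (\<lambda>x. q (b x)) B Q" using x unfolding q(4)[symmetric] by (simp add: kern_def)
      then show "x \<in> {\<zero>\<^bsub>M\<^esub>}" using simpFD(3)[OF B_simpF q(1) qb nv] y mor_zero[OF b(1)] by simp
    qed (use submod_zero[OF K(1)] submod_zero[OF I] in auto)
    obtain P p where p: "P \<in> F" "mor p M P" "p ` carrier M = carrier P" "kern p M P = ?I"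
      using subqE[OF bI] by auto
    have P: "P \<in> T'" by (rule up.T_quotient[OF p(2,3) M(1)])
    have "len M = len (M \<restriction> ?I) + len P" using len_epi[OF p(2,3)] p(4) by simp
    moreover have "len (M \<restriction> ?I) \<noteq> 0"
      using len_eq_0[OF submod_restrict_in[OF I]] b(2) by (auto simp: vanishes_def)
    ultimately have lt: "len P < len M" by simp
    have pz: "p ` {\<zero>\<^bsub>M\<^esub>} = {\<zero>\<^bsub>P\<^esub>}" using mor_zero[OF p(2)] by simp
    have zK: "{\<zero>\<^bsub>M\<^esub>} \<subseteq> K" using submod_zero[OF K(1)] by simp
    have "subq F' P (p ` K) (p ` {\<zero>\<^bsub>M\<^esub>}) \<longleftrightarrow> subq F' M K {\<zero>\<^bsub>M\<^esub>}"
      using KI p(4) by (intro subq_image[OF p(2) K(1) submod_trivial[OF MC] zK]) auto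
    then have PK: "P \<restriction> p ` K \<in> F'" using K(1,2) subq_bot[OF up.F_iso_closed] pz by simp
    \<comment> \<open>This is the sum of \<open>K\<close> and \<open>?I\<close>, written as a
      preimage. Its image in \<open>Q\<close> is that of \<open>?I\<close> and its image in
      \<open>P\<close> is that of \<open>K\<close>, which carries membership in \<open>F\<close>
      from one quotient to the other.\<close>
    define W where "W = {x \<in> carrier M. p x \<in> p ` K}"
    have pK: "submod (p ` K) P" by (rule submod_image[OF p(2) K(1)])
    have W: "submod W M" unfolding W_def by (rule submod_vimage[OF p(2) pK])
    have Wc: "W \<subseteq> carrier M" by (rule submod_subset[OF W])
    have KW: "K \<subseteq> W" using submod_subset[OF K(1)] by (auto simp: W_def)
    have IW: "?I \<subseteq> W"
    proof
      fix x assume "x \<in> ?I"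
      then show "x \<in> W" unfolding p(4)[symmetric] W_def using submod_zero[OF pK] by (simp add: kern_def)
    qed
    have "q ` W = q ` ?I"
    proof (intro equalityI subsetI)
      fix z assume "z \<in> q ` ?I"
      then show "z \<in> q ` W" using IW by blast
    next
      fix z assume "z \<in> q ` W"
      then obtain x k where x: "x \<in> carrier M" "z = q x" and k: "k \<in> K" "p x = p k"
        by (auto simp: W_def)
      have kM: "k \<in> carrier M" using k(1) submod_subset[OF K(1)] by blast
      have d: "x \<ominus>\<^bsub>M\<^esub> k \<in> ?I" using mor_eq_iff[OF p(2) x(1) kM] k(2) p(4) by simp
      have "q x = q (x \<ominus>\<^bsub>M\<^esub> k)"
        using mor_eq_iff[OF q(2) x(1) minus_closed[OF MC x(1) kM]] minus_minus[OF MC x(1) kM] k(1) q(4) by simp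
      then show "z \<in> q ` ?I" using d x(2) by blast
    qed
    then have "subq F Q (q ` carrier M) (q ` W)" using qbI q(3) by simp
    then have "subq F M (carrier M) W"
      using subq_image[OF q(2) submod_carrier[OF MC] W Wc] q(4) KW by auto
    moreover have "p ` W = p ` K" using KW by (auto simp: W_def)
    moreover have "subq F P (p ` carrier M) (p ` W) \<longleftrightarrow> subq F M (carrier M) W"
      using p(4) IW by (intro subq_image[OF p(2) submod_carrier[OF MC] W Wc]) auto
    ultimately have "subq F P (carrier P) (p ` K)" using p(3) by simp
    then have "p ` K = {\<zero>\<^bsub>P\<^esub>}" by (rule less.hyps[OF lt P p(1) pK PK])
    then have "K \<subseteq> ?I"
      using submod_subset[OF K(1)] unfolding p(4)[symmetric] by (auto simp: kern_def)
    then show ?thesis using KI by blast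
  qed
qed

text \<open>Dividing out the \<open>T'\<close>-torsion \<open>N\<close> of \<open>K\<close> keeps
  \<open>M / N\<close> in the gap and leaves \<open>K / N\<close> in \<open>F'\<close>, where
  \<open>gap_no_F'_kernel\<close> applies. Consequently the gap contains the kernel of every map
  from one of its modules to \<open>F\<close>.\<close>

lemma gap_kernel:
  assumes M: "M \<in> T'" "M \<in> F" and K: "subq F M (carrier M) K"
  shows "M \<restriction> K \<in> T'"
proof -
  have MC: "M \<in> C" by (rule lo.F_in[OF M(2)])
  have Ks: "submod K M" by (rule subqD(2)[OF K])
  have zK: "{\<zero>\<^bsub>M\<^esub>} \<subseteq> K" using submod_zero[OF Ks] by simp
  obtain N where N: "{\<zero>\<^bsub>M\<^esub>} \<subseteq> N" "N \<subseteq> K" "subq T' M N {\<zero>\<^bsub>M\<^esub>}" "subq F' M K N"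
    using up.subq_torsion[OF Ks submod_trivial[OF MC] zK] .
  have Ns: "submod N M" by (rule subqD(1)[OF N(3)])
  have NT: "M \<restriction> N \<in> T'" using N(3) subq_bot[OF up.T_iso_closed] by blast
  obtain P p where p: "P \<in> F" "mor p M P" "p ` carrier M = carrier P" "kern p M P = N"
    using subqE[OF gap_sub_F[OF M(2) Ns NT]] by auto
  have P: "P \<in> T'" by (rule up.T_quotient[OF p(2,3) M(1)])
  have "P \<restriction> (p ` K) \<in> F'"
    using subq_kern[OF up.F_iso_closed p(2) Ks] N(2,4) p(4) by (simp add: Int_absorb2)
  moreover have "subq F P (p ` carrier M) (p ` K)"
    using subq_image[OF p(2) submod_carrier[OF MC] Ks submod_subset[OF Ks]] p(4) N(2) K by auto
  ultimately have "p ` K = {\<zero>\<^bsub>P\<^esub>}"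
    using gap_no_F'_kernel[OF P p(1) submod_image[OF p(2) Ks]] p(3) by simp
  then have "K \<subseteq> N"
    using submod_subset[OF Ks] unfolding p(4)[symmetric] by (auto simp: kern_def)
  then show ?thesis using N(2) NT by auto
qed

lemma subq_T'_lower:
  assumes "subq T' M U V" "subq F M U V" and K: "subq F M U K" "V \<subseteq> K"
  shows "subq T' M K V"
proof -
  have U: "submod U M" and Ks: "submod K M" "K \<subseteq> U" using subqD[OF K(1)] by auto
  obtain Q p where p: "Q \<in> F" "mor p (M \<restriction> U) Q" "p ` U = carrier Q" "kern p (M \<restriction> U) Q = V"
    using assms(2) by (rule subqE)
  have Q: "Q \<in> T'" by (rule subq_all[OF up.T_iso_closed assms(1) p(2-4)])
  have KU: "submod K (M \<restriction> U)" and UU: "submod U (M \<restriction> U)" using U Ks by (simp_all add: submod_restrict)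
  have "subq F (M \<restriction> U) U K" using K(1) subq_restrict[OF U order_refl] by blast
  then have "subq F Q (p ` U) (p ` K)" using subq_image[OF p(2) UU KU Ks(2)] p(4) K(2) by auto
  then have "Q \<restriction> (p ` K) \<in> T'" using gap_kernel[OF Q p(1)] p(3) by simp
  then have "subq T' (M \<restriction> U) K (kern p (M \<restriction> U) Q \<inter> K)"
    using subq_kern[OF up.T_iso_closed p(2) KU] by blast
  then show ?thesis using subq_restrict[OF U Ks(2)] p(4) K(2) by (simp add: Int_absorb2)
qed

text \<open>The image of a nonzero \<open>f\<close> lies in the gap and receives a map from
  \<open>B\<close>, so Schur's lemma for \<open>B\<close> makes it everything. The kernel equals its
  own \<open>T'\<close>-torsion \<open>L\<close>: the module \<open>N / L\<close> lies in the gap,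
  and the rest of the kernel would be a submodule of it from \<open>F'\<close>.\<close>

lemma B_simpT: "B \<in> simpT T'"
  unfolding simpT_def
proof (intro CollectI conjI ballI allI impI B_T')
  show "carrier B \<noteq> {\<zero>\<^bsub>B\<^esub>}" by (rule simpFD(2)[OF B_simpF])
  have BF: "B \<in> F" by (rule simpFD(1)[OF B_simpF])
  fix N f assume N: "N \<in> T'" and f: "mor f N B" "\<not> vanishes f N B"
  have NC: "N \<in> C" by (rule morD(1)[OF f(1)])
  have R: "submod (f ` carrier N) B" by (rule submod_range[OF f(1)])
  have "f ` carrier N \<noteq> {\<zero>\<^bsub>B\<^esub>}" using f(2) by (auto simp: vanishes_def)
  then obtain b where b: "mor b B (B \<restriction> (f ` carrier N))" "\<not> vanishes b B (B \<restriction> (f ` carrier N))"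
    using B_embeds[OF up.T_range[OF f(1) N] lo.F_restrict[OF R BF]] by auto
  have "mor b B B" using mor_comp'[OF b(1) mor_incl[OF R]] .
  moreover have "\<not> vanishes b B B" using b(2) by (simp add: vanishes_def)
  ultimately have "b ` carrier B = carrier B"
    using lo.simpF_Hom_iso[OF B_simpF B_simpF] by (auto simp: bij_betw_def)
  moreover have "b ` carrier B \<subseteq> f ` carrier N" using mor_closed[OF b(1)] by auto
  ultimately show surj: "f ` carrier N = carrier B" using submod_subset[OF R] by blast
  let ?K = "kern f N B"
  have K: "submod ?K N" by (rule submod_kern[OF f(1)])
  have zK: "{\<zero>\<^bsub>N\<^esub>} \<subseteq> ?K" using submod_zero[OF K] by simp
  obtain L where L: "L \<subseteq> ?K" "subq T' N L {\<zero>\<^bsub>N\<^esub>}" "subq F' N ?K L"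
    using up.subq_torsion[OF K submod_trivial[OF NC] zK] .
  have Ls: "submod L N" by (rule subqD(1)[OF L(2)])
  have "subq F N (carrier N) ?K" using subq_kern_epi[OF lo.F_iso_closed f(1) surj] BF by blast
  then have "subq F N (carrier N) L" using lo.subq_F_trans subq_mono[OF L(3) F'_le] by blast
  then obtain P p where p: "P \<in> F" "mor p N P" "p ` carrier N = carrier P" "kern p N P = L"
    by (auto elim: subqE)
  have P: "P \<in> T'" by (rule up.T_quotient[OF p(2,3) N])
  have "P \<restriction> (p ` ?K) \<in> F'"
    using subq_kern[OF up.F_iso_closed p(2) K] L(1,3) p(4) by (simp add: Int_absorb2)
  moreover have "subq F P (p ` carrier N) (p ` ?K)"
    using subq_image[OF p(2) submod_carrier[OF NC] K submod_subset[OF K]] p(4) L(1)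
      \<open>subq F N (carrier N) ?K\<close> by auto
  ultimately have "p ` ?K = {\<zero>\<^bsub>P\<^esub>}"
    using gap_no_F'_kernel[OF P p(1) submod_image[OF p(2) K]] p(3) by simp
  then have "?K \<subseteq> L" unfolding p(4)[symmetric] by (auto simp: kern_def)
  then have "?K = L" using L(1) by blast
  then show "N \<restriction> ?K \<in> T'" using L(2) subq_bot[OF up.T_iso_closed] by simp
qed

text \<open>A nonzero map would be injective with cokernel in \<open>F\<close>, so \<open>Y\<close>
  itself would lie in the gap and receive a map from \<open>B\<close>; Schur's lemma then identifies
  the two.\<close>

lemma simpF_Hom_gap:
  assumes Y: "Y \<in> simpF F" and iso: "\<not> mod_iso R B Y" and M: "M \<in> T'" "M \<in> F" and f: "mor f Y M"
  shows "vanishes f Y M"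
proof (rule ccontr)
  assume nv: "\<not> vanishes f Y M"
  have inj: "kern f Y M = {\<zero>\<^bsub>Y\<^esub>}" and sq: "subq F M (carrier M) (f ` carrier Y)"
    using simpFD(3,4)[OF Y M(2) f nv] by auto
  have "M \<restriction> (f ` carrier Y) \<in> T'" by (rule gap_kernel[OF M sq])
  then have "subq T' Y (carrier Y) {\<zero>\<^bsub>Y\<^esub>}"
    using subq_kern[OF up.T_iso_closed f submod_carrier[OF morD(1)[OF f]]] inj zero_in[OF morD(1)[OF f]]
    by simp
  then have "Y \<in> T'" using mem_iff_subq[OF up.T_iso_closed morD(1)[OF f]] by blast
  then obtain b where b: "mor b B Y" "\<not> vanishes b B Y"
    using B_embeds simpFD(1,2)[OF Y] by blast
  then show False using iso mod_isoI lo.simpF_Hom_iso[OF B_simpF Y] by blast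
qed

end

context length_category
begin

section \<open>Pullbacks and pushouts\<close>

text \<open>A biproduct with its structure maps. The sections are homomorphisms because an element
  of \<open>P\<close> is determined by its two components.\<close>

lemma productE:
  assumes M: "M \<in> C" and N: "N \<in> C"
  obtains a P b s t where "mor a P M" "mor b P N" "mor s M P" "mor t N P"
    "\<forall>x\<in>carrier M. a (s x) = x" "\<forall>x\<in>carrier M. b (s x) = \<zero>\<^bsub>N\<^esub>"
    "\<forall>y\<in>carrier N. a (t y) = \<zero>\<^bsub>M\<^esub>" "\<forall>y\<in>carrier N. b (t y) = y"
    "\<forall>z\<in>carrier P. \<forall>z'\<in>carrier P. a z = a z' \<longrightarrow> b z = b z' \<longrightarrow> z = z'"
    "\<forall>x\<in>carrier M. \<forall>y\<in>carrier N. \<exists>z\<in>carrier P. a z = x \<and> b z = y"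
proof -
  obtain P a b where P: "P \<in> C" "a \<in> Hom R P M" "b \<in> Hom R P N"
    and bij: "bij_betw (\<lambda>z. (a z, b z)) (carrier P) (carrier M \<times> carrier N)"
    using product_ex[OF M N] by blast
  have a: "mor a P M" and b: "mor b P N" using P M N by (auto simp: mor_def)
  have inj: "z = z'" if "z \<in> carrier P" "z' \<in> carrier P" "a z = a z'" "b z = b z'" for z z'
    using bij that by (auto simp: bij_betw_def inj_on_def)
  have surj: "\<exists>z\<in>carrier P. a z = x \<and> b z = y" if "x \<in> carrier M" "y \<in> carrier N" for x y
  proof -
    have "(x, y) \<in> (\<lambda>z. (a z, b z)) ` carrier P" using bij that by (simp add: bij_betw_def)
    then show ?thesis by auto
  qed
  interpret a: module_hom_pair R P M a using a by (rule mor_pair)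
  interpret b: module_hom_pair R P N b using b by (rule mor_pair)
  have "\<forall>x\<in>carrier M. \<exists>z. z \<in> carrier P \<and> a z = x \<and> b z = \<zero>\<^bsub>N\<^esub>"
    using surj zero_in[OF N] by blast
  from bchoice[OF this] obtain s where
    s: "\<forall>x\<in>carrier M. s x \<in> carrier P \<and> a (s x) = x \<and> b (s x) = \<zero>\<^bsub>N\<^esub>" by blast
  have "\<forall>y\<in>carrier N. \<exists>z. z \<in> carrier P \<and> a z = \<zero>\<^bsub>M\<^esub> \<and> b z = y"
    using surj zero_in[OF M] by blast
  from bchoice[OF this] obtain t where
    t: "\<forall>y\<in>carrier N. t y \<in> carrier P \<and> a (t y) = \<zero>\<^bsub>M\<^esub> \<and> b (t y) = y" by blast
  have "mor s M P" unfolding mor_iff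
  proof (intro conjI ballI)
    fix x y assume "x \<in> carrier M" "y \<in> carrier M"
    then show "s (x \<oplus>\<^bsub>M\<^esub> y) = s x \<oplus>\<^bsub>P\<^esub> s y"
      by - (rule inj, simp_all add: s a.add b.add)
  next
    fix r x assume "r \<in> carrier R" "x \<in> carrier M"
    then show "s (r \<odot>\<^bsub>M\<^esub> x) = r \<odot>\<^bsub>P\<^esub> s x"
      by - (rule inj, simp_all add: s a.smult b.smult)
  qed (use M P(1) s in auto)
  moreover have "mor t N P" unfolding mor_iff
  proof (intro conjI ballI)
    fix x y assume "x \<in> carrier N" "y \<in> carrier N"
    then show "t (x \<oplus>\<^bsub>N\<^esub> y) = t x \<oplus>\<^bsub>P\<^esub> t y"
      by - (rule inj, simp_all add: t a.add b.add)
  next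
    fix r x assume "r \<in> carrier R" "x \<in> carrier N"
    then show "t (r \<odot>\<^bsub>N\<^esub> x) = r \<odot>\<^bsub>P\<^esub> t x"
      by - (rule inj, simp_all add: t a.smult b.smult)
  qed (use N P(1) t in auto)
  ultimately show thesis using a b s t inj surj by (intro that[of a P b s t]) simp_all
qed

lemma pullbackE:
  assumes f: "mor f M E" and g: "mor g N E"
  obtains a P b where "mor a P M" "mor b P N" "\<forall>z\<in>carrier P. f (a z) = g (b z)"
    "\<forall>x\<in>carrier M. \<forall>y\<in>carrier N. f x = g y \<longrightarrow> (\<exists>z\<in>carrier P. a z = x \<and> b z = y)"
    "\<forall>z\<in>carrier P. a z = \<zero>\<^bsub>M\<^esub> \<longrightarrow> b z = \<zero>\<^bsub>N\<^esub> \<longrightarrow> z = \<zero>\<^bsub>P\<^esub>"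
proof -
  have MN: "M \<in> C" "N \<in> C" using f g by (auto dest: morD)
  obtain a P b s t where P: "mor a P M" "mor b P N" "mor s M P" "mor t N P"
    "\<forall>x\<in>carrier M. a (s x) = x" "\<forall>x\<in>carrier M. b (s x) = \<zero>\<^bsub>N\<^esub>"
    "\<forall>y\<in>carrier N. a (t y) = \<zero>\<^bsub>M\<^esub>" "\<forall>y\<in>carrier N. b (t y) = y"
    "\<forall>z\<in>carrier P. \<forall>z'\<in>carrier P. a z = a z' \<longrightarrow> b z = b z' \<longrightarrow> z = z'"
    "\<forall>x\<in>carrier M. \<forall>y\<in>carrier N. \<exists>z\<in>carrier P. a z = x \<and> b z = y"
    by (rule productE[OF MN])
  interpret a: module_hom_pair R P M a using P(1) by (rule mor_pair)
  interpret b: module_hom_pair R P N b using P(2) by (rule mor_pair)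
  interpret f: module_hom_pair R M E f using f by (rule mor_pair)
  interpret g: module_hom_pair R N E g using g by (rule mor_pair)
  define U where "U = {z \<in> carrier P. f (a z) = g (b z)}"
  have U: "submod U P" unfolding submod_iff
    using morD(1)[OF P(1)] by (auto simp: U_def a.add b.add f.add g.add a.smult b.smult f.smult g.smult)
  show thesis
  proof (rule that[of a "P \<restriction> U" b])
    show "mor a (P \<restriction> U) M" "mor b (P \<restriction> U) N" using mor_restrict P(1,2) U by auto
    have "z = \<zero>\<^bsub>P\<^esub>" if "z \<in> carrier P" "a z = \<zero>\<^bsub>M\<^esub>" "b z = \<zero>\<^bsub>N\<^esub>" for z
      using that P(9) a.M.zero_closed by (metis a.zero b.zero)
    then show "\<forall>z\<in>carrier (P \<restriction> U). a z = \<zero>\<^bsub>M\<^esub> \<longrightarrow> b z = \<zero>\<^bsub>N\<^esub> \<longrightarrow> z = \<zero>\<^bsub>P \<restriction> U\<^esub>"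
      by (simp add: U_def)
    show "\<forall>x\<in>carrier M. \<forall>y\<in>carrier N. f x = g y \<longrightarrow> (\<exists>z\<in>carrier (P \<restriction> U). a z = x \<and> b z = y)"
    proof (intro ballI impI)
      fix x y assume xy: "x \<in> carrier M" "y \<in> carrier N" "f x = g y"
      then obtain z where "z \<in> carrier P" "a z = x" "b z = y" using P(10) by blast
      then show "\<exists>z\<in>carrier (P \<restriction> U). a z = x \<and> b z = y"
        using xy(3) by (intro bexI[of _ z]) (auto simp: U_def)
    qed
  qed (simp add: U_def)
qed

text \<open>The pushout of an extension of \<open>N\<close> along a map \<open>g\<close> on its
  kernel: the outcome \<open>W\<close> is an extension of the same \<open>N\<close> by
  \<open>Z\<close>.\<close>

lemma pushoutE:
  assumes w: "mor w M N" "w ` carrier M = carrier N" and g: "mor g (M \<restriction> kern w M N) Z"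
  obtains i W j v where "mor i M W" "mor j Z W" "mor v W N"
    "kern j Z W = {\<zero>\<^bsub>Z\<^esub>}" "kern v W N = j ` carrier Z"
    "\<forall>x\<in>carrier M. v (i x) = w x" "\<forall>x\<in>kern w M N. i x = j (g x)" "kern i M W = {x \<in> kern w M N. g x = \<zero>\<^bsub>Z\<^esub>}"
proof -
  let ?K = "kern w M N"
  have MZ: "M \<in> C" "Z \<in> C" using w g by (auto dest: morD)
  have K: "submod ?K M" by (rule submod_kern[OF w(1)])
  obtain a P b s t where P: "mor a P M" "mor b P Z" "mor s M P" "mor t Z P"
    "\<forall>x\<in>carrier M. a (s x) = x" "\<forall>x\<in>carrier M. b (s x) = \<zero>\<^bsub>Z\<^esub>"
    "\<forall>y\<in>carrier Z. a (t y) = \<zero>\<^bsub>M\<^esub>" "\<forall>y\<in>carrier Z. b (t y) = y"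
    "\<forall>z\<in>carrier P. \<forall>z'\<in>carrier P. a z = a z' \<longrightarrow> b z = b z' \<longrightarrow> z = z'"
    "\<forall>x\<in>carrier M. \<forall>y\<in>carrier Z. \<exists>z\<in>carrier P. a z = x \<and> b z = y"
    by (rule productE[OF MZ])
  interpret a: module_hom_pair R P M a using P(1) by (rule mor_pair)
  interpret b: module_hom_pair R P Z b using P(2) by (rule mor_pair)
  interpret s: module_hom_pair R M P s using P(3) by (rule mor_pair)
  interpret t: module_hom_pair R Z P t using P(4) by (rule mor_pair)
  interpret g: module_hom_pair R "M \<restriction> ?K" Z g using g by (rule mor_pair)
  have gadd: "g (x \<oplus>\<^bsub>M\<^esub> y) = g x \<oplus>\<^bsub>Z\<^esub> g y" if "x \<in> ?K" "y \<in> ?K" for x y using g.add[of x y] that by simp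
  have gsm: "g (r \<odot>\<^bsub>M\<^esub> x) = r \<odot>\<^bsub>Z\<^esub> g x" if "r \<in> carrier R" "x \<in> ?K" for r x using g.smult[of r x] that by simp
  have gc: "g x \<in> carrier Z" if "x \<in> ?K" for x using g.closed[of x] that by simp
  have g0: "g \<zero>\<^bsub>M\<^esub> = \<zero>\<^bsub>Z\<^esub>" using g.zero by simp
  have Kc: "?K \<subseteq> carrier M" "\<zero>\<^bsub>M\<^esub> \<in> ?K" "\<And>x y. x \<in> ?K \<Longrightarrow> y \<in> ?K \<Longrightarrow> x \<oplus>\<^bsub>M\<^esub> y \<in> ?K"
    "\<And>r x. r \<in> carrier R \<Longrightarrow> x \<in> ?K \<Longrightarrow> r \<odot>\<^bsub>M\<^esub> x \<in> ?K"
    using K by (auto simp: submod_iff)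
  \<comment> \<open>The graph of minus \<open>g\<close>, so that modulo \<open>D\<close> an element
    of the kernel becomes equal to its image under \<open>g\<close>. The sign is moved across the
    equation.\<close>
  define D where "D = {z \<in> carrier P. a z \<in> ?K \<and> b z \<oplus>\<^bsub>Z\<^esub> g (a z) = \<zero>\<^bsub>Z\<^esub>}"
  have D: "submod D P" unfolding submod_iff
  proof (intro conjI ballI)
    show "P \<in> C" by (rule morD(1)[OF P(1)])
    show "D \<subseteq> carrier P" by (auto simp: D_def)
    show "\<zero>\<^bsub>P\<^esub> \<in> D" using Kc(2) g0 by (simp add: D_def)
  next
    fix x y assume "x \<in> D" "y \<in> D"
    then have x: "x \<in> carrier P" "a x \<in> ?K" "b x \<oplus>\<^bsub>Z\<^esub> g (a x) = \<zero>\<^bsub>Z\<^esub>"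
      and y: "y \<in> carrier P" "a y \<in> ?K" "b y \<oplus>\<^bsub>Z\<^esub> g (a y) = \<zero>\<^bsub>Z\<^esub>" by (auto simp: D_def)
    have "(b x \<oplus>\<^bsub>Z\<^esub> b y) \<oplus>\<^bsub>Z\<^esub> (g (a x) \<oplus>\<^bsub>Z\<^esub> g (a y)) = (b x \<oplus>\<^bsub>Z\<^esub> g (a x)) \<oplus>\<^bsub>Z\<^esub> (b y \<oplus>\<^bsub>Z\<^esub> g (a y))"
      using x(1,2) y(1,2) gc by (simp add: b.N.a_ac)
    then show "x \<oplus>\<^bsub>P\<^esub> y \<in> D" using x y Kc(3) by (simp add: D_def a.add b.add gadd)
  next
    fix r x assume r: "r \<in> carrier R" and "x \<in> D"
    then have x: "x \<in> carrier P" "a x \<in> ?K" "b x \<oplus>\<^bsub>Z\<^esub> g (a x) = \<zero>\<^bsub>Z\<^esub>" by (auto simp: D_def)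
    have "r \<odot>\<^bsub>Z\<^esub> (b x \<oplus>\<^bsub>Z\<^esub> g (a x)) = r \<odot>\<^bsub>Z\<^esub> b x \<oplus>\<^bsub>Z\<^esub> r \<odot>\<^bsub>Z\<^esub> g (a x)"
      using r x(1,2) gc by (simp add: b.N.smult_r_distr)
    then show "r \<odot>\<^bsub>P\<^esub> x \<in> D" using r x Kc(4) by (simp add: D_def a.smult b.smult gsm)
  qed
  obtain W p where p: "mor p P W" "p ` carrier P = carrier W" "kern p P W = D"
    using D by (rule quotientE)
  have "mor (\<lambda>z. w (a z)) P N" by (rule mor_comp'[OF P(1) w(1)])
  moreover have "kern p P W \<subseteq> kern (\<lambda>z. w (a z)) P N" unfolding p(3) by (auto simp: D_def kern_def)
  ultimately obtain v where v: "mor v W N" "\<And>z. z \<in> carrier P \<Longrightarrow> v (p z) = w (a z)"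
    using mor_descend[OF p(1,2)] by blast
  show thesis
  proof (rule that[of "\<lambda>x. p (s x)" W "\<lambda>y. p (t y)" v])
    show "mor (\<lambda>x. p (s x)) M W" "mor (\<lambda>y. p (t y)) Z W" using mor_comp' P(3,4) p(1) by auto
    show "mor v W N" by (rule v(1))
    have "t y \<in> D \<longleftrightarrow> y = \<zero>\<^bsub>Z\<^esub>" if "y \<in> carrier Z" for y
      using that P(7,8) Kc(2) g0 by (auto simp: D_def)
    then show "kern (\<lambda>y. p (t y)) Z W = {\<zero>\<^bsub>Z\<^esub>}"
      unfolding p(3)[symmetric] by (auto simp: kern_def)
    show "\<forall>x\<in>carrier M. v (p (s x)) = w x" using v(2) P(5) by simp
    have "s x \<in> D \<longleftrightarrow> x \<in> ?K \<and> g x = \<zero>\<^bsub>Z\<^esub>" if "x \<in> carrier M" for x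
      using that P(5,6) gc by (auto simp: D_def)
    then show "kern (\<lambda>x. p (s x)) M W = {x \<in> ?K. g x = \<zero>\<^bsub>Z\<^esub>}"
      unfolding p(3)[symmetric] using Kc(1) by (auto simp: kern_def)
    show "\<forall>x\<in>?K. p (s x) = p (t (g x))"
    proof
      fix x assume x: "x \<in> ?K"
      have xM: "x \<in> carrier M" and c: "s x \<in> carrier P" "t (g x) \<in> carrier P" using x Kc(1) gc by auto
      have "a (s x \<ominus>\<^bsub>P\<^esub> t (g x)) = x" "b (s x \<ominus>\<^bsub>P\<^esub> t (g x)) = \<ominus>\<^bsub>Z\<^esub> g x"
        using xM gc[OF x] c P(5,6,7,8) by (simp_all add: a.minus b.minus) (simp_all add: a_minus_def)
      then have "s x \<ominus>\<^bsub>P\<^esub> t (g x) \<in> D"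
        using x gc[OF x] c by (simp add: D_def b.N.l_neg)
      then show "p (s x) = p (t (g x))" using mor_eq_iff[OF p(1) c] p(3) by blast
    qed
    show "kern v W N = (\<lambda>y. p (t y)) ` carrier Z"
    proof (intro equalityI subsetI)
      fix q assume "q \<in> kern v W N"
      then have "q \<in> p ` carrier P" "v q = \<zero>\<^bsub>N\<^esub>" using p(2) by (auto simp: kern_def)
      then obtain z where z: "z \<in> carrier P" "q = p z" "v (p z) = \<zero>\<^bsub>N\<^esub>" by blast
      then have aK: "a z \<in> ?K" using v(2)[OF z(1)] by (simp add: kern_def)
      \<comment> \<open>Since \<open>a z\<close> lies in the kernel of \<open>w\<close>, the first
        component of \<open>z\<close> can be moved to the second one modulo \<open>D\<close>;
        \<open>?y\<close> is the resulting second component.\<close>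
      let ?y = "b z \<oplus>\<^bsub>Z\<^esub> g (a z)"
      have y: "?y \<in> carrier Z" using z(1) gc[OF aK] by simp
      have "b (z \<ominus>\<^bsub>P\<^esub> t ?y) = b z \<ominus>\<^bsub>Z\<^esub> ?y" "a (z \<ominus>\<^bsub>P\<^esub> t ?y) = a z"
        using z(1) y P(7,8) by (simp_all add: a.minus b.minus) (simp_all add: a_minus_def)
      moreover have "(b z \<ominus>\<^bsub>Z\<^esub> ?y) \<oplus>\<^bsub>Z\<^esub> g (a z) = \<zero>\<^bsub>Z\<^esub>"
        using z(1) gc[OF aK] by (simp add: a_minus_def b.N.minus_add b.N.a_ac b.N.r_neg b.N.l_neg b.N.r_neg2 b.N.r_neg1)
      ultimately have "z \<ominus>\<^bsub>P\<^esub> t ?y \<in> D" using z(1) y aK by (simp add: D_def)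
      then have "p z = p (t ?y)" using mor_eq_iff[OF p(1) z(1), of "t ?y"] y p(3) by simp
      then show "q \<in> (\<lambda>y. p (t y)) ` carrier Z" using z(2) y by blast
    next
      fix q assume "q \<in> (\<lambda>y. p (t y)) ` carrier Z"
      then obtain y where y: "y \<in> carrier Z" "q = p (t y)" by blast
      then have "v q = \<zero>\<^bsub>N\<^esub>" using v(2)[of "t y"] P(7) mor_zero[OF w(1)] by simp
      then show "q \<in> kern v W N" using y mor_closed[OF p(1)] by (simp add: kern_def)
    qed
  qed
qed

lemma mor_diff:
  assumes f: "mor f M N" and g: "mor g M N"
  shows "mor (\<lambda>x. f x \<ominus>\<^bsub>N\<^esub> g x) M N"
proof -
  interpret f: module_hom_pair R M N f using f by (rule mor_pair)
  interpret g: module_hom_pair R M N g using g by (rule mor_pair)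
  have n: "\<ominus>\<^bsub>N\<^esub> y = (\<ominus>\<^bsub>R\<^esub> \<one>\<^bsub>R\<^esub>) \<odot>\<^bsub>N\<^esub> y" if "y \<in> carrier N" for y
    using that by (simp add: f.N.uminus_one_smult)
  show ?thesis unfolding mor_iff
  proof (intro conjI ballI)
    fix x y assume "x \<in> carrier M" "y \<in> carrier M"
    then show "f (x \<oplus>\<^bsub>M\<^esub> y) \<ominus>\<^bsub>N\<^esub> g (x \<oplus>\<^bsub>M\<^esub> y) = (f x \<ominus>\<^bsub>N\<^esub> g x) \<oplus>\<^bsub>N\<^esub> (f y \<ominus>\<^bsub>N\<^esub> g y)"
      by (simp add: f.add g.add a_minus_def f.N.minus_add f.N.a_ac)
  next
    fix r x assume r: "r \<in> carrier R" and x: "x \<in> carrier M"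
    have "g (r \<odot>\<^bsub>M\<^esub> (\<ominus>\<^bsub>M\<^esub> x)) = \<ominus>\<^bsub>N\<^esub> g (r \<odot>\<^bsub>M\<^esub> x)"
    proof -
      have "r \<odot>\<^bsub>M\<^esub> (\<ominus>\<^bsub>M\<^esub> x) \<oplus>\<^bsub>M\<^esub> r \<odot>\<^bsub>M\<^esub> x = \<zero>\<^bsub>M\<^esub>"
        using r x by (simp add: f.M.l_neg flip: f.M.smult_r_distr)
      then have "g (r \<odot>\<^bsub>M\<^esub> (\<ominus>\<^bsub>M\<^esub> x)) \<oplus>\<^bsub>N\<^esub> g (r \<odot>\<^bsub>M\<^esub> x) = \<zero>\<^bsub>N\<^esub>"
        using r x by (simp flip: g.add)
      then show ?thesis using r x by (simp add: f.N.minus_equality)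
    qed
    moreover have "g (\<ominus>\<^bsub>M\<^esub> x) = \<ominus>\<^bsub>N\<^esub> g x"
    proof -
      have "g (\<ominus>\<^bsub>M\<^esub> x) \<oplus>\<^bsub>N\<^esub> g x = \<zero>\<^bsub>N\<^esub>" using x by (simp add: f.M.l_neg flip: g.add)
      then show ?thesis using x by (simp add: f.N.minus_equality)
    qed
    ultimately have "\<ominus>\<^bsub>N\<^esub> g (r \<odot>\<^bsub>M\<^esub> x) = r \<odot>\<^bsub>N\<^esub> (\<ominus>\<^bsub>N\<^esub> g x)"
      using r x g.smult[of r "\<ominus>\<^bsub>M\<^esub> x"] by simp
    then show "f (r \<odot>\<^bsub>M\<^esub> x) \<ominus>\<^bsub>N\<^esub> g (r \<odot>\<^bsub>M\<^esub> x) = r \<odot>\<^bsub>N\<^esub> (f x \<ominus>\<^bsub>N\<^esub> g x)"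
      using r x by (simp add: a_minus_def f.N.smult_r_distr f.smult)
  qed (use morD[OF f] in auto)
qed

end

section \<open>Images, pullbacks of epimorphisms and extension closure\<close>

context length_category
begin

lemma restrict_mono_image:
  assumes "iso_closed \<P>" and f: "mor f M N" and U: "submod U M" and k: "kern f M N \<inter> U = {\<zero>\<^bsub>M\<^esub>}"
  shows "M \<restriction> U \<in> \<P> \<longleftrightarrow> N \<restriction> (f ` U) \<in> \<P>"
  using subq_kern[OF assms(1) f U] subq_bot[OF assms(1), of M U] U k by simp

lemma mono_image_iff:
  assumes "iso_closed \<P>" and f: "mor f M N" "kern f M N = {\<zero>\<^bsub>M\<^esub>}"
  shows "M \<in> \<P> \<longleftrightarrow> N \<restriction> (f ` carrier M) \<in> \<P>"
proof -
  have "kern f M N \<inter> carrier M = {\<zero>\<^bsub>M\<^esub>}" using f(2) by (auto simp: kern_def)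
  then show ?thesis using restrict_mono_image[OF assms(1) f(1) submod_carrier[OF morD(1)[OF f(1)]]] by simp
qed

text \<open>Pulling back keeps an epimorphism onto, and the two kernels in \<open>P\<close> are
  copies of the original ones. This turns an extension with quotient \<open>E\<close> into one with
  quotient \<open>D\<close>.\<close>

lemma pullback_epiE:
  assumes f: "mor f N E" "f ` carrier N = carrier E" and u: "mor u D E"
  obtains a P b where "mor a P D" "mor b P N" "a ` carrier P = carrier D"
    "\<forall>z\<in>carrier P. u (a z) = f (b z)" "a ` kern b P N = kern u D E" "b ` kern a P D = kern f N E"
    "kern a P D \<inter> kern b P N = {\<zero>\<^bsub>P\<^esub>}"
proof -
  obtain a P b where P: "mor a P D" "mor b P N" "\<forall>z\<in>carrier P. u (a z) = f (b z)"
    "\<forall>x\<in>carrier D. \<forall>y\<in>carrier N. u x = f y \<longrightarrow> (\<exists>z\<in>carrier P. a z = x \<and> b z = y)"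
    "\<forall>z\<in>carrier P. a z = \<zero>\<^bsub>D\<^esub> \<longrightarrow> b z = \<zero>\<^bsub>N\<^esub> \<longrightarrow> z = \<zero>\<^bsub>P\<^esub>"
    by (rule pullbackE[OF u f(1)])
  have C: "D \<in> C" "N \<in> C" "E \<in> C" using f u by (auto dest: morD)
  have 1: "a ` carrier P = carrier D"
  proof (intro equalityI subsetI)
    fix x assume x: "x \<in> carrier D"
    then have "u x \<in> f ` carrier N" using mor_closed[OF u] f(2) by simp
    then obtain y where "y \<in> carrier N" "u x = f y" by blast
    then show "x \<in> a ` carrier P" using P(4) x by blast
  qed (use mor_closed[OF P(1)] in auto)
  have 2: "a ` kern b P N = kern u D E"
  proof (intro equalityI subsetI)
    fix x assume "x \<in> a ` kern b P N"
    then obtain z where z: "z \<in> carrier P" "b z = \<zero>\<^bsub>N\<^esub>" "x = a z" by (auto simp: kern_def)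
    then have "u x = f \<zero>\<^bsub>N\<^esub>" using P(3) by simp
    then show "x \<in> kern u D E" using mor_zero[OF f(1)] mor_closed[OF P(1) z(1)] z(3) by (simp add: kern_def)
  next
    fix x assume x: "x \<in> kern u D E"
    then have "u x = f \<zero>\<^bsub>N\<^esub>" "x \<in> carrier D" using mor_zero[OF f(1)] by (simp_all add: kern_def)
    then obtain z where "z \<in> carrier P" "a z = x" "b z = \<zero>\<^bsub>N\<^esub>" using P(4) zero_in[OF C(2)] by blast
    then show "x \<in> a ` kern b P N" by (auto simp: kern_def)
  qed
  have 3: "b ` kern a P D = kern f N E"
  proof (intro equalityI subsetI)
    fix x assume "x \<in> b ` kern a P D"
    then obtain z where z: "z \<in> carrier P" "a z = \<zero>\<^bsub>D\<^esub>" "x = b z" by (auto simp: kern_def)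
    then have "f x = u \<zero>\<^bsub>D\<^esub>" using P(3) by metis
    then show "x \<in> kern f N E" using mor_zero[OF u] mor_closed[OF P(2) z(1)] z(3) by (simp add: kern_def)
  next
    fix x assume x: "x \<in> kern f N E"
    then have "u \<zero>\<^bsub>D\<^esub> = f x" "x \<in> carrier N" using mor_zero[OF u] by (simp_all add: kern_def)
    then obtain z where "z \<in> carrier P" "a z = \<zero>\<^bsub>D\<^esub>" "b z = x" using P(4) zero_in[OF C(1)] by blast
    then show "x \<in> b ` kern a P D" by (auto simp: kern_def)
  qed
  have "\<zero>\<^bsub>P\<^esub> \<in> kern a P D \<inter> kern b P N"
    using submod_zero[OF submod_kern] P(1,2) by blast
  then have 4: "kern a P D \<inter> kern b P N = {\<zero>\<^bsub>P\<^esub>}" using P(5) by (auto simp: kern_def)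
  show thesis by (rule that[OF P(1,2) 1 P(3) 2 3 4])
qed

lemma kern_Int_carrier [simp]: "kern f M N \<inter> carrier M = kern f M N" "carrier M \<inter> kern f M N = kern f M N"
  by (auto simp: kern_def)

lemma len_mono_restrict:
  assumes f: "mor f M N" and U: "submod U M" and k: "kern f M N \<inter> U = {\<zero>\<^bsub>M\<^esub>}"
  shows "len (M \<restriction> U) = len (N \<restriction> (f ` U))"
  using len_mono[OF mor_restrict[OF f U]] k by (simp add: kern_restrict[OF submod_subset[OF U]])

lemma submod_eqI:
  assumes U: "submod U M" and V: "submod V M" "V \<subseteq> U" and "len (M \<restriction> U) \<le> len (M \<restriction> V)"
  shows "V = U"
  using len_restrict_eq[of V "M \<restriction> U"] len_restrict_le[of V "M \<restriction> U"] assms by (simp add: submod_restrict)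

end

context torsion_pair
begin

lemma subq_F_refl: "submod U M \<Longrightarrow> subq F M U U"
proof -
  assume U: "submod U M"
  obtain W where "U \<subseteq> W" "W \<subseteq> U" "subq T M W U" "subq F M U W"
    using subq_torsion[OF U U order_refl] .
  then show ?thesis by auto
qed

lemma T_ext:
  assumes f: "mor f M N" "f ` carrier M = carrier N" and "M \<restriction> kern f M N \<in> T" "N \<in> T"
  shows "M \<in> T"
proof -
  have "subq T M (carrier M) (kern f M N)" using subq_kern_epi[OF T_iso_closed f] assms(4) by blast
  moreover have "subq T M (kern f M N) {\<zero>\<^bsub>M\<^esub>}"
    using assms(3) submod_kern[OF f(1)] subq_bot[OF T_iso_closed] by blast
  ultimately show ?thesis
    using mem_iff_subq[OF T_iso_closed morD(1)[OF f(1)]] subq_T_trans by blast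
qed

lemma F_ext:
  assumes f: "mor f M N" "f ` carrier M = carrier N" and "M \<restriction> kern f M N \<in> F" "N \<in> F"
  shows "M \<in> F"
proof -
  have "subq F M (carrier M) (kern f M N)" using subq_kern_epi[OF F_iso_closed f] assms(4) by blast
  moreover have "subq F M (kern f M N) {\<zero>\<^bsub>M\<^esub>}"
    using assms(3) submod_kern[OF f(1)] subq_bot[OF F_iso_closed] by blast
  ultimately show ?thesis
    using mem_iff_subq[OF F_iso_closed morD(1)[OF f(1)]] subq_F_trans by blast
qed

end

section \<open>Mutation of simple objects\<close>

context torsion_step
begin

text \<open>An extension by a gap module that has stayed inside \<open>F'\<close>. The simple object
  that replaces \<open>Y\<close> is such an extension of maximal length.\<close>

definition extF :: "('a, 'm) module \<Rightarrow> ('a, 'm) module \<Rightarrow> ('m \<Rightarrow> 'm) \<Rightarrow> bool" where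
  "extF Y E i \<longleftrightarrow> E \<in> F' \<and> mor i Y E \<and> kern i Y E = {\<zero>\<^bsub>Y\<^esub>} \<and>
     subq T' E (carrier E) (i ` carrier Y) \<and> subq F E (carrier E) (i ` carrier Y)"

text \<open>By simplicity of \<open>Y\<close>, the restriction of \<open>g\<close> to
  \<open>Y\<close> is zero as soon as it has a kernel. Then \<open>g\<close> factors over the
  cokernel of \<open>i\<close>, which lies in \<open>T'\<close>, and so it vanishes in
  \<open>F'\<close>.\<close>

lemma extF_endo:
  assumes Y: "Y \<in> simpF F" and E: "extF Y E i" and N: "N \<in> F'" and g: "mor g E N"
    and k: "kern (\<lambda>y. g (i y)) Y N \<noteq> {\<zero>\<^bsub>Y\<^esub>}"
  shows "vanishes g E N"
proof -
  have i: "mor i Y E" and T': "subq T' E (carrier E) (i ` carrier Y)" using E by (auto simp: extF_def)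
  have NF: "N \<in> F" using N F'_le by blast
  have "vanishes (\<lambda>y. g (i y)) Y N" using simpFD(3)[OF Y NF mor_comp'[OF i g]] k by blast
  then have z: "g x = \<zero>\<^bsub>N\<^esub>" if "x \<in> i ` carrier Y" for x using that by (auto simp: vanishes_def)
  show ?thesis unfolding vanishes_def using up.subq_T_Hom_F[OF T' _ N, of g] g z by simp
qed

text \<open>The trivial extension starts the search for a maximal one. It lies in \<open>F'\<close>
  because Schur's lemma forbids nonzero maps from \<open>B\<close>.\<close>

lemma extF_self:
  assumes Y: "Y \<in> simpF F" and iso: "\<not> mod_iso R B Y"
  shows "extF Y Y (\<lambda>x. x)"
proof -
  have YF: "Y \<in> F" by (rule simpFD(1)[OF Y])
  have YC: "Y \<in> C" by (rule lo.F_in[OF YF])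
  have "Y \<in> F'"
  proof (rule F'_I[OF YF])
    fix f assume f: "mor f B Y"
    show "vanishes f B Y" using lo.simpF_Hom_iso[OF B_simpF Y f] mod_isoI[OF f] iso by blast
  qed
  then show ?thesis
    using mor_id[OF YC] zero_in[OF YC] up.subq_T_refl[OF submod_carrier[OF YC]]
      lo.subq_F_refl[OF submod_carrier[OF YC]] by (auto simp: extF_def kern_def)
qed

text \<open>A nonzero \<open>g\<close> from \<open>E\<close> to a module of \<open>F'\<close> embeds
  \<open>Y\<close> with cokernel in \<open>F\<close>. Its kernel meets the copy of \<open>Y\<close>
  trivially, so it embeds in the gap module that is the cokernel of \<open>i\<close>; it lies in
  \<open>T'\<close> and in \<open>F'\<close>, hence is zero. The cokernel of \<open>g\<close> has no
  \<open>T'\<close>-torsion, since such torsion would enlarge \<open>E\<close>.\<close>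

lemma extF_max_simpF:
  assumes Y: "Y \<in> simpF F" and E: "extF Y E i"
    and max: "\<And>E' i'. extF Y E' i' \<Longrightarrow> len E' \<le> len E"
  shows "E \<in> simpF F'"
  unfolding simpF_def
proof (intro CollectI conjI ballI allI impI)
  let ?I = "i ` carrier Y"
  have EF': "E \<in> F'" and i: "mor i Y E" "kern i Y E = {\<zero>\<^bsub>Y\<^esub>}" and IT: "subq T' E (carrier E) ?I"
    and IF: "subq F E (carrier E) ?I" using E by (auto simp: extF_def)
  have EC: "E \<in> C" by (rule morD(2)[OF i(1)])
  have Is: "submod ?I E" by (rule submod_range[OF i(1)])
  show "E \<in> F'" by fact
  show "carrier E \<noteq> {\<zero>\<^bsub>E\<^esub>}"
  proof
    assume "carrier E = {\<zero>\<^bsub>E\<^esub>}"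
    then have "kern i Y E = carrier Y" using mor_closed[OF i(1)] by (auto simp: kern_def)
    then show False using i(2) simpFD(2)[OF Y] by simp
  qed
  fix N g assume N: "N \<in> F'" and g: "mor g E N" and nv: "\<not> vanishes g E N"
  have NF: "N \<in> F" using N F'_le by blast
  have NC: "N \<in> C" by (rule lo.F_in[OF NF])
  let ?K = "kern g E N" and ?J = "g ` ?I" and ?S = "g ` carrier E"
  have gi: "mor (\<lambda>y. g (i y)) Y N" by (rule mor_comp'[OF i(1) g])
  have kgi: "kern (\<lambda>y. g (i y)) Y N = {\<zero>\<^bsub>Y\<^esub>}" using extF_endo[OF Y E N g] nv by blast
  have "\<not> vanishes (\<lambda>y. g (i y)) Y N" by (rule not_vanishes_mono[OF kgi simpFD(2)[OF Y]])
  then have J: "subq F N (carrier N) ?J" using simpFD(4)[OF Y NF gi] by (simp add: image_image)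
  have Ks: "submod ?K E" by (rule submod_kern[OF g])
  have Js: "submod ?J N" by (rule submod_image[OF g Is])
  have Ss: "submod ?S N" by (rule submod_range[OF g])
  have JS: "?J \<subseteq> ?S" using submod_subset[OF Is] by blast
  have KI: "?K \<inter> ?I = {\<zero>\<^bsub>E\<^esub>}"
  proof (intro equalityI subsetI)
    fix x assume "x \<in> ?K \<inter> ?I"
    then obtain y where "y \<in> carrier Y" "x = i y" "g (i y) = \<zero>\<^bsub>N\<^esub>" by (auto simp: kern_def)
    then have "y \<in> kern (\<lambda>y. g (i y)) Y N" by (simp add: kern_def)
    then show "x \<in> {\<zero>\<^bsub>E\<^esub>}" using kgi mor_zero[OF i(1)] \<open>x = i y\<close> by simp
  qed (use submod_zero[OF Ks] submod_zero[OF Is] in auto)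
  \<comment> \<open>The sum of the kernel of \<open>g\<close> and the copy of \<open>Y\<close>, so
    that dividing by the latter gives a copy of the kernel.\<close>
  define W where "W = {x \<in> carrier E. g x \<in> ?J}"
  have Ws: "submod W E" unfolding W_def by (rule submod_vimage[OF g Js])
  have KW: "?K \<subseteq> W" using submod_zero[OF Js] by (auto simp: W_def kern_def)
  have IW: "?I \<subseteq> W" using submod_subset[OF Is] by (auto simp: W_def)
  have gW: "g ` W = ?J" using IW by (auto simp: W_def)
  have "subq F N ?S ?J" by (rule lo.subq_F_lower[OF J Ss JS submod_subset[OF Ss]])
  then have "subq F E (carrier E) W"
    using subq_image[OF g submod_carrier[OF EC] Ws submod_subset[OF Ws]] KW gW by auto
  then have "subq T' E W ?I" by (rule subq_T'_lower[OF IT IF _ IW])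
  moreover have "subq T' E W ?I \<longleftrightarrow> subq T' E ?K (?K \<inter> ?I)"
  proof (rule subq_iso2[OF Ks Is Ws KW IW])
    fix x assume x: "x \<in> W"
    then obtain y where xy: "x \<in> carrier E" "y \<in> ?I" "g x = g y" by (auto simp: W_def)
    have y: "y \<in> carrier E" using xy(2) submod_subset[OF Is] by blast
    have "x \<ominus>\<^bsub>E\<^esub> y \<in> ?K" using mor_eq_iff[OF g xy(1) y] xy(3) by blast
    moreover have "x \<ominus>\<^bsub>E\<^esub> (x \<ominus>\<^bsub>E\<^esub> y) \<in> ?I" using minus_minus[OF EC xy(1) y] xy(2) by simp
    ultimately show "\<exists>u\<in>?K. x \<ominus>\<^bsub>E\<^esub> u \<in> ?I" by blast
  qed
  ultimately have "E \<restriction> ?K \<in> T'" using KI subq_bot[OF up.T_iso_closed] by simp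
  then show inj: "?K = {\<zero>\<^bsub>E\<^esub>}" using up.T_Int_F[OF _ up.F_restrict[OF Ks EF']] by simp
  have "subq T' N ?S ?J"
    using subq_image[OF g submod_carrier[OF EC] Is submod_subset[OF Is]] inj submod_zero[OF Is] IT by auto
  then have S: "subq F N (carrier N) ?S" by (rule subq_F_upper[OF _ J submod_subset[OF Ss]])
  \<comment> \<open>The image of \<open>g\<close> together with the \<open>T'\<close>-torsion of its
    cokernel. As another extension of \<open>Y\<close> by the gap, \<open>L\<close> competes with
    \<open>E\<close> for maximal length.\<close>
  obtain L where L: "?S \<subseteq> L" "L \<subseteq> carrier N" "subq T' N L ?S" "subq F' N (carrier N) L"
    using up.subq_torsion[OF submod_carrier[OF NC] Ss submod_subset[OF Ss]] .
  have Ls: "submod L N" by (rule subqD(1)[OF L(3)])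
  have "extF Y (N \<restriction> L) (\<lambda>y. g (i y))" unfolding extF_def
  proof (intro conjI)
    show "N \<restriction> L \<in> F'" by (rule up.F_restrict[OF Ls N])
    have r: "(\<lambda>y. g (i y)) ` carrier Y = ?J" by (simp add: image_image)
    show "mor (\<lambda>y. g (i y)) Y (N \<restriction> L)" using mor_corestrict[OF gi Ls] r JS L(1) by simp
    show "kern (\<lambda>y. g (i y)) Y (N \<restriction> L) = {\<zero>\<^bsub>Y\<^esub>}" using kgi by simp
    have "subq T' N L ?J" using L(3) \<open>subq T' N ?S ?J\<close> by (rule up.subq_T_trans)
    then show "subq T' (N \<restriction> L) (carrier (N \<restriction> L)) ((\<lambda>y. g (i y)) ` carrier Y)"
      using subq_restrict[OF Ls order_refl] r by simp
    have "subq F N L ?J" by (rule lo.subq_F_lower[OF J Ls]) (use L JS in auto)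
    then show "subq F (N \<restriction> L) (carrier (N \<restriction> L)) ((\<lambda>y. g (i y)) ` carrier Y)"
      using subq_restrict[OF Ls order_refl] r by simp
  qed
  then have "len (N \<restriction> L) \<le> len E" by (rule max)
  also have "len E = len (N \<restriction> ?S)" by (rule len_mono[OF g inj])
  finally have "?S = L" by (rule submod_eqI[OF Ls Ss L(1)])
  then show "subq F' N (carrier N) ?S" using L(4) by simp
qed

text \<open>A map from the gap to \<open>N\<close>, reduced so that its kernel has no
  \<open>T'\<close>-torsion. By \<open>gap_sub_F\<close> such torsion can be divided out without
  leaving the gap.\<close>

definition covT :: "('a, 'm) module \<Rightarrow> ('a, 'm) module \<Rightarrow> ('m \<Rightarrow> 'm) \<Rightarrow> bool" where
  "covT N M w \<longleftrightarrow> M \<in> T' \<and> M \<in> F \<and> mor w M N \<and> M \<restriction> kern w M N \<in> F'"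

text \<open>A nonzero submodule of \<open>N\<close> from \<open>T\<close> is all of
  \<open>N\<close>. So if \<open>w\<close> is not onto, its image has no \<open>T\<close>-torsion
  and lies in \<open>F\<close>; then \<open>gap_kernel\<close> puts the kernel into
  \<open>T'\<close>, while it is in \<open>F'\<close> by assumption.\<close>

lemma covT_pure:
  assumes N: "N \<in> simpT T" and M: "covT N M w"
  shows "kern w M N = {\<zero>\<^bsub>M\<^esub>} \<or> w ` carrier M = carrier N"
proof (rule disjCI)
  assume ns: "w ` carrier M \<noteq> carrier N"
  have MT': "M \<in> T'" and MF: "M \<in> F" and w: "mor w M N" and KF': "M \<restriction> kern w M N \<in> F'"
    using M by (auto simp: covT_def)
  have C: "M \<in> C" "N \<in> C" using morD[OF w] by auto
  let ?I = "w ` carrier M" and ?K = "kern w M N"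
  have I: "submod ?I N" by (rule submod_range[OF w])
  have zI: "{\<zero>\<^bsub>N\<^esub>} \<subseteq> ?I" using submod_zero[OF I] by simp
  obtain L where L: "L \<subseteq> ?I" "subq T N L {\<zero>\<^bsub>N\<^esub>}" "subq F N ?I L"
    using lo.subq_torsion[OF I submod_trivial[OF C(2)] zI] .
  have Ls: "submod L N" by (rule subqD(1)[OF L(2)])
  have LT: "N \<restriction> L \<in> T" using L(2) subq_bot[OF lo.T_iso_closed] by blast
  have "L = {\<zero>\<^bsub>N\<^esub>}"
  proof (rule ccontr)
    assume "L \<noteq> {\<zero>\<^bsub>N\<^esub>}"
    then have "\<not> vanishes (\<lambda>x. x) (N \<restriction> L) N" using submod_zero[OF Ls] by (auto simp: vanishes_def)
    then have "L = carrier N" using simpTD(3)[OF N LT mor_incl[OF Ls]] by simp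
    then show False using ns L(1) submod_subset[OF I] by blast
  qed
  then have "N \<restriction> ?I \<in> F" using L(3) subq_bot[OF lo.F_iso_closed] by simp
  then have "subq F M (carrier M) ?K"
    using subq_kern[OF lo.F_iso_closed w submod_carrier[OF C(1)]] by simp
  then have "M \<restriction> ?K \<in> T'" by (rule gap_kernel[OF MT' MF])
  then show "?K = {\<zero>\<^bsub>M\<^esub>}" using up.T_Int_F[OF _ KF'] by simp
qed

text \<open>Otherwise \<open>N\<close>, a nonzero module of \<open>T\<close>, would be isomorphic to
  a module of \<open>F\<close>.\<close>

lemma covT_surj_kern_nontrivial:
  assumes N: "N \<in> simpT T" and M: "covT N M w" and surj: "w ` carrier M = carrier N"
  shows "kern w M N \<noteq> {\<zero>\<^bsub>M\<^esub>}"
proof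
  have MF: "M \<in> F" and w: "mor w M N" using M by (auto simp: covT_def)
  assume "kern w M N = {\<zero>\<^bsub>M\<^esub>}"
  then have "bij_betw w (carrier M) (carrier N)" using mor_inj_iff[OF w] surj by (simp add: bij_betw_def)
  then obtain g where g: "mor g N M" "\<forall>y\<in>carrier N. w (g y) = y" using mor_inverse[OF w] by blast
  have "y = \<zero>\<^bsub>N\<^esub>" if "y \<in> carrier N" for y
    using lo.Hom_T_F[OF g(1) simpTD(1)[OF N] MF that] g(2) that mor_zero[OF w] by force
  then show False using simpTD(2)[OF N] zero_in[OF morD(2)[OF w]] by blast
qed

text \<open>Push the extension out along a nonzero map \<open>g\<close> from the kernel to a module
  of \<open>F'\<close>. A splitting of the pushout \<open>W\<close> would force \<open>g\<close> to
  vanish, so \<open>simpT_split\<close> puts \<open>W\<close> into \<open>F\<close>. This makes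
  \<open>g\<close> injective. Its cokernel is isomorphic to \<open>W\<close> modulo the image of
  \<open>M\<close>, and maximality of \<open>M\<close> puts it into \<open>F'\<close>.\<close>

lemma covT_surj_simpF:
  assumes N: "N \<in> simpT T" and M: "covT N M w" and surj: "w ` carrier M = carrier N"
    and max: "\<And>M' w'. covT N M' w' \<Longrightarrow> len M' \<le> len M"
  shows "M \<restriction> kern w M N \<in> simpF F'"
  unfolding simpF_def
proof (intro CollectI conjI ballI allI impI)
  let ?K = "kern w M N"
  have MT': "M \<in> T'" and MF: "M \<in> F" and w: "mor w M N" and KF': "M \<restriction> ?K \<in> F'"
    using M by (auto simp: covT_def)
  have MC: "M \<in> C" by (rule morD(1)[OF w])
  have Ks: "submod ?K M" by (rule submod_kern[OF w])
  show "M \<restriction> ?K \<in> F'" by fact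
  show "carrier (M \<restriction> ?K) \<noteq> {\<zero>\<^bsub>M \<restriction> ?K\<^esub>}" using covT_surj_kern_nontrivial[OF N M surj] by simp
  fix Z g assume Z: "Z \<in> F'" and g: "mor g (M \<restriction> ?K) Z" and nv: "\<not> vanishes g (M \<restriction> ?K) Z"
  have ZF: "Z \<in> F" using Z F'_le by blast
  have ZC: "Z \<in> C" by (rule lo.F_in[OF ZF])
  obtain i W j v where i: "mor i M W" and j: "mor j Z W" and v: "mor v W N"
    and kj: "kern j Z W = {\<zero>\<^bsub>Z\<^esub>}" and kv: "kern v W N = j ` carrier Z"
    and vi: "\<forall>x\<in>carrier M. v (i x) = w x"
    and ij: "\<forall>x\<in>?K. i x = j (g x)" and ki: "kern i M W = {x \<in> ?K. g x = \<zero>\<^bsub>Z\<^esub>}"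
    by (rule pushoutE[OF w surj g])
  have WC: "W \<in> C" by (rule morD(1)[OF v])
  let ?I = "i ` carrier M" and ?J = "j ` carrier Z"
  have Is: "submod ?I W" by (rule submod_range[OF i])
  have Js: "submod ?J W" by (rule submod_range[OF j])
  have "v ` carrier W = carrier N"
  proof (intro equalityI subsetI)
    fix y assume "y \<in> carrier N"
    then obtain x where "x \<in> carrier M" "y = w x" using surj by blast
    then show "y \<in> v ` carrier W" using vi mor_closed[OF i] by (intro image_eqI[of _ _ "i x"]) auto
  qed (use mor_closed[OF v] in auto)
  have JF': "W \<restriction> ?J \<in> F'"
    using mono_image_iff[OF up.F_iso_closed j kj] Z by simp
  then have JF: "W \<restriction> kern v W N \<in> F" using F'_le kv by auto
  have "W \<in> F"
  proof (rule ccontr)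
    assume "W \<notin> F"
    then obtain s where s: "mor s N W" "\<forall>x\<in>carrier N. v (s x) = x"
      using lo.simpT_split[OF N v \<open>v ` carrier W = carrier N\<close> JF] by blast
    \<comment> \<open>Corrected by the section, \<open>i\<close> maps \<open>M\<close> into the
      kernel of \<open>v\<close>, a copy of \<open>Z\<close>. As \<open>M\<close> is in
      \<open>T'\<close> and \<open>Z\<close> in \<open>F'\<close>, the difference is zero; on the
      kernel of \<open>w\<close> it agrees with \<open>i\<close>.\<close>
    define h where "h x = i x \<ominus>\<^bsub>W\<^esub> s (w x)" for x
    have sw: "mor (\<lambda>x. s (w x)) M W" by (rule mor_comp'[OF w s(1)])
    have h: "mor h M W" unfolding h_def by (rule mor_diff[OF i sw])
    have "h ` carrier M \<subseteq> ?J"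
    proof
      fix y assume "y \<in> h ` carrier M"
      then obtain x where x: "x \<in> carrier M" "y = h x" by blast
      have "v (i x) = v (s (w x))" using vi s(2) x(1) mor_closed[OF w x(1)] by simp
      then show "y \<in> ?J"
        using mor_eq_iff[OF v mor_closed[OF i x(1)] mor_closed[OF sw x(1)]] x(2) kv by (simp add: h_def)
    qed
    then have "mor h M (W \<restriction> ?J)" by (rule mor_corestrict[OF h Js])
    then have h0: "h x = \<zero>\<^bsub>W\<^esub>" if "x \<in> carrier M" for x
      using up.Hom_T_F[OF _ MT' JF' that] by simp
    have "vanishes g (M \<restriction> ?K) Z" unfolding vanishes_def
    proof
      fix x assume "x \<in> carrier (M \<restriction> ?K)"
      then have x: "x \<in> ?K" "x \<in> carrier M" "w x = \<zero>\<^bsub>N\<^esub>" by (auto simp: kern_def)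
      interpret left_module R W using WC by (rule is_left_module)
      have "i x \<ominus>\<^bsub>W\<^esub> \<zero>\<^bsub>W\<^esub> = \<zero>\<^bsub>W\<^esub>" using h0[OF x(2)] x(3) mor_zero[OF s(1)] by (simp add: h_def)
      moreover have "\<ominus>\<^bsub>W\<^esub> \<zero>\<^bsub>W\<^esub> = \<zero>\<^bsub>W\<^esub>" by (rule minus_equality) simp_all
      ultimately have "i x = \<zero>\<^bsub>W\<^esub>" using mor_closed[OF i x(2)] by (simp add: a_minus_def)
      then have "x \<in> kern i M W" using x(2) by (simp add: kern_def)
      then show "g x = \<zero>\<^bsub>Z\<^esub>" unfolding ki by simp
    qed
    then show False using nv by blast
  qed
  let ?H = "kern i M W"
  have Hs: "submod ?H M" by (rule submod_kern[OF i])
  have "subq F M (carrier M) ?H"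
    using subq_kern[OF lo.F_iso_closed i submod_carrier[OF MC]] lo.F_restrict[OF Is \<open>W \<in> F\<close>] by simp
  then have "M \<restriction> ?H \<in> T'" by (rule gap_kernel[OF MT' MF])
  moreover have "M \<restriction> ?H \<in> F'"
    using up.F_restrict[OF _ KF', of ?H] submod_restrict[OF Ks] Hs ki by auto
  ultimately have H: "?H = {\<zero>\<^bsub>M\<^esub>}" using up.T_Int_F by fastforce
  have "kern g (M \<restriction> ?K) Z = ?H" unfolding ki by (auto simp: kern_def)
  then show "kern g (M \<restriction> ?K) Z = {\<zero>\<^bsub>M \<restriction> ?K\<^esub>}" using H by simp
  have IT': "W \<restriction> ?I \<in> T'" by (rule up.T_range[OF i MT'])
  have "subq F W (carrier W) ?I" by (rule gap_sub_F[OF \<open>W \<in> F\<close> Is IT'])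
  obtain L where L: "?I \<subseteq> L" "L \<subseteq> carrier W" "subq T' W L ?I" "subq F' W (carrier W) L"
    using up.subq_torsion[OF submod_carrier[OF WC] Is submod_subset[OF Is]] .
  have Ls: "submod L W" by (rule subqD(1)[OF L(3)])
  \<comment> \<open>The image of \<open>M\<close> enlarged by the \<open>T'\<close>-torsion of its
    cokernel is again a candidate, so maximality identifies the two.\<close>
  have "covT N (W \<restriction> L) v" unfolding covT_def
  proof (intro conjI)
    have "subq T' W ?I {\<zero>\<^bsub>W\<^esub>}" using IT' Is subq_bot[OF up.T_iso_closed] by blast
    then show "W \<restriction> L \<in> T'" using up.subq_T_trans[OF L(3)] subq_bot[OF up.T_iso_closed] by blast
    show "W \<restriction> L \<in> F" by (rule lo.F_restrict[OF Ls \<open>W \<in> F\<close>])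
    show "mor v (W \<restriction> L) N" by (rule mor_restrict[OF v Ls])
    have "submod (?J \<inter> L) (W \<restriction> ?J)" using submod_Int[OF Js Ls] by (simp add: submod_restrict[OF Js])
    then show "W \<restriction> L \<restriction> kern v (W \<restriction> L) N \<in> F'"
      using up.F_restrict[OF _ JF'] kv by (simp add: kern_restrict[OF L(2)])
  qed
  then have "len (W \<restriction> L) \<le> len M" by (rule max)
  also have "len M = len (W \<restriction> ?I)" by (rule len_mono[OF i H])
  finally have IL: "?I = L" by (rule submod_eqI[OF Ls Is L(1)])
  have JI: "?J \<inter> ?I = j ` g ` ?K"
  proof (intro equalityI subsetI)
    fix y assume y: "y \<in> ?J \<inter> ?I"
    then obtain x where x: "x \<in> carrier M" "y = i x" by blast
    have "v y = \<zero>\<^bsub>N\<^esub>" using y unfolding kv[symmetric] by (simp add: kern_def)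
    then have "x \<in> ?K" using x vi by (simp add: kern_def)
    then show "y \<in> j ` g ` ?K" using x(2) ij by auto
  next
    fix y assume "y \<in> j ` g ` ?K"
    then obtain x where x: "x \<in> ?K" "y = j (g x)" by blast
    have "x \<in> carrier M" "g x \<in> carrier Z" using x(1) kern_subset[of w M N] mor_closed[OF g] by auto
    then show "y \<in> ?J \<inter> ?I" using x ij by (auto intro!: image_eqI[of "j (g x)" i x])
  qed
  have gK: "submod (g ` ?K) Z" using submod_range[OF g] by simp
  have "subq F' W (carrier W) ?I \<longleftrightarrow> subq F' W ?J (?J \<inter> ?I)"
  proof (rule subq_iso2[OF Js Is submod_carrier[OF WC] submod_subset[OF Js] submod_subset[OF Is]])
    fix x assume x: "x \<in> carrier W"
    then have "v x \<in> carrier N" by (rule mor_closed[OF v])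
    then obtain m where m: "m \<in> carrier M" "v x = w m" using surj by (metis imageE)
    have im: "i m \<in> carrier W" by (rule mor_closed[OF i m(1)])
    have "v x = v (i m)" using m vi by simp
    then have "x \<ominus>\<^bsub>W\<^esub> i m \<in> ?J" using mor_eq_iff[OF v x im] kv by simp
    moreover have "x \<ominus>\<^bsub>W\<^esub> (x \<ominus>\<^bsub>W\<^esub> i m) \<in> ?I" using minus_minus[OF WC x im] m(1) by simp
    ultimately show "\<exists>u\<in>?J. x \<ominus>\<^bsub>W\<^esub> u \<in> ?I" by blast
  qed
  then have "subq F' W ?J (j ` g ` ?K)" using L(4) IL JI by simp
  then show "subq F' Z (carrier Z) (g ` carrier (M \<restriction> ?K))"
    using subq_image[OF j submod_carrier[OF ZC] gK submod_subset[OF gK]] kj submod_zero[OF gK] by auto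
qed

text \<open>Pulling \<open>N\<close> back along a map from the gap to its quotient \<open>E\<close>
  gives an extension of a gap module by \<open>M\<close>. This is a candidate over \<open>N\<close>
  that would be longer than \<open>M\<close> if the map were nonzero.\<close>

lemma covT_cokernel_Hom:
  assumes N: "N \<in> simpT T" and M: "covT N M w" and inj: "kern w M N = {\<zero>\<^bsub>M\<^esub>}"
    and max: "\<And>M' w'. covT N M' w' \<Longrightarrow> len M' \<le> len M"
    and p: "mor p N E" "p ` carrier N = carrier E" "kern p N E = w ` carrier M"
    and D: "D \<in> T'" "D \<in> F" and u: "mor u D E"
  shows "vanishes u D E"
proof (rule ccontr)
  assume nv: "\<not> vanishes u D E"
  have MT': "M \<in> T'" and MF: "M \<in> F" and w: "mor w M N" using M by (auto simp: covT_def)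
  have DC: "D \<in> C" by (rule morD(1)[OF u])
  have MC: "M \<in> C" by (rule morD(1)[OF w])
  have Ks: "submod (kern u D E) D" by (rule submod_kern[OF u])
  have zK: "{\<zero>\<^bsub>D\<^esub>} \<subseteq> kern u D E" using submod_zero[OF Ks] by simp
  \<comment> \<open>Dividing \<open>D\<close> by the \<open>T'\<close>-torsion of the kernel puts
    the kernel of the induced map into \<open>F'\<close>, as \<open>covT\<close> demands.\<close>
  obtain L where L: "L \<subseteq> kern u D E" "subq T' D L {\<zero>\<^bsub>D\<^esub>}" "subq F' D (kern u D E) L"
    using up.subq_torsion[OF Ks submod_trivial[OF DC] zK] .
  have Ls: "submod L D" by (rule subqD(1)[OF L(2)])
  have "D \<restriction> L \<in> T'" using L(2) subq_bot[OF up.T_iso_closed] by blast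
  then have "subq F D (carrier D) L" by (rule gap_sub_F[OF D(2) Ls])
  then obtain D1 q where q: "D1 \<in> F" "mor q D D1" "q ` carrier D = carrier D1" "kern q D D1 = L"
    by (auto elim: subqE)
  have D1T': "D1 \<in> T'" by (rule up.T_quotient[OF q(2,3) D(1)])
  obtain u1 where u1: "mor u1 D1 E" "\<forall>x\<in>carrier D. u1 (q x) = u x"
    using mor_descend[OF q(2,3) u] q(4) L(1) by blast
  have "kern u1 D1 E = q ` kern u D E"
  proof (intro equalityI subsetI)
    fix y assume y: "y \<in> kern u1 D1 E"
    then have "y \<in> q ` carrier D" using q(3) by (simp add: kern_def)
    then obtain x where "x \<in> carrier D" "y = q x" by blast
    then show "y \<in> q ` kern u D E" using y u1(2) by (auto simp: kern_def)
  next
    fix y assume "y \<in> q ` kern u D E"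
    then show "y \<in> kern u1 D1 E" using u1(2) mor_closed[OF q(2)] by (auto simp: kern_def)
  qed
  then have ku1: "D1 \<restriction> kern u1 D1 E \<in> F'"
    using subq_kern[OF up.F_iso_closed q(2) Ks] L(1,3) q(4) by (simp add: Int_absorb2)
  obtain a P b where P: "mor a P D1" "mor b P N" "a ` carrier P = carrier D1"
    "\<forall>z\<in>carrier P. u1 (a z) = p (b z)" "a ` kern b P N = kern u1 D1 E" "b ` kern a P D1 = kern p N E"
    "kern a P D1 \<inter> kern b P N = {\<zero>\<^bsub>P\<^esub>}"
    by (rule pullback_epiE[OF p(1,2) u1(1)])
  have ka: "submod (kern a P D1) P" and kb: "submod (kern b P N) P"
    using submod_kern P(1,2) by auto
  have I: "N \<restriction> w ` carrier M \<in> T'" "N \<restriction> w ` carrier M \<in> F"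
    using mono_image_iff[OF up.T_iso_closed w inj] mono_image_iff[OF lo.F_iso_closed w inj] MT' MF
    by simp_all
  have kaI: "b ` kern a P D1 = w ` carrier M" "kern b P N \<inter> kern a P D1 = {\<zero>\<^bsub>P\<^esub>}"
    using P(6,7) p(3) by auto
  have "P \<restriction> kern a P D1 \<in> T'" "P \<restriction> kern a P D1 \<in> F"
    using restrict_mono_image[OF up.T_iso_closed P(2) ka kaI(2)]
      restrict_mono_image[OF lo.F_iso_closed P(2) ka kaI(2)] I kaI(1) by simp_all
  then have PP: "P \<in> T'" "P \<in> F"
    using up.T_ext[OF P(1,3)] lo.F_ext[OF P(1,3)] D1T' q(1) by blast+
  moreover have "P \<restriction> kern b P N \<in> F'"
    using restrict_mono_image[OF up.F_iso_closed P(1) kb P(7)] P(5) ku1 by simp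
  ultimately have "covT N P b" using P(2) by (simp add: covT_def)
  then have "len P \<le> len M" by (rule max)
  moreover have "len P = len (P \<restriction> kern a P D1) + len D1" by (rule len_epi[OF P(1,3)])
  moreover have "len (P \<restriction> kern a P D1) = len (N \<restriction> w ` carrier M)"
    using len_mono_restrict[OF P(2) ka kaI(2)] kaI(1) by simp
  moreover have "len M = len (N \<restriction> w ` carrier M)" by (rule len_mono[OF w inj])
  ultimately have "len D1 = 0" by simp
  then have D1: "carrier D1 = {\<zero>\<^bsub>D1\<^esub>}" using len_eq_0 morD(1)[OF u1(1)] by blast
  have "vanishes u D E" unfolding vanishes_def
  proof
    fix x assume x: "x \<in> carrier D"
    then have "q x = \<zero>\<^bsub>D1\<^esub>" using mor_closed[OF q(2)] D1 by auto
    then show "u x = \<zero>\<^bsub>E\<^esub>" using u1 x mor_zero[OF u1(1)] by metis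
  qed
  then show False using nv by blast
qed

text \<open>A map \<open>f\<close> to the quotient \<open>E\<close> is replaced by its pullback
  \<open>b\<close> from \<open>P\<close> to \<open>N\<close>, restricted to the
  \<open>T\<close>-torsion \<open>L\<close> of \<open>P\<close>, where the simplicity of
  \<open>N\<close> applies. The restriction is nonzero by \<open>covT_cokernel_Hom\<close>.\<close>

lemma covT_cokernel_simpT:
  assumes N: "N \<in> simpT T" and M: "covT N M w" and inj: "kern w M N = {\<zero>\<^bsub>M\<^esub>}"
    and ns: "w ` carrier M \<noteq> carrier N"
    and max: "\<And>M' w'. covT N M' w' \<Longrightarrow> len M' \<le> len M"
    and p: "mor p N E" "p ` carrier N = carrier E" "kern p N E = w ` carrier M"
  shows "E \<in> simpT T'"
  unfolding simpT_def
proof (intro CollectI conjI ballI allI impI)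
  have MT': "M \<in> T'" and MF: "M \<in> F" and w: "mor w M N" using M by (auto simp: covT_def)
  have MC: "M \<in> C" by (rule morD(1)[OF w])
  have NT: "N \<in> T" by (rule simpTD(1)[OF N])
  show "E \<in> T'" using lo.T_quotient[OF p(1,2) NT] T_le by blast
  show "carrier E \<noteq> {\<zero>\<^bsub>E\<^esub>}"
  proof
    assume "carrier E = {\<zero>\<^bsub>E\<^esub>}"
    then have "kern p N E = carrier N" using mor_closed[OF p(1)] by (auto simp: kern_def)
    then show False using p(3) ns by simp
  qed
  fix Z f assume Z: "Z \<in> T'" and f: "mor f Z E" and nv: "\<not> vanishes f Z E"
  obtain a P b where P: "mor a P Z" "mor b P N" "a ` carrier P = carrier Z"
    "\<forall>z\<in>carrier P. f (a z) = p (b z)" "a ` kern b P N = kern f Z E" "b ` kern a P Z = kern p N E"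
    "kern a P Z \<inter> kern b P N = {\<zero>\<^bsub>P\<^esub>}"
    by (rule pullback_epiE[OF p(1,2) f])
  have PC: "P \<in> C" by (rule morD(1)[OF P(1)])
  have ka: "submod (kern a P Z) P" and kb: "submod (kern b P N) P"
    using submod_kern P(1,2) by auto
  have "N \<restriction> w ` carrier M \<in> T'"
    using mono_image_iff[OF up.T_iso_closed w inj] MT' by simp
  moreover have kaI: "b ` kern a P Z = w ` carrier M" "kern b P N \<inter> kern a P Z = {\<zero>\<^bsub>P\<^esub>}"
    using P(6,7) p(3) by auto
  ultimately have "P \<restriction> kern a P Z \<in> T'"
    using restrict_mono_image[OF up.T_iso_closed P(2) ka kaI(2)] by simp
  then have PT': "P \<in> T'" using up.T_ext[OF P(1,3)] Z by blast
  have zP: "{\<zero>\<^bsub>P\<^esub>} \<subseteq> carrier P" using zero_in[OF PC] by simp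
  obtain L where L: "L \<subseteq> carrier P" "subq T P L {\<zero>\<^bsub>P\<^esub>}" "subq F P (carrier P) L"
    using lo.subq_torsion[OF submod_carrier[OF PC] submod_trivial[OF PC] zP] .
  have Ls: "submod L P" by (rule subqD(1)[OF L(2)])
  have LT: "P \<restriction> L \<in> T" using L(2) subq_bot[OF lo.T_iso_closed] by blast
  have PL: "subq T' P (carrier P) L"
    using up.subq_T_upper[OF _ Ls _ L(1)] mem_iff_subq[OF up.T_iso_closed PC] PT' submod_zero[OF Ls] by blast
  have bL: "mor b (P \<restriction> L) N" by (rule mor_restrict[OF P(2) Ls])
  have fa: "mor (\<lambda>z. f (a z)) P E" by (rule mor_comp'[OF P(1) f])
  have nvb: "\<not> vanishes b (P \<restriction> L) N"
  proof
    assume v: "vanishes b (P \<restriction> L) N"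
    \<comment> \<open>The quotient \<open>D\<close> of \<open>P\<close> by \<open>L\<close> lies in
      the gap. If \<open>b\<close> vanishes on \<open>L\<close>, the composite of \<open>a\<close>
      and \<open>f\<close> descends to \<open>D\<close> and hence is zero.\<close>
    obtain D q where q: "D \<in> F" "mor q P D" "q ` carrier P = carrier D" "kern q P D = L"
      using subqE[OF L(3)] by auto
    have "D \<in> T'" by (rule up.T_quotient[OF q(2,3) PT'])
    have "kern q P D \<subseteq> kern (\<lambda>z. f (a z)) P E"
      unfolding q(4) using v P(4) L(1) mor_zero[OF p(1)] by (auto simp: kern_def vanishes_def)
    then obtain u where u: "mor u D E" "\<forall>z\<in>carrier P. u (q z) = f (a z)"
      using mor_descend[OF q(2,3) fa] by blast
    have "vanishes u D E"
      by (rule covT_cokernel_Hom[OF N M inj max p \<open>D \<in> T'\<close> q(1) u(1)])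
    then have fa0: "f (a z) = \<zero>\<^bsub>E\<^esub>" if "z \<in> carrier P" for z
      using u(2) that mor_closed[OF q(2) that] unfolding vanishes_def by metis
    have "vanishes f Z E" unfolding vanishes_def
    proof
      fix x assume "x \<in> carrier Z"
      then obtain z where "z \<in> carrier P" "x = a z" using P(3) by blast
      then show "f x = \<zero>\<^bsub>E\<^esub>" using fa0 by simp
    qed
    then show False using nv by blast
  qed
  have bsL: "b ` L = carrier N" using simpTD(3)[OF N LT bL nvb] by simp
  show "f ` carrier Z = carrier E"
  proof (intro equalityI subsetI)
    fix y assume "y \<in> carrier E"
    then obtain x where x: "x \<in> carrier N" "y = p x" using p(2) by blast
    then obtain z where z: "z \<in> carrier P" "x = b z" using bsL L(1) by blast
    then have "y = f (a z)" using P(4) x(2) by simp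
    then show "y \<in> f ` carrier Z" using mor_closed[OF P(1) z(1)] by blast
  qed (use mor_closed[OF f] in auto)
  have "P \<restriction> (kern b P N \<inter> L) \<in> T"
    using simpTD(4)[OF N LT bL nvb] by (simp add: kern_restrict[OF L(1)])
  then have 1: "subq T' P (kern b P N \<inter> L) {\<zero>\<^bsub>P\<^esub>}"
    using T_le submod_Int[OF kb Ls] subq_bot[OF up.T_iso_closed] by blast
  \<comment> \<open>As \<open>b\<close> maps \<open>L\<close> onto \<open>N\<close>, the module
    \<open>P\<close> is the sum of \<open>L\<close> and the kernel of \<open>b\<close>. So this
    kernel is an extension of the quotient of \<open>P\<close> by \<open>L\<close> by a module of
    \<open>T\<close>.\<close>
  have "subq T' P (carrier P) L \<longleftrightarrow> subq T' P (kern b P N) (kern b P N \<inter> L)"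
  proof (rule subq_iso2[OF kb Ls submod_carrier[OF PC] kern_subset L(1)])
    fix x assume x: "x \<in> carrier P"
    then have "b x \<in> b ` L" using mor_closed[OF P(2)] bsL by blast
    then obtain l where l: "l \<in> L" "b x = b l" by blast
    have lP: "l \<in> carrier P" using l(1) L(1) by blast
    have "x \<ominus>\<^bsub>P\<^esub> l \<in> kern b P N" using mor_eq_iff[OF P(2) x lP] l(2) by blast
    moreover have "x \<ominus>\<^bsub>P\<^esub> (x \<ominus>\<^bsub>P\<^esub> l) \<in> L" using minus_minus[OF PC x lP] l(1) by simp
    ultimately show "\<exists>u\<in>kern b P N. x \<ominus>\<^bsub>P\<^esub> u \<in> L" by blast
  qed
  then have "subq T' P (kern b P N) (kern b P N \<inter> L)" using PL by blast
  then have "P \<restriction> kern b P N \<in> T'"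
    using up.subq_T_trans 1 subq_bot[OF up.T_iso_closed] by blast
  then have "Z \<restriction> (a ` kern b P N) \<in> T'"
    using up.T_range[OF mor_restrict[OF P(1) kb]] by simp
  then show "Z \<restriction> kern f Z E \<in> T'" using P(5) by simp
qed

end

section \<open>Bricks\<close>

text \<open>\<open>S\<close> plays the role of the ground field inside \<open>R\<close>, so that
  eigenvalue arguments can be carried out on modules alone. By \<open>scalar_cases\<close> a scalar
  is zero or injective on each module, as a field element would be.\<close>

locale brick_category = length_category R C len
  for R :: "('a, 'x) ring_scheme" and C :: "('a, 'm) module set" and len +
  fixes S :: "'a set"
  assumes scalar_R: "s \<in> S \<Longrightarrow> s \<in> carrier R"
    and mor_scalar: "s \<in> S \<Longrightarrow> M \<in> C \<Longrightarrow> mor (\<lambda>x. s \<odot>\<^bsub>M\<^esub> x) M M"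
    and eigenvalue: "M \<in> C \<Longrightarrow> carrier M \<noteq> {\<zero>\<^bsub>M\<^esub>} \<Longrightarrow> mor f M M \<Longrightarrow>
      \<exists>s\<in>S. \<exists>x\<in>carrier M. x \<noteq> \<zero>\<^bsub>M\<^esub> \<and> f x = s \<odot>\<^bsub>M\<^esub> x"
    and scalar_cases: "s \<in> S \<Longrightarrow> M \<in> C \<Longrightarrow> (\<forall>x\<in>carrier M. s \<odot>\<^bsub>M\<^esub> x = \<zero>\<^bsub>M\<^esub>) \<or>
      (\<forall>x\<in>carrier M. s \<odot>\<^bsub>M\<^esub> x = \<zero>\<^bsub>M\<^esub> \<longrightarrow> x = \<zero>\<^bsub>M\<^esub>)"
begin

text \<open>Endomorphisms are compared with scalars directly instead of passing through an
  endomorphism algebra; \<open>mem_bricks_iff\<close> links the two notions.\<close>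

definition brick :: "('a, 'm) module \<Rightarrow> bool" where
  "brick M \<longleftrightarrow> M \<in> C \<and> carrier M \<noteq> {\<zero>\<^bsub>M\<^esub>} \<and>
     (\<forall>f. mor f M M \<longrightarrow> (\<exists>s\<in>S. \<forall>x\<in>carrier M. f x = s \<odot>\<^bsub>M\<^esub> x))"

definition cls :: "('a, 'm) module \<Rightarrow> ('a, 'm) module set" where
  "cls M = {N \<in> C. mod_iso R M N}"

lemma cls_eq_iff: "M \<in> C \<Longrightarrow> N \<in> C \<Longrightarrow> cls M = cls N \<longleftrightarrow> mod_iso R M N"
proof
  assume MN: "M \<in> C" "N \<in> C" and "cls M = cls N"
  then show "mod_iso R M N" using mod_iso_refl[OF MN(2)] unfolding cls_def by blast
next
  assume MN: "M \<in> C" "N \<in> C" and iso: "mod_iso R M N"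
  show "cls M = cls N" unfolding cls_def
  proof (intro Collect_cong conj_cong refl iffI)
    fix P assume P: "P \<in> C"
    show "mod_iso R N P" if "mod_iso R M P"
      by (rule mod_iso_trans[OF mod_iso_sym[OF iso MN] that MN(2,1) P])
    show "mod_iso R M P" if "mod_iso R N P" by (rule mod_iso_trans[OF iso that MN P])
  qed
qed

lemma minus_scalar:
  assumes "s \<in> S" "mor f M M"
  shows "mor (\<lambda>x. f x \<ominus>\<^bsub>M\<^esub> s \<odot>\<^bsub>M\<^esub> x) M M"
  by (rule mor_diff[OF assms(2) mor_scalar[OF assms(1) morD(1)[OF assms(2)]]])

lemma minus_scalar_zero_iff:
  assumes "s \<in> S" "mor f M M" "x \<in> carrier M"
  shows "f x \<ominus>\<^bsub>M\<^esub> s \<odot>\<^bsub>M\<^esub> x = \<zero>\<^bsub>M\<^esub> \<longleftrightarrow> f x = s \<odot>\<^bsub>M\<^esub> x"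
proof -
  have MC: "M \<in> C" by (rule morD(1)[OF assms(2)])
  interpret left_module R M using MC by (rule is_left_module)
  have "f x \<in> carrier M" "s \<odot>\<^bsub>M\<^esub> x \<in> carrier M"
    using mor_closed[OF assms(2,3)] mor_closed[OF mor_scalar[OF assms(1) MC] assms(3)] by auto
  then show ?thesis by simp
qed

lemma brickI:
  assumes M: "M \<in> C" "carrier M \<noteq> {\<zero>\<^bsub>M\<^esub>}"
    and *: "\<And>f. mor f M M \<Longrightarrow> kern f M M \<noteq> {\<zero>\<^bsub>M\<^esub>} \<Longrightarrow> vanishes f M M"
  shows "brick M"
  unfolding brick_def
proof (intro conjI allI impI M)
  fix f assume f: "mor f M M"
  obtain s z where s: "s \<in> S" "z \<in> carrier M" "z \<noteq> \<zero>\<^bsub>M\<^esub>" "f z = s \<odot>\<^bsub>M\<^esub> z"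
    using eigenvalue[OF M f] by blast
  let ?g = "\<lambda>x. f x \<ominus>\<^bsub>M\<^esub> s \<odot>\<^bsub>M\<^esub> x"
  have "z \<in> kern ?g M M" using s minus_scalar_zero_iff[OF s(1) f s(2)] by (simp add: kern_def)
  then have "vanishes ?g M M" using *[OF minus_scalar[OF s(1) f]] s(3) by blast
  then have "\<forall>x\<in>carrier M. f x = s \<odot>\<^bsub>M\<^esub> x"
    using minus_scalar_zero_iff[OF s(1) f] by (simp add: vanishes_def)
  then show "\<exists>s\<in>S. \<forall>x\<in>carrier M. f x = s \<odot>\<^bsub>M\<^esub> x" using s(1) by blast
qed

lemma brick_endo:
  assumes M: "brick M" and f: "mor f M M" "\<not> vanishes f M M"
  shows "bij_betw f (carrier M) (carrier M)"
proof -
  have MC: "M \<in> C" using M by (simp add: brick_def)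
  obtain s where s: "s \<in> S" "\<forall>x\<in>carrier M. f x = s \<odot>\<^bsub>M\<^esub> x" using M f(1) unfolding brick_def by blast
  then have "\<forall>x\<in>carrier M. f x = \<zero>\<^bsub>M\<^esub> \<longrightarrow> x = \<zero>\<^bsub>M\<^esub>"
    using scalar_cases[OF s(1) MC] f(2) by (auto simp: vanishes_def)
  then have "kern f M M = {\<zero>\<^bsub>M\<^esub>}" using zero_in[OF MC] mor_zero[OF f(1)] by (auto simp: kern_def)
  then show ?thesis
    using inj_iff_surj[OF f(1) refl] mor_inj_iff[OF f(1)] by (simp add: bij_betw_def)
qed

text \<open>The image of a nonzero endomorphism of minimal length works.\<close>

lemma brick_image_ex:
  assumes M: "M \<in> C" "carrier M \<noteq> {\<zero>\<^bsub>M\<^esub>}"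
  obtains e where "mor e M M" "\<not> vanishes e M M" "brick (M \<restriction> (e ` carrier M))"
proof -
  let ?P = "\<lambda>e. mor e M M \<and> \<not> vanishes e M M"
  have "?P (\<lambda>x. x)" using mor_id[OF M(1)] M(2) zero_in[OF M(1)] by (auto simp: vanishes_def)
  then obtain e where e: "?P e"
    and min: "\<And>e'. ?P e' \<Longrightarrow> len (M \<restriction> (e ` carrier M)) \<le> len (M \<restriction> (e' ` carrier M))"
    using ex_has_least_nat[of ?P "\<lambda>x. x" "\<lambda>e. len (M \<restriction> (e ` carrier M))"] by blast
  let ?B = "M \<restriction> (e ` carrier M)"
  have I: "submod (e ` carrier M) M" using submod_range e by blast
  have BC: "?B \<in> C" by (rule submod_restrict_in[OF I])
  have "brick ?B"
  proof (rule brickI[OF BC])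
    show "carrier ?B \<noteq> {\<zero>\<^bsub>?B\<^esub>}" using e by (auto simp: vanishes_def)
    fix f assume f: "mor f ?B ?B" and k: "kern f ?B ?B \<noteq> {\<zero>\<^bsub>?B\<^esub>}"
    have eB: "mor e M ?B" using mor_corestrict[of e M M "e ` carrier M"] e I by blast
    have fe: "mor (\<lambda>x. f (e x)) M M" using mor_comp'[OF mor_comp'[OF eB f] mor_incl[OF I]] .
    have "\<not> len ?B \<le> len (M \<restriction> (f ` e ` carrier M))"
    proof
      assume "len ?B \<le> len (M \<restriction> (f ` e ` carrier M))"
      then have "len (?B \<restriction> kern f ?B ?B) = 0" using len_mor[OF f] by simp
      then show False using k len_eq_0[OF submod_restrict_in[OF submod_kern[OF f]]] by simp
    qed
    then have "vanishes (\<lambda>x. f (e x)) M M" using min[of "\<lambda>x. f (e x)"] fe by (auto simp: image_image)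
    then show "vanishes f ?B ?B" by (auto simp: vanishes_def)
  qed
  then show thesis using that e by blast
qed

end

locale brick_finite_category = brick_category +
  assumes brick_finite: "finite (cls ` Collect brick)"
begin

text \<open>Length is constant on each of the finitely many isomorphism classes.\<close>

lemma brick_len_bounded: "\<exists>n. \<forall>M. brick M \<longrightarrow> len M \<le> n"
proof -
  have "len M = len (SOME N. N \<in> cls M)" if "brick M" for M
  proof -
    have MC: "M \<in> C" using that by (simp add: brick_def)
    then have "M \<in> cls M" using mod_iso_refl by (simp add: cls_def)
    then have "(SOME N. N \<in> cls M) \<in> cls M" by (rule someI)
    then show ?thesis using len_mod_iso[OF _ MC] by (simp add: cls_def)
  qed
  then have "len ` Collect brick = (\<lambda>c. len (SOME N. N \<in> c)) ` cls ` Collect brick"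
    by (force simp: image_image)
  then have "finite (len ` Collect brick)" using brick_finite by simp
  then show ?thesis using finite_nat_set_iff_bounded_le by auto
qed

end

section \<open>Mutation in the brick-finite case\<close>

context torsion_step
begin

text \<open>Extensions of the simple object \<open>N\<close> by a gap module split: a nonsplit one
  would lie in \<open>F\<close> by \<open>simpT_split\<close>, and then \<open>gap_sub_F\<close>
  would put \<open>N\<close> into \<open>F\<close> too. Hence the pushout along \<open>g\<close>
  splits, and its retraction extends \<open>g\<close> to \<open>M\<close>.\<close>

lemma gap_extend:
  assumes N: "N \<in> simpT T" and w: "mor w M N" "w ` carrier M = carrier N"
    and D: "D \<in> T'" "D \<in> F" and g: "mor g (M \<restriction> kern w M N) D"
  obtains h where "mor h M D" "\<forall>x\<in>kern w M N. h x = g x"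
proof -
  let ?K = "kern w M N"
  have DC: "D \<in> C" by (rule morD(2)[OF g])
  obtain i W j v where i: "mor i M W" and j: "mor j D W" and v: "mor v W N"
    and kj: "kern j D W = {\<zero>\<^bsub>D\<^esub>}" and kv: "kern v W N = j ` carrier D"
    and vi: "\<forall>x\<in>carrier M. v (i x) = w x"
    and ij: "\<forall>x\<in>?K. i x = j (g x)" and ki: "kern i M W = {x \<in> ?K. g x = \<zero>\<^bsub>D\<^esub>}"
    by (rule pushoutE[OF w g])
  have WC: "W \<in> C" by (rule morD(1)[OF v])
  let ?J = "j ` carrier D"
  have Js: "submod ?J W" by (rule submod_range[OF j])
  have v_surj: "v ` carrier W = carrier N"
  proof (intro equalityI subsetI)
    fix y assume "y \<in> carrier N"
    then obtain x where "x \<in> carrier M" "y = w x" using w(2) by blast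
    then show "y \<in> v ` carrier W" using vi mor_closed[OF i] by (intro image_eqI[of _ _ "i x"]) auto
  qed (use mor_closed[OF v] in auto)
  have J: "W \<restriction> ?J \<in> T'" "W \<restriction> ?J \<in> F"
    using mono_image_iff[OF up.T_iso_closed j kj] mono_image_iff[OF lo.F_iso_closed j kj] D by simp_all
  have "W \<notin> F"
  proof
    assume "W \<in> F"
    then have "subq F W (carrier W) (kern v W N)" using gap_sub_F[OF _ Js J(1)] kv by simp
    then have "N \<in> F" using subq_kern_epi[OF lo.F_iso_closed v v_surj] by blast
    then show False using lo.T_Int_F simpTD(1,2)[OF N] by blast
  qed
  then obtain s where s: "mor s N W" "\<forall>x\<in>carrier N. v (s x) = x"
    using lo.simpT_split[OF N v v_surj] J(2) kv by auto
  define h where "h x = i x \<ominus>\<^bsub>W\<^esub> s (w x)" for x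
  have sw: "mor (\<lambda>x. s (w x)) M W" by (rule mor_comp'[OF w(1) s(1)])
  have h: "mor h M W" unfolding h_def by (rule mor_diff[OF i sw])
  have "h ` carrier M \<subseteq> ?J"
  proof
    fix y assume "y \<in> h ` carrier M"
    then obtain x where x: "x \<in> carrier M" "y = h x" by blast
    have "v (i x) = v (s (w x))" using vi s(2) x(1) mor_closed[OF w(1) x(1)] by simp
    then show "y \<in> ?J"
      using mor_eq_iff[OF v mor_closed[OF i x(1)] mor_closed[OF sw x(1)]] x(2) kv by (simp add: h_def)
  qed
  then have hJ: "mor h M (W \<restriction> ?J)" by (rule mor_corestrict[OF h Js])
  have jJ: "mor j D (W \<restriction> ?J)" by (rule mor_corestrict[OF j Js]) simp
  have "bij_betw j (carrier D) (carrier (W \<restriction> ?J))"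
    using mor_inj_iff[OF j] kj by (simp add: bij_betw_def)
  then obtain r where r: "mor r (W \<restriction> ?J) D" "\<forall>x\<in>carrier D. r (j x) = x"
    using mor_inverse[OF jJ] by blast
  have "r (h x) = g x" if x: "x \<in> ?K" for x
  proof -
    have xM: "x \<in> carrier M" "w x = \<zero>\<^bsub>N\<^esub>" using x by (auto simp: kern_def)
    interpret left_module R W using WC by (rule is_left_module)
    have "\<ominus>\<^bsub>W\<^esub> \<zero>\<^bsub>W\<^esub> = \<zero>\<^bsub>W\<^esub>" by (rule minus_equality) simp_all
    then have "h x = i x"
      using xM mor_zero[OF s(1)] mor_closed[OF i xM(1)] by (simp add: h_def a_minus_def)
    then show ?thesis using ij x r(2) mor_closed[OF g, of x] by simp
  qed
  then show thesis using that[OF mor_comp'[OF hJ r(1)]] by blast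
qed

lemma simpT_endo_vanishes:
  assumes N: "N \<in> simpT T" and f: "mor f N N" and k: "kern f N N \<noteq> {\<zero>\<^bsub>N\<^esub>}"
  shows "vanishes f N N"
  using lo.simpT_Hom_iso[OF N N f] mor_inj_iff[OF f] k by (auto simp: bij_betw_def)

end

locale brick_step = torsion_step R C len T F T' F' B + brick_category R C len S
  for R :: "('a, 'x) ring_scheme" and C :: "('a, 'm) module set" and len T F T' F' B S
begin

text \<open>This bounds the length of all candidates. An endomorphism preserves the copy of
  \<open>Y\<close>, because \<open>Y\<close> has no nonzero map to the gap module beyond it; an
  eigenvalue found on that copy then works for all of \<open>E\<close> by
  \<open>extF_endo\<close>.\<close>

lemma extF_brick:
  assumes Y: "Y \<in> simpF F" and iso: "\<not> mod_iso R B Y" and E: "extF Y E i"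
  shows "brick E"
  unfolding brick_def
proof (intro conjI allI impI)
  let ?I = "i ` carrier Y"
  have EF': "E \<in> F'" and i: "mor i Y E" "kern i Y E = {\<zero>\<^bsub>Y\<^esub>}" and IT: "subq T' E (carrier E) ?I"
    and IF: "subq F E (carrier E) ?I" using E by (auto simp: extF_def)
  show EC: "E \<in> C" by (rule morD(2)[OF i(1)])
  have Is: "submod ?I E" by (rule submod_range[OF i(1)])
  have nvi: "\<not> vanishes i Y E" by (rule not_vanishes_mono[OF i(2) simpFD(2)[OF Y]])
  then have I0: "carrier (E \<restriction> ?I) \<noteq> {\<zero>\<^bsub>E \<restriction> ?I\<^esub>}" by (auto simp: vanishes_def)
  then show "carrier E \<noteq> {\<zero>\<^bsub>E\<^esub>}" using submod_subset[OF Is] submod_zero[OF Is] by auto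
  fix f assume f: "mor f E E"
  obtain Q q where q: "Q \<in> F" "mor q E Q" "q ` carrier E = carrier Q" "kern q E Q = ?I"
    using subqE[OF IF] by auto
  have "Q \<in> T'" using subq_all[OF up.T_iso_closed IT] q by simp
  have "mor (\<lambda>y. q (f (i y))) Y Q" by (rule mor_comp'[OF mor_comp'[OF i(1) f] q(2)])
  then have "vanishes (\<lambda>y. q (f (i y))) Y Q" by (rule simpF_Hom_gap[OF Y iso \<open>Q \<in> T'\<close> q(1)])
  then have "f (i y) \<in> kern q E Q" if "y \<in> carrier Y" for y
    using that mor_closed[OF f mor_closed[OF i(1) that]] by (simp add: kern_def vanishes_def)
  then have "f ` ?I \<subseteq> ?I" using q(4) by blast
  then have fI: "mor f (E \<restriction> ?I) (E \<restriction> ?I)"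
    using mor_corestrict[OF mor_restrict[OF f Is] Is] by simp
  obtain s z where s: "s \<in> S" "z \<in> ?I" "z \<noteq> \<zero>\<^bsub>E\<^esub>" "f z = s \<odot>\<^bsub>E\<^esub> z"
    using eigenvalue[OF submod_restrict_in[OF Is] I0 fI] by auto
  let ?g = "\<lambda>x. f x \<ominus>\<^bsub>E\<^esub> s \<odot>\<^bsub>E\<^esub> x"
  obtain y where y: "y \<in> carrier Y" "z = i y" using s(2) by blast
  have zE: "z \<in> carrier E" using s(2) submod_subset[OF Is] by blast
  have "y \<in> kern (\<lambda>y. ?g (i y)) Y E"
    using y s(4) minus_scalar_zero_iff[OF s(1) f zE] by (simp add: kern_def)
  moreover have "y \<noteq> \<zero>\<^bsub>Y\<^esub>" using y(2) s(3) mor_zero[OF i(1)] by blast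
  ultimately have "kern (\<lambda>y. ?g (i y)) Y E \<noteq> {\<zero>\<^bsub>Y\<^esub>}" by blast
  then have "vanishes ?g E E" by (rule extF_endo[OF Y E EF' minus_scalar[OF s(1) f]])
  then have "\<forall>x\<in>carrier E. f x = s \<odot>\<^bsub>E\<^esub> x"
    using minus_scalar_zero_iff[OF s(1) f] by (simp add: vanishes_def)
  then show "\<exists>s\<in>S. \<forall>x\<in>carrier E. f x = s \<odot>\<^bsub>E\<^esub> x" using s(1) by blast
qed

text \<open>An endomorphism of the kernel extends to \<open>M\<close> by \<open>gap_extend\<close>
  and induces one of \<open>N\<close>, which is a scalar by Schur's lemma. After subtracting that
  scalar, the extension maps \<open>M\<close> from \<open>T'\<close> into the kernel from
  \<open>F'\<close>, so it is zero.\<close>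

lemma covT_kern_brick:
  assumes N: "N \<in> simpT T" and M: "covT N M w" and surj: "w ` carrier M = carrier N"
  shows "brick (M \<restriction> kern w M N)"
  unfolding brick_def
proof (intro conjI allI impI)
  let ?K = "kern w M N"
  have MT': "M \<in> T'" and MF: "M \<in> F" and w: "mor w M N" and KF': "M \<restriction> ?K \<in> F'"
    using M by (auto simp: covT_def)
  have MC: "M \<in> C" and NC: "N \<in> C" using morD[OF w] by auto
  have Ks: "submod ?K M" by (rule submod_kern[OF w])
  show "M \<restriction> ?K \<in> C" by (rule submod_restrict_in[OF Ks])
  show "carrier (M \<restriction> ?K) \<noteq> {\<zero>\<^bsub>M \<restriction> ?K\<^esub>}" using covT_surj_kern_nontrivial[OF N M surj] by simp
  fix f assume f: "mor f (M \<restriction> ?K) (M \<restriction> ?K)"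
  have fM: "mor f (M \<restriction> ?K) M" by (rule mor_comp'[OF f mor_incl[OF Ks]])
  obtain h where h: "mor h M M" "\<forall>x\<in>?K. h x = f x" by (rule gap_extend[OF N w surj MT' MF fM])
  have wh: "mor (\<lambda>x. w (h x)) M N" by (rule mor_comp'[OF h(1) w])
  have "?K \<subseteq> kern (\<lambda>x. w (h x)) M N"
  proof
    fix x assume x: "x \<in> ?K"
    then have "f x \<in> ?K" using mor_closed[OF f, of x] by simp
    then show "x \<in> kern (\<lambda>x. w (h x)) M N" using x h(2) by (simp add: kern_def)
  qed
  then obtain t where t: "mor t N N" "\<forall>x\<in>carrier M. t (w x) = w (h x)"
    using mor_descend[OF w surj wh] by blast
  obtain s z where s: "s \<in> S" "z \<in> carrier N" "z \<noteq> \<zero>\<^bsub>N\<^esub>" "t z = s \<odot>\<^bsub>N\<^esub> z"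
    using eigenvalue[OF NC simpTD(2)[OF N] t(1)] by blast
  let ?g = "\<lambda>x. t x \<ominus>\<^bsub>N\<^esub> s \<odot>\<^bsub>N\<^esub> x" and ?h = "\<lambda>x. h x \<ominus>\<^bsub>M\<^esub> s \<odot>\<^bsub>M\<^esub> x"
  have "z \<in> kern ?g N N" using s minus_scalar_zero_iff[OF s(1) t(1) s(2)] by (simp add: kern_def)
  then have "vanishes ?g N N" using simpT_endo_vanishes[OF N minus_scalar[OF s(1) t(1)]] s(3) by blast
  then have ts: "\<forall>x\<in>carrier N. t x = s \<odot>\<^bsub>N\<^esub> x"
    using minus_scalar_zero_iff[OF s(1) t(1)] by (simp add: vanishes_def)
  have hm: "mor ?h M M" by (rule minus_scalar[OF s(1) h(1)])
  have sm: "mor (\<lambda>x. s \<odot>\<^bsub>M\<^esub> x) M M" by (rule mor_scalar[OF s(1) MC])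
  have ws: "w (s \<odot>\<^bsub>M\<^esub> x) = s \<odot>\<^bsub>N\<^esub> w x" if "x \<in> carrier M" for x
    using that w scalar_R[OF s(1)] unfolding mor_iff by blast
  have "?h ` carrier M \<subseteq> ?K"
  proof
    fix y assume "y \<in> ?h ` carrier M"
    then obtain x where x: "x \<in> carrier M" "y = ?h x" by blast
    have "w (h x) = w (s \<odot>\<^bsub>M\<^esub> x)" using t(2) ts x(1) ws mor_closed[OF w x(1)] by metis
    then show "y \<in> ?K"
      using mor_eq_iff[OF w mor_closed[OF h(1) x(1)] mor_closed[OF sm x(1)]] x(2) by simp
  qed
  then have "mor ?h M (M \<restriction> ?K)" by (rule mor_corestrict[OF hm Ks])
  then have "?h x = \<zero>\<^bsub>M\<^esub>" if "x \<in> carrier M" for x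
    using up.Hom_T_F[OF _ MT' KF' that] by simp
  then have "\<forall>x\<in>carrier M. h x = s \<odot>\<^bsub>M\<^esub> x" using minus_scalar_zero_iff[OF s(1) h(1)] by blast
  then have "\<forall>x\<in>carrier (M \<restriction> ?K). f x = s \<odot>\<^bsub>M \<restriction> ?K\<^esub> x"
    using h(2) kern_subset[of w M N] by (simp add: subset_iff)
  then show "\<exists>s\<in>S. \<forall>x\<in>carrier (M \<restriction> ?K). f x = s \<odot>\<^bsub>M \<restriction> ?K\<^esub> x" using s(1) by blast
qed

end

locale brick_finite_step = brick_step R C len T F T' F' B S + brick_finite_category R C len S
  for R :: "('a, 'x) ring_scheme" and C :: "('a, 'm) module set" and len T F T' F' B S
begin

lemma mutate_F:
  assumes Y: "Y \<in> simpF F" and iso: "\<not> mod_iso R B Y"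
  obtains E i where "extF Y E i" "E \<in> simpF F'"
proof -
  obtain n where n: "\<And>M. brick M \<Longrightarrow> len M \<le> n" using brick_len_bounded by blast
  let ?P = "\<lambda>x. extF Y (fst x) (snd x)"
  have "?P (Y, \<lambda>x. x)" using extF_self[OF Y iso] by simp
  moreover have "\<forall>x. ?P x \<longrightarrow> len (fst x) < Suc n"
    using n extF_brick[OF Y iso] by (auto simp: less_Suc_eq_le)
  ultimately obtain x where x: "?P x" "\<And>y. ?P y \<Longrightarrow> len (fst y) \<le> len (fst x)"
    using ex_has_greatest_nat[of ?P "(Y, \<lambda>x. x)" "\<lambda>x. len (fst x)" "Suc n"] by blast
  have "fst x \<in> simpF F'"
    by (rule extF_max_simpF[OF Y x(1)]) (use x(2) in force)
  then show thesis using that x(1) by blast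
qed

text \<open>The alternative is that of \<open>covT_pure\<close> for a candidate of maximal length:
  if it is onto, \<open>N\<close> turns into its kernel on the \<open>F'\<close> side, otherwise
  into its cokernel on the \<open>T'\<close> side.\<close>

lemma mutate_T:
  assumes N: "N \<in> simpT T"
  shows "(\<exists>M w. covT N M w \<and> w ` carrier M = carrier N \<and> M \<restriction> kern w M N \<in> simpF F') \<or>
    (\<exists>E p. mor p N E \<and> p ` carrier N = carrier E \<and> N \<restriction> kern p N E \<in> T' \<and> N \<restriction> kern p N E \<in> F \<and>
       E \<in> simpT T' \<and> \<not> mod_iso R B E)"
proof -
  have NC: "N \<in> C" by (rule lo.T_in[OF simpTD(1)[OF N]])
  obtain n where n: "\<And>M. brick M \<Longrightarrow> len M \<le> n" using brick_len_bounded by blast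
  let ?P = "\<lambda>x. covT N (fst x) (snd x)"
  \<comment> \<open>The zero submodule is always a candidate and starts the search.\<close>
  let ?O = "N \<restriction> {\<zero>\<^bsub>N\<^esub>}"
  have zs: "submod {\<zero>\<^bsub>N\<^esub>} N" by (rule submod_trivial[OF NC])
  have OC: "?O \<in> C" by (rule submod_restrict_in[OF zs])
  have "kern (\<lambda>x. x) ?O N = {\<zero>\<^bsub>N\<^esub>}" by (auto simp: kern_def)
  then have "covT N ?O (\<lambda>x. x)"
    using up.zero_T[OF OC] lo.zero_F[OF OC] up.zero_F[OF OC] mor_incl[OF zs] by (simp add: covT_def)
  then have P0: "?P (?O, \<lambda>x. x)" by simp
  \<comment> \<open>A candidate that is onto has a brick as its kernel, and every other one embeds
    in \<open>N\<close>.\<close>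
  have bound: "len M \<le> n + len N" if M: "covT N M w" for M w
  proof (cases "w ` carrier M = carrier N")
    case True
    have w: "mor w M N" using M by (simp add: covT_def)
    show ?thesis using len_epi[OF w True] n[OF covT_kern_brick[OF N M True]] by simp
  next
    case False
    have w: "mor w M N" using M by (simp add: covT_def)
    have "kern w M N = {\<zero>\<^bsub>M\<^esub>}" using covT_pure[OF N M] False by blast
    then show ?thesis using len_mono[OF w] len_restrict_le[OF submod_range[OF w]] by simp
  qed
  have "\<forall>x. ?P x \<longrightarrow> len (fst x) < Suc (n + len N)" using bound by (simp add: less_Suc_eq_le)
  then obtain x where x: "?P x" "\<And>y. ?P y \<Longrightarrow> len (fst y) \<le> len (fst x)"
    using ex_has_greatest_nat[of ?P "(?O, \<lambda>x. x)" "\<lambda>x. len (fst x)", OF P0] by blast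
  define M w where "M = fst x" and "w = snd x"
  have M: "covT N M w" using x(1) by (simp add: M_def w_def)
  have max: "len M' \<le> len M" if "covT N M' w'" for M' w' using x(2)[of "(M', w')"] that by (simp add: M_def)
  have MT': "M \<in> T'" and MF: "M \<in> F" and w: "mor w M N" using M by (auto simp: covT_def)
  show ?thesis
  proof (cases "w ` carrier M = carrier N")
    case True
    have "M \<restriction> kern w M N \<in> simpF F'" by (rule covT_surj_simpF[OF N M True]) (erule max)
    then show ?thesis using M True by blast
  next
    case False
    have inj: "kern w M N = {\<zero>\<^bsub>M\<^esub>}" using covT_pure[OF N M] False by blast
    obtain E p where p: "mor p N E" "p ` carrier N = carrier E" "kern p N E = w ` carrier M"
      by (rule quotientE[OF submod_range[OF w]])
    have E: "E \<in> simpT T'" by (rule covT_cokernel_simpT[OF N M inj False _ p]) (erule max)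
    \<comment> \<open>\<open>B\<close> lies in the gap, and \<open>E\<close> receives no nonzero map
      from there.\<close>
    have "\<not> mod_iso R B E"
    proof
      assume "mod_iso R B E"
      then obtain f where f: "mor f B E" "bij_betw f (carrier B) (carrier E)"
        by (rule mod_isoE[OF _ B_C morD(2)[OF p(1)]])
      have "vanishes f B E"
        by (rule covT_cokernel_Hom[OF N M inj _ p B_T' simpFD(1)[OF B_simpF] f(1)]) (erule max)
      then have "carrier E \<subseteq> {\<zero>\<^bsub>E\<^esub>}" using f(2) by (auto simp: vanishes_def bij_betw_def)
      then show False using simpTD(2)[OF E] zero_in[OF morD(2)[OF p(1)]] by blast
    qed
    moreover have "N \<restriction> kern p N E \<in> T'" "N \<restriction> kern p N E \<in> F"
      using mono_image_iff[OF up.T_iso_closed w inj] mono_image_iff[OF lo.F_iso_closed w inj] MT' MF p(3)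
      by simp_all
    ultimately show ?thesis using p(1,2) E by blast
  qed
qed

end

section \<open>Counting the simple objects\<close>

context length_category
begin

text \<open>\<open>True\<close> tags the simple objects of the heart that lie in \<open>T\<close>, \<open>False\<close> those that are shifted
  modules of \<open>F\<close>.\<close>

definition simp_objs :: "('a, 'm) module set \<Rightarrow> ('a, 'm) module set \<Rightarrow> (bool \<times> ('a, 'm) module) set" where
  "simp_objs T F = {True} \<times> simpT T \<union> {False} \<times> simpF F"

definition obj_iso :: "bool \<times> ('a, 'm) module \<Rightarrow> bool \<times> ('a, 'm) module \<Rightarrow> bool" where
  "obj_iso x y \<longleftrightarrow> fst x = fst y \<and> mod_iso R (snd x) (snd y)"

text \<open>Counting through finite sets of pairwise nonisomorphic objects gives a meaningful bound
  before the number of classes is known to be finite.\<close>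

definition simp_objs_le :: "nat \<Rightarrow> ('a, 'm) module set \<Rightarrow> ('a, 'm) module set \<Rightarrow> bool" where
  "simp_objs_le n T F \<longleftrightarrow> (\<forall>D. finite D \<longrightarrow> D \<subseteq> simp_objs T F \<longrightarrow>
     (\<forall>x\<in>D. \<forall>y\<in>D. obj_iso x y \<longrightarrow> x = y) \<longrightarrow> card D \<le> n)"

end

context torsion_pair
begin

lemma simp_objs_in: "x \<in> simp_objs T F \<Longrightarrow> snd x \<in> C"
  unfolding simp_objs_def by (elim UnE SigmaE) (auto dest: simpTD(1) simpFD(1) intro: T_in F_in)

lemma obj_iso_trans: "obj_iso x y \<Longrightarrow> obj_iso y z \<Longrightarrow> snd x \<in> C \<Longrightarrow> snd y \<in> C \<Longrightarrow> snd z \<in> C \<Longrightarrow> obj_iso x z"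
  unfolding obj_iso_def by (auto intro: mod_iso_trans)

lemma obj_iso_sym: "obj_iso x y \<Longrightarrow> snd x \<in> C \<Longrightarrow> snd y \<in> C \<Longrightarrow> obj_iso y x"
  unfolding obj_iso_def by (auto intro: mod_iso_sym)

end

context torsion_step
begin

text \<open>The three ways in which a simple object for \<open>(T, F)\<close> other than \<open>B\<close> determines one for
  \<open>(T', F')\<close>: divide a module of \<open>T\<close> by a submodule in the gap, pass from a module of \<open>T\<close> to the
  kernel of an epimorphism from the gap (now on the \<open>F'\<close> side), or extend a module of \<open>F\<close> by the gap.\<close>

definition relTT :: "('a, 'm) module \<Rightarrow> ('a, 'm) module \<Rightarrow> bool" where
  "relTT N E \<longleftrightarrow> (\<exists>p. mor p N E \<and> p ` carrier N = carrier E \<and>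
     N \<restriction> kern p N E \<in> T' \<and> N \<restriction> kern p N E \<in> F)"

definition relTF :: "('a, 'm) module \<Rightarrow> ('a, 'm) module \<Rightarrow> bool" where
  "relTF N K \<longleftrightarrow> (\<exists>M w j. M \<in> T' \<and> M \<in> F \<and> mor w M N \<and> w ` carrier M = carrier N \<and>
     mor j K M \<and> kern j K M = {\<zero>\<^bsub>K\<^esub>} \<and> j ` carrier K = kern w M N)"

definition relFF :: "('a, 'm) module \<Rightarrow> ('a, 'm) module \<Rightarrow> bool" where
  "relFF Y E \<longleftrightarrow> (\<exists>i. extF Y E i)"

lemma kern_comp_inj:
  assumes "mor g N P" "inj_on g (carrier N)" "mor f M N"
  shows "kern (\<lambda>x. g (f x)) M P = kern f M N"
proof (intro equalityI subsetI)
  fix x assume x: "x \<in> kern (\<lambda>x. g (f x)) M P"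
  then have "g (f x) = g \<zero>\<^bsub>N\<^esub>" using mor_zero[OF assms(1)] by (simp add: kern_def)
  then have "f x = \<zero>\<^bsub>N\<^esub>"
    using x inj_onD[OF assms(2)] mor_closed[OF assms(3)] zero_in[OF morD(1)[OF assms(1)]] by (simp add: kern_def)
  then show "x \<in> kern f M N" using x by (simp add: kern_def)
qed (use mor_zero[OF assms(1)] in \<open>auto simp: kern_def\<close>)

lemma relTT_iso:
  assumes "relTT N E" "mod_iso R E E'" "E' \<in> C"
  shows "relTT N E'"
proof -
  obtain p where p: "mor p N E" "p ` carrier N = carrier E" "N \<restriction> kern p N E \<in> T'" "N \<restriction> kern p N E \<in> F"
    using assms(1) unfolding relTT_def by blast
  obtain f where f: "mor f E E'" "bij_betw f (carrier E) (carrier E')"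
    by (rule mod_isoE[OF assms(2) morD(2)[OF p(1)] assms(3)])
  have "kern (\<lambda>x. f (p x)) N E' = kern p N E"
    using f by (intro kern_comp_inj[OF f(1) _ p(1)]) (simp add: bij_betw_def)
  moreover have "(\<lambda>x. f (p x)) ` carrier N = carrier E'"
    using f(2) p(2) by (simp add: bij_betw_def flip: image_image)
  ultimately show ?thesis unfolding relTT_def using mor_comp'[OF p(1) f(1)] p(3,4) by auto
qed

lemma relTF_iso:
  assumes "relTF N K" "mod_iso R K K'" "K' \<in> C"
  shows "relTF N K'"
proof -
  obtain M w j where *: "M \<in> T'" "M \<in> F" "mor w M N" "w ` carrier M = carrier N"
    and j: "mor j K M" "kern j K M = {\<zero>\<^bsub>K\<^esub>}" "j ` carrier K = kern w M N"
    using assms(1) unfolding relTF_def by blast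
  obtain f where f: "mor f K' K" "bij_betw f (carrier K') (carrier K)"
    by (rule mod_isoE[OF mod_iso_sym[OF assms(2)] assms(3)]) (use morD[OF j(1)] assms(3) in auto)
  have "inj_on j (carrier K)" using mor_inj_iff[OF j(1)] j(2) by simp
  then have "kern (\<lambda>x. j (f x)) K' M = {\<zero>\<^bsub>K'\<^esub>}"
    using kern_comp_inj[OF j(1) _ f(1)] mor_inj_iff[OF f(1)] f(2) by (simp add: bij_betw_def)
  moreover have "(\<lambda>x. j (f x)) ` carrier K' = kern w M N"
    using f(2) j(3) by (simp add: bij_betw_def flip: image_image)
  ultimately show ?thesis unfolding relTF_def using * mor_comp'[OF f(1) j(1)] by blast
qed

lemma relFF_iso:
  assumes "relFF Y E" "mod_iso R E E'" "E' \<in> C"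
  shows "relFF Y E'"
proof -
  obtain i where i: "E \<in> F'" "mor i Y E" "kern i Y E = {\<zero>\<^bsub>Y\<^esub>}"
    "subq T' E (carrier E) (i ` carrier Y)" "subq F E (carrier E) (i ` carrier Y)"
    using assms(1) unfolding relFF_def extF_def by blast
  have EC: "E \<in> C" by (rule morD(2)[OF i(2)])
  obtain f where f: "mor f E E'" "bij_betw f (carrier E) (carrier E')"
    by (rule mod_isoE[OF assms(2) EC assms(3)])
  have k0: "kern f E E' = {\<zero>\<^bsub>E\<^esub>}" and im: "f ` carrier E = carrier E'"
    using mor_inj_iff[OF f(1)] f(2) by (auto simp: bij_betw_def)
  have Is: "submod (i ` carrier Y) E" by (rule submod_range[OF i(2)])
  have "kern f E E' \<inter> carrier E \<subseteq> i ` carrier Y" using k0 submod_zero[OF Is] by auto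
  then have "subq \<P> E' (f ` carrier E) (f ` i ` carrier Y) \<longleftrightarrow> subq \<P> E (carrier E) (i ` carrier Y)" for \<P>
    by (rule subq_image[OF f(1) submod_carrier[OF EC] Is submod_subset[OF Is]])
  then have "subq \<P> E' (carrier E') ((\<lambda>y. f (i y)) ` carrier Y) \<longleftrightarrow> subq \<P> E (carrier E) (i ` carrier Y)" for \<P>
    using im by (simp add: image_image)
  moreover have "kern (\<lambda>y. f (i y)) Y E' = {\<zero>\<^bsub>Y\<^esub>}"
    using kern_comp_inj[OF f(1) _ i(2)] f(2) i(3) by (simp add: bij_betw_def)
  moreover have "E' \<in> F'" using up.F_iso_closed i(1) assms(2,3) unfolding iso_closed_def by blast
  ultimately have "extF Y E' (\<lambda>y. f (i y))"
    using i(4,5) mor_comp'[OF i(2) f(1)] by (simp add: extF_def)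
  then show ?thesis unfolding relFF_def by blast
qed

text \<open>In the pullback \<open>P\<close> of the two projections, the map to \<open>N\<close> has
  a gap kernel, so \<open>P\<close> is not in \<open>F\<close>: otherwise \<open>gap_sub_F\<close>
  would put \<open>N\<close> there. Thus the map splits. Its section followed by the map to
  \<open>N'\<close> is nonzero, because it lies over the first projection, and Schur's lemma
  applies.\<close>

lemma relTT_inj:
  assumes N: "N \<in> simpT T" "N' \<in> simpT T" and "relTT N E" "relTT N' E" and E: "carrier E \<noteq> {\<zero>\<^bsub>E\<^esub>}"
  shows "mod_iso R N N'"
proof -
  obtain p where p: "mor p N E" "p ` carrier N = carrier E" using assms(3) unfolding relTT_def by blast
  obtain q where q: "mor q N' E" "q ` carrier N' = carrier E" "N' \<restriction> kern q N' E \<in> T'" "N' \<restriction> kern q N' E \<in> F"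
    using assms(4) unfolding relTT_def by blast
  obtain a P b where P: "mor a P N" "mor b P N'" "a ` carrier P = carrier N"
    "\<forall>z\<in>carrier P. p (a z) = q (b z)" "a ` kern b P N' = kern p N E" "b ` kern a P N = kern q N' E"
    "kern a P N \<inter> kern b P N' = {\<zero>\<^bsub>P\<^esub>}"
    by (rule pullback_epiE[OF q(1,2) p(1)])
  have ka: "submod (kern a P N) P" by (rule submod_kern[OF P(1)])
  have k: "kern b P N' \<inter> kern a P N = {\<zero>\<^bsub>P\<^esub>}" using P(7) by auto
  have KT: "P \<restriction> kern a P N \<in> T'" and KF: "P \<restriction> kern a P N \<in> F"
    using restrict_mono_image[OF up.T_iso_closed P(2) ka k]
      restrict_mono_image[OF lo.F_iso_closed P(2) ka k] q(3,4) P(6) by simp_all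
  have "P \<notin> F"
  proof
    assume "P \<in> F"
    then have "N \<in> F" using gap_sub_F[OF _ ka KT] subq_kern_epi[OF lo.F_iso_closed P(1,3)] by blast
    then show False using lo.T_Int_F simpTD(1,2)[OF N(1)] by blast
  qed
  then obtain s where s: "mor s N P" "\<forall>x\<in>carrier N. a (s x) = x"
    using lo.simpT_split[OF N(1) P(1,3) KF] by blast
  have bs: "mor (\<lambda>x. b (s x)) N N'" by (rule mor_comp'[OF s(1) P(2)])
  have "\<not> vanishes (\<lambda>x. b (s x)) N N'"
  proof
    assume v: "vanishes (\<lambda>x. b (s x)) N N'"
    have "p x = \<zero>\<^bsub>E\<^esub>" if x: "x \<in> carrier N" for x
    proof -
      have "p x = q (b (s x))" using P(4) s(2) x mor_closed[OF s(1) x] by metis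
      then show ?thesis using v x mor_zero[OF q(1)] by (simp add: vanishes_def)
    qed
    then have "p ` carrier N \<subseteq> {\<zero>\<^bsub>E\<^esub>}" by auto
    then show False using p(2) E zero_in[OF morD(2)[OF p(1)]] by auto
  qed
  then show ?thesis using mod_isoI[OF bs] lo.simpT_Hom_iso[OF N bs] by blast
qed

text \<open>The embedding of \<open>K\<close> into \<open>M'\<close> extends to \<open>M\<close> by
  \<open>gap_extend\<close> and so induces a map from \<open>N\<close> to \<open>N'\<close>. Were
  that zero, the extension would map \<open>M\<close> into a copy of \<open>K\<close> and vanish,
  although it is injective on \<open>K\<close>.\<close>

lemma relTF_inj:
  assumes N: "N \<in> simpT T" "N' \<in> simpT T" and "relTF N K" "relTF N' K" and K: "K \<in> F'" "carrier K \<noteq> {\<zero>\<^bsub>K\<^esub>}"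
  shows "mod_iso R N N'"
proof -
  obtain M w j where M: "M \<in> T'" "M \<in> F" "mor w M N" "w ` carrier M = carrier N"
    and j: "mor j K M" "kern j K M = {\<zero>\<^bsub>K\<^esub>}" "j ` carrier K = kern w M N"
    using assms(3) unfolding relTF_def by blast
  obtain M' w' j' where M': "M' \<in> T'" "M' \<in> F" "mor w' M' N'" "w' ` carrier M' = carrier N'"
    and j': "mor j' K M'" "kern j' K M' = {\<zero>\<^bsub>K\<^esub>}" "j' ` carrier K = kern w' M' N'"
    using assms(4) unfolding relTF_def by blast
  let ?K = "kern w M N"
  have Ks: "submod ?K M" by (rule submod_kern[OF M(3)])
  have jK: "mor j K (M \<restriction> ?K)" by (rule mor_corestrict[OF j(1) Ks]) (simp add: j(3))
  have "bij_betw j (carrier K) (carrier (M \<restriction> ?K))"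
    using mor_inj_iff[OF j(1)] j(2,3) by (simp add: bij_betw_def)
  then obtain r where r: "mor r (M \<restriction> ?K) K" "\<forall>x\<in>carrier K. r (j x) = x"
    using mor_inverse[OF jK] by blast
  obtain h where h: "mor h M M'" "\<forall>x\<in>?K. h x = j' (r x)"
    by (rule gap_extend[OF N(1) M(3,4) M'(1,2) mor_comp'[OF r(1) j'(1)]])
  have hK: "h x \<in> kern w' M' N'" if "x \<in> ?K" for x
    using h(2) that mor_closed[OF r(1), of x] j'(3) by auto
  have wh: "mor (\<lambda>x. w' (h x)) M N'" by (rule mor_comp'[OF h(1) M'(3)])
  have "?K \<subseteq> kern (\<lambda>x. w' (h x)) M N'"
    using hK kern_subset[of w M N] by (auto simp: kern_def)
  then obtain t where t: "mor t N N'" "\<forall>x\<in>carrier M. t (w x) = w' (h x)"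
    using mor_descend[OF M(3,4) wh] by blast
  have "\<not> vanishes t N N'"
  proof
    assume v: "vanishes t N N'"
    have h': "h ` carrier M \<subseteq> kern w' M' N'"
    proof
      fix y assume "y \<in> h ` carrier M"
      then obtain x where x: "x \<in> carrier M" "y = h x" by blast
      have "w' y = \<zero>\<^bsub>N'\<^esub>" using t(2) v x mor_closed[OF M(3) x(1)] unfolding vanishes_def by metis
      then show "y \<in> kern w' M' N'" using x mor_closed[OF h(1) x(1)] by (simp add: kern_def)
    qed
    have "mor h M (M' \<restriction> kern w' M' N')" by (rule mor_corestrict[OF h(1) submod_kern[OF M'(3)] h'])
    moreover have "M' \<restriction> kern w' M' N' \<in> F'"
      using mono_image_iff[OF up.F_iso_closed j'(1,2)] K(1) j'(3) by simp
    ultimately have h0: "h x = \<zero>\<^bsub>M'\<^esub>" if "x \<in> carrier M" for x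
      using up.Hom_T_F[OF _ M(1) _ that] by fastforce
    have "x = \<zero>\<^bsub>K\<^esub>" if x: "x \<in> carrier K" for x
    proof -
      have jx: "j x \<in> ?K" using j(3) x by blast
      then have "j' x = \<zero>\<^bsub>M'\<^esub>" using h(2) r(2) x h0[of "j x"] mor_closed[OF j(1) x] by simp
      then have "x \<in> kern j' K M'" using x by (simp add: kern_def)
      then show ?thesis using j'(2) by simp
    qed
    then show False using K(2) zero_in[OF morD(1)[OF j(1)]] by blast
  qed
  then show ?thesis using mod_isoI[OF t(1)] lo.simpT_Hom_iso[OF N t(1)] by blast
qed

text \<open>\<open>Y\<close> has no nonzero map to the gap module that is the cokernel of
  \<open>Y'\<close> in \<open>E\<close>, so inside \<open>E\<close> it is contained in
  \<open>Y'\<close>; Schur's lemma does the rest.\<close>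

lemma relFF_inj:
  assumes Y: "Y \<in> simpF F" "Y' \<in> simpF F" and iso: "\<not> mod_iso R B Y" and "relFF Y E" "relFF Y' E"
  shows "mod_iso R Y Y'"
proof -
  obtain i where i: "mor i Y E" "kern i Y E = {\<zero>\<^bsub>Y\<^esub>}" using assms(4) unfolding relFF_def extF_def by blast
  obtain i' where i': "mor i' Y' E" "kern i' Y' E = {\<zero>\<^bsub>Y'\<^esub>}" "subq T' E (carrier E) (i' ` carrier Y')"
      "subq F E (carrier E) (i' ` carrier Y')"
    using assms(5) unfolding relFF_def extF_def by blast
  obtain Q q where q: "Q \<in> F" "mor q E Q" "q ` carrier E = carrier Q" "kern q E Q = i' ` carrier Y'"
    using subqE[OF i'(4)] by auto
  have "Q \<in> T'" using subq_all[OF up.T_iso_closed i'(3)] q by simp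
  then have v: "vanishes (\<lambda>y. q (i y)) Y Q"
    by (rule simpF_Hom_gap[OF Y(1) iso _ q(1) mor_comp'[OF i(1) q(2)]])
  have sub: "i ` carrier Y \<subseteq> i' ` carrier Y'"
    unfolding q(4)[symmetric] using v mor_closed[OF i(1)] by (auto simp: kern_def vanishes_def)
  let ?J = "i' ` carrier Y'"
  have Js: "submod ?J E" by (rule submod_range[OF i'(1)])
  have iJ: "mor i Y (E \<restriction> ?J)" by (rule mor_corestrict[OF i(1) Js sub])
  have i'J: "mor i' Y' (E \<restriction> ?J)" by (rule mor_corestrict[OF i'(1) Js]) simp
  have "bij_betw i' (carrier Y') (carrier (E \<restriction> ?J))"
    using mor_inj_iff[OF i'(1)] i'(2) by (simp add: bij_betw_def)
  then obtain r where r: "mor r (E \<restriction> ?J) Y'" "\<forall>x\<in>carrier (E \<restriction> ?J). i' (r x) = x"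
    using mor_inverse[OF i'J] by blast
  have ri: "mor (\<lambda>y. r (i y)) Y Y'" by (rule mor_comp'[OF iJ r(1)])
  have "\<not> vanishes (\<lambda>y. r (i y)) Y Y'"
  proof
    assume v: "vanishes (\<lambda>y. r (i y)) Y Y'"
    have "vanishes i Y E" unfolding vanishes_def
    proof
      fix y assume y: "y \<in> carrier Y"
      then have "i y = i' (r (i y))" using r(2) sub by auto
      then show "i y = \<zero>\<^bsub>E\<^esub>" using v y mor_zero[OF i'(1)] by (simp add: vanishes_def)
    qed
    then show False using not_vanishes_mono[OF i(2) simpFD(2)[OF Y(1)]] by blast
  qed
  then show ?thesis using mod_isoI[OF ri] lo.simpF_Hom_iso[OF Y ri] by blast
qed

text \<open>Embedding \<open>K\<close> in a gap module would embed \<open>Y\<close> there too. So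
  objects from the two sides of the lower pair never mutate to the same object.\<close>

lemma relTF_relFF:
  assumes Y: "Y \<in> simpF F" and iso: "\<not> mod_iso R B Y" and "relTF N K" "relFF Y K"
  shows False
proof -
  obtain M j where M: "M \<in> T'" "M \<in> F" and j: "mor j K M" "kern j K M = {\<zero>\<^bsub>K\<^esub>}"
    using assms(3) unfolding relTF_def by blast
  obtain i where i: "mor i Y K" "kern i Y K = {\<zero>\<^bsub>Y\<^esub>}" using assms(4) unfolding relFF_def extF_def by blast
  have ji: "mor (\<lambda>y. j (i y)) Y M" by (rule mor_comp'[OF i(1) j(1)])
  have "kern (\<lambda>y. j (i y)) Y M = {\<zero>\<^bsub>Y\<^esub>}"
    using kern_comp_inj[OF j(1) _ i(1)] mor_inj_iff[OF j(1)] j(2) i(2) by simp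
  then show False
    using not_vanishes_mono simpFD(2)[OF Y] simpF_Hom_gap[OF Y iso M ji] by blast
qed

text \<open>The \<open>False\<close> case reflects that an object of the \<open>F\<close> side never
  changes sides, apart from \<open>B\<close>, which is treated separately.\<close>

fun mut :: "bool \<times> ('a, 'm) module \<Rightarrow> bool \<times> ('a, 'm) module \<Rightarrow> bool" where
  "mut (True, N) (True, E) = relTT N E"
| "mut (True, N) (False, K) = relTF N K"
| "mut (False, Y) (False, E) = relFF Y E"
| "mut (False, Y) (True, E) = False"

lemma mut_iso: "mut x y \<Longrightarrow> obj_iso y y' \<Longrightarrow> snd y' \<in> C \<Longrightarrow> mut x y'"
  by (cases x; cases y; cases y'; cases "fst x"; cases "fst y")
    (auto simp: obj_iso_def intro: relTT_iso relTF_iso relFF_iso)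

lemma mut_inj:
  assumes "x \<in> simp_objs T F" "x' \<in> simp_objs T F" "\<not> obj_iso (False, B) x" "\<not> obj_iso (False, B) x'"
    and "mut x y" "mut x' y" "y \<in> simp_objs T' F'"
  shows "obj_iso x x'"
proof -
  obtain b N b' N' c E where [simp]: "x = (b, N)" "x' = (b', N')" "y = (c, E)" by (metis surj_pair)
  show ?thesis
  proof (cases c)
    case True
    then have "b" "b'" using assms(5,6) by (cases b; cases b'; simp)+
    then show ?thesis using assms True relTT_inj[of N N' E] simpTD(2)[of E T']
      by (simp add: simp_objs_def obj_iso_def)
  next
    case False
    then have E: "E \<in> F'" "carrier E \<noteq> {\<zero>\<^bsub>E\<^esub>}"
      using assms(7) simpFD(1,2)[of E F'] by (auto simp: simp_objs_def)
    show ?thesis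
      using assms False E relTF_inj[of N N' E] relFF_inj[of N N' E] relTF_relFF[of N N' E] relTF_relFF[of N' N E]
      by (cases b; cases b') (auto simp: simp_objs_def obj_iso_def)
  qed
qed

end

context brick_finite_step
begin

lemma mut_ex:
  assumes "x \<in> simp_objs T F" "\<not> obj_iso (False, B) x"
  obtains y where "y \<in> simp_objs T' F'" "\<not> obj_iso (True, B) y" "mut x y"
proof -
  obtain b N where x: "x = (b, N)" by (metis surj_pair)
  show thesis
  proof (cases b)
    case True
    then have "N \<in> simpT T" using assms(1) by (simp add: x simp_objs_def)
    from mutate_T[OF this] show thesis
    proof (elim disjE exE conjE)
      fix M w assume M: "covT N M w" "w ` carrier M = carrier N" "M \<restriction> kern w M N \<in> simpF F'"
      let ?K = "M \<restriction> kern w M N"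
      have w: "M \<in> T'" "M \<in> F" "mor w M N" using M(1) by (auto simp: covT_def)
      have Ks: "submod (kern w M N) M" by (rule submod_kern[OF w(3)])
      have "kern (\<lambda>x. x) ?K M = {\<zero>\<^bsub>?K\<^esub>}" using submod_zero[OF Ks] by (auto simp: kern_def)
      then have "relTF N ?K" unfolding relTF_def using w M(2) mor_incl[OF Ks] by auto
      then show thesis using True M(3) by (intro that[of "(False, ?K)"]) (simp_all add: x simp_objs_def obj_iso_def)
    next
      fix E p assume E: "mor p N E" "p ` carrier N = carrier E" "N \<restriction> kern p N E \<in> T'" "N \<restriction> kern p N E \<in> F"
         "E \<in> simpT T'" "\<not> mod_iso R B E"
      then have "relTT N E" unfolding relTT_def by blast
      then show thesis using True E(5,6) by (intro that[of "(True, E)"]) (simp_all add: x simp_objs_def obj_iso_def)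
    qed
  next
    case False
    then have "N \<in> simpF F" "\<not> mod_iso R B N" using assms by (auto simp: x simp_objs_def obj_iso_def)
    then obtain E i where "extF N E i" "E \<in> simpF F'" by (rule mutate_F)
    then show thesis using False
      by (intro that[of "(False, E)"]) (auto simp: x simp_objs_def obj_iso_def relFF_def)
  qed
qed

text \<open>Isomorphic copies of \<open>(False, B)\<close> contribute at most one member to
  \<open>D\<close>. The other members mutate injectively to objects not isomorphic to
  \<open>(True, B)\<close>, so \<open>(True, B)\<close> can make up for the lost one.\<close>

lemma simp_objs_le_step:
  assumes le: "simp_objs_le n T' F'"
  shows "simp_objs_le n T F"
  unfolding simp_objs_le_def
proof (intro allI impI)
  fix D assume D: "finite D" "D \<subseteq> simp_objs T F" and inj: "\<forall>x\<in>D. \<forall>y\<in>D. obj_iso x y \<longrightarrow> x = y"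
  have DC: "snd x \<in> C" if "x \<in> D" for x using lo.simp_objs_in D(2) that by blast
  define D0 where "D0 = {x \<in> D. \<not> obj_iso (False, B) x}"
  have fin0: "finite D0" using D(1) by (simp add: D0_def)
  have "x = y" if "x \<in> D - D0" "y \<in> D - D0" for x y
  proof -
    have xy: "x \<in> D" "y \<in> D" "obj_iso (False, B) x" "obj_iso (False, B) y" using that by (auto simp: D0_def)
    have "obj_iso x y"
      by (rule lo.obj_iso_trans[OF lo.obj_iso_sym[OF xy(3)] xy(4)]) (use DC xy B_C in auto)
    then show ?thesis using inj xy by blast
  qed
  then have "card (D - D0) \<le> Suc 0" using D(1) by (subst card_le_Suc0_iff_eq) auto
  moreover have "card D = card D0 + card (D - D0)"
    using card_Diff_subset[OF fin0, of D] card_mono[OF D(1), of D0] by (simp add: D0_def)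
  ultimately have 1: "card D \<le> Suc (card D0)" by simp
  have "\<forall>x\<in>D0. \<exists>y. y \<in> simp_objs T' F' \<and> \<not> obj_iso (True, B) y \<and> mut x y"
  proof
    fix x assume "x \<in> D0"
    then have "x \<in> simp_objs T F" "\<not> obj_iso (False, B) x" using D(2) by (auto simp: D0_def)
    then show "\<exists>y. y \<in> simp_objs T' F' \<and> \<not> obj_iso (True, B) y \<and> mut x y" by (rule mut_ex) blast
  qed
  from bchoice[OF this] obtain m where
    m: "\<And>x. x \<in> D0 \<Longrightarrow> m x \<in> simp_objs T' F' \<and> \<not> obj_iso (True, B) (m x) \<and> mut x (m x)" by blast
  have m_inj: "x = y" if xy: "x \<in> D0" "y \<in> D0" "obj_iso (m x) (m y)" for x y
  proof -
    have "mut x (m y)" using mut_iso[OF _ xy(3)] m[OF xy(1)] m[OF xy(2)] up.simp_objs_in by blast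
    then have "obj_iso x y"
      using mut_inj[of x y "m y"] m[OF xy(2)] xy(1,2) D(2) by (auto simp: D0_def)
    then show ?thesis using inj xy by (simp add: D0_def)
  qed
  have refl: "obj_iso z z" if "snd z \<in> C" for z using mod_iso_refl[OF that] by (simp add: obj_iso_def)
  have mC: "snd (m x) \<in> C" if "x \<in> D0" for x using m[OF that] up.simp_objs_in by blast
  have "inj_on m D0"
    by (rule inj_onI, rule m_inj) (use refl mC in auto)
  moreover have "(True, B) \<notin> m ` D0"
  proof
    assume "(True, B) \<in> m ` D0"
    then obtain x where x: "x \<in> D0" "(True, B) = m x" by blast
    then show False using m[OF x(1)] refl[OF mC[OF x(1)]] by simp
  qed
  ultimately have "card (insert (True, B) (m ` D0)) = Suc (card D0)"
    using fin0 by (simp add: card_image)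
  moreover have "card (insert (True, B) (m ` D0)) \<le> n"
  proof -
    let ?D' = "insert (True, B) (m ` D0)"
    have "finite ?D'" using fin0 by simp
    moreover have "?D' \<subseteq> simp_objs T' F'"
    proof (intro insert_subsetI image_subsetI)
      show "(True, B) \<in> simp_objs T' F'" using B_simpT by (simp add: simp_objs_def)
    qed (use m in blast)
    moreover have "\<forall>x\<in>?D'. \<forall>y\<in>?D'. obj_iso x y \<longrightarrow> x = y"
    proof (intro ballI impI)
      fix y z assume y: "y \<in> ?D'" and z: "z \<in> ?D'" and yz: "obj_iso y z"
      have C: "snd y \<in> C" "snd z \<in> C" using y z mC B_C by auto
      have zy: "obj_iso z y" by (rule lo.obj_iso_sym[OF yz C])
      consider "y = (True, B)" "z = (True, B)" | "y = (True, B)" "z \<in> m ` D0" | "y \<in> m ` D0" "z = (True, B)"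
        | "y \<in> m ` D0" "z \<in> m ` D0" using y z by blast
      then show "y = z"
      proof cases
        case 2
        then show ?thesis using m yz by blast
      next
        case 3
        then show ?thesis using m zy by blast
      next
        case 4
        then show ?thesis using m_inj yz by blast
      qed simp
    qed
    ultimately show ?thesis using le unfolding simp_objs_le_def by blast
  qed
  ultimately show "card D \<le> n" using 1 by simp
qed

end

section \<open>Torsion pairs generated by a set, and the existence of a mutation step\<close>

context length_category
begin

lemma lperp_rperp_superset: "G \<subseteq> C \<Longrightarrow> G \<subseteq> lperp (rperp G)"
  by (auto simp: lperp_def rperp_def)

lemma rperp_antimono: "G \<subseteq> H \<Longrightarrow> rperp H \<subseteq> rperp G"
  by (auto simp: rperp_def)

lemma lperp_antimono: "G \<subseteq> H \<Longrightarrow> lperp H \<subseteq> lperp G"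
  by (auto simp: lperp_def)

lemma rperp_lperp_rperp: "G \<subseteq> C \<Longrightarrow> rperp (lperp (rperp G)) = rperp G"
  using lperp_rperp_superset[of G] by (auto simp: lperp_def rperp_def)

text \<open>The two perpendiculars form a Galois connection, so a third application changes
  nothing.\<close>

lemma torsion_pair_generated:
  assumes "G \<subseteq> C"
  shows "torsion_pair R C len (lperp (rperp G)) (rperp G)"
  using rperp_lperp_rperp[OF assms]
  by (intro torsion_pair.intro length_category_axioms torsion_pair_axioms.intro) simp_all

lemma rperp_insertI:
  assumes "T \<subseteq> C" "Z \<in> C" "M \<in> rperp T" "\<And>f. mor f Z M \<Longrightarrow> vanishes f Z M"
  shows "M \<in> rperp (insert Z T)"
  using assms unfolding rperp_def by (auto simp: Hom_zero_iff vanishes_def)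

text \<open>The witness is the \<open>F\<close>-quotient of a module of \<open>T'\<close> outside
  \<open>T\<close>.\<close>

lemma torsion_pair_strict:
  assumes "torsion_pair R C len T F" "torsion_pair R C len T' F'" "T \<subset> T'"
  obtains Q where "Q \<in> T'" "Q \<in> F" "carrier Q \<noteq> {\<zero>\<^bsub>Q\<^esub>}"
proof -
  interpret lo: torsion_pair R C len T F by fact
  interpret up: torsion_pair R C len T' F' by fact
  obtain Z where Z: "Z \<in> T'" "Z \<notin> T" using assms(3) by blast
  have ZC: "Z \<in> C" by (rule up.T_in[OF Z(1)])
  have z: "{\<zero>\<^bsub>Z\<^esub>} \<subseteq> carrier Z" using zero_in[OF ZC] by simp
  obtain L where L: "L \<subseteq> carrier Z" "subq T Z L {\<zero>\<^bsub>Z\<^esub>}" "subq F Z (carrier Z) L"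
    using lo.subq_torsion[OF submod_carrier[OF ZC] submod_trivial[OF ZC] z] .
  obtain Q q where q: "Q \<in> F" "mor q Z Q" "q ` carrier Z = carrier Q" "kern q Z Q = L"
    using subqE[OF L(3)] by auto
  have "carrier Q \<noteq> {\<zero>\<^bsub>Q\<^esub>}"
  proof
    assume "carrier Q = {\<zero>\<^bsub>Q\<^esub>}"
    then have "kern q Z Q = carrier Z" using mor_closed[OF q(2)] by (auto simp: kern_def)
    then have "Z \<in> T" using L(2) q(4) mem_iff_subq[OF lo.T_iso_closed ZC] by simp
    then show False using Z(2) by blast
  qed
  then show thesis using that up.T_quotient[OF q(2,3) Z(1)] q(1) by blast
qed

lemma minus_restrict:
  assumes U: "submod U M" and y: "y \<in> U"
  shows "x \<ominus>\<^bsub>M \<restriction> U\<^esub> y = x \<ominus>\<^bsub>M\<^esub> y"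
proof -
  interpret M: left_module R M by (rule is_left_module[OF submod_in[OF U]])
  interpret U: left_module R "M \<restriction> U" by (rule is_left_module[OF submod_restrict_in[OF U]])
  have yM: "y \<in> carrier M" using y submod_subset[OF U] by blast
  have "(\<ominus>\<^bsub>R\<^esub> \<one>\<^bsub>R\<^esub>) \<odot>\<^bsub>M\<^esub> y = \<ominus>\<^bsub>M \<restriction> U\<^esub> y" using U.uminus_one_smult[of y] y by simp
  then show ?thesis using M.uminus_one_smult[OF yM] by (simp add: a_minus_def)
qed

definition simple :: "('a, 'm) module \<Rightarrow> bool" where
  "simple M \<longleftrightarrow> M \<in> C \<and> carrier M \<noteq> {\<zero>\<^bsub>M\<^esub>} \<and>
     (\<forall>U. submod U M \<longrightarrow> U = {\<zero>\<^bsub>M\<^esub>} \<or> U = carrier M)"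

lemma simple_Hom_iso:
  assumes M: "simple M" and N: "simple N" and f: "mor f M N" "\<not> vanishes f M N"
  shows "mod_iso R M N"
proof -
  have "kern f M N = {\<zero>\<^bsub>M\<^esub>}"
    using M submod_kern[OF f(1)] f(2) unfolding simple_def vanishes_iff_kern by blast
  moreover have "f ` carrier M \<noteq> {\<zero>\<^bsub>N\<^esub>}" using f(2) by (auto simp: vanishes_def)
  then have "f ` carrier M = carrier N" using N submod_range[OF f(1)] unfolding simple_def by blast
  ultimately show ?thesis
    using mor_inj_iff[OF f(1)] by (intro mod_isoI[OF f(1)]) (simp add: bij_betw_def)
qed

end

context brick_category
begin

lemma simple_brick:
  assumes M: "simple M"
  shows "brick M"
proof (rule brickI)
  show "M \<in> C" "carrier M \<noteq> {\<zero>\<^bsub>M\<^esub>}" using M by (simp_all add: simple_def)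
  fix f assume f: "mor f M M" "kern f M M \<noteq> {\<zero>\<^bsub>M\<^esub>}"
  then show "vanishes f M M"
    using M submod_kern[OF f(1)] unfolding simple_def vanishes_iff_kern by blast
qed

text \<open>A nonzero module of \<open>T'\<close> and \<open>F\<close> yields a new brick: the image
  of an endomorphism is both a quotient and a submodule, so it remains in both classes.\<close>

lemma cls_bricks_strict:
  assumes tp: "torsion_pair R C len T F" and tp': "torsion_pair R C len T' F'" and "T \<subset> T'"
  shows "cls ` {M. brick M \<and> M \<in> T} \<subset> cls ` {M. brick M \<and> M \<in> T'}"
proof -
  interpret lo: torsion_pair R C len T F by fact
  interpret up: torsion_pair R C len T' F' by fact
  obtain Q where Q: "Q \<in> T'" "Q \<in> F" "carrier Q \<noteq> {\<zero>\<^bsub>Q\<^esub>}"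
    using torsion_pair_strict[OF assms] .
  have QC: "Q \<in> C" by (rule lo.F_in[OF Q(2)])
  obtain e where e: "mor e Q Q" "\<not> vanishes e Q Q" "brick (Q \<restriction> (e ` carrier Q))"
    by (rule brick_image_ex[OF QC Q(3)])
  let ?B = "Q \<restriction> (e ` carrier Q)"
  have BT': "?B \<in> T'" by (rule up.T_range[OF e(1) Q(1)])
  have BF: "?B \<in> F" by (rule lo.F_restrict[OF submod_range[OF e(1)] Q(2)])
  have BC: "?B \<in> C" by (rule lo.F_in[OF BF])
  have "cls ?B \<notin> cls ` {M. brick M \<and> M \<in> T}"
  proof
    assume "cls ?B \<in> cls ` {M. brick M \<and> M \<in> T}"
    then obtain M where M: "M \<in> T" "cls M = cls ?B" by auto
    have "mod_iso R M ?B" using cls_eq_iff[OF lo.T_in[OF M(1)] BC] M(2) by simp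
    then have "?B \<in> T" using lo.T_iso_closed M(1) BC unfolding iso_closed_def by blast
    then have "carrier ?B = {\<zero>\<^bsub>?B\<^esub>}" using lo.T_Int_F BF by blast
    then show False using e(3) by (simp add: brick_def)
  qed
  moreover have "cls ?B \<in> cls ` {M. brick M \<and> M \<in> T'}" using e(3) BT' by blast
  ultimately show ?thesis using assms(3) by blast
qed

end

context brick_finite_category
begin

lemma finite_cls_bricks: "finite (cls ` {M. brick M \<and> P M})"
  by (rule finite_subset[OF _ brick_finite]) blast

text \<open>The number of brick classes acts as a rank function on torsion classes, by
  \<open>cls_bricks_strict\<close>. Simplicity of \<open>B\<close> has two halves: its minimal
  length makes nonzero maps from \<open>B\<close> to \<open>F\<close> injective, and a retraction
  from the image enlarged by the torsion of its cokernel shows that this cokernel has no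
  torsion.\<close>

lemma torsion_step_ex:
  assumes tp: "torsion_pair R C len T F" and M: "M \<in> F" "carrier M \<noteq> {\<zero>\<^bsub>M\<^esub>}"
  obtains T' F' B where "torsion_step R C len T F T' F' B" "T \<subset> T'"
proof -
  interpret lo: torsion_pair R C len T F by fact
  have MC: "M \<in> C" by (rule lo.F_in[OF M(1)])
  have TC: "T \<subseteq> C" using lo.T_in by blast
  let ?n = "\<lambda>T'. card (cls ` {M. brick M \<and> M \<in> T'})"
  let ?P = "\<lambda>T'. torsion_pair R C len T' (rperp T') \<and> T \<subset> T'"
  \<comment> \<open>The torsion class generated by everything starts the search; it differs from
    \<open>T\<close> because it contains \<open>M\<close>.\<close>
  have "?P (lperp (rperp C))"
  proof
    show "torsion_pair R C len (lperp (rperp C)) (rperp (lperp (rperp C)))"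
      using torsion_pair_generated[of C] rperp_lperp_rperp[of C] by simp
    have "T \<subseteq> lperp (rperp C)" "M \<in> lperp (rperp C)" using lperp_rperp_superset[of C] TC MC by auto
    then show "T \<subset> lperp (rperp C)" using lo.T_Int_F M by blast
  qed
  then obtain T' where T': "?P T'" and min: "\<And>T''. ?P T'' \<Longrightarrow> ?n T' \<le> ?n T''"
    using ex_has_least_nat[of ?P "lperp (rperp C)" ?n] by blast
  define F' where "F' = rperp T'"
  interpret up: torsion_pair R C len T' F' using T' by (simp add: F'_def)
  have tp': "torsion_pair R C len T' F'" using T' by (simp add: F'_def)
  have T_T': "T \<subset> T'" using T' by blast
  text \<open>By minimality, \<open>T'\<close> is generated by \<open>T\<close> and any nonzero object of \<open>T' \<inter> F\<close>.\<close>
  have gen: "N \<in> F'" if Z: "Z \<in> T'" "Z \<in> F" "carrier Z \<noteq> {\<zero>\<^bsub>Z\<^esub>}"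
      and N: "N \<in> F" "\<And>f. mor f Z N \<Longrightarrow> vanishes f Z N" for Z N
  proof -
    have ZC: "Z \<in> C" by (rule lo.F_in[OF Z(2)])
    have GC: "insert Z T \<subseteq> C" using TC ZC by blast
    define T'' where "T'' = lperp (rperp (insert Z T))"
    have r: "rperp T'' = rperp (insert Z T)" unfolding T''_def by (rule rperp_lperp_rperp[OF GC])
    have tp'': "torsion_pair R C len T'' (rperp T'')"
      using torsion_pair_generated[OF GC] r by (simp add: T''_def)
    have sub: "insert Z T \<subseteq> T''" unfolding T''_def by (rule lperp_rperp_superset[OF GC])
    have "Z \<notin> T" using lo.T_Int_F Z(2,3) by blast
    then have P: "?P T''" using tp'' sub by blast
    have "insert Z T \<subseteq> T'" using Z(1) T_T' by blast
    then have "F' \<subseteq> rperp (insert Z T)" unfolding F'_def by (rule rperp_antimono)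
    then have "T'' \<subseteq> lperp F'" unfolding T''_def by (rule lperp_antimono)
    then have "T'' \<subseteq> T'" by (simp flip: up.T_eq)
    moreover have "\<not> T'' \<subset> T'"
    proof
      assume "T'' \<subset> T'"
      then have "?n T'' < ?n T'"
        by (intro psubset_card_mono finite_cls_bricks cls_bricks_strict[OF tp'' tp'])
      then show False using min[OF P] by simp
    qed
    ultimately have "T'' = T'" by blast
    then have "F' = rperp (insert Z T)" using r by (simp add: F'_def)
    moreover have "N \<in> rperp T" using N(1) lo.F_eq by simp
    ultimately show ?thesis using rperp_insertI[OF TC ZC] N(2) by blast
  qed
  let ?Q = "\<lambda>Z. Z \<in> T' \<and> Z \<in> F \<and> carrier Z \<noteq> {\<zero>\<^bsub>Z\<^esub>}"
  obtain Z0 where "?Q Z0" using torsion_pair_strict[OF tp tp' T_T'] by blast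
  then obtain B where B: "B \<in> T'" "B \<in> F" "carrier B \<noteq> {\<zero>\<^bsub>B\<^esub>}" and Bmin: "\<And>Z. ?Q Z \<Longrightarrow> len B \<le> len Z"
    using ex_has_least_nat[of ?Q Z0 len] by blast
  have BC: "B \<in> C" by (rule lo.F_in[OF B(2)])
  have mono: "kern g B N = {\<zero>\<^bsub>B\<^esub>}" if N: "N \<in> F" and g: "mor g B N" "\<not> vanishes g B N" for N g
  proof -
    have Is: "submod (g ` carrier B) N" by (rule submod_range[OF g(1)])
    have "?Q (N \<restriction> (g ` carrier B))"
      using up.T_range[OF g(1) B(1)] lo.F_restrict[OF Is N] g(2) by (auto simp: vanishes_def)
    then have "len B \<le> len (N \<restriction> (g ` carrier B))" by (rule Bmin)
    then have "len (B \<restriction> kern g B N) = 0" using len_mor[OF g(1)] by simp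
    then show ?thesis using len_eq_0[OF submod_restrict_in[OF submod_kern[OF g(1)]]] by simp
  qed
  have "B \<in> simpF F" unfolding simpF_def
  proof (intro CollectI conjI ballI allI impI B)
    fix N g assume N: "N \<in> F" and g: "mor g B N" and nv: "\<not> vanishes g B N"
    show inj: "kern g B N = {\<zero>\<^bsub>B\<^esub>}" by (rule mono[OF N g nv])
    have NC: "N \<in> C" by (rule lo.F_in[OF N])
    let ?I = "g ` carrier B"
    have Is: "submod ?I N" by (rule submod_range[OF g])
    obtain L where L: "?I \<subseteq> L" "L \<subseteq> carrier N" "subq T N L ?I" "subq F N (carrier N) L"
      using lo.subq_torsion[OF submod_carrier[OF NC] Is submod_subset[OF Is]] .
    have Ls: "submod L N" by (rule subqD(1)[OF L(3)])
    let ?Z = "N \<restriction> L"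
    have IT': "N \<restriction> ?I \<in> T'" by (rule up.T_range[OF g B(1)])
    have "subq T' N ?I {\<zero>\<^bsub>N\<^esub>}" using IT' Is subq_bot[OF up.T_iso_closed] by blast
    moreover have "subq T' N L ?I" using subq_mono[OF L(3)] T_T' by blast
    ultimately have ZT': "?Z \<in> T'" using up.subq_T_trans subq_bot[OF up.T_iso_closed] by blast
    have ZF: "?Z \<in> F" by (rule lo.F_restrict[OF Ls N])
    have I0: "?I \<noteq> {\<zero>\<^bsub>N\<^esub>}" using nv by (auto simp: vanishes_def)
    have "carrier ?Z \<noteq> {\<zero>\<^bsub>?Z\<^esub>}" using I0 L(1) submod_zero[OF Is] by auto
    moreover have "B \<notin> F'" using up.T_Int_F B(1,3) by blast
    \<comment> \<open>If \<open>?Z\<close> had no nonzero map to \<open>B\<close>, then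
      \<open>gen\<close> would put \<open>B\<close> into \<open>F'\<close>, although it is a nonzero
      module of \<open>T'\<close>.\<close>
    ultimately obtain h where h: "mor h ?Z B" "\<not> vanishes h ?Z B" using gen[OF ZT' ZF _ B(2)] by blast
    have gL: "mor g B ?Z" by (rule mor_corestrict[OF g Ls L(1)])
    have hg: "mor (\<lambda>x. h (g x)) B B" by (rule mor_comp'[OF gL h(1)])
    have "\<not> vanishes (\<lambda>x. h (g x)) B B"
    proof
      assume v: "vanishes (\<lambda>x. h (g x)) B B"
      then have "h x = \<zero>\<^bsub>B\<^esub>" if "x \<in> ?I" for x using that by (auto simp: vanishes_def)
      then have "vanishes h ?Z B"
        unfolding vanishes_def using lo.subq_T_Hom_F[OF L(3) h(1) B(2)] by simp
      then show False using h(2) by blast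
    qed
    then have khg: "kern (\<lambda>x. h (g x)) B B = {\<zero>\<^bsub>B\<^esub>}" by (rule mono[OF B(2) hg])
    have hgs: "(\<lambda>x. h (g x)) ` carrier B = carrier B" using inj_iff_surj[OF hg refl] khg by blast
    let ?K = "kern h ?Z B"
    have KsZ: "submod ?K ?Z" by (rule submod_kern[OF h(1)])
    have Ks: "submod ?K N" and KL: "?K \<subseteq> L" using KsZ submod_restrict[OF Ls] by auto
    have KI: "?K \<inter> ?I = {\<zero>\<^bsub>N\<^esub>}"
    proof (intro equalityI subsetI)
      fix x assume "x \<in> ?K \<inter> ?I"
      then obtain y where y: "y \<in> carrier B" "x = g y" "h (g y) = \<zero>\<^bsub>B\<^esub>" by (auto simp: kern_def)
      then have "y \<in> kern (\<lambda>x. h (g x)) B B" by (simp add: kern_def)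
      then show "x \<in> {\<zero>\<^bsub>N\<^esub>}" using khg y(2) mor_zero[OF g] by simp
    qed (use submod_zero[OF Ks] submod_zero[OF Is] in auto)
    \<comment> \<open>The kernel of \<open>h\<close> is a complement of the image in
      \<open>L\<close>. So it is isomorphic to the torsion quotient of \<open>L\<close> by the
      image, while as a submodule of \<open>N\<close> it is in \<open>F\<close>.\<close>
    have "subq T N L ?I \<longleftrightarrow> subq T N ?K (?K \<inter> ?I)"
    proof (rule subq_iso2[OF Ks Is Ls KL L(1)])
      fix x assume x: "x \<in> L"
      then have "h x \<in> (\<lambda>x. h (g x)) ` carrier B" using mor_closed[OF h(1)] hgs by auto
      then obtain y where y: "y \<in> carrier B" "h x = h (g y)" by blast
      have c: "x \<in> carrier N" "g y \<in> carrier N" "g y \<in> L" using x y(1) L(1,2) mor_closed[OF g] by auto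
      have d: "x \<ominus>\<^bsub>N\<^esub> g y \<in> L"
        using submod_diff[OF Ls c(1,3)] x by blast
      have "x \<ominus>\<^bsub>?Z\<^esub> g y \<in> ?K" using mor_eq_iff[OF h(1)] x c(3) y(2) by simp
      moreover have "x \<ominus>\<^bsub>?Z\<^esub> g y = x \<ominus>\<^bsub>N\<^esub> g y" by (rule minus_restrict[OF Ls c(3)])
      moreover have "x \<ominus>\<^bsub>N\<^esub> (x \<ominus>\<^bsub>N\<^esub> g y) \<in> ?I" using minus_minus[OF NC c(1,2)] y(1) by simp
      ultimately show "\<exists>u\<in>?K. x \<ominus>\<^bsub>N\<^esub> u \<in> ?I" by auto
    qed
    then have KT: "N \<restriction> ?K \<in> T" using L(3) KI subq_bot[OF lo.T_iso_closed] by simp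
    then have "?K = {\<zero>\<^bsub>N\<^esub>}" using lo.T_Int_F[OF _ lo.F_restrict[OF Ks N]] by simp
    then have "len L' = 0" if "L' = ?Z \<restriction> ?K" for L'
      using that len_eq_0[OF submod_restrict_in[OF KsZ]] by simp
    then have "len ?Z = len (B \<restriction> (h ` L))" using len_mor[OF h(1)] by simp
    also have "\<dots> \<le> len B" using len_restrict_le[OF submod_range[OF h(1)]] by simp
    also have "len B = len (N \<restriction> ?I)" by (rule len_mono[OF g inj])
    finally have "?I = L" by (rule submod_eqI[OF Ls Is L(1)])
    then show "subq F N (carrier N) ?I" using L(4) by simp
  qed
  then have "torsion_step R C len T F T' F' B"
    using T_T' B(1) gen[OF B]
    by (intro torsion_step.intro length_category_axioms tp tp' torsion_step_axioms.intro) auto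
  then show thesis using that T_T' by blast
qed

section \<open>The bound by the number of simple modules, and semibricks attaining it\<close>

definition num_simples :: nat where
  "num_simples = card (cls ` {M. simple M})"

text \<open>With \<open>F\<close> zero, every module is in \<open>T\<close>, so the inclusion of any
  submodule is an admissible map and must be zero or onto.\<close>

lemma simpT_all_simple:
  assumes tp: "torsion_pair R C len T F" and F: "\<And>M. M \<in> F \<Longrightarrow> carrier M = {\<zero>\<^bsub>M\<^esub>}" and M: "M \<in> simpT T"
  shows "simple M"
proof -
  interpret torsion_pair R C len T F by fact
  have T: "N \<in> T" if "N \<in> C" for N
  proof (rule T_I[OF that])
    fix P f x assume "P \<in> F" "mor f N P" "x \<in> carrier N"
    then have "f x \<in> carrier P" "carrier P = {\<zero>\<^bsub>P\<^esub>}" using mor_closed[of f N P x] F by auto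
    then show "f x = \<zero>\<^bsub>P\<^esub>" by simp
  qed
  have MC: "M \<in> C" by (rule T_in[OF simpTD(1)[OF M]])
  show ?thesis unfolding simple_def
  proof (intro conjI allI impI)
    show "M \<in> C" by (rule MC)
    show "carrier M \<noteq> {\<zero>\<^bsub>M\<^esub>}" by (rule simpTD(2)[OF M])
    fix U assume U: "submod U M"
    show "U = {\<zero>\<^bsub>M\<^esub>} \<or> U = carrier M"
    proof (cases "vanishes (\<lambda>x. x) (M \<restriction> U) M")
      case True
      then have "U \<subseteq> {\<zero>\<^bsub>M\<^esub>}" by (simp add: vanishes_def subset_iff)
      then show ?thesis using submod_zero[OF U] by blast
    next
      case False
      then show ?thesis using simpTD(3)[OF M T[OF submod_restrict_in[OF U]] mor_incl[OF U] False] by simp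
    qed
  qed
qed

text \<open>The measure is the number of brick classes outside \<open>T\<close>, which drops at
  every step up. When \<open>F\<close> has become zero, only simple modules are counted.\<close>

theorem simp_objs_le_num_simples:
  assumes "torsion_pair R C len T F"
  shows "simp_objs_le num_simples T F"
  using assms
proof (induction "card (cls ` Collect brick) - card (cls ` {M. brick M \<and> M \<in> T})" arbitrary: T F
    rule: less_induct)
  case less
  interpret torsion_pair R C len T F by fact
  show ?case
  proof (cases "\<forall>M\<in>F. carrier M = {\<zero>\<^bsub>M\<^esub>}")
    case True
    have "simpF F = {}" using True simpFD(1,2) by blast
    then have L: "x \<in> simp_objs T F \<Longrightarrow> fst x \<and> simple (snd x)" for x
      using simpT_all_simple[OF less.prems] True by (auto simp: simp_objs_def)
    show ?thesis unfolding simp_objs_le_def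
    proof (intro allI impI)
      fix D assume D: "finite D" "D \<subseteq> simp_objs T F" "\<forall>x\<in>D. \<forall>y\<in>D. obj_iso x y \<longrightarrow> x = y"
      have "inj_on (\<lambda>x. cls (snd x)) D"
      proof (rule inj_onI)
        fix x y assume xy: "x \<in> D" "y \<in> D" "cls (snd x) = cls (snd y)"
        have "simple (snd x)" "simple (snd y)" "fst x" "fst y" using L D(2) xy(1,2) by blast+
        then have "obj_iso x y" using xy(3) cls_eq_iff by (simp add: obj_iso_def simple_def)
        then show "x = y" using D(3) xy(1,2) by blast
      qed
      then have "card D = card ((\<lambda>x. cls (snd x)) ` D)" by (simp add: card_image)
      also have "\<dots> \<le> num_simples" unfolding num_simples_def
      proof (rule card_mono)
        show "finite (cls ` {M. simple M})"
          by (rule finite_subset[OF _ brick_finite]) (use simple_brick in blast)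
      qed (use L D(2) in blast)
      finally show "card D \<le> num_simples" .
    qed
  next
    case False
    then obtain M where M: "M \<in> F" "carrier M \<noteq> {\<zero>\<^bsub>M\<^esub>}" by blast
    obtain T' F' B where step: "torsion_step R C len T F T' F' B" and TT': "T \<subset> T'"
      by (rule torsion_step_ex[OF less.prems M])
    interpret st: torsion_step R C len T F T' F' B by fact
    interpret st: brick_finite_step R C len T F T' F' B S by unfold_locales
    have tp': "torsion_pair R C len T' F'" by unfold_locales
    have "card (cls ` {M. brick M \<and> M \<in> T}) < card (cls ` {M. brick M \<and> M \<in> T'})"
      by (intro psubset_card_mono finite_cls_bricks cls_bricks_strict[OF less.prems tp' TT'])
    moreover have "card (cls ` {M. brick M \<and> M \<in> T'}) \<le> card (cls ` Collect brick)"
      by (rule card_mono[OF brick_finite]) blast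
    ultimately have "simp_objs_le num_simples T' F'" by (intro less.hyps tp') linarith
    then show ?thesis by (rule st.simp_objs_le_step)
  qed
qed

text \<open>A module outside \<open>F\<close> receives a nonzero map from some member of
  \<open>S'\<close>, and a nonzero map from a member to \<open>M\<close> is an automorphism of
  \<open>M\<close>, by orthogonality and \<open>brick_endo\<close>. Applying this to the image of a
  map from \<open>T\<close> to \<open>M\<close>, and then to its source modulo the torsion of the
  kernel, makes \<open>M\<close> a simple object on the \<open>T\<close> side.\<close>

theorem semibrick_le_num_simples:
  assumes fin: "finite S'" and bricks: "\<And>M. M \<in> S' \<Longrightarrow> brick M"
    and orth: "\<And>M N f. M \<in> S' \<Longrightarrow> N \<in> S' \<Longrightarrow> M \<noteq> N \<Longrightarrow> mor f M N \<Longrightarrow> vanishes f M N"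
  shows "card S' \<le> num_simples" and "card S' = num_simples \<Longrightarrow> cls ` S' = cls ` {M. simple M}"
proof -
  have SC: "S' \<subseteq> C" using bricks by (auto simp: brick_def)
  define T F where "T = lperp (rperp S')" and "F = rperp S'"
  have tp: "torsion_pair R C len T F" unfolding T_def F_def by (rule torsion_pair_generated[OF SC])
  interpret torsion_pair R C len T F by (rule tp)
  have ST: "S' \<subseteq> T" unfolding T_def by (rule lperp_rperp_superset[OF SC])
  have F_mem: "M \<in> F" if "M \<in> C" "\<And>N f. N \<in> S' \<Longrightarrow> mor f N M \<Longrightarrow> vanishes f N M" for M
    using that SC unfolding F_def rperp_def by (auto simp: Hom_zero_iff vanishes_def)
  have Hom_S: "\<exists>N\<in>S'. \<exists>f. mor f N M \<and> \<not> vanishes f N M" if M: "M \<in> C" "M \<notin> F" for M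
    using F_mem[OF M(1)] M(2) by blast
  have simp: "M \<in> simpT T" if M: "M \<in> S'" for M
    unfolding simpT_def
  proof (intro CollectI conjI ballI allI impI)
    show "M \<in> T" using M ST by blast
    show M0: "carrier M \<noteq> {\<zero>\<^bsub>M\<^esub>}" using bricks[OF M] by (simp add: brick_def)
    have to_M: "bij_betw f (carrier N) (carrier M) \<and> N = M" if "N \<in> S'" "mor f N M" "\<not> vanishes f N M" for N f
      using orth[OF that(1) M _ that(2)] that brick_endo[OF bricks[OF M]] by blast
    fix Z f assume Z: "Z \<in> T" and f: "mor f Z M" and nv: "\<not> vanishes f Z M"
    let ?I = "f ` carrier Z" and ?K = "kern f Z M"
    have ZC: "Z \<in> C" by (rule T_in[OF Z])
    have Is: "submod ?I M" by (rule submod_range[OF f])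
    have "M \<restriction> ?I \<notin> F"
    proof
      assume "M \<restriction> ?I \<in> F"
      then have "?I = {\<zero>\<^bsub>M\<^esub>}" using T_Int_F[OF T_range[OF f Z]] by simp
      then show False using nv by (auto simp: vanishes_def)
    qed
    then obtain N g where g: "N \<in> S'" "mor g N (M \<restriction> ?I)" "\<not> vanishes g N (M \<restriction> ?I)"
      using Hom_S[OF submod_restrict_in[OF Is]] by blast
    have "mor g N M" using mor_comp'[OF g(2) mor_incl[OF Is]] .
    moreover have "\<not> vanishes g N M" using g(3) by (simp add: vanishes_def)
    ultimately have "g ` carrier N = carrier M" using to_M g(1) by (auto simp: bij_betw_def)
    moreover have "g ` carrier N \<subseteq> ?I" using mor_closed[OF g(2)] by auto
    ultimately show surj: "?I = carrier M" using submod_subset[OF Is] by simp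
    have Ks: "submod ?K Z" by (rule submod_kern[OF f])
    have zK: "{\<zero>\<^bsub>Z\<^esub>} \<subseteq> ?K" using submod_zero[OF Ks] by simp
    obtain L where L: "L \<subseteq> ?K" "subq T Z L {\<zero>\<^bsub>Z\<^esub>}" "subq F Z ?K L"
      using subq_torsion[OF Ks submod_trivial[OF ZC] zK] .
    have Ls: "submod L Z" by (rule subqD(1)[OF L(2)])
    \<comment> \<open>After dividing out the torsion part \<open>L\<close> of the kernel, the kernel
      of the induced map \<open>u\<close> lies in \<open>F\<close>.\<close>
    obtain P p where p: "mor p Z P" "p ` carrier Z = carrier P" "kern p Z P = L" by (rule quotientE[OF Ls])
    have PC: "P \<in> C" by (rule morD(2)[OF p(1)])
    have PT: "P \<in> T" by (rule T_quotient[OF p(1,2) Z])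
    obtain u where u: "mor u P M" "\<forall>x\<in>carrier Z. u (p x) = f x"
      using mor_descend[OF p(1,2) f] p(3) L(1) by blast
    have us: "u ` carrier P = carrier M" using image_factor[OF p(2), where g = u and q = f] u(2) surj by simp
    have ku: "kern u P M = p ` ?K"
    proof (intro equalityI subsetI)
      fix y assume y: "y \<in> kern u P M"
      then have "y \<in> p ` carrier Z" using p(2) by (simp add: kern_def)
      then obtain x where "x \<in> carrier Z" "y = p x" by blast
      then show "y \<in> p ` ?K" using y u(2) by (auto simp: kern_def)
    next
      fix y assume "y \<in> p ` ?K"
      then show "y \<in> kern u P M" using u(2) mor_closed[OF p(1)] by (auto simp: kern_def)
    qed
    let ?H = "kern u P M"
    have Hs: "submod ?H P" by (rule submod_kern[OF u(1)])
    have HF: "P \<restriction> ?H \<in> F"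
      using subq_kern[OF F_iso_closed p(1) Ks] L(1,3) p(3) ku by (simp add: Int_absorb2)
    have "P \<notin> F"
    proof
      assume "P \<in> F"
      then have "carrier P = {\<zero>\<^bsub>P\<^esub>}" using T_Int_F PT by blast
      then have "u ` carrier P = {\<zero>\<^bsub>M\<^esub>}" using mor_zero[OF u(1)] by simp
      then show False using us M0 by simp
    qed
    then obtain N' h where h: "N' \<in> S'" "mor h N' P" "\<not> vanishes h N' P" using Hom_S[OF PC] by blast
    have uh: "mor (\<lambda>x. u (h x)) N' M" by (rule mor_comp'[OF h(2) u(1)])
    have "\<not> vanishes (\<lambda>x. u (h x)) N' M"
    proof
      assume "vanishes (\<lambda>x. u (h x)) N' M"
      then have "h ` carrier N' \<subseteq> ?H" using mor_closed[OF h(2)] by (auto simp: vanishes_def kern_def)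
      then have "mor h N' (P \<restriction> ?H)" by (rule mor_corestrict[OF h(2) Hs])
      then have "vanishes h N' P" using Hom_T_F[OF _ _ HF] ST h(1) by (auto simp: vanishes_def)
      then show False using h(3) by blast
    qed
    then have uhb: "bij_betw (\<lambda>x. u (h x)) (carrier N') (carrier M)" using to_M[OF h(1) uh] by blast
    let ?J = "h ` carrier N'"
    have Js: "submod ?J P" by (rule submod_range[OF h(2)])
    have HJ: "?H \<inter> ?J = {\<zero>\<^bsub>P\<^esub>}"
    proof (intro equalityI subsetI)
      fix x assume "x \<in> ?H \<inter> ?J"
      then obtain y where y: "y \<in> carrier N'" "x = h y" "u (h y) = \<zero>\<^bsub>M\<^esub>" by (auto simp: kern_def)
      then have "y \<in> kern (\<lambda>x. u (h x)) N' M" by (simp add: kern_def)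
      then show "x \<in> {\<zero>\<^bsub>P\<^esub>}"
        using mor_inj_iff[OF uh] uhb y(2) mor_zero[OF h(2)] by (simp add: bij_betw_def)
    qed (use submod_zero[OF Hs] submod_zero[OF Js] in auto)
    \<comment> \<open>\<open>?J\<close> is a complement of \<open>?H\<close>, since it maps
      isomorphically onto \<open>M\<close>. So \<open>?H\<close> is isomorphic to a quotient of the
      torsion module \<open>P\<close>; being also in \<open>F\<close>, it is zero.\<close>
    have "subq T P (carrier P) ?J \<longleftrightarrow> subq T P ?H (?H \<inter> ?J)"
    proof (rule subq_iso2[OF Hs Js submod_carrier[OF PC] submod_subset[OF Hs] submod_subset[OF Js]])
      fix x assume x: "x \<in> carrier P"
      then have "u x \<in> (\<lambda>x. u (h x)) ` carrier N'" using mor_closed[OF u(1)] uhb by (auto simp: bij_betw_def)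
      then obtain y where y: "y \<in> carrier N'" "u x = u (h y)" by blast
      have hy: "h y \<in> carrier P" by (rule mor_closed[OF h(2) y(1)])
      have "x \<ominus>\<^bsub>P\<^esub> h y \<in> ?H" using mor_eq_iff[OF u(1) x hy] y(2) by blast
      moreover have "x \<ominus>\<^bsub>P\<^esub> (x \<ominus>\<^bsub>P\<^esub> h y) \<in> ?J" using minus_minus[OF PC x hy] y(1) by simp
      ultimately show "\<exists>v\<in>?H. x \<ominus>\<^bsub>P\<^esub> v \<in> ?J" by blast
    qed
    moreover have "subq T P (carrier P) ?J"
      using subq_T_upper[OF _ Js _ submod_subset[OF Js]] mem_iff_subq[OF T_iso_closed PC] PT submod_zero[OF Js]
      by blast
    ultimately have "P \<restriction> ?H \<in> T" using HJ subq_bot[OF T_iso_closed] by simp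
    then have "?H = {\<zero>\<^bsub>P\<^esub>}" using T_Int_F[OF _ HF] by simp
    then have "?K \<subseteq> L" using ku submod_subset[OF Ks] unfolding p(3)[symmetric] by (auto simp: kern_def)
    then have "?K = L" using L(1) by blast
    then show "Z \<restriction> ?K \<in> T" using L(2) subq_bot[OF T_iso_closed] by simp
  qed
  let ?D = "{True} \<times> S'"
  have le: "simp_objs_le num_simples T F" by (rule simp_objs_le_num_simples[OF tp])
  have Deq: "x = y" if "x \<in> ?D" "y \<in> ?D" "obj_iso x y" for x y
  proof (rule ccontr)
    assume "x \<noteq> y"
    then have *: "snd x \<in> S'" "snd y \<in> S'" "snd x \<noteq> snd y" "mod_iso R (snd x) (snd y)"
      using that by (auto simp: obj_iso_def)
    obtain f where f: "mor f (snd x) (snd y)" "bij_betw f (carrier (snd x)) (carrier (snd y))"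
      by (rule mod_isoE[OF *(4)]) (use SC * in auto)
    have "vanishes f (snd x) (snd y)" by (rule orth[OF *(1-3) f(1)])
    then have "carrier (snd y) \<subseteq> {\<zero>\<^bsub>snd y\<^esub>}" using f(2) by (auto simp: vanishes_def bij_betw_def)
    then show False using bricks[OF *(2)] zero_in by (auto simp: brick_def)
  qed
  have D: "finite ?D" "?D \<subseteq> simp_objs T F" "card ?D = card S'"
    using fin simp by (auto simp: simp_objs_def card_cartesian_product)
  show "card S' \<le> num_simples" using le D Deq unfolding simp_objs_le_def by metis
  assume card: "card S' = num_simples"
  have F0: "carrier M = {\<zero>\<^bsub>M\<^esub>}" if "M \<in> F" for M
  proof (rule ccontr)
    assume "carrier M \<noteq> {\<zero>\<^bsub>M\<^esub>}"
    then obtain T' F' B where "torsion_step R C len T F T' F' B" by (rule torsion_step_ex[OF tp \<open>M \<in> F\<close>])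
    then interpret st: torsion_step R C len T F T' F' B .
    let ?E = "insert (False, B) ?D"
    have "finite ?E" using fin by simp
    moreover have "?E \<subseteq> simp_objs T F" using D(2) st.B_simpF by (simp add: simp_objs_def)
    moreover have "\<forall>x\<in>?E. \<forall>y\<in>?E. obj_iso x y \<longrightarrow> x = y" using Deq by (auto simp: obj_iso_def)
    ultimately have "card ?E \<le> num_simples" using le unfolding simp_objs_le_def by blast
    then show False using card fin D(3) by (simp add: card_insert_if)
  qed
  have simple: "simple M" if "M \<in> S'" for M by (rule simpT_all_simple[OF tp F0 simp[OF that]])
  show "cls ` S' = cls ` {M. simple M}"
  proof (intro equalityI subsetI)
    fix c assume "c \<in> cls ` {M. simple M}"
    then obtain M where M: "simple M" "c = cls M" by blast
    have MC: "M \<in> C" using M(1) by (simp add: simple_def)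
    have "M \<notin> F" using F0 M(1) by (auto simp: simple_def)
    then obtain N f where f: "N \<in> S'" "mor f N M" "\<not> vanishes f N M" using Hom_S[OF MC] by blast
    have "mod_iso R N M" by (rule simple_Hom_iso[OF simple[OF f(1)] M(1) f(2,3)])
    then have "cls N = cls M" using cls_eq_iff SC f(1) MC by blast
    then show "c \<in> cls ` S'" using M(2) f(1) by blast
  qed (use simple in blast)
qed

end

section \<open>Eigenvectors over an algebraically closed field\<close>

context vectorspace
begin

text \<open>Independent subsets of the subspace stay independent in the whole space, so their size
  is bounded and a maximal one exists.\<close>

lemma subspace_fin_dim:
  assumes fd: "fin_dim" and W: "VectorSpace.subspace K W V"
  shows "vectorspace.fin_dim K (vs W)"
proof -
  interpret W: vectorspace K "vs W" by (rule subspace_is_vs[OF W])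
  have sm: "LinearCombinations.submodule K W V" using W by simp
  have WV: "W \<subseteq> carrier V" using sm by (simp add: LinearCombinations.submodule_def)
  let ?P = "\<lambda>A. A \<subseteq> carrier (vs W) \<and> W.lin_indpt A"
  have "finite A \<and> card A \<le> dim" if "?P A" for A
  proof -
    have "A \<subseteq> W" using that by simp
    then have "lin_indpt A" using that span_li_not_depend(2)[OF _ sm] by blast
    then show ?thesis using li_le_dim[OF fd] \<open>A \<subseteq> W\<close> WV by blast
  qed
  moreover have "?P {}" by (auto simp: W.lin_dep_def)
  ultimately obtain A where A: "finite A" "maximal A ?P" using maximal_exists[of ?P dim "{}"] by blast
  then have "W.gen_set A" "A \<subseteq> carrier (vs W)" using W.max_li_is_gen[of A] by (auto simp: maximal_def)
  then show ?thesis using A(1) unfolding W.fin_dim_def by blast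
qed

end

text \<open>With a vector fixed, polynomials in \<open>f\<close> have to be evaluated only there,
  and no algebra of operators is required.\<close>

locale pointed_endomorphism = vectorspace K V
  for K :: "('a, 'b) ring_scheme" and V :: "('a, 'c, 'd) module_scheme" +
  fixes f and v
  assumes f_closed: "\<And>x. x \<in> carrier V \<Longrightarrow> f x \<in> carrier V"
    and f_add: "\<And>x y. x \<in> carrier V \<Longrightarrow> y \<in> carrier V \<Longrightarrow> f (x \<oplus>\<^bsub>V\<^esub> y) = f x \<oplus>\<^bsub>V\<^esub> f y"
    and f_smult: "\<And>c x. c \<in> carrier K \<Longrightarrow> x \<in> carrier V \<Longrightarrow> f (c \<odot>\<^bsub>V\<^esub> x) = c \<odot>\<^bsub>V\<^esub> f x"
    and v: "v \<in> carrier V"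
begin

text \<open>The value at \<open>v\<close> of the polynomial in \<open>f\<close> with the given coefficients, constant term first;
  HOL-Algebra lists the coefficients of a polynomial in the opposite order.\<close>

primrec pol_app :: "'a list \<Rightarrow> 'c" where
  "pol_app [] = \<zero>\<^bsub>V\<^esub>"
| "pol_app (c # q) = c \<odot>\<^bsub>V\<^esub> v \<oplus>\<^bsub>V\<^esub> f (pol_app q)"

lemma f_zero: "f \<zero>\<^bsub>V\<^esub> = \<zero>\<^bsub>V\<^esub>"
  using f_smult[of "\<zero>\<^bsub>K\<^esub>" "\<zero>\<^bsub>V\<^esub>"] f_closed[of "\<zero>\<^bsub>V\<^esub>"] by simp

lemma pol_app_closed: "set q \<subseteq> carrier K \<Longrightarrow> pol_app q \<in> carrier V"
  by (induction q) (auto simp: v f_closed)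

lemma pol_app_add:
  "length p = length q \<Longrightarrow> set p \<subseteq> carrier K \<Longrightarrow> set q \<subseteq> carrier K \<Longrightarrow>
    pol_app (map2 (\<lambda>x y. x \<oplus>\<^bsub>K\<^esub> y) p q) = pol_app p \<oplus>\<^bsub>V\<^esub> pol_app q"
proof (induction p q rule: list_induct2)
  case (Cons x xs y ys)
  then show ?case
    by (simp add: v f_closed f_add pol_app_closed smult_l_distr M.a_ac)
qed simp

lemma pol_app_smult:
  "c \<in> carrier K \<Longrightarrow> set q \<subseteq> carrier K \<Longrightarrow> pol_app (map (\<lambda>x. c \<otimes>\<^bsub>K\<^esub> x) q) = c \<odot>\<^bsub>V\<^esub> pol_app q"
  by (induction q) (simp_all add: v f_closed f_smult pol_app_closed smult_r_distr smult_assoc1)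

lemma pol_app_append:
  "set q \<subseteq> carrier K \<Longrightarrow> c \<in> carrier K \<Longrightarrow>
    pol_app (q @ [c]) = pol_app q \<oplus>\<^bsub>V\<^esub> c \<odot>\<^bsub>V\<^esub> (f ^^ length q) v"
proof (induction q)
  case (Cons x xs)
  have "(f ^^ n) v \<in> carrier V" for n by (induction n) (simp_all add: v f_closed)
  then show ?case using Cons by (simp add: v f_closed f_add f_smult pol_app_closed M.a_assoc)
qed (simp add: v f_zero)

lemma power_closed: "(f ^^ n) v \<in> carrier V"
  by (induction n) (simp_all add: v f_closed)

lemma pol_app_replicate: "pol_app (replicate n \<zero>\<^bsub>K\<^esub>) = \<zero>\<^bsub>V\<^esub>"
  by (induction n) (simp_all add: v f_zero)

lemma pol_app_subspace: "LinearCombinations.submodule K {pol_app q | q. length q = n \<and> set q \<subseteq> carrier K} V"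
proof (rule LinearCombinations.submodule.intro)
  show "Module.module K V" by (rule module_axioms)
  show "{pol_app q | q. length q = n \<and> set q \<subseteq> carrier K} \<subseteq> carrier V" using pol_app_closed by blast
  have "set (replicate n \<zero>\<^bsub>K\<^esub>) \<subseteq> carrier K" by auto
  then show "\<zero>\<^bsub>V\<^esub> \<in> {pol_app q | q. length q = n \<and> set q \<subseteq> carrier K}"
    using pol_app_replicate[of n, symmetric] by (intro CollectI exI[of _ "replicate n \<zero>\<^bsub>K\<^esub>"]) simp
next
  fix x y assume "x \<in> {pol_app q | q. length q = n \<and> set q \<subseteq> carrier K}"
    "y \<in> {pol_app q | q. length q = n \<and> set q \<subseteq> carrier K}"
  then obtain p q where pq: "x = pol_app p" "length p = n" "set p \<subseteq> carrier K"
    "y = pol_app q" "length q = n" "set q \<subseteq> carrier K" by blast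
  have "set (map2 (\<lambda>x y. x \<oplus>\<^bsub>K\<^esub> y) p q) \<subseteq> carrier K"
  proof -
    have "set (zip p q) \<subseteq> carrier K \<times> carrier K"
      using pq by (auto dest: set_zip_leftD set_zip_rightD)
    then show ?thesis by auto
  qed
  then show "x \<oplus>\<^bsub>V\<^esub> y \<in> {pol_app q | q. length q = n \<and> set q \<subseteq> carrier K}"
    using pq pol_app_add[of p q] by (intro CollectI exI[of _ "map2 (\<lambda>x y. x \<oplus>\<^bsub>K\<^esub> y) p q"]) simp
next
  fix c x assume c: "c \<in> carrier K" and "x \<in> {pol_app q | q. length q = n \<and> set q \<subseteq> carrier K}"
  then obtain q where q: "x = pol_app q" "length q = n" "set q \<subseteq> carrier K" by blast
  then show "c \<odot>\<^bsub>V\<^esub> x \<in> {pol_app q | q. length q = n \<and> set q \<subseteq> carrier K}"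
    using c pol_app_smult[of c q] by (intro CollectI exI[of _ "map (\<lambda>x. c \<otimes>\<^bsub>K\<^esub> x) q"]) auto
qed

text \<open>A linear dependence among the iterates of \<open>v\<close>, normalised to be monic;
  \<open>q\<close> lists the coefficients below the leading one.\<close>

lemma annihilating_polynomial:
  assumes fd: "fin_dim"
  shows "\<exists>q. set q \<subseteq> carrier K \<and> pol_app (q @ [\<one>\<^bsub>K\<^esub>]) = \<zero>\<^bsub>V\<^esub>"
proof -
  define P where "P n = (\<lambda>i. (f ^^ i) v) ` {..<n}" for n
  have PC: "P n \<subseteq> carrier V" for n using power_closed by (auto simp: P_def)
  \<comment> \<open>Otherwise the first \<open>n\<close> iterates would be independent for every
    \<open>n\<close>, even beyond the dimension.\<close>
  have "\<exists>n. (f ^^ n) v \<in> span (P n)"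
  proof (rule ccontr)
    assume no: "\<nexists>n. (f ^^ n) v \<in> span (P n)"
    have "lin_indpt (P n) \<and> card (P n) = n" for n
    proof (induction n)
      case 0
      then show ?case by (auto simp: P_def lin_dep_def)
    next
      case (Suc n)
      have S: "P (Suc n) = P n \<union> {(f ^^ n) v}" by (auto simp: P_def lessThan_Suc)
      have "(f ^^ n) v \<notin> P n" using no in_own_span[OF PC] by blast
      then have "\<not> lin_dep (P (Suc n))"
        using lin_dep_iff_in_span[OF PC _ power_closed] Suc no unfolding S by blast
      moreover have "finite (P n)" by (simp add: P_def)
      then have "card (P (Suc n)) = Suc n" using Suc \<open>(f ^^ n) v \<notin> P n\<close> unfolding S by simp
      ultimately show ?case by blast
    qed
    then show False using li_le_dim(2)[OF fd PC, of "Suc dim"] by (metis Suc_n_not_le_n)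
  qed
  then obtain n where n: "(f ^^ n) v \<in> span (P n)" by blast
  let ?L = "{pol_app q | q. length q = n \<and> set q \<subseteq> carrier K}"
  have "P n \<subseteq> ?L"
  proof
    fix x assume "x \<in> P n"
    then obtain i where i: "i < n" "x = (f ^^ i) v" by (auto simp: P_def)
    \<comment> \<open>Zero blocks for the coefficient list of the monomial of degree
      \<open>i\<close>, padded to length \<open>n\<close>.\<close>
    let ?r = "\<lambda>m. replicate m \<zero>\<^bsub>K\<^esub>"
    have z: "set (?r m) \<subseteq> carrier K" for m by auto
    have "pol_app ((?r i @ [\<one>\<^bsub>K\<^esub>]) @ ?r m) = (f ^^ i) v" for m
    proof (induction m)
      case 0
      show ?case using pol_app_append[OF z, of "\<one>\<^bsub>K\<^esub>" i] by (simp add: pol_app_replicate power_closed)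
    next
      case (Suc m)
      have "set ((?r i @ [\<one>\<^bsub>K\<^esub>]) @ ?r m) \<subseteq> carrier K" by auto
      from pol_app_append[OF this, of "\<zero>\<^bsub>K\<^esub>"] show ?case
        using Suc by (simp add: power_closed f_closed replicate_append_same flip: replicate_Suc)
    qed
    then have "x = pol_app (?r i @ [\<one>\<^bsub>K\<^esub>] @ ?r (n - Suc i))" using i(2) by simp
    moreover have "length (?r i @ [\<one>\<^bsub>K\<^esub>] @ ?r (n - Suc i)) = n" using i(1) by simp
    moreover have "set (?r i @ [\<one>\<^bsub>K\<^esub>] @ ?r (n - Suc i)) \<subseteq> carrier K" by auto
    ultimately show "x \<in> ?L" by blast
  qed
  then have "span (P n) \<subseteq> ?L" using pol_app_subspace by (rule span_is_subset)
  then obtain q where q: "length q = n" "set q \<subseteq> carrier K" "(f ^^ n) v = pol_app q" using n by blast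
  let ?q = "map (\<lambda>x. (\<ominus>\<^bsub>K\<^esub> \<one>\<^bsub>K\<^esub>) \<otimes>\<^bsub>K\<^esub> x) q"
  have q': "set ?q \<subseteq> carrier K" using q(2) by auto
  have "pol_app (?q @ [\<one>\<^bsub>K\<^esub>]) = pol_app ?q \<oplus>\<^bsub>V\<^esub> (f ^^ n) v"
    using pol_app_append[OF q', of "\<one>\<^bsub>K\<^esub>"] q(1) power_closed by simp
  also have "pol_app ?q = \<ominus>\<^bsub>V\<^esub> pol_app q"
    using pol_app_smult[of "\<ominus>\<^bsub>K\<^esub> \<one>\<^bsub>K\<^esub>" q] q(2) pol_app_closed[OF q(2)] by (simp add: smult_minus_1)
  finally have "pol_app (?q @ [\<one>\<^bsub>K\<^esub>]) = \<zero>\<^bsub>V\<^esub>"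
    using q(3) pol_app_closed[OF q(2)] by (simp add: M.l_neg)
  then show ?thesis using q' by blast
qed

text \<open>Synthetic division of a polynomial by \<open>x - r\<close>.\<close>

primrec pol_div :: "'a \<Rightarrow> 'a list \<Rightarrow> 'a list" where
  "pol_div r [] = []"
| "pol_div r (c # q) = (if q = [] then [] else eval (rev q) r # pol_div r q)"

lemma pol_div_closed: "set q \<subseteq> carrier K \<Longrightarrow> r \<in> carrier K \<Longrightarrow> set (pol_div r q) \<subseteq> carrier K"
  by (induction q) (simp_all add: eval_in_carrier)

text \<open>It lets the quotient compete with a monic annihilating polynomial of least
  degree.\<close>

lemma pol_div_monic:
  assumes "q \<noteq> []" "r \<in> carrier K"
  shows "\<exists>d. pol_div r (q @ [\<one>\<^bsub>K\<^esub>]) = d @ [\<one>\<^bsub>K\<^esub>] \<and> length d < length q"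
  using assms(1)
proof (induction q)
  case (Cons c q)
  show ?case
  proof (cases "q = []")
    case True
    then show ?thesis using assms(2) by (intro exI[of _ "[]"]) simp
  next
    case False
    then obtain d where "pol_div r (q @ [\<one>\<^bsub>K\<^esub>]) = d @ [\<one>\<^bsub>K\<^esub>]" "length d < length q" using Cons.IH by blast
    then show ?thesis by (intro exI[of _ "eval (rev (q @ [\<one>\<^bsub>K\<^esub>])) r # d"]) simp
  qed
qed simp

text \<open>The identity p(x) - p(r) = (x - r) d(x), evaluated at \<open>f\<close> and applied to
  \<open>v\<close>, with the negative terms moved to the other side.\<close>

lemma pol_app_div:
  assumes "set q \<subseteq> carrier K" and r: "r \<in> carrier K"
  shows "pol_app q \<oplus>\<^bsub>V\<^esub> r \<odot>\<^bsub>V\<^esub> pol_app (pol_div r q) = f (pol_app (pol_div r q)) \<oplus>\<^bsub>V\<^esub> eval (rev q) r \<odot>\<^bsub>V\<^esub> v"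
  using assms(1)
proof (induction q)
  case Nil
  show ?case using r by (simp add: v f_zero)
next
  case (Cons c q)
  have c: "c \<in> carrier K" and q: "set q \<subseteq> carrier K" using Cons.prems by auto
  show ?case
  proof (cases "q = []")
    case True
    then show ?thesis using c r by (simp add: v f_zero)
  next
    case False
    let ?e = "eval (rev q) r" and ?w = "pol_app (pol_div r q)"
    have e: "?e \<in> carrier K" using q r by (intro eval_in_carrier) auto
    have w: "?w \<in> carrier V" by (rule pol_app_closed[OF pol_div_closed[OF q r]])
    have pq: "pol_app q \<in> carrier V" by (rule pol_app_closed[OF q])
    have IH: "f (pol_app q) \<oplus>\<^bsub>V\<^esub> r \<odot>\<^bsub>V\<^esub> f ?w = f (f ?w) \<oplus>\<^bsub>V\<^esub> ?e \<odot>\<^bsub>V\<^esub> f v"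
      using arg_cong[OF Cons.IH[OF q], of f] w pq r e by (simp add: f_add f_smult f_closed v)
    have ev: "eval (rev (c # q)) r = ?e \<otimes>\<^bsub>K\<^esub> r \<oplus>\<^bsub>K\<^esub> c"
      using eval_append_aux[of "rev q" c r] q c r by simp
    have "pol_app (c # q) \<oplus>\<^bsub>V\<^esub> r \<odot>\<^bsub>V\<^esub> pol_app (pol_div r (c # q))
        = c \<odot>\<^bsub>V\<^esub> v \<oplus>\<^bsub>V\<^esub> (r \<otimes>\<^bsub>K\<^esub> ?e) \<odot>\<^bsub>V\<^esub> v \<oplus>\<^bsub>V\<^esub> (f (pol_app q) \<oplus>\<^bsub>V\<^esub> r \<odot>\<^bsub>V\<^esub> f ?w)"
      using False c r e w pq
      by (simp add: v f_closed smult_r_distr smult_assoc1 M.a_ac)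
    also have "\<dots> = f (?e \<odot>\<^bsub>V\<^esub> v \<oplus>\<^bsub>V\<^esub> f ?w) \<oplus>\<^bsub>V\<^esub> eval (rev (c # q)) r \<odot>\<^bsub>V\<^esub> v"
      unfolding IH ev using c r e w
      by (simp add: v f_closed f_add f_smult smult_l_distr M.a_ac R.m_comm)
    finally show ?thesis using False by simp
  qed
qed

text \<open>Let r be a root of a monic polynomial of least degree that annihilates \<open>v\<close>.
  By minimality the quotient by x - r does not annihilate \<open>v\<close>, and the vector it
  produces is killed by f - r.\<close>

theorem eigenvector_ex:
  assumes ac: "algebraically_closed K" and fd: "fin_dim" and v0: "v \<noteq> \<zero>\<^bsub>V\<^esub>"
  shows "\<exists>r\<in>carrier K. \<exists>w\<in>carrier V. w \<noteq> \<zero>\<^bsub>V\<^esub> \<and> f w = r \<odot>\<^bsub>V\<^esub> w"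
proof -
  interpret L: algebraically_closed K by fact
  let ?P = "\<lambda>q. set q \<subseteq> carrier K \<and> pol_app (q @ [\<one>\<^bsub>K\<^esub>]) = \<zero>\<^bsub>V\<^esub>"
  obtain q0 where "?P q0" using annihilating_polynomial[OF fd] by blast
  then obtain q where q: "?P q" and min: "\<And>q'. ?P q' \<Longrightarrow> length q \<le> length q'"
    using ex_has_least_nat[of ?P q0 length] by blast
  \<comment> \<open>An empty \<open>q\<close> stands for the constant polynomial one, whose value at
    \<open>v\<close> is \<open>v\<close> itself.\<close>
  have ne: "q \<noteq> []" using q v0 v f_zero by auto
  let ?p = "rev (q @ [\<one>\<^bsub>K\<^esub>])"
  have p: "?p \<in> carrier (poly_ring K)"
    using q unfolding sym[OF univ_poly_carrier] by (auto simp: polynomial_def)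
  have "size (roots ?p) = degree ?p"
    using L.roots_over_carrier[OF p] by (simp add: splitted_def)
  then have "roots ?p \<noteq> {#}" using ne by auto
  then obtain r where "r \<in># roots ?p" by blast
  then have r: "r \<in> carrier K" "eval ?p r = \<zero>\<^bsub>K\<^esub>"
    using roots_mem_iff_is_root[OF p] by (auto simp: is_root_def)
  have qc: "set (q @ [\<one>\<^bsub>K\<^esub>]) \<subseteq> carrier K" using q by auto
  let ?w = "pol_app (pol_div r (q @ [\<one>\<^bsub>K\<^esub>]))"
  have dc: "set (pol_div r (q @ [\<one>\<^bsub>K\<^esub>])) \<subseteq> carrier K" by (rule pol_div_closed[OF qc r(1)])
  obtain d where d: "pol_div r (q @ [\<one>\<^bsub>K\<^esub>]) = d @ [\<one>\<^bsub>K\<^esub>]" "length d < length q"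
    using pol_div_monic[OF ne r(1)] by blast
  have "?w \<noteq> \<zero>\<^bsub>V\<^esub>" using min[of d] d dc by auto
  moreover have w: "?w \<in> carrier V" by (rule pol_app_closed[OF dc])
  moreover have "f ?w = r \<odot>\<^bsub>V\<^esub> ?w"
    using pol_app_div[OF qc r(1)] q r w by (simp add: v f_closed)
  ultimately show ?thesis using r(1) by blast
qed

end

section \<open>Quotient modules\<close>

text \<open>Unlike \<open>epi_kern_iso\<close>, this allows three different carrier types, as is
  needed for quotient modules made of cosets.\<close>

lemma epi_fibres_iso:
  fixes M :: "('a, 'm) module" and Q :: "('a, 'n) module" and P :: "('a, 'q) module"
  assumes "left_module R M" and p: "p \<in> Hom R M Q" "p ` carrier M = carrier Q"
    and q: "q \<in> Hom R M P" "q ` carrier M = carrier P"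
    and fib: "\<And>x y. x \<in> carrier M \<Longrightarrow> y \<in> carrier M \<Longrightarrow> p x = p y \<longleftrightarrow> q x = q y"
  shows "mod_iso R Q P"
proof -
  interpret left_module R M by fact
  define g where "g z = q (inv_into (carrier M) p z)" for z
  have g: "g (p x) = q x" if x: "x \<in> carrier M" for x
  proof -
    have "inv_into (carrier M) p (p x) \<in> carrier M" "p (inv_into (carrier M) p (p x)) = p x"
      using x by (auto intro: inv_into_into f_inv_into_f)
    then show ?thesis using fib x by (simp add: g_def)
  qed
  have "g \<in> Hom R Q P" unfolding Hom_iff
  proof (intro conjI ballI)
    fix z assume "z \<in> carrier Q"
    then obtain x where "x \<in> carrier M" "z = p x" using p(2) by blast
    then show "g z \<in> carrier P" using g q(1) by (simp add: Hom_iff)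
  next
    fix z w assume "z \<in> carrier Q" "w \<in> carrier Q"
    then obtain x y where xy: "x \<in> carrier M" "z = p x" "y \<in> carrier M" "w = p y" using p(2) by blast
    then have "z \<oplus>\<^bsub>Q\<^esub> w = p (x \<oplus>\<^bsub>M\<^esub> y)" using p(1) by (simp add: Hom_iff)
    then show "g (z \<oplus>\<^bsub>Q\<^esub> w) = g z \<oplus>\<^bsub>P\<^esub> g w" using xy g q(1) by (simp add: Hom_iff)
  next
    fix a z assume a: "a \<in> carrier R" and "z \<in> carrier Q"
    then obtain x where x: "x \<in> carrier M" "z = p x" using p(2) by blast
    then have "a \<odot>\<^bsub>Q\<^esub> z = p (a \<odot>\<^bsub>M\<^esub> x)" using a p(1) by (simp add: Hom_iff)
    then show "g (a \<odot>\<^bsub>Q\<^esub> z) = a \<odot>\<^bsub>P\<^esub> g z" using a x g q(1) by (simp add: Hom_iff)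
  qed
  moreover have "inj_on g (carrier Q)"
  proof (rule inj_onI)
    fix z w assume "z \<in> carrier Q" "w \<in> carrier Q" and eq: "g z = g w"
    then obtain x y where xy: "x \<in> carrier M" "z = p x" "y \<in> carrier M" "w = p y" using p(2) by blast
    then show "z = w" using eq g fib by simp
  qed
  moreover have "g ` carrier Q = carrier P" using image_factor[where g = g and q = q, OF p(2) g] q(2) by simp
  ultimately show ?thesis unfolding mod_iso_def bij_betw_def by blast
qed

lemma quotient_projection:
  fixes M :: "('a, 'm) module"
  assumes M: "left_module R M" and U: "is_submodule R M U"
  shows "(\<lambda>x. U +>\<^bsub>M\<^esub> x) \<in> Hom R M (quotient_module M U)"
    and "(\<lambda>x. U +>\<^bsub>M\<^esub> x) ` carrier M = carrier (quotient_module M U)"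
    and "\<And>x y. x \<in> carrier M \<Longrightarrow> y \<in> carrier M \<Longrightarrow> U +>\<^bsub>M\<^esub> x = U +>\<^bsub>M\<^esub> y \<longleftrightarrow> x \<ominus>\<^bsub>M\<^esub> y \<in> U"
    and "x \<in> carrier M \<Longrightarrow> U +>\<^bsub>M\<^esub> x = \<zero>\<^bsub>quotient_module M U\<^esub> \<longleftrightarrow> x \<in> U"
proof -
  interpret left_module R M by fact
  interpret U: Module.submodule U R M by fact
  interpret ab: abelian_subgroup U M
    by (metis U.subgroup_axioms a_comm_group abelian_group.intro abelian_group_axioms abelian_subgroupI3
        additive_subgroup_def)
  have Uc: "U \<subseteq> carrier M" by (rule ab.a_subset)
  show fib: "U +>\<^bsub>M\<^esub> x = U +>\<^bsub>M\<^esub> y \<longleftrightarrow> x \<ominus>\<^bsub>M\<^esub> y \<in> U" if "x \<in> carrier M" "y \<in> carrier M" for x y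
  proof
    assume "U +>\<^bsub>M\<^esub> x = U +>\<^bsub>M\<^esub> y"
    then have "x \<in> U +>\<^bsub>M\<^esub> y" using ab.a_rcos_self that by blast
    then show "x \<ominus>\<^bsub>M\<^esub> y \<in> U" using ab.a_rcos_module_imp that by (simp add: a_minus_def)
  next
    assume "x \<ominus>\<^bsub>M\<^esub> y \<in> U"
    then have "x \<in> U +>\<^bsub>M\<^esub> y" using ab.a_rcos_module_rev that by (simp add: a_minus_def)
    then show "U +>\<^bsub>M\<^esub> x = U +>\<^bsub>M\<^esub> y"
      using a_repr_independence[of x U y] ab.a_subgroup that by simp
  qed
  have smult: "U <+>\<^bsub>M\<^esub> ((\<lambda>x. a \<odot>\<^bsub>M\<^esub> x) ` (U +>\<^bsub>M\<^esub> x)) = U +>\<^bsub>M\<^esub> (a \<odot>\<^bsub>M\<^esub> x)"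
    if a: "a \<in> carrier R" and x: "x \<in> carrier M" for a x
  proof (intro equalityI subsetI)
    fix z assume "z \<in> U <+>\<^bsub>M\<^esub> ((\<lambda>x. a \<odot>\<^bsub>M\<^esub> x) ` (U +>\<^bsub>M\<^esub> x))"
    then obtain u w where uw: "u \<in> U" "w \<in> U" "z = u \<oplus>\<^bsub>M\<^esub> a \<odot>\<^bsub>M\<^esub> (w \<oplus>\<^bsub>M\<^esub> x)"
      unfolding set_add_def' a_r_coset_def' by auto
    have wM: "w \<in> carrier M" "u \<in> carrier M" using uw Uc by auto
    have "z = (u \<oplus>\<^bsub>M\<^esub> a \<odot>\<^bsub>M\<^esub> w) \<oplus>\<^bsub>M\<^esub> a \<odot>\<^bsub>M\<^esub> x" using uw(3) wM a x by (simp add: smult_r_distr a_assoc)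
    moreover have "u \<oplus>\<^bsub>M\<^esub> a \<odot>\<^bsub>M\<^esub> w \<in> U" using uw(1,2) a by auto
    ultimately show "z \<in> U +>\<^bsub>M\<^esub> (a \<odot>\<^bsub>M\<^esub> x)" unfolding a_r_coset_def' by blast
  next
    fix z assume "z \<in> U +>\<^bsub>M\<^esub> (a \<odot>\<^bsub>M\<^esub> x)"
    then obtain u where u: "u \<in> U" "z = u \<oplus>\<^bsub>M\<^esub> a \<odot>\<^bsub>M\<^esub> x" unfolding a_r_coset_def' by auto
    have "x \<in> U +>\<^bsub>M\<^esub> x" using x by (rule ab.a_rcos_self)
    then show "z \<in> U <+>\<^bsub>M\<^esub> ((\<lambda>x. a \<odot>\<^bsub>M\<^esub> x) ` (U +>\<^bsub>M\<^esub> x))"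
      unfolding set_add_def' using u by auto
  qed
  show "(\<lambda>x. U +>\<^bsub>M\<^esub> x) ` carrier M = carrier (quotient_module M U)"
    by (auto simp: quotient_module_def A_RCOSETS_def')
  then show "(\<lambda>x. U +>\<^bsub>M\<^esub> x) \<in> Hom R M (quotient_module M U)"
    unfolding Hom_iff using smult by (auto simp: quotient_module_def ab.a_rcos_sum)
  show "U +>\<^bsub>M\<^esub> x = \<zero>\<^bsub>quotient_module M U\<^esub> \<longleftrightarrow> x \<in> U" if "x \<in> carrier M" for x
    using that ab.a_rcos_const[of x] a_coset_join1[OF _ that ab.a_subgroup] by (auto simp: quotient_module_def)
qed

lemma first_isomorphism:
  fixes M :: "('a, 'm) module" and N :: "('a, 'n) module"
  assumes M: "left_module R M" "left_module R N" and f: "f \<in> Hom R M N" "f ` carrier M = carrier N"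
  shows "mod_iso R N (quotient_module M (kern f M N))"
proof -
  interpret module_hom_pair R M N f
    using M f(1) by (simp add: module_hom_pair_def module_hom_pair_axioms_def)
  note q = quotient_projection[OF M(1) submodule_kern]
  show ?thesis by (rule epi_fibres_iso[OF M(1) f q(1,2)]) (simp add: q(3) eq_iff)
qed

section \<open>Finitely generated modules over a finite dimensional algebra\<close>

context fd_algebra
begin

lemma scalar_mult: "c \<in> carrier K \<Longrightarrow> a \<in> carrier A \<Longrightarrow> (c \<odot>\<^bsub>A\<^esub> \<one>\<^bsub>A\<^esub>) \<otimes>\<^bsub>A\<^esub> a = c \<odot>\<^bsub>A\<^esub> a"
  using smult_mult_left[of c "\<one>\<^bsub>A\<^esub>" a] by simp

lemma mult_scalar: "c \<in> carrier K \<Longrightarrow> a \<in> carrier A \<Longrightarrow> a \<otimes>\<^bsub>A\<^esub> (c \<odot>\<^bsub>A\<^esub> \<one>\<^bsub>A\<^esub>) = c \<odot>\<^bsub>A\<^esub> a"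
  using smult_mult_right[of c a "\<one>\<^bsub>A\<^esub>"] by simp

lemma underlying_simps [simp]:
  "carrier (underlying_vs A M) = carrier M" "zero (underlying_vs A M) = zero M"
  "add (underlying_vs A M) = add M"
  "smult (underlying_vs A M) c x = (c \<odot>\<^bsub>A\<^esub> \<one>\<^bsub>A\<^esub>) \<odot>\<^bsub>M\<^esub> x"
  by (simp_all add: underlying_vs_def)

lemma underlying_restrict: "underlying_vs A (M \<restriction> U) = (underlying_vs A M)\<lparr>carrier := U\<rparr>"
  by (simp add: underlying_vs_def)

lemma underlying_vectorspace:
  assumes "left_module A M"
  shows "vectorspace K (underlying_vs A M)"
proof -
  interpret M: left_module A M by fact
  have "abelian_group (underlying_vs A M)"
    by (rule abelian_groupI) (auto simp: M.a_ac intro: bexI[of _ "\<ominus>\<^bsub>M\<^esub> x" for x] M.l_neg)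
  then have "Module.module K (underlying_vs A M)"
    by (intro moduleI R.is_cring)
      (simp_all add: smult_l_distr M.smult_l_distr M.smult_r_distr smult_assoc1 scalar_mult flip: M.smult_assoc)
  then show ?thesis unfolding vectorspace_def by (simp add: field_axioms)
qed

lemma underlying_subspace:
  assumes M: "left_module A M" and U: "is_submodule A M U"
  shows "VectorSpace.subspace K U (underlying_vs A M)"
proof -
  interpret V: vectorspace K "underlying_vs A M" by (rule underlying_vectorspace[OF M])
  show ?thesis
    using U V.vectorspace_axioms V.module_axioms
    unfolding is_submodule_iff[OF M] VectorSpace.subspace_def LinearCombinations.submodule_def by auto
qed

lemma underlying_linear:
  assumes "left_module A M" "left_module A N" "f \<in> Hom A M N"
  shows "linear_map K (underlying_vs A M) (underlying_vs A N) f"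
proof -
  interpret V: vectorspace K "underlying_vs A M" by (rule underlying_vectorspace[OF assms(1)])
  interpret W: vectorspace K "underlying_vs A N" by (rule underlying_vectorspace[OF assms(2)])
  have "f \<in> LinearCombinations.module_hom K (underlying_vs A M) (underlying_vs A N)"
    using assms(3) by (simp add: Hom_iff LinearCombinations.module_hom_def Pi_iff)
  then show ?thesis
    by (intro linear_map.intro mod_hom.intro mod_hom_axioms.intro V.vectorspace_axioms W.vectorspace_axioms
        V.module_axioms W.module_axioms)
qed

text \<open>Products of a spanning set of \<open>A\<close> with generators of \<open>M\<close> span
  \<open>M\<close>. The converse holds because submodules are subspaces.\<close>

lemma fin_gen_iff:
  assumes M: "left_module A M"
  shows "fin_gen A M \<longleftrightarrow> vectorspace.fin_dim K (underlying_vs A M)"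
proof -
  interpret M: left_module A M by (rule M)
  interpret V: vectorspace K "underlying_vs A M" by (rule underlying_vectorspace[OF M])
  show ?thesis
  proof
    assume "fin_gen A M"
    then obtain G where G: "finite G" "G \<subseteq> carrier M"
      and gen: "\<And>U. is_submodule A M U \<Longrightarrow> G \<subseteq> U \<Longrightarrow> U = carrier M" unfolding fin_gen_def by blast
    obtain B where B: "finite B" "B \<subseteq> carrier A" "span B = carrier A"
      using finite_dimensional unfolding fin_dim_def by auto
    define S where "S = (\<lambda>(b, g). b \<odot>\<^bsub>M\<^esub> g) ` (B \<times> G)"
    have S: "finite S" "S \<subseteq> carrier (underlying_vs A M)" using G B(1,2) by (auto simp: S_def)
    define W where "W = V.span S"
    have W: "LinearCombinations.submodule K W (underlying_vs A M)"
      unfolding W_def by (rule V.span_is_submodule[OF S(2)])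
    note WD = LinearCombinations.submodule.subset[OF W] LinearCombinations.submodule.m_closed[OF W]
      LinearCombinations.submodule.zero_closed[OF W] LinearCombinations.submodule.smult_closed[OF W]
    have SW: "S \<subseteq> W" unfolding W_def by (rule V.in_own_span[OF S(2)])
    have AG: "a \<odot>\<^bsub>M\<^esub> g \<in> W" if a: "a \<in> carrier A" and g: "g \<in> G" for a g
    proof -
      have gM: "g \<in> carrier M" using g G(2) by blast
      have "LinearCombinations.submodule K {a \<in> carrier A. a \<odot>\<^bsub>M\<^esub> g \<in> W} A"
      proof (rule LinearCombinations.submodule.intro)
        fix c x assume c: "c \<in> carrier K" and "x \<in> {a \<in> carrier A. a \<odot>\<^bsub>M\<^esub> g \<in> W}"
        then have x: "x \<in> carrier A" "x \<odot>\<^bsub>M\<^esub> g \<in> W" by auto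
        have "(c \<odot>\<^bsub>A\<^esub> x) \<odot>\<^bsub>M\<^esub> g = (c \<odot>\<^bsub>A\<^esub> \<one>\<^bsub>A\<^esub>) \<odot>\<^bsub>M\<^esub> (x \<odot>\<^bsub>M\<^esub> g)"
          using c x(1) gM by (simp add: scalar_mult flip: M.smult_assoc)
        then show "c \<odot>\<^bsub>A\<^esub> x \<in> {a \<in> carrier A. a \<odot>\<^bsub>M\<^esub> g \<in> W}" using WD(4)[OF c x(2)] c x(1) by simp
      qed (use WD(2,3) gM in \<open>auto simp: module_axioms M.smult_l_distr\<close>)
      moreover have "B \<subseteq> {a \<in> carrier A. a \<odot>\<^bsub>M\<^esub> g \<in> W}" using B(2) SW g by (auto simp: S_def)
      ultimately have "span B \<subseteq> {a \<in> carrier A. a \<odot>\<^bsub>M\<^esub> g \<in> W}" by (intro span_is_subset)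
      then show ?thesis using B(3) a by blast
    qed
    \<comment> \<open>The vectors that \<open>a\<close> sends into \<open>W\<close> form a subspace,
      which contains the spanning set \<open>S\<close> of \<open>W\<close>.\<close>
    have AW: "W \<subseteq> {x \<in> carrier M. a \<odot>\<^bsub>M\<^esub> x \<in> W}" if a: "a \<in> carrier A" for a
    proof -
      have "LinearCombinations.submodule K {x \<in> carrier M. a \<odot>\<^bsub>M\<^esub> x \<in> W} (underlying_vs A M)"
      proof (rule LinearCombinations.submodule.intro)
        fix c x assume c: "c \<in> carrier K" and "x \<in> {x \<in> carrier M. a \<odot>\<^bsub>M\<^esub> x \<in> W}"
        then have x: "x \<in> carrier M" "a \<odot>\<^bsub>M\<^esub> x \<in> W" by auto
        have "a \<odot>\<^bsub>M\<^esub> ((c \<odot>\<^bsub>A\<^esub> \<one>\<^bsub>A\<^esub>) \<odot>\<^bsub>M\<^esub> x) = (c \<odot>\<^bsub>A\<^esub> \<one>\<^bsub>A\<^esub>) \<odot>\<^bsub>M\<^esub> (a \<odot>\<^bsub>M\<^esub> x)"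
          using a c x(1) by (simp add: scalar_mult mult_scalar flip: M.smult_assoc)
        then show "c \<odot>\<^bsub>underlying_vs A M\<^esub> x \<in> {x \<in> carrier M. a \<odot>\<^bsub>M\<^esub> x \<in> W}"
          using WD(4)[OF c x(2)] c x(1) by simp
      qed (use WD(2,3) a in \<open>auto simp: V.module_axioms M.smult_r_distr\<close>)
      moreover have "S \<subseteq> {x \<in> carrier M. a \<odot>\<^bsub>M\<^esub> x \<in> W}"
        using a AG[OF A.m_closed[OF a]] B(2) G(2) by (auto simp: S_def subset_iff simp flip: M.smult_assoc)
      ultimately show ?thesis unfolding W_def[symmetric] using V.span_is_subset W_def by blast
    qed
    have "is_submodule A M W"
      unfolding is_submodule_iff[OF M] using WD(1-3) subsetD[OF AW] by auto
    moreover have "G \<subseteq> W" using AG[OF A.one_closed] G(2) by (auto simp: subset_iff)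
    ultimately have "V.span S = carrier (underlying_vs A M)" using gen W_def by simp
    then show "V.fin_dim" unfolding V.fin_dim_def using S by blast
  next
    assume "V.fin_dim"
    then obtain G where G: "finite G" "G \<subseteq> carrier M" "V.span G = carrier M"
      unfolding V.fin_dim_def by auto
    have "U = carrier M" if U: "is_submodule A M U" "G \<subseteq> U" for U
    proof -
      have "V.span G \<subseteq> U"
        using V.span_is_subset[OF U(2)] underlying_subspace[OF M U(1)] by (simp add: VectorSpace.subspace_def)
      then show ?thesis using G(3) U(1) by (auto simp: is_submodule_iff[OF M])
    qed
    then show "fin_gen A M" unfolding fin_gen_def using G(1,2) by blast
  qed
qed

lemma mod_catI: "left_module A M \<Longrightarrow> vectorspace.fin_dim K (underlying_vs A M) \<Longrightarrow> M \<in> mod_cat A"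
  by (simp add: mod_cat_def fin_gen_iff)

lemma mod_catD: "M \<in> mod_cat A \<Longrightarrow> left_module A M" "M \<in> mod_cat A \<Longrightarrow> vectorspace.fin_dim K (underlying_vs A M)"
  by (auto simp: mod_cat_def fin_gen_iff)

lemma mod_cat_restrict:
  assumes "M \<in> mod_cat A" "is_submodule A M U"
  shows "M \<restriction> U \<in> mod_cat A"
proof (rule mod_catI)
  have M: "left_module A M" by (rule mod_catD[OF assms(1)])
  show "left_module A (M \<restriction> U)" by (rule left_module_restrict[OF M assms(2)])
  interpret V: vectorspace K "underlying_vs A M" by (rule underlying_vectorspace[OF M])
  show "vectorspace.fin_dim K (underlying_vs A (M \<restriction> U))"
    using V.subspace_fin_dim[OF mod_catD(2)[OF assms(1)] underlying_subspace[OF M assms(2)]]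
    by (simp add: underlying_restrict)
qed

lemma Hom_comp: "f \<in> Hom A M N \<Longrightarrow> g \<in> Hom A N P \<Longrightarrow> (\<lambda>x. g (f x)) \<in> Hom A M P"
  by (simp add: Hom_iff)

text \<open>Cosets form a carrier of another type, so the quotient is transported back by
  \<open>mod_cat_universal\<close>. The product below needs the same detour.\<close>

lemma mod_cat_quotient:
  assumes M: "M \<in> mod_cat A" and U: "is_submodule A M U"
  shows "\<exists>Q\<in>mod_cat A. \<exists>p\<in>Hom A M Q. p ` carrier M = carrier Q \<and> kern p M Q = U"
proof -
  have lm: "left_module A M" by (rule mod_catD[OF M])
  let ?Q = "quotient_module M U" and ?p = "\<lambda>x. U +>\<^bsub>M\<^esub> x"
  note p = quotient_projection[OF lm U]
  have lQ: "left_module A ?Q" by (rule quotient_module_is_left_module[OF lm U])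
  interpret linear_map K "underlying_vs A M" "underlying_vs A ?Q" ?p
    by (rule underlying_linear[OF lm lQ p(1)])
  have "W.fin_dim" using surj_fin_dim[OF mod_catD(2)[OF M]] p(2) by simp
  then have "fin_gen A ?Q" by (simp add: fin_gen_iff[OF lQ])
  then obtain Q where Q: "Q \<in> mod_cat A" "mod_iso A ?Q Q"
    using mod_cat_universal[OF fd_algebra_axioms lQ] by blast
  then obtain f where f: "f \<in> Hom A ?Q Q" "bij_betw f (carrier ?Q) (carrier Q)" unfolding mod_iso_def by blast
  interpret f: module_hom_pair A ?Q Q f
    using lQ mod_catD(1)[OF Q(1)] f(1) by (simp add: module_hom_pair_def module_hom_pair_axioms_def)
  have z: "f y = \<zero>\<^bsub>Q\<^esub> \<longleftrightarrow> y = \<zero>\<^bsub>?Q\<^esub>" if "y \<in> carrier ?Q" for y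
    using that f.inj_on_iff f(2) by (auto simp: bij_betw_def kern_def)
  have pc: "?p x \<in> carrier ?Q" if "x \<in> carrier M" for x using p(1) that by (simp add: Hom_iff)
  have "kern (\<lambda>x. f (?p x)) M Q = U"
    using z[OF pc] p(4) U unfolding kern_def is_submodule_iff[OF lm] by auto
  moreover have "(\<lambda>x. f (?p x)) ` carrier M = carrier Q"
    using p(2) f(2) by (simp add: bij_betw_def flip: image_image)
  ultimately show ?thesis using Q(1) Hom_comp[OF p(1) f(1)] by blast
qed

definition product_module :: "('a, 'm) module \<Rightarrow> ('a, 'n) module \<Rightarrow> ('a, 'm \<times> 'n) module" where
  "product_module M N =
     \<lparr>carrier = carrier M \<times> carrier N, monoid.mult = undefined, one = undefined,
      zero = (\<zero>\<^bsub>M\<^esub>, \<zero>\<^bsub>N\<^esub>), add = (\<lambda>x y. (fst x \<oplus>\<^bsub>M\<^esub> fst y, snd x \<oplus>\<^bsub>N\<^esub> snd y)),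
      smult = (\<lambda>a x. (a \<odot>\<^bsub>M\<^esub> fst x, a \<odot>\<^bsub>N\<^esub> snd x))\<rparr>"

lemma product_module_simps [simp]:
  "carrier (product_module M N) = carrier M \<times> carrier N"
  "zero (product_module M N) = (\<zero>\<^bsub>M\<^esub>, \<zero>\<^bsub>N\<^esub>)"
  "add (product_module M N) x y = (fst x \<oplus>\<^bsub>M\<^esub> fst y, snd x \<oplus>\<^bsub>N\<^esub> snd y)"
  "smult (product_module M N) a x = (a \<odot>\<^bsub>M\<^esub> fst x, a \<odot>\<^bsub>N\<^esub> snd x)"
  by (simp_all add: product_module_def)

lemma product_left_module:
  assumes "left_module A M" "left_module A N"
  shows "left_module A (product_module M N)"
proof -
  interpret M: left_module A M by fact
  interpret N: left_module A N by fact
  have "abelian_group (product_module M N)"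
  proof (rule abelian_groupI)
    fix x assume "x \<in> carrier (product_module M N)"
    then show "\<exists>y\<in>carrier (product_module M N). y \<oplus>\<^bsub>product_module M N\<^esub> x = \<zero>\<^bsub>product_module M N\<^esub>"
      by (intro bexI[of _ "(\<ominus>\<^bsub>M\<^esub> fst x, \<ominus>\<^bsub>N\<^esub> snd x)"]) (auto simp: M.l_neg N.l_neg)
  qed (auto simp: M.a_ac N.a_ac)
  then show ?thesis
    by (intro left_module.intro left_module_axioms.intro A.ring_axioms)
      (auto simp: M.smult_l_distr M.smult_r_distr M.smult_assoc N.smult_l_distr N.smult_r_distr N.smult_assoc)
qed

lemma product_fin_gen:
  assumes M: "left_module A M" "fin_gen A M" and N: "left_module A N" "fin_gen A N"
  shows "fin_gen A (product_module M N)"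
proof -
  interpret M: left_module A M by fact
  interpret N: left_module A N by fact
  note P = product_left_module[OF M(1) N(1)]
  obtain G where G: "finite G" "G \<subseteq> carrier M" "\<And>U. is_submodule A M U \<Longrightarrow> G \<subseteq> U \<Longrightarrow> U = carrier M"
    using M(2) unfolding fin_gen_def by blast
  obtain H where H: "finite H" "H \<subseteq> carrier N" "\<And>U. is_submodule A N U \<Longrightarrow> H \<subseteq> U \<Longrightarrow> U = carrier N"
    using N(2) unfolding fin_gen_def by blast
  let ?S = "(\<lambda>x. (x, \<zero>\<^bsub>N\<^esub>)) ` G \<union> (\<lambda>y. (\<zero>\<^bsub>M\<^esub>, y)) ` H"
  have "U = carrier (product_module M N)" if U: "is_submodule A (product_module M N) U" "?S \<subseteq> U" for U
  proof -
    have s: "U \<subseteq> carrier M \<times> carrier N" "(\<zero>\<^bsub>M\<^esub>, \<zero>\<^bsub>N\<^esub>) \<in> U"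
      "\<And>x y. x \<in> U \<Longrightarrow> y \<in> U \<Longrightarrow> (fst x \<oplus>\<^bsub>M\<^esub> fst y, snd x \<oplus>\<^bsub>N\<^esub> snd y) \<in> U"
      "\<And>a x. a \<in> carrier A \<Longrightarrow> x \<in> U \<Longrightarrow> (a \<odot>\<^bsub>M\<^esub> fst x, a \<odot>\<^bsub>N\<^esub> snd x) \<in> U"
      using U(1) unfolding is_submodule_iff[OF P] by auto
    have "is_submodule A M {x \<in> carrier M. (x, \<zero>\<^bsub>N\<^esub>) \<in> U}"
      unfolding is_submodule_iff[OF M(1)]
    proof (intro conjI ballI)
      fix x y assume "x \<in> {x \<in> carrier M. (x, \<zero>\<^bsub>N\<^esub>) \<in> U}" "y \<in> {x \<in> carrier M. (x, \<zero>\<^bsub>N\<^esub>) \<in> U}"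
      then show "x \<oplus>\<^bsub>M\<^esub> y \<in> {x \<in> carrier M. (x, \<zero>\<^bsub>N\<^esub>) \<in> U}"
        using s(3)[of "(x, \<zero>\<^bsub>N\<^esub>)" "(y, \<zero>\<^bsub>N\<^esub>)"] by simp
    next
      fix a x assume "a \<in> carrier A" "x \<in> {x \<in> carrier M. (x, \<zero>\<^bsub>N\<^esub>) \<in> U}"
      then show "a \<odot>\<^bsub>M\<^esub> x \<in> {x \<in> carrier M. (x, \<zero>\<^bsub>N\<^esub>) \<in> U}" using s(4)[of a "(x, \<zero>\<^bsub>N\<^esub>)"] by simp
    qed (use s(2) in auto)
    then have 1: "{x \<in> carrier M. (x, \<zero>\<^bsub>N\<^esub>) \<in> U} = carrier M" using U(2) G(2) by (intro G(3)) auto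
    have "is_submodule A N {y \<in> carrier N. (\<zero>\<^bsub>M\<^esub>, y) \<in> U}"
      unfolding is_submodule_iff[OF N(1)]
    proof (intro conjI ballI)
      fix x y assume "x \<in> {y \<in> carrier N. (\<zero>\<^bsub>M\<^esub>, y) \<in> U}" "y \<in> {y \<in> carrier N. (\<zero>\<^bsub>M\<^esub>, y) \<in> U}"
      then show "x \<oplus>\<^bsub>N\<^esub> y \<in> {y \<in> carrier N. (\<zero>\<^bsub>M\<^esub>, y) \<in> U}"
        using s(3)[of "(\<zero>\<^bsub>M\<^esub>, x)" "(\<zero>\<^bsub>M\<^esub>, y)"] by simp
    next
      fix a x assume "a \<in> carrier A" "x \<in> {y \<in> carrier N. (\<zero>\<^bsub>M\<^esub>, y) \<in> U}"
      then show "a \<odot>\<^bsub>N\<^esub> x \<in> {y \<in> carrier N. (\<zero>\<^bsub>M\<^esub>, y) \<in> U}" using s(4)[of a "(\<zero>\<^bsub>M\<^esub>, x)"] by simp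
    qed (use s(2) in auto)
    then have 2: "{y \<in> carrier N. (\<zero>\<^bsub>M\<^esub>, y) \<in> U} = carrier N" using U(2) H(2) by (intro H(3)) auto
    have "(x, y) \<in> U" if "x \<in> carrier M" "y \<in> carrier N" for x y
      using s(3)[of "(x, \<zero>\<^bsub>N\<^esub>)" "(\<zero>\<^bsub>M\<^esub>, y)"] 1 2 that by auto
    then show ?thesis using s(1) by auto
  qed
  then show ?thesis unfolding fin_gen_def using G(1,2) H(1,2)
    by (intro exI[of _ ?S]) auto
qed

lemma mod_cat_product:
  assumes M: "M \<in> mod_cat A" and N: "N \<in> mod_cat A"
  shows "\<exists>P\<in>mod_cat A. \<exists>a\<in>Hom A P M. \<exists>b\<in>Hom A P N.
    bij_betw (\<lambda>z. (a z, b z)) (carrier P) (carrier M \<times> carrier N)"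
proof -
  let ?P = "product_module M N"
  have MN: "left_module A M" "fin_gen A M" "left_module A N" "fin_gen A N"
    using M N by (auto simp: mod_cat_def)
  have lP: "left_module A ?P" by (rule product_left_module[OF MN(1,3)])
  obtain P where P: "P \<in> mod_cat A" "mod_iso A ?P P"
    using mod_cat_universal[OF fd_algebra_axioms lP product_fin_gen[OF MN]] by blast
  then obtain f where f: "f \<in> Hom A ?P P" "bij_betw f (carrier ?P) (carrier P)" unfolding mod_iso_def by blast
  define g where "g = inv_into (carrier ?P) f"
  have g: "bij_betw g (carrier P) (carrier ?P)" unfolding g_def by (rule bij_betw_inv_into[OF f(2)])
  have fg: "f (g z) = z" if "z \<in> carrier P" for z
    unfolding g_def using f(2) that by (simp add: bij_betw_inv_into_right)
  have gc: "g z \<in> carrier ?P" if "z \<in> carrier P" for z using g that by (auto simp: bij_betw_def)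
  have gf: "g (f x) = x" if "x \<in> carrier ?P" for x
    unfolding g_def using f(2) that by (simp add: bij_betw_inv_into_left)
  interpret P: left_module A ?P by (rule lP)
  have gH: "g \<in> Hom A P ?P" unfolding Hom_iff
  proof (intro conjI ballI)
    fix z w assume zw: "z \<in> carrier P" "w \<in> carrier P"
    have "f (g z \<oplus>\<^bsub>?P\<^esub> g w) = z \<oplus>\<^bsub>P\<^esub> w" using f(1) gc zw fg unfolding Hom_iff by metis
    then show "g (z \<oplus>\<^bsub>P\<^esub> w) = g z \<oplus>\<^bsub>?P\<^esub> g w" using gf P.a_closed gc zw by metis
  next
    fix a z assume az: "a \<in> carrier A" "z \<in> carrier P"
    have "f (a \<odot>\<^bsub>?P\<^esub> g z) = a \<odot>\<^bsub>P\<^esub> z" using f(1) gc az fg unfolding Hom_iff by metis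
    then show "g (a \<odot>\<^bsub>P\<^esub> z) = a \<odot>\<^bsub>?P\<^esub> g z" using gf P.smult_closed gc az by metis
  qed (rule gc)
  have "fst \<in> Hom A ?P M" "snd \<in> Hom A ?P N" by (auto simp: Hom_iff)
  from this[THEN Hom_comp[OF gH]]
  have "(\<lambda>z. fst (g z)) \<in> Hom A P M" "(\<lambda>z. snd (g z)) \<in> Hom A P N" by auto
  moreover have "bij_betw (\<lambda>z. (fst (g z), snd (g z))) (carrier P) (carrier M \<times> carrier N)"
    using g by simp
  ultimately show ?thesis
    by (intro bexI[OF _ P(1)] bexI[of _ "\<lambda>z. fst (g z)"] bexI[of _ "\<lambda>z. snd (g z)"])
qed

text \<open>This is rank-nullity for the underlying vector spaces.\<close>

lemma mod_dim_Hom: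
  assumes "M \<in> mod_cat A" "N \<in> mod_cat A" "f \<in> Hom A M N"
  shows "mod_dim K A M = mod_dim K A (M \<restriction> kern f M N) + mod_dim K A (N \<restriction> (f ` carrier M))"
proof -
  interpret linear_map K "underlying_vs A M" "underlying_vs A N" f
    using underlying_linear mod_catD(1) assms by blast
  have "im = f ` carrier M" "ker = kern f M N" by (auto simp: im_def ker_def kern_def)
  then show ?thesis
    using rank_nullity[OF mod_catD(2)[OF assms(1)]] by (simp add: mod_dim_def underlying_restrict)
qed

lemma mod_dim_eq_0:
  assumes M: "M \<in> mod_cat A"
  shows "mod_dim K A M = 0 \<longleftrightarrow> carrier M = {\<zero>\<^bsub>M\<^esub>}"
proof -
  interpret V: vectorspace K "underlying_vs A M" by (rule underlying_vectorspace[OF mod_catD(1)[OF M]])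
  have fd: "V.fin_dim" by (rule mod_catD(2)[OF M])
  show ?thesis
  proof
    assume 0: "mod_dim K A M = 0"
    obtain \<beta> where "finite \<beta>" "V.basis \<beta>" using V.finite_basis_exists[OF fd] by blast
    then have "\<beta> = {}" using V.dim_basis[of \<beta>] 0 by (simp add: mod_dim_def)
    then show "carrier M = {\<zero>\<^bsub>M\<^esub>}" using \<open>V.basis \<beta>\<close> V.span_empty by (simp add: V.basis_def)
  next
    assume "carrier M = {\<zero>\<^bsub>M\<^esub>}"
    then have "V.gen_set {\<zero>\<^bsub>underlying_vs A M\<^esub>}"
      using V.in_own_span[of "{\<zero>\<^bsub>underlying_vs A M\<^esub>}"] V.span_is_subset2[of "{\<zero>\<^bsub>underlying_vs A M\<^esub>}"] by auto
    then show "mod_dim K A M = 0" unfolding mod_dim_def by (rule V.dim0I)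
  qed
qed

lemma scalar_smult_Hom:
  assumes M: "left_module A M" and c: "c \<in> carrier K"
  shows "(\<lambda>x. (c \<odot>\<^bsub>A\<^esub> \<one>\<^bsub>A\<^esub>) \<odot>\<^bsub>M\<^esub> x) \<in> Hom A M M"
proof -
  interpret M: left_module A M by (rule M)
  show ?thesis unfolding Hom_iff using c
    by (simp add: M.smult_r_distr scalar_mult mult_scalar flip: M.smult_assoc)
qed

lemma scalar_smult_inverse:
  assumes M: "left_module A M" and c: "c \<in> carrier K" "c \<noteq> \<zero>\<^bsub>K\<^esub>" and x: "x \<in> carrier M"
  shows "(inv\<^bsub>K\<^esub> c \<odot>\<^bsub>A\<^esub> \<one>\<^bsub>A\<^esub>) \<odot>\<^bsub>M\<^esub> ((c \<odot>\<^bsub>A\<^esub> \<one>\<^bsub>A\<^esub>) \<odot>\<^bsub>M\<^esub> x) = x"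
proof -
  interpret M: left_module A M by (rule M)
  have u: "c \<in> Units K" using c field_Units by auto
  then have i: "inv\<^bsub>K\<^esub> c \<in> carrier K" "inv\<^bsub>K\<^esub> c \<otimes>\<^bsub>K\<^esub> c = \<one>\<^bsub>K\<^esub>" by simp_all
  have "(inv\<^bsub>K\<^esub> c \<odot>\<^bsub>A\<^esub> \<one>\<^bsub>A\<^esub>) \<otimes>\<^bsub>A\<^esub> (c \<odot>\<^bsub>A\<^esub> \<one>\<^bsub>A\<^esub>) = \<one>\<^bsub>A\<^esub>"
    using c i by (simp add: scalar_mult flip: smult_assoc1)
  then show ?thesis using c(1) i(1) x by (simp flip: M.smult_assoc)
qed

definition scalars :: "'a set" where
  "scalars = (\<lambda>c. c \<odot>\<^bsub>A\<^esub> \<one>\<^bsub>A\<^esub>) ` carrier K"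

lemma scalar_smult_cases:
  assumes M: "left_module A M" and s: "s \<in> scalars"
  shows "(\<forall>x\<in>carrier M. s \<odot>\<^bsub>M\<^esub> x = \<zero>\<^bsub>M\<^esub>) \<or> (\<forall>x\<in>carrier M. s \<odot>\<^bsub>M\<^esub> x = \<zero>\<^bsub>M\<^esub> \<longrightarrow> x = \<zero>\<^bsub>M\<^esub>)"
proof -
  interpret M: left_module A M by (rule M)
  obtain c where c: "c \<in> carrier K" "s = c \<odot>\<^bsub>A\<^esub> \<one>\<^bsub>A\<^esub>" using s by (auto simp: scalars_def)
  show ?thesis
  proof (cases "c = \<zero>\<^bsub>K\<^esub>")
    case True
    then have "s = \<zero>\<^bsub>A\<^esub>" using c by simp
    then show ?thesis by simp
  next
    case False
    have "x = \<zero>\<^bsub>M\<^esub>" if "x \<in> carrier M" "s \<odot>\<^bsub>M\<^esub> x = \<zero>\<^bsub>M\<^esub>" for x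
      using scalar_smult_inverse[OF M c(1) False that(1)] that(2) c False field_Units by simp
    then show ?thesis by blast
  qed
qed

lemma scalar_eigenvector:
  assumes M: "M \<in> mod_cat A" "carrier M \<noteq> {\<zero>\<^bsub>M\<^esub>}" and f: "f \<in> Hom A M M"
  shows "\<exists>s\<in>scalars. \<exists>x\<in>carrier M. x \<noteq> \<zero>\<^bsub>M\<^esub> \<and> f x = s \<odot>\<^bsub>M\<^esub> x"
proof -
  have lm: "left_module A M" by (rule mod_catD[OF M(1)])
  interpret M: left_module A M by (rule lm)
  interpret V: vectorspace K "underlying_vs A M" by (rule underlying_vectorspace[OF lm])
  obtain u where u: "u \<in> carrier M" "u \<noteq> \<zero>\<^bsub>M\<^esub>" using M(2) M.zero_closed by blast
  interpret pointed_endomorphism K "underlying_vs A M" f u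
    by unfold_locales (use f u(1) in \<open>simp_all add: Hom_iff\<close>)
  show ?thesis
    using eigenvector_ex[OF alg_closed mod_catD(2)[OF M(1)]] u(2) by (auto simp: scalars_def)
qed

text \<open>The length is the dimension over \<open>K\<close>: all that is asked of it is additivity
  and the detection of the zero module.\<close>

sublocale mods: length_category A "mod_cat A" "mod_dim K A"
  by (intro length_category.intro mod_catD mod_cat_restrict mod_cat_quotient mod_cat_product mod_dim_Hom mod_dim_eq_0)

sublocale mods: brick_category A "mod_cat A" "mod_dim K A" scalars
proof unfold_locales
  fix s assume "s \<in> scalars"
  then obtain c where c: "c \<in> carrier K" "s = c \<odot>\<^bsub>A\<^esub> \<one>\<^bsub>A\<^esub>" by (auto simp: scalars_def)
  show "s \<in> carrier A" using c by simp
  show "mods.mor (\<lambda>x. s \<odot>\<^bsub>M\<^esub> x) M M" if "M \<in> mod_cat A" for M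
    using scalar_smult_Hom[OF mod_catD(1)[OF that] c(1)] that c(2) by (simp add: mods.mor_def)
next
  fix s and M :: "('a, nat \<Rightarrow> 'k) module" assume "s \<in> scalars" "M \<in> mod_cat A"
  then show "(\<forall>x\<in>carrier M. s \<odot>\<^bsub>M\<^esub> x = \<zero>\<^bsub>M\<^esub>) \<or> (\<forall>x\<in>carrier M. s \<odot>\<^bsub>M\<^esub> x = \<zero>\<^bsub>M\<^esub> \<longrightarrow> x = \<zero>\<^bsub>M\<^esub>)"
    by (intro scalar_smult_cases mod_catD)
qed (simp add: mods.mor_def scalar_eigenvector)

end

section \<open>Bricks, simple modules and semibricks over an algebra\<close>

context length_category
begin

lemma mod_iso_trivial:
  assumes MN: "M \<in> C" "N \<in> C" and iso: "mod_iso R M N" and zero: "Hom_zero R M N"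
  shows "carrier M = {\<zero>\<^bsub>M\<^esub>}"
proof -
  obtain f where f: "mor f M N" "bij_betw f (carrier M) (carrier N)" by (rule mod_isoE[OF iso MN])
  then have "kern f M N = carrier M" using zero MN by (auto simp: Hom_zero_iff kern_def)
  then show ?thesis using f mor_inj_iff by (auto simp: bij_betw_def)
qed

text \<open>A nonzero submodule of least length has no proper nonzero submodule.\<close>

lemma simple_submodule_ex:
  assumes M: "M \<in> C" "carrier M \<noteq> {\<zero>\<^bsub>M\<^esub>}"
  shows "\<exists>U. simple (M \<restriction> U)"
proof -
  let ?P = "\<lambda>U. submod U M \<and> U \<noteq> {\<zero>\<^bsub>M\<^esub>}"
  have "?P (carrier M)" using submod_carrier M by blast
  then obtain U where U: "?P U" and min: "\<And>V. ?P V \<Longrightarrow> len (M \<restriction> U) \<le> len (M \<restriction> V)"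
    using ex_has_least_nat[of ?P "carrier M" "\<lambda>U. len (M \<restriction> U)"] by blast
  have "simple (M \<restriction> U)" unfolding simple_def
  proof (intro conjI allI impI)
    show "M \<restriction> U \<in> C" using submod_restrict_in U by blast
    show "carrier (M \<restriction> U) \<noteq> {\<zero>\<^bsub>M \<restriction> U\<^esub>}" using U by simp
    fix V assume V: "submod V (M \<restriction> U)"
    then have "submod V M" using submod_restrict U by blast
    then show "V = {\<zero>\<^bsub>M \<restriction> U\<^esub>} \<or> V = carrier (M \<restriction> U)"
      using min[of V] len_restrict_le[OF V] len_restrict_eq[OF V] by (cases "V = {\<zero>\<^bsub>M\<^esub>}") simp_all
  qed
  then show ?thesis by blast
qed

lemma iso_to_submodule_len:
  assumes "iso_to_submodule R N M" "N \<in> C" "M \<in> C"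
  shows "len N \<le> len M"
proof -
  obtain U where U: "submod U M" "mod_iso R N (M \<restriction> U)"
    using assms unfolding iso_to_submodule_def submod_def by blast
  then show ?thesis using len_mod_iso[OF U(2) assms(2) submod_restrict_in] len_restrict_le by force
qed

end

context fd_algebra
begin

lemma End_algebra_simps [simp]:
  "carrier (End_algebra A M) = Hom A M M \<inter> extensional (carrier M)"
  "f \<otimes>\<^bsub>End_algebra A M\<^esub> g = compose (carrier M) f g"
  "one (End_algebra A M) = (\<lambda>x\<in>carrier M. x)"
  "f \<oplus>\<^bsub>End_algebra A M\<^esub> g = (\<lambda>x\<in>carrier M. f x \<oplus>\<^bsub>M\<^esub> g x)"
  "c \<odot>\<^bsub>End_algebra A M\<^esub> f = (\<lambda>x\<in>carrier M. (c \<odot>\<^bsub>A\<^esub> \<one>\<^bsub>A\<^esub>) \<odot>\<^bsub>M\<^esub> f x)"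
  by (simp_all add: End_algebra_def)

lemma ground_algebra_simps [simp]:
  "carrier (ground_algebra K) = carrier K" "monoid.mult (ground_algebra K) = monoid.mult K"
  "one (ground_algebra K) = one K" "add (ground_algebra K) = add K" "smult (ground_algebra K) = monoid.mult K"
  by (simp_all add: ground_algebra_def)

lemma scalar_faithful:
  assumes M: "left_module A M" and cd: "c \<in> carrier K" "d \<in> carrier K"
    and x: "x \<in> carrier M" "x \<noteq> \<zero>\<^bsub>M\<^esub>" and eq: "(c \<odot>\<^bsub>A\<^esub> \<one>\<^bsub>A\<^esub>) \<odot>\<^bsub>M\<^esub> x = (d \<odot>\<^bsub>A\<^esub> \<one>\<^bsub>A\<^esub>) \<odot>\<^bsub>M\<^esub> x"
  shows "c = d"
proof (rule ccontr)
  interpret M: left_module A M by (rule M)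
  interpret V: vectorspace K "underlying_vs A M" by (rule underlying_vectorspace[OF M])
  assume "c \<noteq> d"
  then have e: "c \<ominus>\<^bsub>K\<^esub> d \<in> carrier K" "c \<ominus>\<^bsub>K\<^esub> d \<noteq> \<zero>\<^bsub>K\<^esub>" using cd by auto
  have "d \<odot>\<^bsub>underlying_vs A M\<^esub> x = ((c \<ominus>\<^bsub>K\<^esub> d) \<oplus>\<^bsub>K\<^esub> d) \<odot>\<^bsub>underlying_vs A M\<^esub> x"
    using eq cd by (simp add: R.minus_eq R.a_assoc R.l_neg)
  also have "\<dots> = (c \<ominus>\<^bsub>K\<^esub> d) \<odot>\<^bsub>underlying_vs A M\<^esub> x \<oplus>\<^bsub>underlying_vs A M\<^esub> d \<odot>\<^bsub>underlying_vs A M\<^esub> x"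
    using cd e(1) x(1) by (intro V.smult_l_distr) simp_all
  finally have "((c \<ominus>\<^bsub>K\<^esub> d) \<odot>\<^bsub>A\<^esub> \<one>\<^bsub>A\<^esub>) \<odot>\<^bsub>M\<^esub> x = \<zero>\<^bsub>M\<^esub>"
    using cd e(1) x(1) by (simp add: M.add.r_cancel_one')
  then show False
    using scalar_smult_inverse[OF M e x(1)] x(2) e field_Units by simp
qed

text \<open>A linear ring isomorphism sends \<open>c\<close> times the identity to \<open>c\<close>,
  so its injectivity identifies each endomorphism with a scalar. Conversely, on a nonzero module
  distinct scalars act differently, and all endomorphisms are scalars.\<close>

lemma mem_bricks_iff: "M \<in> bricks K A \<longleftrightarrow> mods.brick M"
proof (cases "M \<in> mod_cat A")
  case True
  have lm: "left_module A M" by (rule mod_catD[OF True])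
  interpret M: left_module A M by (rule lm)
  let ?id = "\<lambda>x\<in>carrier M. x"
  have one: "?id \<in> carrier (End_algebra A M)" by (simp add: Hom_iff)
  show ?thesis
  proof
    assume "M \<in> bricks K A"
    then obtain h where h: "h \<in> ring_iso (End_algebra A M) (ground_algebra K)"
      and lin: "\<And>c f. c \<in> carrier K \<Longrightarrow> f \<in> carrier (End_algebra A M) \<Longrightarrow>
        h (c \<odot>\<^bsub>End_algebra A M\<^esub> f) = c \<otimes>\<^bsub>K\<^esub> h f"
      unfolding bricks_def algebra_iso_def by auto
    have h1: "h ?id = \<one>\<^bsub>K\<^esub>" using ring_hom_one[of h "End_algebra A M" "ground_algebra K"] h by (simp add: ring_iso_def)
    have inj: "inj_on h (carrier (End_algebra A M))" using h by (simp add: ring_iso_def bij_betw_def)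
    have hc: "h (c \<odot>\<^bsub>End_algebra A M\<^esub> ?id) = c" if "c \<in> carrier K" for c
      using lin[OF that one] h1 that by simp
    have cid: "c \<odot>\<^bsub>End_algebra A M\<^esub> ?id \<in> carrier (End_algebra A M)" if "c \<in> carrier K" for c
      using scalar_smult_Hom[OF lm that] by (simp add: Hom_iff)
    have "carrier M \<noteq> {\<zero>\<^bsub>M\<^esub>}"
    proof
      assume "carrier M = {\<zero>\<^bsub>M\<^esub>}"
      then have "\<zero>\<^bsub>K\<^esub> \<odot>\<^bsub>End_algebra A M\<^esub> ?id = ?id" by (auto simp: fun_eq_iff)
      then show False using hc[of "\<zero>\<^bsub>K\<^esub>"] h1 by simp
    qed
    moreover have "\<exists>s\<in>scalars. \<forall>x\<in>carrier M. f x = s \<odot>\<^bsub>M\<^esub> x" if f: "mods.mor f M M" for f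
    proof -
      have g: "restrict f (carrier M) \<in> carrier (End_algebra A M)"
        using f by (simp add: mods.mor_iff Hom_iff)
      define c where "c = h (restrict f (carrier M))"
      have c: "c \<in> carrier K" using g h unfolding c_def ring_iso_def bij_betw_def by auto
      have "restrict f (carrier M) = c \<odot>\<^bsub>End_algebra A M\<^esub> ?id"
        by (rule inj_onD[OF inj _ g cid[OF c]]) (unfold hc[OF c], simp add: c_def)
      then have "f x = (c \<odot>\<^bsub>A\<^esub> \<one>\<^bsub>A\<^esub>) \<odot>\<^bsub>M\<^esub> x" if "x \<in> carrier M" for x
        using that by (auto dest: fun_cong[of _ _ x])
      then show ?thesis using c by (auto simp: scalars_def)
    qed
    ultimately show "mods.brick M" using True by (simp add: mods.brick_def)
  next
    assume brick: "mods.brick M"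
    \<comment> \<open>The required isomorphism is the inverse of the embedding \<open>g\<close> of
      the scalars, for which the ring laws are immediate.\<close>
    define g where "g c = (\<lambda>x\<in>carrier M. (c \<odot>\<^bsub>A\<^esub> \<one>\<^bsub>A\<^esub>) \<odot>\<^bsub>M\<^esub> x)" for c
    define h where "h = inv_into (carrier K) g"
    obtain u where u: "u \<in> carrier M" "u \<noteq> \<zero>\<^bsub>M\<^esub>"
      using brick M.zero_closed unfolding mods.brick_def by blast
    have bij: "bij_betw g (carrier K) (carrier (End_algebra A M))"
    proof (rule bij_betw_imageI)
      show "inj_on g (carrier K)"
      proof (rule inj_onI)
        fix c d assume "c \<in> carrier K" "d \<in> carrier K" "g c = g d"
        then show "c = d"
          using scalar_faithful[OF lm _ _ u, of c d] u(1) by (auto simp: g_def dest: fun_cong[of _ _ u])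
      qed
      show "g ` carrier K = carrier (End_algebra A M)"
      proof (intro equalityI subsetI)
        fix f assume "f \<in> g ` carrier K"
        then show "f \<in> carrier (End_algebra A M)" using scalar_smult_Hom[OF lm] by (auto simp: g_def Hom_iff)
      next
        fix f assume f: "f \<in> carrier (End_algebra A M)"
        then obtain s where "s \<in> scalars" "\<forall>x\<in>carrier M. f x = s \<odot>\<^bsub>M\<^esub> x"
          using brick True unfolding mods.brick_def mods.mor_def by auto
        then obtain c where c: "c \<in> carrier K" "\<forall>x\<in>carrier M. f x = (c \<odot>\<^bsub>A\<^esub> \<one>\<^bsub>A\<^esub>) \<odot>\<^bsub>M\<^esub> x"
          by (auto simp: scalars_def)
        have "f = g c"
          by (rule extensionalityI[of _ "carrier M"]) (use f c(2) in \<open>auto simp: g_def\<close>)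
        then show "f \<in> g ` carrier K" using c(1) by blast
      qed
    qed
    have hg: "h (g c) = c" if "c \<in> carrier K" for c
      unfolding h_def using bij that by (simp add: bij_betw_def)
    have ex: "\<exists>c\<in>carrier K. f = g c" if "f \<in> carrier (End_algebra A M)" for f
      using that bij unfolding bij_betw_def by blast
    have add: "g c \<oplus>\<^bsub>End_algebra A M\<^esub> g d = g (c \<oplus>\<^bsub>K\<^esub> d)"
      and mult: "g c \<otimes>\<^bsub>End_algebra A M\<^esub> g d = g (c \<otimes>\<^bsub>K\<^esub> d)"
      and smult: "c \<odot>\<^bsub>End_algebra A M\<^esub> g d = g (c \<otimes>\<^bsub>K\<^esub> d)" if cd: "c \<in> carrier K" "d \<in> carrier K" for c d
    proof -
      have *: "(c \<odot>\<^bsub>A\<^esub> \<one>\<^bsub>A\<^esub>) \<odot>\<^bsub>M\<^esub> ((d \<odot>\<^bsub>A\<^esub> \<one>\<^bsub>A\<^esub>) \<odot>\<^bsub>M\<^esub> x) = ((c \<otimes>\<^bsub>K\<^esub> d) \<odot>\<^bsub>A\<^esub> \<one>\<^bsub>A\<^esub>) \<odot>\<^bsub>M\<^esub> x"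
        if "x \<in> carrier M" for x
        using that cd by (simp add: scalar_mult smult_assoc1 flip: M.smult_assoc)
      show "g c \<oplus>\<^bsub>End_algebra A M\<^esub> g d = g (c \<oplus>\<^bsub>K\<^esub> d)"
        using cd by (auto simp: g_def fun_eq_iff smult_l_distr M.smult_l_distr)
      show "g c \<otimes>\<^bsub>End_algebra A M\<^esub> g d = g (c \<otimes>\<^bsub>K\<^esub> d)" "c \<odot>\<^bsub>End_algebra A M\<^esub> g d = g (c \<otimes>\<^bsub>K\<^esub> d)"
        using cd by (auto simp: g_def compose_def fun_eq_iff *)
    qed
    have "h \<in> ring_hom (End_algebra A M) (ground_algebra K)"
    proof (rule ring_hom_memI)
      fix f assume "f \<in> carrier (End_algebra A M)"
      then obtain c where "c \<in> carrier K" "f = g c" using ex by blast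
      then show "h f \<in> carrier (ground_algebra K)" by (simp only: hg ground_algebra_simps)
    next
      fix f f' assume f: "f \<in> carrier (End_algebra A M)" "f' \<in> carrier (End_algebra A M)"
      obtain c d where cd: "c \<in> carrier K" "d \<in> carrier K" "f = g c" "f' = g d"
        using ex[OF f(1)] ex[OF f(2)] that by (elim bexE)
      show "h (f \<otimes>\<^bsub>End_algebra A M\<^esub> f') = h f \<otimes>\<^bsub>ground_algebra K\<^esub> h f'"
        using cd by (simp only: mult hg R.m_closed ground_algebra_simps)
      show "h (f \<oplus>\<^bsub>End_algebra A M\<^esub> f') = h f \<oplus>\<^bsub>ground_algebra K\<^esub> h f'"
        using cd by (simp only: add hg R.a_closed ground_algebra_simps)
    next
      have "one (End_algebra A M) = g \<one>\<^bsub>K\<^esub>" by (auto simp: g_def fun_eq_iff)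
      then show "h \<one>\<^bsub>End_algebra A M\<^esub> = \<one>\<^bsub>ground_algebra K\<^esub>" by (simp only: hg R.one_closed ground_algebra_simps)
    qed
    moreover have "bij_betw h (carrier (End_algebra A M)) (carrier (ground_algebra K))"
      unfolding h_def using bij_betw_inv_into[OF bij] by simp
    moreover have "h (c \<odot>\<^bsub>End_algebra A M\<^esub> f) = c \<odot>\<^bsub>ground_algebra K\<^esub> h f"
      if c: "c \<in> carrier K" and f: "f \<in> carrier (End_algebra A M)" for c f
    proof -
      obtain d where "d \<in> carrier K" "f = g d" using ex[OF f] by blast
      then show ?thesis using c by (simp only: smult hg R.m_closed ground_algebra_simps)
    qed
    ultimately show "M \<in> bricks K A"
      using True unfolding bricks_def algebra_iso_def ring_iso_def by (intro CollectI conjI bexI[of _ h]) auto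
  qed
qed (auto simp: bricks_def mods.brick_def)

lemma mem_simples_iff: "M \<in> simples A \<longleftrightarrow> mods.simple M"
  by (auto simp: simples_def simple_module_def mods.simple_def mods.submod_def nonzero_module_def dest: mod_catD)

lemma iso_class_eq_cls: "iso_class A = mods.cls"
  by (simp add: fun_eq_iff iso_class_def mods.cls_def)

lemma alg_rank_eq: "alg_rank A = card (mods.cls ` {M. mods.simple M})"
proof -
  have "simples A = {M. mods.simple M}" using mem_simples_iff by blast
  then show ?thesis by (simp add: alg_rank_def iso_class_eq_cls)
qed

text \<open>The regular module is nonzero and so has a simple submodule. This supplies the
  nonemptiness that a semibrick requires.\<close>

lemma simples_nonempty:
  assumes "carrier A \<noteq> {\<zero>\<^bsub>A\<^esub>}"
  shows "simples A \<noteq> {}"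
proof -
  let ?P = "principal_left_module A \<one>\<^bsub>A\<^esub>"
  have P: "carrier ?P = carrier A" "zero ?P = zero A" "add ?P = add A" "smult ?P = monoid.mult A"
    by (auto simp: principal_left_module_def)
  have "abelian_group ?P"
    by (rule abelian_groupI) (auto simp: P M.a_ac intro: bexI[of _ "\<ominus>\<^bsub>A\<^esub> x" for x] M.l_neg)
  then have lP: "left_module A ?P"
    by (intro left_module.intro left_module_axioms.intro A.ring_axioms)
      (simp_all add: P A.l_distr A.r_distr A.m_assoc)
  have "fin_gen A ?P" unfolding fin_gen_def is_submodule_iff[OF lP] P
  proof (intro exI[of _ "{\<one>\<^bsub>A\<^esub>}"] conjI allI impI)
    fix N assume N: "(N \<subseteq> carrier A \<and> \<zero>\<^bsub>A\<^esub> \<in> N \<and> (\<forall>x\<in>N. \<forall>y\<in>N. x \<oplus>\<^bsub>A\<^esub> y \<in> N) \<and>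
      (\<forall>a\<in>carrier A. \<forall>x\<in>N. a \<otimes>\<^bsub>A\<^esub> x \<in> N)) \<and> {\<one>\<^bsub>A\<^esub>} \<subseteq> N"
    then have "a \<in> N" if "a \<in> carrier A" for a using that A.r_one[OF that] by (metis insert_subset)
    then show "N = carrier A" using N by blast
  qed auto
  then obtain M where M: "M \<in> mod_cat A" "mod_iso A ?P M"
    using mod_cat_universal[OF fd_algebra_axioms lP] by blast
  then obtain f where f: "bij_betw f (carrier A) (carrier M)" unfolding mod_iso_def P by blast
  have "carrier M \<noteq> {\<zero>\<^bsub>M\<^esub>}"
  proof
    assume "carrier M = {\<zero>\<^bsub>M\<^esub>}"
    then have "f a = \<zero>\<^bsub>M\<^esub>" if "a \<in> carrier A" for a using f that bij_betwE by blast
    then have "\<one>\<^bsub>A\<^esub> = \<zero>\<^bsub>A\<^esub>" using f by (intro inj_onD[of f "carrier A"]) (auto simp: bij_betw_def)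
    then show False using assms A.one_zeroD by blast
  qed
  then show ?thesis using mods.simple_submodule_ex[OF M(1)] mem_simples_iff by blast
qed

section \<open>From Hom-orthogonal sets to semibricks, and the claims on their sizes\<close>

lemma Hom_orthogonal_bricks:
  fixes I :: "'i set"
  assumes orth: "hom_orthogonal A (M ` I)" and niso: "pairwise (\<lambda>i j. \<not> mod_iso A (M i) (M j)) I"
  shows "\<exists>B. semibrick K A (B ` I) \<and> pairwise (\<lambda>i j. \<not> mod_iso A (B i) (B j)) I \<and>
    (\<forall>i\<in>I. iso_to_submodule A (B i) (M i) \<and> iso_to_quotient A (B i) (M i))"
proof -
  have M: "M i \<in> mod_cat A" "carrier (M i) \<noteq> {\<zero>\<^bsub>M i\<^esub>}" if "i \<in> I" for i
    using orth that by (auto simp: hom_orthogonal_def nonzero_module_def)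
  have "\<exists>e. mods.mor e (M i) (M i) \<and> mods.brick (M i \<restriction> (e ` carrier (M i)))" if i: "i \<in> I" for i
    by (rule mods.brick_image_ex[OF M[OF i]]) blast
  then have "\<forall>i\<in>I. \<exists>e. mods.mor e (M i) (M i) \<and> mods.brick (M i \<restriction> (e ` carrier (M i)))" by blast
  then obtain e where e: "\<And>i. i \<in> I \<Longrightarrow> mods.mor (e i) (M i) (M i)"
    "\<And>i. i \<in> I \<Longrightarrow> mods.brick (M i \<restriction> (e i ` carrier (M i)))" by (auto dest!: bchoice)
  define B where "B i = M i \<restriction> (e i ` carrier (M i))" for i
  have sub: "mods.submod (e i ` carrier (M i)) (M i)" if "i \<in> I" for i
    by (rule mods.submod_range[OF e(1)[OF that]])
  have BC: "B i \<in> mod_cat A" if "i \<in> I" for i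
    unfolding B_def by (rule mods.submod_restrict_in[OF sub[OF that]])
  have eB: "mods.mor (e i) (M i) (B i)" if i: "i \<in> I" for i
    unfolding B_def by (rule mods.mor_corestrict[OF e(1)[OF i] sub[OF i]]) simp
  have B0: "carrier (B i) \<noteq> {\<zero>\<^bsub>B i\<^esub>}" if "i \<in> I" for i
    using e(2)[OF that] by (simp add: B_def mods.brick_def)
  have Hom: "Hom_zero A (B i) (B j)" if ij: "i \<in> I" "j \<in> I" "i \<noteq> j" for i j
    unfolding mods.Hom_zero_iff[OF BC[OF ij(1)] BC[OF ij(2)]]
  proof (intro allI impI ballI)
    fix f x assume f: "mods.mor f (B i) (B j)" and "x \<in> carrier (B i)"
    then obtain y where y: "y \<in> carrier (M i)" "x = e i y" by (auto simp: B_def)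
    \<comment> \<open>The maps \<open>e i\<close> and \<open>f\<close> and this inclusion compose to
      a map from \<open>M i\<close> to \<open>M j\<close>, which is zero. Since \<open>e i\<close>
      is onto \<open>B i\<close>, the map \<open>f\<close> is zero.\<close>
    have "mods.mor (\<lambda>x. x) (B j) (M j)" unfolding B_def by (rule mods.mor_incl[OF sub[OF ij(2)]])
    then have "mods.mor (\<lambda>x. f (e i x)) (M i) (M j)"
      using mods.mor_comp'[OF mods.mor_comp'[OF eB[OF ij(1)] f]] by blast
    moreover have "\<not> mod_iso A (M i) (M j)" using niso ij by (simp add: pairwise_def)
    then have "M i \<noteq> M j" using mods.mod_iso_refl[OF M(1)[OF ij(1)]] by auto
    then have "Hom_zero A (M i) (M j)" using orth ij by (simp add: hom_orthogonal_def pairwise_def)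
    ultimately have "f (e i y) = \<zero>\<^bsub>M j\<^esub>"
      using y(1) unfolding mods.Hom_zero_iff[OF M(1)[OF ij(1)] M(1)[OF ij(2)]] by blast
    then show "f x = \<zero>\<^bsub>B j\<^esub>" using y(2) by (simp add: B_def)
  qed
  have niso': "\<not> mod_iso A (B i) (B j)" if ij: "i \<in> I" "j \<in> I" "i \<noteq> j" for i j
    using mods.mod_iso_trivial[OF BC[OF ij(1)] BC[OF ij(2)] _ Hom[OF ij]] B0[OF ij(1)] by blast
  have "hom_orthogonal A (B ` I)" unfolding hom_orthogonal_def
  proof (intro conjI)
    show "B ` I \<noteq> {}" using orth by (simp add: hom_orthogonal_def)
    show "\<forall>N\<in>B ` I. nonzero_module N" using B0 by (simp add: nonzero_module_def)
    show "pairwise (\<lambda>M N. \<not> mod_iso A M N \<and> Hom_zero A M N \<and> Hom_zero A N M) (B ` I)"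
      using niso' Hom by (auto simp: pairwise_def)
  qed (use BC in blast)
  moreover have "B ` I \<subseteq> bricks K A" using e(2) by (auto simp: mem_bricks_iff B_def)
  moreover have "iso_to_submodule A (B i) (M i)" if "i \<in> I" for i
    using sub[OF that] mods.mod_iso_refl[OF BC[OF that]] unfolding iso_to_submodule_def B_def mods.submod_def
    by blast
  moreover have "iso_to_quotient A (B i) (M i)" if i: "i \<in> I" for i
    unfolding iso_to_quotient_def
  proof (intro exI conjI)
    show "is_submodule A (M i) (kern (e i) (M i) (B i))"
      using mods.submod_kern[OF eB[OF i]] by (simp add: mods.submod_def)
    show "mod_iso A (B i) (quotient_module (M i) (kern (e i) (M i) (B i)))"
      by (rule first_isomorphism[OF mod_catD(1)[OF M(1)[OF i]] mod_catD(1)[OF BC[OF i]] mods.morD(3)[OF eB[OF i]]])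
        (simp add: B_def)
  qed
  ultimately show ?thesis using niso' unfolding semibrick_def by (intro exI[of _ B]) (auto simp: pairwise_def)
qed

text \<open>The set is indexed by itself. As the bricks are pairwise nonisomorphic, passing to them
  is injective and preserves cardinality and infinitude.\<close>

lemma Hom_orthogonal_bricks_inj:
  assumes S: "hom_orthogonal A S"
  shows "\<exists>B. semibrick K A (B ` S) \<and> inj_on B S \<and> (\<forall>M\<in>S. mod_dim K A (B M) \<le> mod_dim K A M)"
proof -
  have "hom_orthogonal A (id ` S)" "pairwise (\<lambda>M N. \<not> mod_iso A (id M) (id N)) S"
    using S by (auto simp: hom_orthogonal_def pairwise_def)
  from Hom_orthogonal_bricks[OF this] obtain B where B: "semibrick K A (B ` S)"
    "pairwise (\<lambda>M N. \<not> mod_iso A (B M) (B N)) S" "\<And>M. M \<in> S \<Longrightarrow> iso_to_submodule A (B M) M" by auto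
  have BC: "B M \<in> mod_cat A" "M \<in> mod_cat A" if "M \<in> S" for M
    using B(1) S that by (auto simp: semibrick_def hom_orthogonal_def)
  have "inj_on B S"
  proof (rule inj_onI, rule ccontr)
    fix M N assume MN: "M \<in> S" "N \<in> S" "B M = B N" "M \<noteq> N"
    then have "\<not> mod_iso A (B M) (B N)" using B(2) unfolding pairwise_def by blast
    then show False using mods.mod_iso_refl[OF BC(1)[OF MN(1)]] MN(3) by simp
  qed
  then show ?thesis using B mods.iso_to_submodule_len BC by blast
qed

lemma semibrick_orthogonal:
  assumes "semibrick K A S"
  shows "M \<in> S \<Longrightarrow> mods.brick M"
    and "M \<in> S \<Longrightarrow> N \<in> S \<Longrightarrow> M \<noteq> N \<Longrightarrow> mods.mor f M N \<Longrightarrow> mods.vanishes f M N"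
proof -
  show "mods.brick M" if "M \<in> S" for M using assms that by (auto simp: semibrick_def mem_bricks_iff)
  show "mods.vanishes f M N" if "M \<in> S" "N \<in> S" "M \<noteq> N" "mods.mor f M N"
  proof -
    have "Hom_zero A M N" using assms that(1-3) unfolding semibrick_def hom_orthogonal_def pairwise_def by blast
    then show ?thesis using mods.morD(3)[OF that(4)] by (simp add: Hom_zero_def mods.vanishes_def)
  qed
qed

lemma semibrick_size:
  assumes fin: "brick_finite K A" "finite S" and S: "semibrick K A S"
  shows "card S \<le> alg_rank A"
    and "card S = alg_rank A \<Longrightarrow> iso_class A ` S = iso_class A ` simples A"
proof -
  have "bricks K A = Collect mods.brick" "simples A = Collect mods.simple"
    using mem_bricks_iff mem_simples_iff by blast+
  note eq = this
  interpret brick_finite_category A "mod_cat A" "mod_dim K A" scalars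
    by unfold_locales (use fin(1) in \<open>simp add: brick_finite_def eq iso_class_eq_cls\<close>)
  have "alg_rank A = num_simples" by (simp add: alg_rank_eq num_simples_def)
  then show "card S \<le> alg_rank A" "card S = alg_rank A \<Longrightarrow> iso_class A ` S = iso_class A ` simples A"
    using semibrick_le_num_simples[OF fin(2) semibrick_orthogonal[OF S]] by (simp_all add: eq iso_class_eq_cls)
qed

lemma hom_orthogonal_card_le:
  assumes fin: "brick_finite K A" "finite S" and S: "hom_orthogonal A S"
  shows "card S \<le> alg_rank A"
proof -
  obtain B where B: "semibrick K A (B ` S)" "inj_on B S" using Hom_orthogonal_bricks_inj[OF S] by blast
  then show ?thesis using semibrick_size(1)[OF fin(1) _ B(1)] fin(2) card_image[OF B(2)] by simp
qed

text \<open>Semibricks consist of modules rather than classes, so one representative is chosen in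
  each class; nonzero maps between simple modules are isomorphisms.\<close>

lemma semibrick_of_simples:
  assumes fin: "brick_finite K A" and ne: "simples A \<noteq> {}"
  shows "iso_class A ` simples A \<in> semibricks_of_size K A (alg_rank A)"
proof -
  obtain S where S: "S \<subseteq> simples A" "inj_on (iso_class A) S" "iso_class A ` simples A = iso_class A ` S"
    using subset_image_inj[of "iso_class A ` simples A" "iso_class A" "simples A"] by auto
  have brick: "M \<in> bricks K A" if "M \<in> simples A" for M
    using mods.simple_brick that by (simp add: mem_simples_iff mem_bricks_iff)
  have "finite (iso_class A ` simples A)"
    using fin brick unfolding brick_finite_def by (auto intro: finite_subset[OF image_mono])
  then have "finite S" using S(2,3) by (simp add: finite_image_iff)
  moreover have "card S = alg_rank A" using card_image[OF S(2)] S(3) by (simp add: alg_rank_def)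
  moreover have "hom_orthogonal A S" unfolding hom_orthogonal_def
  proof (intro conjI)
    show "S \<noteq> {}" using S(3) ne by auto
    show SC: "S \<subseteq> mod_cat A" using S(1) by (auto simp: simples_def)
    show "\<forall>M\<in>S. nonzero_module M" using S(1) by (auto simp: simples_def simple_module_def)
    have niso: "\<not> mod_iso A M N" if "M \<in> S" "N \<in> S" "M \<noteq> N" for M N
      using that S(2) SC mods.cls_eq_iff[of M N] by (auto simp: iso_class_eq_cls inj_on_def)
    have "Hom_zero A M N" if MN: "M \<in> S" "N \<in> S" "M \<noteq> N" for M N
      using MN S(1) SC niso[OF MN] mods.simple_Hom_iso[of M N]
      unfolding mods.Hom_zero_iff[OF subsetD[OF SC MN(1)] subsetD[OF SC MN(2)]]
      by (auto simp: mods.vanishes_def mem_simples_iff subset_iff)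
    then show "pairwise (\<lambda>M N. \<not> mod_iso A M N \<and> Hom_zero A M N \<and> Hom_zero A N M) S"
      using niso by (auto simp: pairwise_def)
  qed
  ultimately show ?thesis
    using S(1,3) brick unfolding semibricks_of_size_def semibrick_def by blast
qed

lemma semibricks_of_rank_size_unique:
  assumes "brick_finite K A" "D \<in> semibricks_of_size K A (alg_rank A)"
  shows "D = iso_class A ` simples A"
  using assms semibrick_size(2) unfolding semibricks_of_size_def by blast

lemma semibrick_subset: "semibrick K A S \<Longrightarrow> T \<subseteq> S \<Longrightarrow> T \<noteq> {} \<Longrightarrow> semibrick K A T"
  unfolding semibrick_def hom_orthogonal_def by (auto intro: pairwise_mono)

text \<open>The bricks have dimensions in the finite set \<open>{..d'}\<close>, because each embeds
  in a member of \<open>S\<close>.\<close>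

lemma infinite_semibrick:
  assumes "infinite S" and S: "hom_orthogonal A S" and d': "\<And>M. M \<in> S \<Longrightarrow> mod_dim K A M = d'"
  shows "\<exists>d\<le>d'. \<exists>S. infinite S \<and> semibrick K A S \<and> (\<forall>M\<in>S. mod_dim K A M = d)"
proof -
  obtain B where B: "semibrick K A (B ` S)" "inj_on B S" "\<forall>M\<in>S. mod_dim K A (B M) \<le> mod_dim K A M"
    using Hom_orthogonal_bricks_inj[OF S] by blast
  have le: "mod_dim K A N \<le> d'" if "N \<in> B ` S" for N using that B(3) d' by fastforce
  have "infinite (B ` S)" using assms(1) finite_imageD B(2) by blast
  moreover have "finite (mod_dim K A ` B ` S)" by (rule finite_subset[of _ "{..d'}"]) (use le in blast, simp)
  ultimately have "\<exists>N\<in>B ` S. infinite {M \<in> B ` S. mod_dim K A M = mod_dim K A N}"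
    by (rule pigeonhole_infinite)
  then obtain N where N: "N \<in> B ` S" "infinite {M \<in> B ` S. mod_dim K A M = mod_dim K A N}" by (rule bexE)
  have "semibrick K A {M \<in> B ` S. mod_dim K A M = mod_dim K A N}"
    by (rule semibrick_subset[OF B(1)]) (use N(1) in auto)
  then show ?thesis using le[OF N(1)] N(2) by (intro exI[of _ "mod_dim K A N"]) auto
qed

end

theorem theoremA:
  fixes K :: "'k ring" and A :: "('k, 'a) module"
  assumes "fd_algebra K A" and "basic_algebra A" and "connected_algebra A"
  shows
    "(\<forall>(I :: 'i set) M.
        hom_orthogonal A (M ` I) \<and> pairwise (\<lambda>i j. \<not> mod_iso A (M i) (M j)) I \<longrightarrow>
        (\<exists>B. semibrick K A (B ` I) \<and> pairwise (\<lambda>i j. \<not> mod_iso A (B i) (B j)) I \<and>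
             (\<forall>i\<in>I. iso_to_submodule A (B i) (M i) \<and> iso_to_quotient A (B i) (M i))))
     \<and>
     (\<forall>n. brick_finite K A \<and> alg_rank A = n \<longrightarrow>
        \<not> (\<exists>S. hom_orthogonal A S \<and> finite S \<and> card S = n + 1) \<and>
        (\<exists>!C. C \<in> semibricks_of_size K A n) \<and>
        iso_class A ` simples A \<in> semibricks_of_size K A n)
     \<and>
     (\<forall>d'. (\<exists>S. infinite S \<and> hom_orthogonal A S \<and> (\<forall>M\<in>S. mod_dim K A M = d')) \<longrightarrow>
        (\<exists>d\<le>d'. \<exists>S. infinite S \<and> semibrick K A S \<and> (\<forall>M\<in>S. mod_dim K A M = d)))"
proof -
  interpret fd_algebra K A by fact
  \<comment> \<open>A connected algebra is nonzero by definition.\<close>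
  have ne: "simples A \<noteq> {}" using simples_nonempty assms(3) by (simp add: connected_algebra_def)
  show ?thesis
  proof (intro conjI allI impI)
    fix n assume n: "brick_finite K A \<and> alg_rank A = n"
    show "\<not> (\<exists>S. hom_orthogonal A S \<and> finite S \<and> card S = n + 1)"
      using hom_orthogonal_card_le n by fastforce
    show simples: "iso_class A ` simples A \<in> semibricks_of_size K A n"
      using semibrick_of_simples ne n by blast
    show "\<exists>!C. C \<in> semibricks_of_size K A n"
      using simples semibricks_of_rank_size_unique n by blast
  next
    fix d' assume "\<exists>S. infinite S \<and> hom_orthogonal A S \<and> (\<forall>M\<in>S. mod_dim K A M = d')"
    then show "\<exists>d\<le>d'. \<exists>S. infinite S \<and> semibrick K A S \<and> (\<forall>M\<in>S. mod_dim K A M = d)"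
      using infinite_semibrick by metis
  qed (auto intro: Hom_orthogonal_bricks)
qed

end
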